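(* Let $K\subset\{1,\dots,2d\}$ be nonempty, and let $n^0,n^+,n^-,n_0^0,n_0^+,n_0^-$ be nonnegative integers with $n^0+n^++n^-=n_0^0+n_0^++n_0^-=\sharp(K)$, $0<n_0^0$, $n^0<n_0^0$, $n^+\ge n_0^+$, $n^-\ge n_0^-$. Then for any $(\boldsymbol\omega,\mathbf A)\in\Omega\times J^{(n_0^0,n_0^+,n_0^-)}_{\mathcal O_K^{\mathbb C}}$ and any path $(\boldsymbol\omega_s,\mathbf A_s)\in\Omega\times J^{(n^0,n^+,n^-)}_{\mathcal O_K^{\mathbb C}}$, $s\in(0,1]$, with $(\boldsymbol\omega_s,\mathbf A_s)\to(\boldsymbol\omega,\mathbf A)$ as $s\to0^+$, $$\lim_{s\to0^+}\lambda_n(\boldsymbol\omega_s,\mathbf A_s)=-\infty\ \ (n\le n^+-n_0^+),\qquad \lim_{s\to0^+}\lambda_n(\boldsymbol\omega_s,\mathbf A_s)=\lambda_{n-(n^+-n_0^+)}(\boldsymbol\omega,\mathbf A)\ \ (n>n^+-n_0^+).$$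
   Context: Let $d\ge2$, $[a,b]$ compact. $\Omega$ is the set of triples $\boldsymbol\omega=(P,Q,W)$ of $d\times d$ real symmetric matrix-valued functions in $L^\infty([a,b],\mathbb R^{d\times d})$ with $P(t)\ge\mu_1I_d$, $W(t)\ge\mu_2I_d$ a.e. for some $\mu_1,\mu_2>0$, with product $L^\infty$ topology. $\mathcal B^{\mathbb C}$ is the quotient of the set of complex $2d\times4d$ matrices $(A\,|\,B)$ with $\operatorname{rank}(A\,|\,B)=2d$, $AB^*=BA^*$ (topology from $\mathbb C^{8d^2}$) by the left action of $GL(2d,\mathbb C)$, with quotient topology. The problem $(\boldsymbol\omega,[A\,|\,B])$ is $-(Py')'+Qy=\lambda Wy$ on $[a,b]$ with $(A\,|\,B)(-y(a)^T,y(b)^T,(Py')(a)^T,(Py')(b)^T)^T=0$; eigenvalues are real, discrete, bounded below, listed $\lambda_1\le\lambda_2\le\cdots$ with multiplicity. For $K\subset\{1,\dots,2d\}$, $\mathcal O_K^{\mathbb C}$ is the set of $[A\,|\,B]$ having a representative with columns $a_i=-e_i$, $b_i=s_i$ ($i\in K$), $a_i=s_i$, $b_i=e_i$ ($i\notin K$), for a Hermitian $2d\times2d$ matrix $S=(s_1,\dots,s_{2d})=(s_{lj})$ (denoted $S(\mathbf A)$); $e_i$ are standard basis vectors. For $K=\{n_1<\dots<n_{m_0}\}$, $S_K(\mathbf A)=(s_{n_in_j})_{i,j}$, and $J^{(n^0,n^+,n^-)}_{\mathcal O_K^{\mathbb C}}$ is the set of $\mathbf A\in\mathcal O_K^{\mathbb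 C}$ with $S_K(\mathbf A)$ having exactly $n^0$ zero, $n^+$ positive, $n^-$ negative eigenvalues counted with multiplicity. A path means a continuous map into $\Omega\times\mathcal O_K^{\mathbb C}$ (product topology, $\mathcal O_K^{\mathbb C}$ with topology from $\mathcal B^{\mathbb C}$). *)

theory Defs
  imports "HOL-Analysis.Analysis" "HOL-Probability.Essential_Supremum"
          "HOL-Computational_Algebra.Polynomial"
begin

type_synonym 'd rmatf = "real \<Rightarrow> real^('d::finite)^'d"
type_synonym 'd coef = "'d rmatf \<times> 'd rmatf \<times> 'd rmatf"

definition Linf_dist :: "real \<Rightarrow> real \<Rightarrow> (real \<Rightarrow> 'a::real_normed_vector) \<Rightarrow> (real \<Rightarrow> 'a) \<Rightarrow> ereal" where
  "Linf_dist a b f g = esssup (lebesgue_on {a..b}) (\<lambda>t. ereal (norm (f t - g t)))"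

definition Linf_fun :: "real \<Rightarrow> real \<Rightarrow> (real \<Rightarrow> 'a::real_normed_vector) \<Rightarrow> bool" where
  "Linf_fun a b f \<longleftrightarrow> f \<in> borel_measurable (lebesgue_on {a..b})
      \<and> (\<exists>C. AE t in lebesgue_on {a..b}. norm (f t) \<le> C)"

definition mat_ge_scalar :: "real^('d::finite)^'d \<Rightarrow> real \<Rightarrow> bool" where
  "mat_ge_scalar M \<mu> \<longleftrightarrow> (\<forall>x. \<mu> * (x \<bullet> x) \<le> x \<bullet> (M *v x))"

definition Omega :: "real \<Rightarrow> real \<Rightarrow> ('d::finite) coef set" where
  "Omega a b = {(P, Q, W). Linf_fun a b P \<and> Linf_fun a b Q \<and> Linf_fun a b W
      \<and> (AE t in lebesgue_on {a..b}. transpose (P t) = P t \<and> transpose (Q t) = Q t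
                                       \<and> transpose (W t) = W t)
      \<and> (\<exists>\<mu>1>0. AE t in lebesgue_on {a..b}. mat_ge_scalar (P t) \<mu>1)
      \<and> (\<exists>\<mu>2>0. AE t in lebesgue_on {a..b}. mat_ge_scalar (W t) \<mu>2)}"

definition Omega_tendsto :: "real \<Rightarrow> real \<Rightarrow> ('s \<Rightarrow> ('d::finite) coef) \<Rightarrow> ('d::finite) coef \<Rightarrow> 's filter \<Rightarrow> bool" where
  "Omega_tendsto a b wpath w F \<longleftrightarrow>
     ((\<lambda>s. Linf_dist a b (fst (wpath s)) (fst w)) \<longlongrightarrow> 0) F
   \<and> ((\<lambda>s. Linf_dist a b (fst (snd (wpath s))) (fst (snd w))) \<longlongrightarrow> 0) F
   \<and> ((\<lambda>s. Linf_dist a b (snd (snd (wpath s))) (snd (snd w))) \<longlongrightarrow> 0) F"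

definition Omega_continuous_on :: "real \<Rightarrow> real \<Rightarrow> real set \<Rightarrow> (real \<Rightarrow> ('d::finite) coef) \<Rightarrow> bool" where
  "Omega_continuous_on a b S wpath \<longleftrightarrow> (\<forall>s0\<in>S. Omega_tendsto a b wpath (wpath s0) (at s0 within S))"

text \<open>Index i in {1..2d} is modelled by the type 'd + 'd: Inl j is index j, Inr j is index d+j.\<close>
type_synonym 'd cm2 = "complex^('d+'d)^('d+'d)"
type_synonym 'd bmat = "('d::finite) cm2 \<times> ('d::finite) cm2"
type_synonym 'd bcond = "('d::finite) bmat set"

definition adj :: "complex^'n^'m \<Rightarrow> complex^'m^'n" where
  "adj M = (\<chi> i j. cnj (M $ j $ i))"

definition hcat :: "('d::finite) cm2 \<Rightarrow> ('d::finite) cm2 \<Rightarrow> complex^(('d+'d)+('d+'d))^('d+'d)" where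
  "hcat A B = (\<chi> i j. case j of Inl k \<Rightarrow> A $ i $ k | Inr k \<Rightarrow> B $ i $ k)"

definition BCset :: "('d::finite) bmat set" where
  "BCset = {(A, B). rank (hcat A B) = CARD('d+'d) \<and> A ** adj B = B ** adj A}"

definition orbit :: "('d::finite) bmat \<Rightarrow> ('d::finite) bcond" where
  "orbit X = {(G ** fst X, G ** snd X) | G :: ('d::finite) cm2. invertible G}"

definition BC :: "('d::finite) bcond set" where
  "BC = orbit ` BCset"

definition BCopen :: "('d::finite) bcond set \<Rightarrow> bool" where
  "BCopen U \<longleftrightarrow> U \<subseteq> BC \<and> openin (top_of_set BCset) {x \<in> BCset. orbit x \<in> U}"

lemma istopology_BCopen: "istopology BCopen"
  unfolding istopology_def
proof (intro conjI allI impI)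
  fix S T :: "('d::finite) bcond set" assume "BCopen S" "BCopen T"
  moreover have "{x \<in> BCset. orbit x \<in> S \<inter> T} =
      {x \<in> BCset. orbit x \<in> S} \<inter> {x \<in> BCset. orbit x \<in> T}" by auto
  ultimately show "BCopen (S \<inter> T)"
    unfolding BCopen_def by (metis (no_types, lifting) le_infI1 openin_Int)
next
  fix K :: "('d::finite) bcond set set" assume K: "\<forall>S\<in>K. BCopen S"
  have eq: "{x \<in> BCset. orbit x \<in> \<Union>K} = (\<Union>S\<in>K. {x \<in> BCset. orbit x \<in> S})" by auto
  show "BCopen (\<Union>K)" using K unfolding BCopen_def eq by auto
qed

definition BCtop :: "('d::finite) bcond topology" where
  "BCtop = topology BCopen"

definition hermitian :: "complex^'n^'n \<Rightarrow> bool" where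
  "hermitian S \<longleftrightarrow> adj S = S"

definition nfA :: "('d+'d) set \<Rightarrow> ('d::finite) cm2 \<Rightarrow> ('d::finite) cm2" where
  "nfA K S = (\<chi> i j. if j \<in> K then - (if i = j then 1 else 0) else S $ i $ j)"

definition nfB :: "('d+'d) set \<Rightarrow> ('d::finite) cm2 \<Rightarrow> ('d::finite) cm2" where
  "nfB K S = (\<chi> i j. if j \<in> K then S $ i $ j else (if i = j then 1 else 0))"

definition OK :: "('d+'d) set \<Rightarrow> ('d::finite) bcond set" where
  "OK K = {X. \<exists>S. hermitian S \<and> X = orbit (nfA K S, nfB K S)}"

definition S_of :: "('d+'d) set \<Rightarrow> ('d::finite) bcond \<Rightarrow> ('d::finite) cm2" where
  "S_of K X = (THE S. hermitian S \<and> X = orbit (nfA K S, nfB K S))"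

text \<open>Characteristic polynomial det(x I - S_K) of the principal submatrix S_K indexed by K
  (Leibniz formula over permutations of K).\<close>
definition charpoly_sub :: "('d+'d) set \<Rightarrow> ('d::finite) cm2 \<Rightarrow> complex poly" where
  "charpoly_sub K M = (\<Sum>p\<in>{p. p permutes K}. of_int (sign p) *
       (\<Prod>i\<in>K. [: - (M $ i $ p i), (if p i = i then 1 else 0) :]))"

definition n_zero :: "('d+'d) set \<Rightarrow> ('d::finite) cm2 \<Rightarrow> nat" where
  "n_zero K M = order 0 (charpoly_sub K M)"

definition n_pos :: "('d+'d) set \<Rightarrow> ('d::finite) cm2 \<Rightarrow> nat" where
  "n_pos K M = (\<Sum>r\<in>{r. poly (charpoly_sub K M) r = 0 \<and> r \<in> \<real> \<and> Re r > 0}.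
                   order r (charpoly_sub K M))"

definition n_neg :: "('d+'d) set \<Rightarrow> ('d::finite) cm2 \<Rightarrow> nat" where
  "n_neg K M = (\<Sum>r\<in>{r. poly (charpoly_sub K M) r = 0 \<and> r \<in> \<real> \<and> Re r < 0}.
                   order r (charpoly_sub K M))"

definition J :: "('d+'d) set \<Rightarrow> nat \<Rightarrow> nat \<Rightarrow> nat \<Rightarrow> ('d::finite) bcond set" where
  "J K n0 np nm = {X \<in> OK K. n_zero K (S_of K X) = n0 \<and> n_pos K (S_of K X) = np
                              \<and> n_neg K (S_of K X) = nm}"

definition cmat :: "real^'n^'m \<Rightarrow> complex^'n^'m" where
  "cmat M = (\<chi> i j. complex_of_real (M $ i $ j))"

text \<open>y solves -(Py')' + Qy = lambda W y on [a,b] with quasi-derivative z = P y':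
  y and z are absolutely continuous (indefinite integrals), P y' = z a.e., z' = (Q - lambda W) y.\<close>
definition sl_sol :: "real \<Rightarrow> real \<Rightarrow> ('d::finite) coef \<Rightarrow> real \<Rightarrow> (real \<Rightarrow> complex^('d::finite)) \<Rightarrow> (real \<Rightarrow> complex^('d::finite)) \<Rightarrow> bool" where
  "sl_sol a b w lam y z \<longleftrightarrow>
     (case w of (P, Q, W) \<Rightarrow>
       (\<exists>u. u absolutely_integrable_on {a..b}
            \<and> (\<forall>t\<in>{a..b}. y t = y a + integral {a..t} u)
            \<and> (AE t in lebesgue_on {a..b}. cmat (P t) *v u t = z t))
     \<and> (\<lambda>s. cmat (Q s - lam *\<^sub>R W s) *v y s) absolutely_integrable_on {a..b}
     \<and> (\<forall>t\<in>{a..b}. z t = z a + integral {a..t} (\<lambda>s. cmat (Q s - lam *\<^sub>R W s) *v y s)))"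

definition bvY :: "real \<Rightarrow> real \<Rightarrow> (real \<Rightarrow> complex^('d::finite)) \<Rightarrow> complex^('d+'d)" where
  "bvY a b y = (\<chi> i. case i of Inl j \<Rightarrow> - (y a $ j) | Inr j \<Rightarrow> y b $ j)"

definition bvZ :: "real \<Rightarrow> real \<Rightarrow> (real \<Rightarrow> complex^('d::finite)) \<Rightarrow> complex^('d+'d)" where
  "bvZ a b z = (\<chi> i. case i of Inl j \<Rightarrow> z a $ j | Inr j \<Rightarrow> z b $ j)"

definition bvp_sol :: "real \<Rightarrow> real \<Rightarrow> ('d::finite) coef \<Rightarrow> ('d::finite) bcond \<Rightarrow> real \<Rightarrow> (real \<Rightarrow> complex^('d::finite)) \<Rightarrow> bool" where
  "bvp_sol a b w X lam y \<longleftrightarrow>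
     (\<exists>z. sl_sol a b w lam y z \<and>
          (\<exists>(A, B)\<in>X. A *v bvY a b y + B *v bvZ a b z = 0))"

definition lin_indep_on :: "real \<Rightarrow> real \<Rightarrow> (real \<Rightarrow> complex^('d::finite)) set \<Rightarrow> bool" where
  "lin_indep_on a b F \<longleftrightarrow>
     (\<forall>c. (\<forall>t\<in>{a..b}. (\<Sum>f\<in>F. c f *s f t) = 0) \<longrightarrow> (\<forall>f\<in>F. c f = 0))"

definition eig_mult :: "real \<Rightarrow> real \<Rightarrow> ('d::finite) coef \<Rightarrow> ('d::finite) bcond \<Rightarrow> real \<Rightarrow> nat" where
  "eig_mult a b w X lam = Sup {card F | F. finite F \<and> F \<subseteq> {y. bvp_sol a b w X lam y}
                                            \<and> lin_indep_on a b F}"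

definition eig_count :: "real \<Rightarrow> real \<Rightarrow> ('d::finite) coef \<Rightarrow> ('d::finite) bcond \<Rightarrow> real \<Rightarrow> nat" where
  "eig_count a b w X \<mu> = (\<Sum>lam\<in>{lam. lam \<le> \<mu> \<and> eig_mult a b w X lam > 0}. eig_mult a b w X lam)"

text \<open>The n-th eigenvalue (n \<ge> 1), lambda_1 \<le> lambda_2 \<le> ... listed with multiplicity.\<close>
definition eigval :: "real \<Rightarrow> real \<Rightarrow> nat \<Rightarrow> ('d::finite) coef \<Rightarrow> ('d::finite) bcond \<Rightarrow> real" where
  "eigval a b n w X = Inf {\<mu>. n \<le> eig_count a b w X \<mu>}"

end

theory Submission
  imports Defs
begin

text \<open>
  On a mesh so fine that the energy \<open>\<integral> P y' \<bullet> y' + (Q - \<lambda> W) y \<bullet> y\<close> is coercive on functions vanishing at the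
  nodes, a solution is determined by its nodal values. Adding one Lagrange multiplier for each index in
  \<open>K\<close>, the eigenvalue problem becomes the kernel problem of a Hermitian form on a finite-dimensional
  space, the multiplicity of \<open>\<lambda>\<close> being the nullity. The form depends continuously on the
  coefficients, on \<open>S(A)\<close> and on \<open>\<lambda>\<close>, decreases strictly in \<open>\<lambda>\<close> on its kernel, and for \<open>\<lambda>\<close> near \<open>-\<infinity>\<close>
  its negative index is \<open>#K - n\<^sup>+(S_K)\<close>. Hence the number of eigenvalues up to \<open>\<lambda>\<close> is
  negative index + nullity \<open>- #K + n\<^sup>+(S_K)\<close>. If \<open>\<lambda>\<close> is not an eigenvalue of the limit problem, the
  form is nondegenerate and its negative index is locally constant, so along the path this number
  exceeds that of the limit problem by exactly \<open>n\<^sup>+ - n\<^sub>0\<^sup>+\<close>.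
\<close>

text \<open>The obstacle is that \<open>S_K\<close> degenerates in the limit. Solving the boundary
  condition for the quasi-derivatives in \<open>K\<close> would require the inverse of
  \<open>S_K\<close>, which blows up along the path; with multipliers \<open>S_K\<close> itself
  stays in the form and nothing singular happens at \<open>s = 0\<close>. The starting index at
  minus infinity is a Schur complement effect: a large positive energy on the nodal values leaves,
  on the multipliers, \<open>S_K\<close> minus a small positive matrix. Hence the null directions of
  \<open>S_K\<close> count as negative, and only the number of positive eigenvalues is seen. The
  level below which this index is attained depends on the gap of \<open>S_K\<close> above 0 and is
  not uniform along the path; this leaves room for the eigenvalues that escape to minus infinity.
  Coercivity needs only a lower bound of \<open>Q - \<lambda> W\<close>, so one mesh serves all
  \<open>\<lambda>\<close> below a given level and all coefficients near the limit. All forms to be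
  compared therefore live on the same coordinates.\<close>

lemma homogeneous_system_nontrivial:
  fixes v :: "'k \<Rightarrow> 'i \<Rightarrow> complex"
  assumes "finite I" "finite T" "card I < card T"
  shows "\<exists>c. (\<exists>j\<in>T. c j \<noteq> 0) \<and> (\<forall>i\<in>I. (\<Sum>j\<in>T. c j * v j i) = 0)"
  using assms
proof (induction I arbitrary: T v rule: finite_induct)
  case empty
  then have "T \<noteq> {}" by auto
  then show ?case by (intro exI[of _ "\<lambda>_. 1"]) auto
next
  case (insert i0 I)
  show ?case
  proof (cases "\<forall>j\<in>T. v j i0 = 0")
    case True
    have "card I < card T" using insert by simp
    from insert.IH[OF insert.prems(1) this, of v] obtain c
      where "\<exists>j\<in>T. c j \<noteq> 0" "\<forall>i\<in>I. (\<Sum>j\<in>T. c j * v j i) = 0" by blast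
    then show ?thesis using True by (intro exI[of _ c]) simp
  next
    case False
    then obtain t where t: "t \<in> T" "v t i0 \<noteq> 0" by blast
    \<comment> \<open>Gaussian elimination: with column \<open>t\<close> as pivot, \<open>v'\<close>
      has zeros in row \<open>i0\<close>. The coefficient of \<open>t\<close> is restored afterwards
      as \<open>- s\<close>, so that row \<open>i0\<close> holds too.\<close>
    define v' where "v' = (\<lambda>j i. v j i - (v j i0 / v t i0) * v t i)"
    have "card I < card (T - {t})" using insert t by simp
    from insert.IH[OF _ this, of v'] insert.prems(1) obtain c'
      where c': "\<exists>j\<in>T-{t}. c' j \<noteq> 0" "\<forall>i\<in>I. (\<Sum>j\<in>T-{t}. c' j * v' j i) = 0" by auto
    define s where "s = (\<Sum>j\<in>T-{t}. c' j * (v j i0 / v t i0))"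
    define c where "c = c'(t := - s)"
    have split: "(\<Sum>j\<in>T. c j * v j i) = - s * v t i + (\<Sum>j\<in>T-{t}. c' j * v j i)" for i
      using t insert.prems(1) by (subst sum.remove[of T t]) (auto simp: c_def)
    have "s * v t i0 = (\<Sum>j\<in>T-{t}. c' j * v j i0)"
      using t by (simp add: s_def sum_distrib_right)
    then have "(\<Sum>j\<in>T. c j * v j i0) = 0" unfolding split by simp
    moreover have "(\<Sum>j\<in>T. c j * v j i) = 0" if "i \<in> I" for i
    proof -
      have "(\<Sum>j\<in>T-{t}. c' j * v' j i) = (\<Sum>j\<in>T-{t}. c' j * v j i) - s * v t i"
        by (simp add: v'_def s_def algebra_simps sum_subtractf sum_distrib_left)
      then show ?thesis using c'(2) that unfolding split by simp
    qed
    moreover have "\<exists>j\<in>T. c j \<noteq> 0" using c'(1) t by (auto simp: c_def)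
    ultimately show ?thesis by (intro exI[of _ c]) auto
  qed
qed

section \<open>Hermitian forms and their inertia\<close>

definition lc :: "('k \<Rightarrow> complex) \<Rightarrow> ('k \<Rightarrow> 'i \<Rightarrow> complex) \<Rightarrow> 'k set \<Rightarrow> 'i \<Rightarrow> complex" where
  "lc c v T = (\<lambda>i. \<Sum>j\<in>T. c j * v j i)"

definition lspan :: "('k \<Rightarrow> 'i \<Rightarrow> complex) \<Rightarrow> 'k set \<Rightarrow> ('i \<Rightarrow> complex) set" where
  "lspan v T = {x. \<exists>c. x = lc c v T}"

lemma lspan_base: "finite T \<Longrightarrow> j \<in> T \<Longrightarrow> v j \<in> lspan v T"
  unfolding lspan_def lc_def
  by (auto intro!: exI[of _ "\<lambda>k. if k = j then 1 else 0"] simp: if_distrib[of "\<lambda>x. x * _"] cong: if_cong)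

lemma lspan_comb: "x \<in> lspan v T \<Longrightarrow> y \<in> lspan v T \<Longrightarrow> (\<lambda>i. x i + c * y i) \<in> lspan v T"
  unfolding lspan_def lc_def
proof clarify
  fix c1 c2
  show "\<exists>ca. (\<lambda>i. (\<Sum>j\<in>T. c1 j * v j i) + c * (\<Sum>j\<in>T. c2 j * v j i)) = (\<lambda>i. \<Sum>j\<in>T. ca j * v j i)"
    by (rule exI[of _ "\<lambda>j. c1 j + c * c2 j"]) (simp add: algebra_simps sum.distrib sum_distrib_left)
qed

lemma lspan_zero: "(\<lambda>i. 0) \<in> lspan v T"
  unfolding lspan_def lc_def by (auto intro!: exI[of _ "\<lambda>_. 0"])

lemma lspan_lc:
  assumes "\<And>j. j \<in> U \<Longrightarrow> w j \<in> lspan v T"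
  shows "lc c w U \<in> lspan v T"
proof (cases "finite U")
  case True
  then show ?thesis using assms
  proof (induction U rule: finite_induct)
    case empty
    then show ?case using lspan_zero by (simp add: lc_def)
  next
    case (insert j U)
    have "lc c w (insert j U) = (\<lambda>i. lc c w U i + c j * w j i)"
      using insert by (simp add: lc_def add.commute)
    moreover have "lc c w U \<in> lspan v T" "w j \<in> lspan v T" using insert by auto
    ultimately show ?case using lspan_comb[of "lc c w U" v T "w j" "c j"] by simp
  qed
qed (use lspan_zero in \<open>simp add: lc_def\<close>)

lemma lspan_trans:
  assumes "x \<in> lspan w U" "\<And>j. j \<in> U \<Longrightarrow> w j \<in> lspan v T"
  shows "x \<in> lspan v T"
proof -
  obtain c where "x = lc c w U" using assms(1) by (auto simp: lspan_def)
  then show ?thesis using lspan_lc[OF assms(2)] by simp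
qed

text \<open>Vectors are functions on an index type, and \<open>I\<close> is the set of coordinates the form sees; this
  keeps spaces of different dimensions in one type.\<close>
definition hform :: "'i set \<Rightarrow> (('i \<Rightarrow> complex) \<Rightarrow> ('i \<Rightarrow> complex) \<Rightarrow> complex) \<Rightarrow> bool" where
  "hform I B \<longleftrightarrow> (\<forall>x y z c. B x (\<lambda>i. y i + c * z i) = B x y + c * B x z) \<and>
     (\<forall>x y. B y x = cnj (B x y)) \<and> (\<forall>x y. (\<forall>i\<in>I. y i = 0) \<longrightarrow> B x y = 0)"

lemma hformD:
  assumes "hform I B"
  shows "B x (\<lambda>i. y i + c * z i) = B x y + c * B x z" "B y x = cnj (B x y)"
    "(\<And>i. i \<in> I \<Longrightarrow> y i = 0) \<Longrightarrow> B x y = 0"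
  using assms unfolding hform_def by blast+

lemma hformI:
  assumes "\<And>x y z c. B x (\<lambda>i. y i + c * z i) = B x y + c * B x z" "\<And>x y. B y x = cnj (B x y)"
    "\<And>x y. (\<And>i. i \<in> I \<Longrightarrow> y i = 0) \<Longrightarrow> B x y = 0"
  shows "hform I B"
  unfolding hform_def using assms by blast

lemma hform_uminus:
  assumes "hform I B"
  shows "hform I (\<lambda>x y. - B x y)"
proof (rule hformI)
  fix x y show "- B y x = cnj (- B x y)" using hformD(2)[OF assms, of y x] by simp
qed (use assms in \<open>auto simp: hformD(1) hformD(3)\<close>)

lemma hform_add:
  assumes "hform I B" "hform I B'"
  shows "hform I (\<lambda>x y. B x y + complex_of_real r * B' x y)"
proof (rule hformI)
  fix x y
  show "B y x + complex_of_real r * B' y x = cnj (B x y + complex_of_real r * B' x y)"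
    using hformD(2)[OF assms(1), of y x] hformD(2)[OF assms(2), of y x] by simp
qed (use assms in \<open>auto simp: hformD(1) hformD(3) algebra_simps\<close>)

lemma hform_lc_right:
  assumes "hform I B" "finite T"
  shows "B x (lc c v T) = (\<Sum>j\<in>T. c j * B x (v j))"
  using assms(2,1)
proof (induction T rule: finite_induct)
  case empty
  have "B x (lc c v {}) = 0" by (rule hformD(3)[OF assms(1)]) (simp add: lc_def)
  then show ?case by simp
next
  case (insert j T)
  have "lc c v (insert j T) = (\<lambda>i. lc c v T i + c j * v j i)"
    using insert by (simp add: lc_def add.commute)
  then have "B x (lc c v (insert j T)) = B x (\<lambda>i. lc c v T i + c j * v j i)" by simp
  also have "\<dots> = B x (lc c v T) + c j * B x (v j)"
    by (rule hformD(1)[OF assms(1)])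
  also have "B x (lc c v T) = (\<Sum>j\<in>T. c j * B x (v j))" by (rule insert.IH[OF assms(1)])
  finally show ?case using insert by (simp add: add.commute)
qed

lemma hform_lc_left:
  assumes "hform I B" "finite T"
  shows "B (lc c v T) x = (\<Sum>j\<in>T. cnj (c j) * B (v j) x)"
proof -
  have "B (lc c v T) x = cnj (B x (lc c v T))" by (rule hformD(2)[OF assms(1)])
  also have "\<dots> = (\<Sum>j\<in>T. cnj (c j) * cnj (B x (v j)))"
    unfolding hform_lc_right[OF assms] by simp
  also have "\<dots> = (\<Sum>j\<in>T. cnj (c j) * B (v j) x)"
    by (intro sum.cong refl arg_cong2[where f="(*)"] hformD(2)[OF assms(1), symmetric])
  finally show ?thesis .
qed

lemma hform_cong:
  assumes "hform I B" "\<And>i. i \<in> I \<Longrightarrow> y i = y' i"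
  shows "B x y = B x y'"
proof -
  have "B x (\<lambda>i. y i + 1 * (y' i - y i)) = B x y + 1 * B x (\<lambda>i. y' i - y i)"
    by (rule hformD(1)[OF assms(1)])
  moreover have "B x (\<lambda>i. y' i - y i) = 0" by (rule hformD(3)[OF assms(1)]) (simp add: assms)
  ultimately show ?thesis by simp
qed

lemma hform_cong2:
  assumes "hform I B" "\<And>i. i \<in> I \<Longrightarrow> y i = y' i" "\<And>i. i \<in> I \<Longrightarrow> x i = x' i"
  shows "B x y = B x' y'"
proof -
  have "B x y = B x y'" by (rule hform_cong[OF assms(1,2)])
  also have "\<dots> = cnj (B y' x)" by (rule hformD(2)[OF assms(1)])
  also have "B y' x = B y' x'" by (rule hform_cong[OF assms(1,3)])
  also have "cnj \<dots> = B x' y'" by (rule hformD(2)[OF assms(1), symmetric])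
  finally show ?thesis .
qed

lemma hform_add_expand:
  assumes "hform I B"
  shows "B (\<lambda>i. x i + c * y i) (\<lambda>i. x i + c * y i) = B x x + c * B x y + cnj c * B y x + cnj c * c * B y y"
proof -
  have l: "B (\<lambda>i. x i + c * y i) z = B x z + cnj c * B y z" for z
  proof -
    have "B (\<lambda>i. x i + c * y i) z = cnj (B z (\<lambda>i. x i + c * y i))" by (rule hformD(2)[OF assms])
    also have "\<dots> = cnj (B z x) + cnj c * cnj (B z y)" by (simp add: hformD(1)[OF assms])
    also have "cnj (B z x) = B x z" by (rule hformD(2)[OF assms, symmetric])
    also have "cnj (B z y) = B y z" by (rule hformD(2)[OF assms, symmetric])
    finally show ?thesis .
  qed
  show ?thesis by (simp add: l hformD(1)[OF assms] algebra_simps)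
qed

lemma hform_polarization:
  assumes "hform I B"
  shows "4 * B x y = complex_of_real (Re (B (\<lambda>i. x i + 1 * y i) (\<lambda>i. x i + 1 * y i))
     - Re (B (\<lambda>i. x i + (-1) * y i) (\<lambda>i. x i + (-1) * y i)))
     - \<i> * complex_of_real (Re (B (\<lambda>i. x i + \<i> * y i) (\<lambda>i. x i + \<i> * y i))
     - Re (B (\<lambda>i. x i + (-\<i>) * y i) (\<lambda>i. x i + (-\<i>) * y i)))"
  using hformD(2)[OF assms, of y x]
  unfolding hform_add_expand[OF assms] by (auto simp: complex_eq_iff)

text \<open>The variational estimates for the reduced energy control only quadratic values;
  polarization extends convergence to all pairs of arguments.\<close>

lemma hform_tendsto:
  assumes "hform I B" "\<forall>\<^sub>F s in F. hform I (Bs s)"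
    and q: "\<And>x. ((\<lambda>s. Re (Bs s x x)) \<longlongrightarrow> Re (B x x)) F"
  shows "((\<lambda>s. Bs s x y) \<longlongrightarrow> B x y) F"
proof -
  have 1: "((\<lambda>s. (complex_of_real (Re (Bs s (\<lambda>i. x i + 1 * y i) (\<lambda>i. x i + 1 * y i))
     - Re (Bs s (\<lambda>i. x i + (-1) * y i) (\<lambda>i. x i + (-1) * y i)))
     - \<i> * complex_of_real (Re (Bs s (\<lambda>i. x i + \<i> * y i) (\<lambda>i. x i + \<i> * y i))
     - Re (Bs s (\<lambda>i. x i + (-\<i>) * y i) (\<lambda>i. x i + (-\<i>) * y i)))) / 4) \<longlongrightarrow> 4 * B x y / 4) F"
    unfolding hform_polarization[OF assms(1)] by (intro tendsto_intros q) simp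
  have 2: "\<forall>\<^sub>F s in F. (complex_of_real (Re (Bs s (\<lambda>i. x i + 1 * y i) (\<lambda>i. x i + 1 * y i))
     - Re (Bs s (\<lambda>i. x i + (-1) * y i) (\<lambda>i. x i + (-1) * y i)))
     - \<i> * complex_of_real (Re (Bs s (\<lambda>i. x i + \<i> * y i) (\<lambda>i. x i + \<i> * y i))
     - Re (Bs s (\<lambda>i. x i + (-\<i>) * y i) (\<lambda>i. x i + (-\<i>) * y i)))) / 4 = Bs s x y"
    using assms(2)
  proof eventually_elim
    case (elim s)
    show ?case unfolding hform_polarization[OF elim, symmetric] by simp
  qed
  from tendsto_cong[OF 2] 1 show ?thesis by simp
qed

section \<open>Orthogonalisation for indefinite Hermitian forms\<close>

definition orth_fam :: "(('i \<Rightarrow> complex) \<Rightarrow> ('i \<Rightarrow> complex) \<Rightarrow> complex) \<Rightarrow> ('k \<Rightarrow> 'i \<Rightarrow> complex) \<Rightarrow> ('k \<Rightarrow> real) \<Rightarrow> 'k set \<Rightarrow> bool" where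
  "orth_fam B e \<sigma> T \<longleftrightarrow> (\<forall>j\<in>T. \<forall>k\<in>T. B (e j) (e k) = (if j = k then complex_of_real (\<sigma> j) else 0))"

lemma hform_real: "hform I B \<Longrightarrow> B x x = complex_of_real (Re (B x x))"
  using hformD(2)[of I B x x] by (simp add: complex_eq_iff)

lemma hform_isotropic_zero:
  assumes "hform I B" "\<And>x. x \<in> lspan f T \<Longrightarrow> Re (B x x) = 0" "x \<in> lspan f T" "y \<in> lspan f T"
  shows "B x y = 0"
proof -
  have "4 * B x y = 0" unfolding hform_polarization[OF assms(1)]
    by (simp only: assms(2)[OF lspan_comb[OF assms(3,4)]]) simp
  then show ?thesis by simp
qed

text \<open>Gram-Schmidt without definiteness: a span on which the quadratic form vanishes is
  isotropic by polarization, so \<open>f\<close> itself will do. Otherwise some \<open>x\<close> in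
  the span has \<open>B x x\<close> nonzero, and the projections of the other vectors along
  \<open>x\<close> are handled by induction.\<close>

lemma exists_orth_fam:
  assumes "hform I B" "finite T"
  shows "\<exists>e \<sigma>. orth_fam B e \<sigma> T \<and> (\<forall>j\<in>T. e j \<in> lspan f T) \<and> (\<forall>j\<in>T. f j \<in> lspan e T)"
  using assms(2)
proof (induction "card T" arbitrary: T f)
  case 0
  then show ?case by (simp add: orth_fam_def)
next
  case (Suc n)
  show ?case
  proof (cases "\<forall>x \<in> lspan f T. Re (B x x) = 0")
    case True
    have "orth_fam B f (\<lambda>_. 0) T"
      unfolding orth_fam_def
    proof (intro ballI)
      fix j k assume "j \<in> T" "k \<in> T"
      then have "B (f j) (f k) = 0"
        using hform_isotropic_zero[OF assms(1), of f T "f j" "f k"] True lspan_base[OF Suc.prems] by blast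
      then show "B (f j) (f k) = (if j = k then complex_of_real 0 else 0)" by simp
    qed
    then show ?thesis using lspan_base[OF Suc.prems] by blast
  next
    case False
    then obtain x where x: "x \<in> lspan f T" "Re (B x x) \<noteq> 0" by blast
    then obtain a where a: "x = lc a f T" by (auto simp: lspan_def)
    \<comment> \<open>An index with a nonzero coefficient in \<open>x\<close>: there
      \<open>x\<close> can take the place of \<open>f t\<close> without changing the span.\<close>
    have "\<exists>t\<in>T. a t \<noteq> 0"
    proof (rule ccontr)
      assume "\<not> ?thesis"
      then have "x = (\<lambda>_. 0)" unfolding a lc_def by simp
      then show False using x(2) hformD(3)[OF assms(1), of x x] by simp
    qed
    then obtain t where t: "t \<in> T" "a t \<noteq> 0" by blast
    \<comment> \<open>Projection along \<open>x\<close>, legitimate for an indefinite form because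
      \<open>B x x\<close> is nonzero.\<close>
    define f' where "f' = (\<lambda>j i. f j i + (- (B x (f j) / B x x)) * x i)"
    have Bxx: "B x x \<noteq> 0" using x(2) by auto
    have orth: "B x (f' j) = 0" for j
      unfolding f'_def hformD(1)[OF assms(1)] using Bxx by simp
    have "n = card (T - {t})" using Suc t by simp
    from Suc.hyps(1)[OF this, of f'] Suc.prems obtain e' \<sigma>' where
      e': "orth_fam B e' \<sigma>' (T-{t})" "\<forall>j\<in>T-{t}. e' j \<in> lspan f' (T-{t})" "\<forall>j\<in>T-{t}. f' j \<in> lspan e' (T-{t})"
      by auto
    define e where "e = e'(t := x)"
    define \<sigma> where "\<sigma> = \<sigma>'(t := Re (B x x))"
    have orth': "B x (e' j) = 0" if "j \<in> T-{t}" for j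
    proof -
      obtain c where "e' j = lc c f' (T-{t})" using e'(2) \<open>j \<in> T-{t}\<close> by (auto simp: lspan_def)
      then show ?thesis using orth hform_lc_right[OF assms(1), of "T-{t}"] Suc.prems by simp
    qed
    have orth'': "B (e' j) x = 0" if "j \<in> T-{t}" for j
      using orth'[OF that] hformD(2)[OF assms(1), of "e' j" x] by simp
    have A: "orth_fam B e \<sigma> T"
      using e'(1) orth' orth'' hform_real[OF assms(1), of x]
      unfolding orth_fam_def e_def \<sigma>_def by auto
    have f'T: "f' j \<in> lspan f T" if "j \<in> T" for j
      unfolding f'_def by (rule lspan_comb[OF lspan_base[OF Suc.prems that] x(1)])
    have B: "\<forall>j\<in>T. e j \<in> lspan f T"
    proof
      fix j assume "j \<in> T"
      show "e j \<in> lspan f T"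
      proof (cases "j = t")
        case False
        then have "e' j \<in> lspan f' (T-{t})" using e'(2) \<open>j \<in> T\<close> by auto
        then show ?thesis using f'T False by (auto simp: e_def intro: lspan_trans)
      qed (use x in \<open>simp add: e_def\<close>)
    qed
    have ee: "e' j \<in> lspan e T" if "j \<in> T-{t}" for j
      using lspan_base[OF Suc.prems, of j e] that by (simp add: e_def)
    have xe: "x \<in> lspan e T" using lspan_base[OF Suc.prems t(1), of e] by (simp add: e_def)
    have fe: "f j \<in> lspan e T" if "j \<in> T-{t}" for j
    proof -
      have "f' j \<in> lspan e T" using e'(3) that ee lspan_trans by blast
      from lspan_comb[OF this xe, of "B x (f j) / B x x"] show ?thesis by (simp add: f'_def)
    qed
    have "f t \<in> lspan e T"
    proof -
      have "x = (\<lambda>i. a t * f t i + lc a f (T-{t}) i)"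
        unfolding a lc_def using sum.remove[OF Suc.prems t(1)] by auto
      then have "f t = (\<lambda>i. 0 + (1 / a t) * (\<lambda>i. x i + (-1) * lc a f (T-{t}) i) i)"
        using t(2) by (auto simp: field_simps fun_eq_iff)
      moreover have "\<dots> \<in> lspan e T"
        using fe by (intro lspan_comb[OF lspan_zero] lspan_comb[OF xe] lspan_lc) auto
      ultimately show ?thesis by simp
    qed
    then have "\<forall>j\<in>T. f j \<in> lspan e T" using fe by auto
    with A B show ?thesis by blast
  qed
qed

text \<open>Coordinates outside \<open>I\<close> are invisible to the form, so spanning is required
  on \<open>I\<close> only. Independence is automatic because the family has exactly as many members
  as \<open>I\<close>; see \<open>spanning_independent\<close>.\<close>

definition diag_basis :: "'i set \<Rightarrow> (('i \<Rightarrow> complex) \<Rightarrow> ('i \<Rightarrow> complex) \<Rightarrow> complex) \<Rightarrow> ('i \<Rightarrow> 'i \<Rightarrow> complex) \<Rightarrow> ('i \<Rightarrow> real) \<Rightarrow> bool" where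
  "diag_basis I B e \<sigma> \<longleftrightarrow> orth_fam B e \<sigma> I \<and> (\<forall>x. \<exists>c. \<forall>i\<in>I. x i = lc c e I i)"

lemma exists_diag_basis:
  assumes "hform I B" "finite I"
  shows "\<exists>e \<sigma>. diag_basis I B e \<sigma>"
proof -
  define f :: "'a \<Rightarrow> 'a \<Rightarrow> complex" where "f = (\<lambda>j i. if i = j then 1 else 0)"
  from exists_orth_fam[OF assms, of f] obtain e \<sigma> where
    e: "orth_fam B e \<sigma> I" "\<forall>j\<in>I. f j \<in> lspan e I" by blast
  have "\<exists>c. \<forall>i\<in>I. x i = lc c e I i" for x
  proof -
    have "lc x f I \<in> lspan e I" by (rule lspan_lc) (use e in auto)
    then obtain c where "lc x f I = lc c e I" by (auto simp: lspan_def)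
    moreover have "lc x f I i = x i" if "i \<in> I" for i
      using assms(2) that by (simp add: lc_def f_def if_distrib[of "(*) _"] cong: if_cong)
    ultimately show ?thesis by (intro exI[of _ c]) auto
  qed
  then show ?thesis using e(1) unfolding diag_basis_def by blast
qed

text \<open>A dependency with \<open>c t\<close> nonzero would let the other
  \<open>card I - 1\<close> vectors span all unit vectors; a nontrivial combination of the unit
  vectors would then vanish.\<close>

lemma spanning_independent:
  fixes e :: "'i \<Rightarrow> 'i \<Rightarrow> complex"
  assumes "finite I" "\<And>x. \<exists>c. \<forall>i\<in>I. x i = lc c e I i" "\<And>i. i \<in> I \<Longrightarrow> lc c e I i = 0" "t \<in> I"
  shows "c t = 0"
proof (rule ccontr)
  assume ct: "c t \<noteq> 0"
  have "\<forall>j. \<exists>a. \<forall>i\<in>I. (if i = j then 1 else 0) = lc a e I i"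
    by (intro allI assms(2))
  then obtain a where a: "\<And>j i. i \<in> I \<Longrightarrow> (if i = j then 1 else 0) = lc (a j) e I i" by metis
  have "card (I - {t}) < card I" using assms(1,4) by (rule card_Diff1_less)
  \<comment> \<open>Coefficients of the unit vector \<open>j\<close> after \<open>e t\<close> has
    been eliminated through the dependency; at \<open>k = t\<close> they are 0.\<close>
  from homogeneous_system_nontrivial[OF _ assms(1) this, of "\<lambda>j k. a j k - a j t * c k / c t"] assms(1) obtain b
    where b: "\<exists>j\<in>I. b j \<noteq> 0" "\<And>k. k \<in> I - {t} \<Longrightarrow> (\<Sum>j\<in>I. b j * (a j k - a j t * c k / c t)) = 0" by auto
  have "b i = 0" if i: "i \<in> I" for i
  proof -
    have "b i = (\<Sum>j\<in>I. b j * (if i = j then 1 else 0))"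
      using assms(1) i by (simp add: if_distrib[of "(*) _"] cong: if_cong)
    also have "\<dots> = (\<Sum>j\<in>I. b j * (\<Sum>k\<in>I. a j k * e k i))"
      using a i by (auto simp: lc_def intro!: sum.cong)
    also have "\<dots> = (\<Sum>j\<in>I. b j * (\<Sum>k\<in>I. (a j k - a j t * c k / c t) * e k i))"
    proof (rule sum.cong, simp)
      fix j assume "j \<in> I"
      have "(\<Sum>k\<in>I. (a j k - a j t * c k / c t) * e k i) = (\<Sum>k\<in>I. a j k * e k i) - (\<Sum>k\<in>I. (a j t / c t) * (c k * e k i))"
        unfolding sum_subtractf[symmetric] by (rule sum.cong) (auto simp: algebra_simps)
      also have "(\<Sum>k\<in>I. (a j t / c t) * (c k * e k i)) = (a j t / c t) * lc c e I i"
        unfolding lc_def by (rule sum_distrib_left[symmetric])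
      also have "\<dots> = 0" using assms(3)[OF i] by simp
      finally show "b j * (\<Sum>k\<in>I. a j k * e k i) = b j * (\<Sum>k\<in>I. (a j k - a j t * c k / c t) * e k i)" by simp
    qed
    also have "\<dots> = (\<Sum>j\<in>I. \<Sum>k\<in>I. b j * (a j k - a j t * c k / c t) * e k i)"
      by (simp add: sum_distrib_left mult.assoc)
    also have "\<dots> = (\<Sum>k\<in>I. \<Sum>j\<in>I. b j * (a j k - a j t * c k / c t) * e k i)"
      by (rule sum.swap)
    also have "\<dots> = (\<Sum>k\<in>I. (\<Sum>j\<in>I. b j * (a j k - a j t * c k / c t)) * e k i)"
      by (simp add: sum_distrib_right)
    also have "\<dots> = 0"
    proof (rule sum.neutral, rule ballI)
      fix k assume "k \<in> I"
      then show "(\<Sum>j\<in>I. b j * (a j k - a j t * c k / c t)) * e k i = 0"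
        using b(2) ct by (cases "k = t") auto
    qed
    finally show ?thesis .
  qed
  then show False using b(1) by blast
qed

lemma diag_quad:
  assumes "hform I B" "orth_fam B e \<sigma> T" "finite T"
  shows "B (lc c e T) (lc c e T) = complex_of_real (\<Sum>j\<in>T. \<sigma> j * (cmod (c j))\<^sup>2)"
proof -
  have "B (lc c e T) (lc c e T) = (\<Sum>j\<in>T. cnj (c j) * (\<Sum>k\<in>T. c k * B (e j) (e k)))"
    by (simp only: hform_lc_left[OF assms(1,3)], simp only: hform_lc_right[OF assms(1,3)])
  also have "\<dots> = (\<Sum>j\<in>T. cnj (c j) * (\<Sum>k\<in>T. if j = k then c j * of_real (\<sigma> j) else 0))"
    using assms(2) by (intro sum.cong arg_cong2[where f="(*)"]) (auto simp: orth_fam_def)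
  also have "\<dots> = (\<Sum>j\<in>T. cnj (c j) * (c j * of_real (\<sigma> j)))"
    using assms(3) by simp
  also have "\<dots> = of_real (\<Sum>j\<in>T. \<sigma> j * (cmod (c j))\<^sup>2)"
    unfolding of_real_sum by (intro sum.cong refl) (metis (no_types, lifting) complex_norm_square mult.commute mult.left_commute of_real_mult)
  finally show ?thesis .
qed

text \<open>Every nonzero coefficient vector must give a negative value. This makes independence of
  the family part of the notion, since a vanishing combination would have value 0.\<close>

definition negf :: "(('i \<Rightarrow> complex) \<Rightarrow> ('i \<Rightarrow> complex) \<Rightarrow> complex) \<Rightarrow> ('k \<Rightarrow> 'i \<Rightarrow> complex) \<Rightarrow> 'k set \<Rightarrow> bool" where
  "negf B v T \<longleftrightarrow> (\<forall>c. (\<exists>j\<in>T. c j \<noteq> 0) \<longrightarrow> Re (B (lc c v T) (lc c v T)) < 0)"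

text \<open>Sylvester's argument: a longer negative family would contain a nontrivial combination
  without components along the negative \<open>e i\<close>, and there the form is
  nonnegative.\<close>

lemma negf_card_le:
  assumes "hform I B" "finite I" "diag_basis I B e \<sigma>" "finite T" "negf B v T"
  shows "card T \<le> card {i\<in>I. \<sigma> i < 0}"
proof (rule ccontr)
  assume "\<not> ?thesis"
  then have lt: "card {i\<in>I. \<sigma> i < 0} < card T" by simp
  have "\<forall>j. \<exists>a. \<forall>i\<in>I. v j i = lc a e I i" using assms(3) unfolding diag_basis_def by blast
  then obtain a where a: "\<And>j i. i \<in> I \<Longrightarrow> v j i = lc (a j) e I i" by metis
  from homogeneous_system_nontrivial[OF _ assms(4) lt, of a] assms(2) obtain c where
    c: "\<exists>j\<in>T. c j \<noteq> 0" "\<And>i. i \<in> I \<Longrightarrow> \<sigma> i < 0 \<Longrightarrow> (\<Sum>j\<in>T. c j * a j i) = 0" by auto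
  define b where "b = (\<lambda>i. \<Sum>j\<in>T. c j * a j i)"
  have eq: "lc c v T i = lc b e I i" if "i \<in> I" for i
  proof -
    have "lc c v T i = (\<Sum>j\<in>T. c j * (\<Sum>k\<in>I. a j k * e k i))"
      using a that by (simp add: lc_def)
    also have "\<dots> = (\<Sum>j\<in>T. \<Sum>k\<in>I. c j * a j k * e k i)" by (simp add: sum_distrib_left mult.assoc)
    also have "\<dots> = (\<Sum>k\<in>I. \<Sum>j\<in>T. c j * a j k * e k i)" by (rule sum.swap)
    also have "\<dots> = lc b e I i" by (simp add: lc_def b_def sum_distrib_right)
    finally show ?thesis .
  qed
  have "B (lc c v T) (lc c v T) = B (lc b e I) (lc b e I)"
    by (rule hform_cong2[OF assms(1)]) (use eq in auto)
  also have "\<dots> = complex_of_real (\<Sum>j\<in>I. \<sigma> j * (cmod (b j))\<^sup>2)"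
    using diag_quad[OF assms(1) _ assms(2)] assms(3) unfolding diag_basis_def by blast
  also have "Re \<dots> \<ge> 0" using c(2) unfolding Re_complex_of_real
    by (intro sum_nonneg) (metis b_def linorder_not_less mult_nonneg_nonneg mult_zero_right norm_zero power_zero_numeral zero_le_power2)
  finally show False using assms(5) c(1) unfolding negf_def by (metis linorder_not_less)
qed

text \<open>The maximum is only meaningful if the dimensions of negative subspaces are bounded, as they are for
  a Hermitian form on finitely many coordinates.\<close>
definition nidx :: "(('i \<Rightarrow> complex) \<Rightarrow> ('i \<Rightarrow> complex) \<Rightarrow> complex) \<Rightarrow> nat" where
  "nidx B = Max {k. \<exists>v::nat \<Rightarrow> 'i \<Rightarrow> complex. negf B v {..<k}}"

text \<open>Negative families occur with several index types, whereas \<open>nidx\<close> has to fix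
  one; the natural numbers are the common choice.\<close>

lemma negf_reindex:
  assumes "finite T" "negf B v T"
  shows "\<exists>v'::nat \<Rightarrow> 'i \<Rightarrow> complex. negf B v' {..<card T}"
proof -
  from ex_bij_betw_nat_finite[OF assms(1)] obtain h where h: "bij_betw h {..<card T} T"
    by (auto simp: atLeast0LessThan)
  have "negf B (v \<circ> h) {..<card T}"
    unfolding negf_def
  proof (intro allI impI)
    fix c :: "nat \<Rightarrow> complex" assume "\<exists>j\<in>{..<card T}. c j \<noteq> 0"
    then obtain j where j: "j < card T" "c j \<noteq> 0" by auto
    define c' where "c' = (\<lambda>t. c (the_inv_into {..<card T} h t))"
    have c'h: "c' (h k) = c k" if "k < card T" for k
      using h that by (simp add: c'_def the_inv_into_f_f bij_betw_def)
    have "lc c (v \<circ> h) {..<card T} = lc c' v T"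
      unfolding lc_def by (subst sum.reindex_bij_betw[OF h, symmetric]) (simp add: c'h)
    moreover have "h j \<in> T" "c' (h j) \<noteq> 0" using h j c'h by (auto simp: bij_betw_def)
    ultimately show "Re (B (lc c (v \<circ> h) {..<card T}) (lc c (v \<circ> h) {..<card T})) < 0"
      using assms(2) unfolding negf_def by auto
  qed
  then show ?thesis by blast
qed

lemma negf_diag:
  assumes "hform I B" "orth_fam B e \<sigma> T" "finite T" "\<And>j. j \<in> T \<Longrightarrow> \<sigma> j < 0"
  shows "negf B e T"
  unfolding negf_def diag_quad[OF assms(1-3)]
proof (intro allI impI)
  fix c :: "'b \<Rightarrow> complex" assume "\<exists>j\<in>T. c j \<noteq> 0"
  then obtain j where j: "j \<in> T" "c j \<noteq> 0" by auto
  have "(\<Sum>j\<in>T. \<sigma> j * (cmod (c j))\<^sup>2) < (\<Sum>j\<in>T. 0)"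
  proof (rule sum_strict_mono_ex1[OF assms(3)])
    show "\<forall>x\<in>T. \<sigma> x * (cmod (c x))\<^sup>2 \<le> 0" using assms(4) by (meson less_imp_le mult_nonpos_nonneg zero_le_power2)
    show "\<exists>a\<in>T. \<sigma> a * (cmod (c a))\<^sup>2 < 0" using j assms(4) by (intro bexI[of _ j]) (auto simp: mult_neg_pos)
  qed
  then show "Re (complex_of_real (\<Sum>j\<in>T. \<sigma> j * (cmod (c j))\<^sup>2)) < 0" by simp
qed

lemma orth_fam_subset: "orth_fam B e \<sigma> I \<Longrightarrow> T \<subseteq> I \<Longrightarrow> orth_fam B e \<sigma> T"
  unfolding orth_fam_def by blast

lemma nidx_ge:
  fixes v :: "'k \<Rightarrow> 'i \<Rightarrow> complex"
  assumes "hform I B" "finite I" "finite T" "negf B v T"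
  shows "card T \<le> nidx B"
proof -
  obtain e \<sigma> where d: "diag_basis I B e \<sigma>" using exists_diag_basis[OF assms(1,2)] by blast
  have "{k. \<exists>v::nat \<Rightarrow> 'i \<Rightarrow> complex. negf B v {..<k}} \<subseteq> {..card {i\<in>I. \<sigma> i < 0}}"
    using negf_card_le[OF assms(1,2) d] by fastforce
  then have "finite {k. \<exists>v::nat \<Rightarrow> 'i \<Rightarrow> complex. negf B v {..<k}}" using finite_subset by blast
  then show ?thesis unfolding nidx_def using negf_reindex[OF assms(3,4)] by (intro Max_ge) auto
qed

lemma nidx_diag:
  fixes B :: "('i \<Rightarrow> complex) \<Rightarrow> ('i \<Rightarrow> complex) \<Rightarrow> complex"
  assumes "hform I B" "finite I" "diag_basis I B e \<sigma>"
  shows "nidx B = card {i\<in>I. \<sigma> i < 0}"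
proof (rule antisym)
  have "{k. \<exists>v::nat \<Rightarrow> 'i \<Rightarrow> complex. negf B v {..<k}} \<subseteq> {..card {i\<in>I. \<sigma> i < 0}}"
    using negf_card_le[OF assms] by fastforce
  moreover have "negf B (\<lambda>_ _. 0) {..<(0::nat)}" by (simp add: negf_def)
  then have "0 \<in> {k. \<exists>v::nat \<Rightarrow> 'i \<Rightarrow> complex. negf B v {..<k}}" by blast
  ultimately show "nidx B \<le> card {i\<in>I. \<sigma> i < 0}" unfolding nidx_def
    using finite_subset[OF _ finite_atMost] by (subst Max_le_iff) blast+
  show "card {i\<in>I. \<sigma> i < 0} \<le> nidx B"
    using assms unfolding diag_basis_def
    by (intro nidx_ge[OF assms(1,2)] negf_diag[OF assms(1)]) (auto intro: orth_fam_subset)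
qed

abbreviation pidx :: "(('i \<Rightarrow> complex) \<Rightarrow> ('i \<Rightarrow> complex) \<Rightarrow> complex) \<Rightarrow> nat" where
  "pidx B \<equiv> nidx (\<lambda>x y. - B x y)"

lemma diag_basis_uminus: "diag_basis I B e \<sigma> \<Longrightarrow> diag_basis I (\<lambda>x y. - B x y) e (\<lambda>i. - \<sigma> i)"
  unfolding diag_basis_def orth_fam_def by auto

lemma pidx_diag:
  assumes "hform I B" "finite I" "diag_basis I B e \<sigma>"
  shows "pidx B = card {i\<in>I. \<sigma> i > 0}"
  using nidx_diag[OF hform_uminus[OF assms(1)] assms(2) diag_basis_uminus[OF assms(3)]] by simp

text \<open>The nullity as what the two definite indices leave over. \<open>inertia_sum\<close>
  shows that the truncated subtraction is exact; \<open>kernel_family_card_le\<close> and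
  \<open>kernel_basis_exists\<close> identify the number with the dimension of the kernel.\<close>

definition zidx :: "'i set \<Rightarrow> (('i \<Rightarrow> complex) \<Rightarrow> ('i \<Rightarrow> complex) \<Rightarrow> complex) \<Rightarrow> nat" where
  "zidx I B = card I - nidx B - pidx B"

lemma card_sign_split:
  fixes \<sigma> :: "'i \<Rightarrow> real"
  assumes "finite I"
  shows "card {i\<in>I. \<sigma> i < 0} + card {i\<in>I. \<sigma> i = 0} + card {i\<in>I. \<sigma> i > 0} = card I"
proof -
  have "card I = (\<Sum>i\<in>I. 1)" by simp
  also have "\<dots> = (\<Sum>i\<in>I. (if \<sigma> i < 0 then 1 else 0) + (if \<sigma> i = 0 then 1 else 0) + (if \<sigma> i > 0 then 1 else 0))"
    by (intro sum.cong) auto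
  also have "\<dots> = card {i\<in>I. \<sigma> i < 0} + card {i\<in>I. \<sigma> i = 0} + card {i\<in>I. \<sigma> i > 0}"
    using assms by (simp only: sum.distrib sum.inter_filter[symmetric] card_eq_sum)
  finally show ?thesis by simp
qed

lemma zidx_diag:
  assumes "hform I B" "finite I" "diag_basis I B e \<sigma>"
  shows "zidx I B = card {i\<in>I. \<sigma> i = 0}"
  unfolding zidx_def nidx_diag[OF assms] pidx_diag[OF assms]
  using card_sign_split[OF assms(2), of \<sigma>] by simp

lemma inertia_sum:
  assumes "hform I B" "finite I"
  shows "nidx B + zidx I B + pidx B = card I"
proof -
  obtain e \<sigma> where d: "diag_basis I B e \<sigma>" using exists_diag_basis[OF assms] by blast
  show ?thesis unfolding zidx_diag[OF assms d] nidx_diag[OF assms d] pidx_diag[OF assms d]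
    by (rule card_sign_split[OF assms(2)])
qed

text \<open>On a diagonal negative family the form is at most \<open>- \<delta>\<close> times the
  squared length of the coefficient vector. Finitely many matrix entries govern the perturbation, so
  a single eventual bound works for all coefficients.\<close>

lemma negf_perturb:
  fixes e :: "'k \<Rightarrow> 'i \<Rightarrow> complex"
  assumes h: "hform I B" and ev: "\<forall>\<^sub>F s in F. hform I (Bs s)"
    and o: "orth_fam B e \<sigma> T" and T: "finite T" and neg: "\<And>j. j \<in> T \<Longrightarrow> \<sigma> j < 0"
    and lim: "\<And>x y. ((\<lambda>s. Bs s x y) \<longlongrightarrow> B x y) F"
  shows "\<forall>\<^sub>F s in F. negf (Bs s) e T"
proof (cases "T = {}")
  case True
  then show ?thesis by (simp add: negf_def)
next
  case False
  define \<delta> where "\<delta> = Min ((\<lambda>j. - \<sigma> j) ` T)"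
  have \<delta>: "\<delta> > 0" using T False neg by (auto simp: \<delta>_def)
  have \<delta>le: "\<sigma> j \<le> - \<delta>" if "j \<in> T" for j
  proof -
    have "\<delta> \<le> - \<sigma> j" unfolding \<delta>_def using T that by (intro Min_le) auto
    then show ?thesis by simp
  qed
  define M where "M = real (card T)"
  have M: "M > 0" using T False by (simp add: M_def card_gt_0_iff)
  \<comment> \<open>Entries of size \<open>\<eta>\<close> change the value by at most
    \<open>\<eta> * (M * S)\<close>, by Cauchy-Schwarz for the sum of the moduli; this is half of
    the gap.\<close>
  define \<eta> where "\<eta> = \<delta> / (2 * M)"
  have \<eta>: "\<eta> > 0" using \<delta> M by (simp add: \<eta>_def)
  have "\<forall>\<^sub>F s in F. \<forall>j\<in>T. \<forall>k\<in>T. cmod (Bs s (e j) (e k) - B (e j) (e k)) < \<eta>"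
    using lim \<eta> T unfolding tendsto_iff dist_norm
    by (intro eventually_ball_finite ballI) auto
  then show ?thesis using ev
  proof eventually_elim
    case (elim s)
    show ?case unfolding negf_def
    proof (intro allI impI)
      fix c :: "'k \<Rightarrow> complex" assume "\<exists>j\<in>T. c j \<noteq> 0"
      then obtain j0 where j0: "j0 \<in> T" "c j0 \<noteq> 0" by auto
      define S where "S = (\<Sum>j\<in>T. (cmod (c j))\<^sup>2)"
      have S: "S > 0" unfolding S_def using T j0 by (intro sum_pos2[of _ j0]) auto
      define D where "D = (\<lambda>x y. Bs s x y + complex_of_real (-1) * B x y)"
      have hD: "hform I D" unfolding D_def by (rule hform_add[OF elim(2) h])
      let ?x = "lc c e T"
      have "D ?x ?x = (\<Sum>j\<in>T. \<Sum>k\<in>T. cnj (c j) * c k * D (e j) (e k))"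
        by (simp only: hform_lc_left[OF hD T], simp only: hform_lc_right[OF hD T], simp add: sum_distrib_left mult.assoc)
      then have "cmod (D ?x ?x) \<le> (\<Sum>j\<in>T. \<Sum>k\<in>T. cmod (cnj (c j) * c k * D (e j) (e k)))"
        by (auto intro!: order_trans[OF norm_sum] sum_mono)
      also have "\<dots> \<le> (\<Sum>j\<in>T. \<Sum>k\<in>T. cmod (c j) * cmod (c k) * \<eta>)"
      proof (intro sum_mono)
        fix j k assume "j \<in> T" "k \<in> T"
        then have "cmod (D (e j) (e k)) \<le> \<eta>" using elim(1) by (auto simp: D_def intro: less_imp_le)
        then show "cmod (cnj (c j) * c k * D (e j) (e k)) \<le> cmod (c j) * cmod (c k) * \<eta>"
          by (simp add: norm_mult mult_left_mono)
      qed
      also have "\<dots> = \<eta> * (\<Sum>j\<in>T. cmod (c j))\<^sup>2"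
        by (simp add: power2_eq_square sum_product sum_distrib_left mult.commute mult.left_commute)
      also have "(\<Sum>j\<in>T. cmod (c j))\<^sup>2 \<le> M * S"
        using sum_squared_le_sum_of_squares[of "\<lambda>j. cmod (c j)" T] unfolding M_def S_def by (simp add: mult.commute)
      finally have D: "cmod (D ?x ?x) \<le> \<eta> * (M * S)" using \<eta> by simp
      have "Re (B ?x ?x) = (\<Sum>j\<in>T. \<sigma> j * (cmod (c j))\<^sup>2)"
        unfolding diag_quad[OF h o T] by simp
      also have "\<dots> \<le> (\<Sum>j\<in>T. - \<delta> * (cmod (c j))\<^sup>2)"
        using \<delta>le by (intro sum_mono mult_right_mono) auto
      also have "\<dots> = - \<delta> * S" by (simp add: S_def sum_distrib_left)
      finally have "Re (B ?x ?x) \<le> - \<delta> * S" .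
      moreover have "Re (D ?x ?x) \<le> \<delta> * S / 2"
        using D complex_Re_le_cmod[of "D ?x ?x"] M by (simp add: \<eta>_def)
      moreover have "Re (Bs s ?x ?x) = Re (B ?x ?x) + Re (D ?x ?x)" by (simp add: D_def)
      moreover have "\<delta> * S > 0" using \<delta> S by simp
      ultimately show "Re (Bs s ?x ?x) < 0" by simp
    qed
  qed
qed

text \<open>As the form decreases, its old kernel joins the negative directions.\<close>
lemma negf_crossing:
  assumes h: "hform I B" "hform I B'" and I: "finite I" and d: "diag_basis I B e \<sigma>"
    and mono: "\<And>x. Re (B' x x) \<le> Re (B x x)"
    and strict: "\<And>x. (\<And>y. B y x = 0) \<Longrightarrow> (\<exists>i\<in>I. x i \<noteq> 0) \<Longrightarrow> Re (B' x x) < 0"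
  shows "negf B' e {i\<in>I. \<sigma> i \<le> 0}"
  unfolding negf_def
proof (intro allI impI)
  let ?T = "{i\<in>I. \<sigma> i \<le> 0}"
  fix c :: "'a \<Rightarrow> complex" assume "\<exists>j\<in>?T. c j \<noteq> 0"
  then obtain j where j: "j \<in> ?T" "c j \<noteq> 0" by auto
  have T: "finite ?T" and o: "orth_fam B e \<sigma> ?T" and oI: "orth_fam B e \<sigma> I"
    and sp: "\<And>x. \<exists>c. \<forall>i\<in>I. x i = lc c e I i"
    using I d unfolding diag_basis_def by (auto intro: orth_fam_subset)
  let ?x = "lc c e ?T"
  have qx: "Re (B ?x ?x) = (\<Sum>j\<in>?T. \<sigma> j * (cmod (c j))\<^sup>2)" unfolding diag_quad[OF h(1) o T] by simp
  have le: "\<sigma> i * (cmod (c i))\<^sup>2 \<le> 0" if "i \<in> ?T" for i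
    using that by (simp add: mult_nonpos_nonneg)
  \<comment> \<open>If a strictly negative direction takes part, monotonicity alone suffices.
    Otherwise the combination lies in the kernel of \<open>B\<close>, and the strict hypothesis
    applies.\<close>
  show "Re (B' ?x ?x) < 0"
  proof (cases "\<exists>i\<in>?T. \<sigma> i * (cmod (c i))\<^sup>2 < 0")
    case True
    have "(\<Sum>j\<in>?T. \<sigma> j * (cmod (c j))\<^sup>2) < (\<Sum>j\<in>?T. 0)"
      by (rule sum_strict_mono_ex1[OF T]) (use le True in auto)
    then show ?thesis using mono[of ?x] qx by simp
  next
    case False
    have z: "\<sigma> i = 0" if i: "i \<in> ?T" "c i \<noteq> 0" for i
    proof (rule ccontr)
      assume "\<sigma> i \<noteq> 0"
      then have "\<sigma> i * (cmod (c i))\<^sup>2 < 0" using i by (intro mult_neg_pos) auto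
      then show False using False i by blast
    qed
    have ker: "B y ?x = 0" for y
    proof -
      obtain a where a: "\<forall>i\<in>I. y i = lc a e I i" using sp by blast
      have "B y ?x = B (lc a e I) ?x" by (rule hform_cong2[OF h(1)]) (use a in auto)
      also have "\<dots> = (\<Sum>j\<in>I. cnj (a j) * (\<Sum>k\<in>?T. c k * B (e j) (e k)))"
        by (simp only: hform_lc_left[OF h(1) I], simp only: hform_lc_right[OF h(1) T])
      also have "\<dots> = 0"
      proof (intro sum.neutral ballI)
        fix j assume j: "j \<in> I"
        have "c k * B (e j) (e k) = 0" if "k \<in> ?T" for k
          using oI j that z[OF that] unfolding orth_fam_def by auto
        then show "cnj (a j) * (\<Sum>k\<in>?T. c k * B (e j) (e k)) = 0" by (simp add: sum.neutral)
      qed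
      finally show ?thesis .
    qed
    have "\<exists>i\<in>I. ?x i \<noteq> 0"
    proof (rule ccontr)
      assume n: "\<not> ?thesis"
      define c' where "c' = (\<lambda>i. if i \<in> ?T then c i else 0)"
      have "lc c' e I i = ?x i" for i
        unfolding lc_def c'_def using I by (simp add: sum.inter_filter if_distrib[of "\<lambda>x. x * _"] cong: if_cong)
      then have "c' j = 0" using spanning_independent[OF I sp, of c' j] n j by auto
      then show False using j by (simp add: c'_def)
    qed
    with ker strict show ?thesis by blast
  qed
qed

text \<open>Lower semicontinuity: definite directions survive small changes, while null directions
  may turn either way.\<close>

lemma nidx_stable:
  assumes h: "hform I B" and I: "finite I" and ev: "\<forall>\<^sub>F s in F. hform I (Bs s)"
    and lim: "\<And>x y. ((\<lambda>s. Bs s x y) \<longlongrightarrow> B x y) F"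
  shows "\<forall>\<^sub>F s in F. nidx B \<le> nidx (Bs s) \<and> pidx B \<le> pidx (Bs s)"
proof -
  obtain e \<sigma> where d: "diag_basis I B e \<sigma>" using exists_diag_basis[OF h I] by blast
  have d': "diag_basis I (\<lambda>x y. - B x y) e (\<lambda>i. - \<sigma> i)" by (rule diag_basis_uminus[OF d])
  have "\<forall>\<^sub>F s in F. negf (Bs s) e {i\<in>I. \<sigma> i < 0}"
    using d I unfolding diag_basis_def
    by (intro negf_perturb[OF h ev _ _ _ lim, of e \<sigma>]) (auto intro: orth_fam_subset)
  moreover have "\<forall>\<^sub>F s in F. negf (\<lambda>x y. - Bs s x y) e {i\<in>I. - \<sigma> i < 0}"
    using d' I ev unfolding diag_basis_def
    by (intro negf_perturb[OF hform_uminus[OF h], of _ _ e "\<lambda>i. - \<sigma> i"])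
       (auto intro: orth_fam_subset hform_uminus tendsto_minus lim elim: eventually_mono)
  ultimately show ?thesis using ev
  proof eventually_elim
    case (elim s)
    have "card {i\<in>I. \<sigma> i < 0} \<le> nidx (Bs s)"
      by (rule nidx_ge[OF elim(3) I _ elim(1)]) (use I in auto)
    moreover have "card {i\<in>I. - \<sigma> i < 0} \<le> pidx (Bs s)"
      by (rule nidx_ge[OF hform_uminus[OF elim(3)] I _ elim(2)]) (use I in auto)
    ultimately show ?case using nidx_diag[OF h I d] nidx_diag[OF hform_uminus[OF h] I d'] by simp
  qed
qed

text \<open>The two indices of \<open>B\<close> already fill the whole dimension; since neither can
  drop, neither can rise.\<close>

lemma nidx_nondegenerate_limit:
  assumes h: "hform I B" and I: "finite I" and ev: "\<forall>\<^sub>F s in F. hform I (Bs s)"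
    and lim: "\<And>x y. ((\<lambda>s. Bs s x y) \<longlongrightarrow> B x y) F" and z: "zidx I B = 0"
  shows "\<forall>\<^sub>F s in F. nidx (Bs s) = nidx B \<and> zidx I (Bs s) = 0"
  using nidx_stable[OF h I ev lim] ev
proof eventually_elim
  case (elim s)
  then show ?case using inertia_sum[OF h I] inertia_sum[OF elim(2) I] z by linarith
qed

lemma nidx_crossing:
  assumes h: "hform I B" "hform I B'" and I: "finite I"
    and mono: "\<And>x. Re (B' x x) \<le> Re (B x x)"
    and strict: "\<And>x. (\<And>y. B y x = 0) \<Longrightarrow> (\<exists>i\<in>I. x i \<noteq> 0) \<Longrightarrow> Re (B' x x) < 0"
  shows "nidx B + zidx I B \<le> nidx B'"
proof -
  obtain e \<sigma> where d: "diag_basis I B e \<sigma>" using exists_diag_basis[OF h(1) I] by blast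
  have "card {i\<in>I. \<sigma> i \<le> 0} \<le> nidx B'"
    by (rule nidx_ge[OF h(2) I _ negf_crossing[OF h I d mono strict]]) (use I in auto)
  moreover have "{i\<in>I. \<sigma> i \<le> 0} = {i\<in>I. \<sigma> i < 0} \<union> {i\<in>I. \<sigma> i = 0}" by auto
  moreover have "card ({i\<in>I. \<sigma> i < 0} \<union> {i\<in>I. \<sigma> i = 0}) = card {i\<in>I. \<sigma> i < 0} + card {i\<in>I. \<sigma> i = 0}"
    using I by (intro card_Un_disjoint) auto
  ultimately show ?thesis unfolding nidx_diag[OF h(1) I d] zidx_diag[OF h(1) I d] by simp
qed

lemma zidx_uminus: "zidx I (\<lambda>x y. - B x y) = zidx I B"
  unfolding zidx_def by simp

text \<open>The identity is additive over adjacent intervals, so bisection reduces it to small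
  intervals around a point \<open>x\<close>. Just right of \<open>x\<close> the negative index has
  gained the nullity at \<open>x\<close> and the positive index has not dropped, which leaves no
  room for a kernel; on the left the roles of the signs are exchanged. The interval is half-open: a
  zero at \<open>\<alpha>\<close> counts, one at \<open>\<beta>\<close> does not yet.\<close>

lemma nidx_crossing_count:
  fixes B :: "real \<Rightarrow> ('i \<Rightarrow> complex) \<Rightarrow> ('i \<Rightarrow> complex) \<Rightarrow> complex"
  assumes I: "finite I" and ab: "\<alpha> \<le> \<beta>"
    and h: "\<And>l. l \<in> {\<alpha>..\<beta>} \<Longrightarrow> hform I (B l)"
    and lim: "\<And>l0 x y. l0 \<in> {\<alpha>..\<beta>} \<Longrightarrow> ((\<lambda>l. B l x y) \<longlongrightarrow> B l0 x y) (at l0 within {\<alpha>..\<beta>})"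
    and mono: "\<And>l1 l2 x. l1 \<in> {\<alpha>..\<beta>} \<Longrightarrow> l2 \<in> {\<alpha>..\<beta>} \<Longrightarrow> l1 \<le> l2 \<Longrightarrow> Re (B l2 x x) \<le> Re (B l1 x x)"
    and strict: "\<And>l1 l2 x. l1 \<in> {\<alpha>..\<beta>} \<Longrightarrow> l2 \<in> {\<alpha>..\<beta>} \<Longrightarrow> (\<And>y. B l1 y x = 0) \<Longrightarrow> (\<exists>i\<in>I. x i \<noteq> 0) \<Longrightarrow>
        (l1 < l2 \<longrightarrow> Re (B l2 x x) < 0) \<and> (l2 < l1 \<longrightarrow> 0 < Re (B l2 x x))"
  shows "finite {l. \<alpha> \<le> l \<and> l < \<beta> \<and> zidx I (B l) > 0} \<and>
     nidx (B \<beta>) = nidx (B \<alpha>) + (\<Sum>l\<in>{l. \<alpha> \<le> l \<and> l < \<beta> \<and> zidx I (B l) > 0}. zidx I (B l))"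
proof -
  define Z where "Z = (\<lambda>u v. {l. u \<le> l \<and> l < v \<and> zidx I (B l) > 0})"
  \<comment> \<open>The guards make \<open>P\<close> vacuous for intervals that leave the given
    range, because the local step of the bisection has to treat every short interval around a
    point.\<close>
  define P where "P = (\<lambda>u v. \<alpha> \<le> u \<longrightarrow> v \<le> \<beta> \<longrightarrow> u \<le> v \<longrightarrow>
     finite (Z u v) \<and> nidx (B v) = nidx (B u) + (\<Sum>l\<in>Z u v. zidx I (B l)))"
  have "P \<alpha> \<beta>" using ab
  proof (induct rule: Bolzano)
    case (trans u v w)
    show ?case unfolding P_def
    proof (intro impI)
      assume a: "\<alpha> \<le> u" "w \<le> \<beta>" "u \<le> w"
      have 1: "finite (Z u v)" "nidx (B v) = nidx (B u) + (\<Sum>l\<in>Z u v. zidx I (B l))"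
        and 2: "finite (Z v w)" "nidx (B w) = nidx (B v) + (\<Sum>l\<in>Z v w. zidx I (B l))"
        using trans a unfolding P_def by auto
      have "Z u w = Z u v \<union> Z v w" using trans unfolding Z_def by auto
      moreover have "Z u v \<inter> Z v w = {}" unfolding Z_def by auto
      ultimately show "finite (Z u w) \<and> nidx (B w) = nidx (B u) + (\<Sum>l\<in>Z u w. zidx I (B l))"
        using 1 2 by (simp add: sum.union_disjoint)
    qed
  next
    case (local x)
    then have x: "x \<in> {\<alpha>..\<beta>}" by simp
    have "\<forall>\<^sub>F l in at x within {\<alpha>..\<beta>}. hform I (B l)"
      using h by (auto simp: eventually_at_filter)
    from nidx_stable[OF h[OF x] I this lim[OF x]] obtain d where d: "d > 0"
      "\<And>l. l \<in> {\<alpha>..\<beta>} \<Longrightarrow> l \<noteq> x \<Longrightarrow> \<bar>l - x\<bar> < d \<Longrightarrow> nidx (B x) \<le> nidx (B l) \<and> pidx (B x) \<le> pidx (B l)"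
      by (auto simp: eventually_at dist_real_def)
    have R: "nidx (B l) = nidx (B x) + zidx I (B x) \<and> zidx I (B l) = 0"
      if l: "l \<in> {\<alpha>..\<beta>}" "x < l" "l < x + d" for l
    proof -
      have "nidx (B x) + zidx I (B x) \<le> nidx (B l)"
      proof (rule nidx_crossing[OF h[OF x] h[OF l(1)] I])
        show "Re (B l y y) \<le> Re (B x y y)" for y using mono[OF x l(1)] l by simp
        show "Re (B l y y) < 0" if "\<And>z. B x z y = 0" "\<exists>i\<in>I. y i \<noteq> 0" for y
          using strict[OF x l(1) that] l by simp
      qed
      moreover have "pidx (B x) \<le> pidx (B l)" using d(2)[of l] l by auto
      ultimately show ?thesis using inertia_sum[OF h[OF x] I] inertia_sum[OF h[OF l(1)] I] by linarith
    qed
    have L: "nidx (B l) = nidx (B x) \<and> zidx I (B l) = 0"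
      if l: "l \<in> {\<alpha>..\<beta>}" "l < x" "x - d < l" for l
    proof -
      have "pidx (B x) + zidx I (\<lambda>x' y. - B x x' y) \<le> pidx (B l)"
      proof (rule nidx_crossing[OF hform_uminus[OF h[OF x]] hform_uminus[OF h[OF l(1)]] I])
        show "Re (- B l y y) \<le> Re (- B x y y)" for y using mono[OF l(1) x] l by simp
        show "Re (- B l y y) < 0" if "\<And>z. - B x z y = 0" "\<exists>i\<in>I. y i \<noteq> 0" for y
          using strict[OF x l(1) _ that(2)] that(1) l by simp
      qed
      moreover have "nidx (B x) \<le> nidx (B l)" using d(2)[of l] l by auto
      ultimately show ?thesis using inertia_sum[OF h[OF x] I] inertia_sum[OF h[OF l(1)] I]
        unfolding zidx_uminus by linarith
    qed
    show ?case
    proof (intro exI[of _ d] conjI d(1) allI impI)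
      fix u v assume uv: "u \<le> x \<and> x \<le> v \<and> v - u < d"
      show "P u v" unfolding P_def
      proof (intro impI)
        assume a: "\<alpha> \<le> u" "v \<le> \<beta>" "u \<le> v"
        have zero: "zidx I (B l) = 0" if "u \<le> l" "l \<le> v" "l \<noteq> x" for l
          using L[of l] R[of l] that uv a by (cases "l < x") auto
        have nu: "nidx (B u) = nidx (B x)" using L[of u] uv a x by (cases "u = x") auto
        show "finite (Z u v) \<and> nidx (B v) = nidx (B u) + (\<Sum>l\<in>Z u v. zidx I (B l))"
        proof (cases "x < v")
          case True
          have "Z u v \<subseteq> {x}" using zero unfolding Z_def by fastforce
          moreover have "(\<Sum>l\<in>{x}. zidx I (B l)) = (\<Sum>l\<in>Z u v. zidx I (B l))"
            by (rule sum.mono_neutral_right) (use calculation uv True in \<open>auto simp: Z_def\<close>)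
          moreover have "nidx (B v) = nidx (B x) + zidx I (B x)" using R[of v] uv a True x by auto
          ultimately show ?thesis using nu by (auto intro: finite_subset)
        next
          case False
          then have "v = x" using uv by auto
          have "Z u v = {}" using zero \<open>v = x\<close> unfolding Z_def by fastforce
          then show ?thesis using nu \<open>v = x\<close> by simp
        qed
      qed
    qed
  qed
  then show ?thesis using ab unfolding P_def Z_def by simp
qed

section \<open>Bounded measurable functions and their primitives\<close>

text \<open>The bound holds at every point and not just almost everywhere. Coefficients are changed
  on a null set beforehand, in \<open>Omega_nice\<close>, so that integral estimates can be made
  pointwise.\<close>

definition bm :: "real \<Rightarrow> real \<Rightarrow> (real \<Rightarrow> 'v::euclidean_space) \<Rightarrow> bool" where
  "bm a b f \<longleftrightarrow> f \<in> borel_measurable (lebesgue_on {a..b}) \<and> (\<exists>C. \<forall>t\<in>{a..b}. norm (f t) \<le> C)"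

lemma bmI: "f \<in> borel_measurable (lebesgue_on {a..b}) \<Longrightarrow> (\<And>t. t \<in> {a..b} \<Longrightarrow> norm (f t) \<le> C) \<Longrightarrow> bm a b f"
  unfolding bm_def by blast

lemma bm_measurable: "bm a b f \<Longrightarrow> f \<in> borel_measurable (lebesgue_on {a..b})"
  unfolding bm_def by blast

lemma bm_bound:
  assumes "bm a b f"
  obtains C where "C > 0" "\<And>t. t \<in> {a..b} \<Longrightarrow> norm (f t) \<le> C"
proof -
  obtain C where "\<forall>t\<in>{a..b}. norm (f t) \<le> C" using assms unfolding bm_def by blast
  then show ?thesis using that[of "max C 1"] by fastforce
qed

lemma bm_continuous: "continuous_on {a..b} f \<Longrightarrow> bm a b f"
proof -
  assume c: "continuous_on {a..b} f"
  have "bounded (f ` {a..b})" using c by (intro compact_imp_bounded compact_continuous_image) auto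
  then obtain C where "\<forall>x\<in>f ` {a..b}. norm x \<le> C" unfolding bounded_iff by blast
  then show ?thesis using c
    by (intro bmI[of _ _ _ C] continuous_imp_measurable_on_sets_lebesgue) auto
qed

lemma bm_const: "bm a b (\<lambda>t. c)"
  by (rule bm_continuous) auto

lemma bm_bilinear:
  fixes h :: "'u::euclidean_space \<Rightarrow> 'v::euclidean_space \<Rightarrow> 'w::euclidean_space"
  assumes "bounded_bilinear h" "bm a b f" "bm a b g"
  shows "bm a b (\<lambda>t. h (f t) (g t))"
proof -
  obtain F where F: "F > 0" "\<And>t. t \<in> {a..b} \<Longrightarrow> norm (f t) \<le> F" using bm_bound[OF assms(2)] by blast
  obtain G where G: "G > 0" "\<And>t. t \<in> {a..b} \<Longrightarrow> norm (g t) \<le> G" using bm_bound[OF assms(3)] by blast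
  obtain K where K: "K \<ge> 0" "\<And>x y. norm (h x y) \<le> norm x * norm y * K"
    using bounded_bilinear.nonneg_bounded[OF assms(1)] by blast
  show ?thesis
  proof (rule bmI)
    show "(\<lambda>t. h (f t) (g t)) \<in> borel_measurable (lebesgue_on {a..b})"
      by (rule borel_measurable_bilinear[OF _ bm_measurable[OF assms(2)] bm_measurable[OF assms(3)]])
         (use assms(1) in \<open>auto simp: bilinear_conv_bounded_bilinear\<close>)
    fix t assume "t \<in> {a..b}"
    then have "norm (f t) * norm (g t) \<le> F * G" using F G by (intro mult_mono) auto
    then show "norm (h (f t) (g t)) \<le> F * G * K"
      using K by (intro order_trans[OF K(2) mult_right_mono]) auto
  qed
qed

lemma bm_add: "bm a b f \<Longrightarrow> bm a b g \<Longrightarrow> bm a b (\<lambda>t. f t + g t)"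
proof -
  assume a: "bm a b f" "bm a b g"
  obtain F where F: "F > 0" "\<And>t. t \<in> {a..b} \<Longrightarrow> norm (f t) \<le> F" using bm_bound[OF a(1)] by blast
  obtain G where G: "G > 0" "\<And>t. t \<in> {a..b} \<Longrightarrow> norm (g t) \<le> G" using bm_bound[OF a(2)] by blast
  show ?thesis
    using a F G by (intro bmI[of _ _ _ "F + G"] borel_measurable_add) (auto simp: bm_measurable intro!: norm_triangle_mono)
qed

lemma bm_linear:
  fixes L :: "'u::euclidean_space \<Rightarrow> 'v::euclidean_space"
  assumes "bounded_linear L" "bm a b f"
  shows "bm a b (\<lambda>t. L (f t))"
proof -
  have "bounded_bilinear (\<lambda>(r::real) x. r *\<^sub>R L x)"
    by (rule bounded_bilinear.comp[OF bounded_bilinear_scaleR bounded_linear_ident assms(1)])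
  from bm_bilinear[OF this bm_const[of a b 1] assms(2)] show ?thesis by simp
qed

lemma bm_uminus: "bm a b f \<Longrightarrow> bm a b (\<lambda>t. - f t)"
  by (rule bm_linear[OF bounded_linear_minus[OF bounded_linear_ident]])

lemma bm_diff: "bm a b f \<Longrightarrow> bm a b g \<Longrightarrow> bm a b (\<lambda>t. f t - g t)"
  using bm_add[of a b f "\<lambda>t. - g t"] bm_uminus[of a b g] by simp

lemma bm_scaleR: "bm a b f \<Longrightarrow> bm a b (\<lambda>t. c *\<^sub>R f t)"
  by (rule bm_linear[OF bounded_linear_scaleR_right])

lemma bm_sum: "finite T \<Longrightarrow> (\<And>k. k \<in> T \<Longrightarrow> bm a b (f k)) \<Longrightarrow> bm a b (\<lambda>t. \<Sum>k\<in>T. f k t)"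
  by (induction T rule: finite_induct) (auto intro: bm_add bm_const)

lemma bm_subinterval:
  assumes "bm a b f" "a \<le> c" "d \<le> b"
  shows "bm c d f"
proof -
  have sub: "{c..d} \<subseteq> {a..b}" using assms by auto
  obtain C where "\<And>t. t \<in> {a..b} \<Longrightarrow> norm (f t) \<le> C" using bm_bound[OF assms(1)] by blast
  then show ?thesis
    using sub by (intro bmI[of _ _ _ C] measurable_restrict_mono[OF bm_measurable[OF assms(1)] sub]) auto
qed

lemma bm_integrable: "bm a b f \<Longrightarrow> f integrable_on {a..b}"
proof -
  assume a: "bm a b f"
  obtain F where F: "F > 0" "\<And>t. t \<in> {a..b} \<Longrightarrow> norm (f t) \<le> F" using bm_bound[OF a(1)] by blast
  show ?thesis
    by (rule measurable_bounded_by_integrable_imp_integrable[OF bm_measurable[OF a], of "\<lambda>_. F"]) (use F in auto)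
qed

lemma bm_integrable_sub: "bm a b f \<Longrightarrow> a \<le> c \<Longrightarrow> d \<le> b \<Longrightarrow> f integrable_on {c..d}"
  by (rule bm_integrable[OF bm_subinterval])

lemma bm_norm: "bm a b f \<Longrightarrow> bm a b (\<lambda>t. norm (f t))"
  unfolding bm_def by auto

lemma bm_absolutely_integrable: "bm a b f \<Longrightarrow> f absolutely_integrable_on {a..b}"
  using bm_integrable[of a b f] bm_integrable[OF bm_norm[of a b f]] by (simp add: absolutely_integrable_on_def)

lemma bm_if_le: "bm a b f \<Longrightarrow> bm a b (\<lambda>t. if c \<le> t then f t else 0)"
proof -
  assume a: "bm a b f"
  obtain F where F: "F > 0" "\<And>t. t \<in> {a..b} \<Longrightarrow> norm (f t) \<le> F" using bm_bound[OF a(1)] by blast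
  have "{t \<in> space (lebesgue_on {a..b}). c \<le> t} = {a..b} \<inter> {c..}" by auto
  moreover have "{a..b} \<inter> {c..} \<in> sets (lebesgue_on {a..b})"
    by (auto simp: sets_restrict_space)
  ultimately have "(\<lambda>t. if c \<le> t then f t else 0) \<in> borel_measurable (lebesgue_on {a..b})"
    using bm_measurable[OF a] by (intro measurable_If) auto
  then show ?thesis using F by (intro bmI[of _ _ _ F]) auto
qed

text \<open>Integrands are bounded, so \<open>y\<close> is Lipschitz. This suffices because the solutions have bounded
  derivative \<open>P\<inverse> z\<close>.\<close>
definition prim :: "real \<Rightarrow> real \<Rightarrow> (real \<Rightarrow> 'v::euclidean_space) \<Rightarrow> (real \<Rightarrow> 'v) \<Rightarrow> bool" where
  "prim a b y u \<longleftrightarrow> bm a b u \<and> (\<forall>t\<in>{a..b}. y t = y a + integral {a..t} u)"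

lemma prim_bm_deriv: "prim a b y u \<Longrightarrow> bm a b u"
  unfolding prim_def by blast

lemma primI: "bm a b u \<Longrightarrow> (\<And>t. t \<in> {a..b} \<Longrightarrow> y t = y a + integral {a..t} u) \<Longrightarrow> prim a b y u"
  unfolding prim_def by blast

lemma primD: "prim a b y u \<Longrightarrow> t \<in> {a..b} \<Longrightarrow> y t = y a + integral {a..t} u"
  unfolding prim_def by blast

lemma prim_diff:
  assumes "prim a b y u" "a \<le> s" "s \<le> t" "t \<le> b"
  shows "y t - y s = integral {s..t} u"
proof -
  have "integral {a..s} u + integral {s..t} u = integral {a..t} u"
    by (intro Henstock_Kurzweil_Integration.integral_combine bm_integrable_sub[OF prim_bm_deriv[OF assms(1)]])
       (use assms in auto)
  moreover have "y t = y a + integral {a..t} u" "y s = y a + integral {a..s} u"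
    by (rule primD[OF assms(1)], use assms in simp)+
  ultimately show ?thesis by (metis add_diff_cancel_left add_diff_cancel_left')
qed

lemma prim_lipschitz:
  assumes "prim a b y u" "\<And>t. t \<in> {a..b} \<Longrightarrow> norm (u t) \<le> C" "a \<le> s" "s \<le> t" "t \<le> b"
  shows "norm (y t - y s) \<le> C * (t - s)"
  unfolding prim_diff[OF assms(1,3-5)]
proof (rule order_trans[OF integral_norm_bound_integral[where g = "\<lambda>_. C"]])
  show "u integrable_on {s..t}" by (rule bm_integrable_sub[OF prim_bm_deriv[OF assms(1)] assms(3,5)])
qed (use assms in auto)

lemma prim_continuous:
  assumes "prim a b y u"
  shows "continuous_on {a..b} y"
proof (rule continuous_on_eq)
  show "continuous_on {a..b} (\<lambda>t. y a + integral {a..t} u)"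
    by (intro continuous_intros indefinite_integral_continuous_1 bm_integrable prim_bm_deriv[OF assms])
qed (rule primD[OF assms, symmetric])

lemma prim_bm: "prim a b y u \<Longrightarrow> bm a b y"
  by (rule bm_continuous[OF prim_continuous])

lemma prim_linear:
  fixes L :: "'u::euclidean_space \<Rightarrow> 'v::euclidean_space"
  assumes L: "bounded_linear L" and p: "prim a b y u"
  shows "prim a b (\<lambda>t. L (y t)) (\<lambda>t. L (u t))"
proof (rule primI)
  show "bm a b (\<lambda>t. L (u t))" by (rule bm_linear[OF L prim_bm_deriv[OF p]])
  fix t assume t: "t \<in> {a..b}"
  have "u integrable_on {a..t}" by (rule bm_integrable_sub[OF prim_bm_deriv[OF p]]) (use t in auto)
  from integral_linear[OF this L] have "L (integral {a..t} u) = integral {a..t} (\<lambda>t. L (u t))" by (simp add: o_def)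
  moreover have "L (y a + integral {a..t} u) = L (y a) + L (integral {a..t} u)"
    by (rule linear_add[OF bounded_linear.linear[OF L]])
  ultimately show "L (y t) = L (y a) + integral {a..t} (\<lambda>t. L (u t))"
    unfolding primD[OF p t] by (simp only:)
qed

lemma prim_add:
  assumes p: "prim a b y u" "prim a b z w"
  shows "prim a b (\<lambda>t. y t + z t) (\<lambda>t. u t + w t)"
proof (rule primI)
  show "bm a b (\<lambda>t. u t + w t)" by (intro bm_add prim_bm_deriv[OF p(1)] prim_bm_deriv[OF p(2)])
  fix t assume t: "t \<in> {a..b}"
  have "u integrable_on {a..t}" "w integrable_on {a..t}"
    by (rule bm_integrable_sub[OF prim_bm_deriv[OF p(1)]], use t in auto)
       (rule bm_integrable_sub[OF prim_bm_deriv[OF p(2)]], use t in auto)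
  then have "integral {a..t} (\<lambda>t. u t + w t) = integral {a..t} u + integral {a..t} w"
    by (rule Henstock_Kurzweil_Integration.integral_add)
  then show "y t + z t = y a + z a + integral {a..t} (\<lambda>t. u t + w t)"
    unfolding primD[OF p(1) t] primD[OF p(2) t] by (simp only: ac_simps)
qed

lemma prim_const: "prim a b (\<lambda>_. c) (\<lambda>_. 0)"
  by (rule primI) (auto intro: bm_const)

lemma prim_diff_fun:
  "prim a b y u \<Longrightarrow> prim a b z w \<Longrightarrow> prim a b (\<lambda>t. y t - z t) (\<lambda>t. u t - w t)"
  using prim_add[of a b y u "\<lambda>t. - z t" "\<lambda>t. - w t"] prim_linear[OF bounded_linear_minus[OF bounded_linear_ident], of a b z w] by simp

lemma prim_sum: "finite T \<Longrightarrow> (\<And>k. k \<in> T \<Longrightarrow> prim a b (y k) (u k)) \<Longrightarrow> prim a b (\<lambda>t. \<Sum>k\<in>T. y k t) (\<lambda>t. \<Sum>k\<in>T. u k t)"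
  by (induction T rule: finite_induct) (auto intro: prim_add prim_const)

lemma prim_subinterval:
  assumes "prim a b y u" "a \<le> c" "d \<le> b"
  shows "prim c d y u"
proof (rule primI)
  show "bm c d u" by (rule bm_subinterval[OF prim_bm_deriv[OF assms(1)] assms(2,3)])
  fix t assume "t \<in> {c..d}"
  then show "y t = y c + integral {c..t} u" using prim_diff[OF assms(1), of c t] assms by (simp add: algebra_simps)
qed

text \<open>Such increments force derivative zero at every point. In the product rule this takes the
  place of differentiating almost everywhere.\<close>

lemma quadratic_increment_constant:
  fixes D :: "real \<Rightarrow> 'v::real_normed_vector"
  assumes "\<And>s t. a \<le> s \<Longrightarrow> s \<le> t \<Longrightarrow> t \<le> b \<Longrightarrow> norm (D t - D s) \<le> C * (t - s)\<^sup>2"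
    and "s \<in> {a..b}" "t \<in> {a..b}"
  shows "D s = D t"
proof -
  have sym: "norm (D t - D s) \<le> C * (t - s)\<^sup>2" if "s \<in> {a..b}" "t \<in> {a..b}" for s t
    using assms(1)[of s t] assms(1)[of t s] that by (cases "s \<le> t") (auto simp: norm_minus_commute power2_commute)
  have "\<exists>c. \<forall>x\<in>{a..b}. D x = c"
  proof (rule has_derivative_zero_constant)
    fix x assume x: "x \<in> {a..b}"
    have "((\<lambda>y. (1 / norm (y - x)) *\<^sub>R (D y - (D x + 0))) \<longlongrightarrow> 0) (at x within {a..b})"
    proof (rule Lim_null_comparison)
      show "\<forall>\<^sub>F y in at x within {a..b}. norm ((1 / norm (y - x)) *\<^sub>R (D y - (D x + 0))) \<le> C * \<bar>y - x\<bar>"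
        unfolding eventually_at_filter
      proof (intro always_eventually allI impI)
        fix y assume y: "y \<noteq> x" "y \<in> {a..b}"
        have "norm (D y - D x) \<le> C * \<bar>y - x\<bar> * \<bar>y - x\<bar>"
          using sym[OF x y(2)] by (simp add: power2_eq_square mult.assoc abs_mult_self_eq)
        then show "norm ((1 / norm (y - x)) *\<^sub>R (D y - (D x + 0))) \<le> C * \<bar>y - x\<bar>"
          using y(1) by (simp add: pos_divide_le_eq mult.assoc)
      qed
      have "((\<lambda>y. C * \<bar>y - x\<bar>) \<longlongrightarrow> C * \<bar>x - x\<bar>) (at x within {a..b})" by (intro tendsto_intros)
      then show "((\<lambda>y. C * \<bar>y - x\<bar>) \<longlongrightarrow> 0) (at x within {a..b})" by simp
    qed
    then show "(D has_derivative (\<lambda>h. 0)) (at x within {a..b})" by (simp add: has_derivative_within)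
  qed auto
  then show ?thesis using assms by metis
qed

text \<open>Product rule for factors that need not be differentiable everywhere: over
  \<open>[s, t]\<close> the increment of the product differs from the integral of the expected
  derivative by at most a multiple of \<open>(t - s)\<^sup>2\<close>, so the discrepancy
  \<open>D\<close> is constant.\<close>

lemma prim_bilinear:
  fixes h :: "'u::euclidean_space \<Rightarrow> 'v::euclidean_space \<Rightarrow> 'w::euclidean_space"
  assumes h: "bounded_bilinear h" and y: "prim a b y u" and z: "prim a b z w"
  shows "prim a b (\<lambda>t. h (y t) (z t)) (\<lambda>t. h (u t) (z t) + h (y t) (w t))"
proof -
  let ?f = "\<lambda>t. h (u t) (z t) + h (y t) (w t)"
  have bf: "bm a b ?f"
    by (intro bm_add bm_bilinear[OF h] prim_bm[OF y] prim_bm[OF z] prim_bm_deriv[OF y] prim_bm_deriv[OF z])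
  obtain U where U: "U > 0" "\<And>t. t \<in> {a..b} \<Longrightarrow> norm (u t) \<le> U" using bm_bound[OF prim_bm_deriv[OF y]] by blast
  obtain W where W: "W > 0" "\<And>t. t \<in> {a..b} \<Longrightarrow> norm (w t) \<le> W" using bm_bound[OF prim_bm_deriv[OF z]] by blast
  obtain K where K: "K \<ge> 0" "\<And>x y. norm (h x y) \<le> norm x * norm y * K"
    using bounded_bilinear.nonneg_bounded[OF h] by blast
  define D where "D = (\<lambda>t. h (y t) (z t) - integral {a..t} ?f)"
  have est: "norm (D t - D s) \<le> (2 * U * W * K) * (t - s)\<^sup>2" if st: "a \<le> s" "s \<le> t" "t \<le> b" for s t
  proof -
    have iu: "u integrable_on {s..t}" "w integrable_on {s..t}" "?f integrable_on {s..t}"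
      using st by (auto intro!: bm_integrable_sub[OF prim_bm_deriv[OF y]] bm_integrable_sub[OF prim_bm_deriv[OF z]]
          bm_integrable_sub[OF bf])
    have bl: "bounded_linear (\<lambda>x. h x (z s))" "bounded_linear (\<lambda>x. h (y t) x)"
      by (rule bounded_bilinear.bounded_linear_left[OF h], rule bounded_bilinear.bounded_linear_right[OF h])
    have 1: "h (integral {s..t} u) (z s) = integral {s..t} (\<lambda>r. h (u r) (z s))"
      using integral_linear[OF iu(1) bl(1)] by (simp add: o_def)
    have 2: "h (y t) (integral {s..t} w) = integral {s..t} (\<lambda>r. h (y t) (w r))"
      using integral_linear[OF iu(2) bl(2)] by (simp add: o_def)
    have i1: "(\<lambda>r. h (u r) (z s)) integrable_on {s..t}" "(\<lambda>r. h (y t) (w r)) integrable_on {s..t}"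
      using integrable_linear[OF iu(1) bl(1)] integrable_linear[OF iu(2) bl(2)] by (simp_all add: o_def)
    have "integral {a..s} ?f + integral {s..t} ?f = integral {a..t} ?f"
      using st bf by (intro Henstock_Kurzweil_Integration.integral_combine bm_integrable_sub[of a b]) auto
    then have "D t - D s = h (y t - y s) (z s) + h (y t) (z t - z s) - integral {s..t} ?f"
      unfolding D_def by (simp add: bounded_bilinear.diff_left[OF h] bounded_bilinear.diff_right[OF h] algebra_simps)
    also have "\<dots> = integral {s..t} (\<lambda>r. h (u r) (z s)) + integral {s..t} (\<lambda>r. h (y t) (w r)) - integral {s..t} ?f"
      unfolding prim_diff[OF y st] prim_diff[OF z st] 1 2 ..
    also have "\<dots> = integral {s..t} (\<lambda>r. h (u r) (z s) + h (y t) (w r) - ?f r)"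
      using i1 iu by (simp add: Henstock_Kurzweil_Integration.integral_add Henstock_Kurzweil_Integration.integral_diff integrable_add)
    also have "norm \<dots> \<le> integral {s..t} (\<lambda>r. 2 * U * W * K * (t - s))"
    proof (rule integral_norm_bound_integral)
      show "(\<lambda>r. h (u r) (z s) + h (y t) (w r) - ?f r) integrable_on {s..t}"
        by (rule integrable_diff[OF integrable_add[OF i1] iu(3)])
      fix r assume r: "r \<in> {s..t}"
      \<comment> \<open>Each remaining term pairs one bounded derivative with one increment of order
        \<open>t - s\<close>; integration supplies the second factor \<open>t - s\<close>.\<close>
      have "h (u r) (z s) + h (y t) (w r) - ?f r = h (u r) (z s - z r) + h (y t - y r) (w r)"
        by (simp add: bounded_bilinear.diff_left[OF h] bounded_bilinear.diff_right[OF h])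
      also have "norm \<dots> \<le> norm (u r) * norm (z s - z r) * K + norm (y t - y r) * norm (w r) * K"
        by (intro norm_triangle_mono K)
      also have "\<dots> \<le> U * (W * (t - s)) * K + (U * (t - s)) * W * K"
      proof (intro add_mono mult_right_mono mult_mono)
        show "norm (u r) \<le> U" "norm (w r) \<le> W" using U W r st by auto
        have "norm (z s - z r) \<le> W * (r - s)"
          using prim_lipschitz[OF z W(2), of s r] r st by (simp add: norm_minus_commute)
        also have "\<dots> \<le> W * (t - s)" using W r by (intro mult_left_mono) auto
        finally show "norm (z s - z r) \<le> W * (t - s)" .
        have "norm (y t - y r) \<le> U * (t - r)"
          using prim_lipschitz[OF y U(2), of r t] r st by simp
        also have "\<dots> \<le> U * (t - s)" using U r by (intro mult_left_mono) auto
        finally show "norm (y t - y r) \<le> U * (t - s)" .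
      qed (use U W K st in auto)
      finally show "norm (h (u r) (z s) + h (y t) (w r) - ?f r) \<le> 2 * U * W * K * (t - s)"
        by (simp add: algebra_simps)
    qed auto
    also have "\<dots> = (2 * U * W * K) * (t - s)\<^sup>2" using st by (simp add: power2_eq_square)
    finally show ?thesis .
  qed
  show ?thesis
  proof (rule primI[OF bf])
    fix t assume t: "t \<in> {a..b}"
    have "D t = D a" by (rule quadratic_increment_constant[of a b D, OF est]) (use t in auto)
    then show "h (y t) (z t) = h (y a) (z a) + integral {a..t} ?f" by (simp add: D_def algebra_simps)
  qed
qed

lemma prim_parts:
  fixes h :: "'u::euclidean_space \<Rightarrow> 'v::euclidean_space \<Rightarrow> 'w::euclidean_space"
  assumes "bounded_bilinear h" "prim a b y u" "prim a b z w" "a \<le> b"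
  shows "integral {a..b} (\<lambda>t. h (u t) (z t) + h (y t) (w t)) = h (y b) (z b) - h (y a) (z a)"
  using primD[OF prim_bilinear[OF assms(1-3)], of b] assms(4) by (simp add: algebra_simps)

section \<open>Linear initial value problems\<close>

text \<open>Picard iteration in an exponentially weighted supremum norm, in which the integral
  operator contracts on the whole interval at once.\<close>

lemma volterra_exists:
  fixes f :: "real \<Rightarrow> 'v::euclidean_space \<Rightarrow> 'v"
  assumes ab: "a \<le> b" and L: "L > 0"
    and meas: "\<And>x. continuous_on {a..b} x \<Longrightarrow> bm a b (\<lambda>t. f t (x t))"
    and lip: "\<And>t x y. t \<in> {a..b} \<Longrightarrow> norm (f t x - f t y) \<le> L * norm (x - y)"
  shows "\<exists>x. continuous_on {a..b} x \<and> (\<forall>t\<in>{a..b}. x t = x0 + integral {a..t} (\<lambda>s. f s (x s)))"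
proof -
  \<comment> \<open>The weight \<open>exp (M * (t - a))\<close> gives the contraction factor
    \<open>L / M\<close>, here one half.\<close>
  define M where "M = 2 * L"
  have M: "M > 0" using L by (simp add: M_def)
  \<comment> \<open>Clamping to the interval turns functions on it into bounded continuous functions
    on the line, which form a complete space.\<close>
  define c where "c = (\<lambda>t. max a (min b t))"
  have c: "c t \<in> {a..b}" for t using ab by (auto simp: c_def)
  have cid: "c t = t" if "t \<in> {a..b}" for t using that by (auto simp: c_def)
  have cc: "continuous_on UNIV c" unfolding c_def by (intro continuous_intros)
  \<comment> \<open>The unknown \<open>\<phi>\<close> of the fixed point equation is the solution
    divided by the weight.\<close>
  define g where "g = (\<lambda>(\<phi>::real \<Rightarrow>\<^sub>C 'v) s. f s (exp (M * (s - a)) *\<^sub>R apply_bcontfun \<phi> s))"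
  have gbm: "bm a b (g \<phi>)" for \<phi>
    unfolding g_def by (intro meas continuous_intros continuous_on_apply_bcontfun)
  define H where "H = (\<lambda>\<phi> t. exp (- M * (t - a)) *\<^sub>R (x0 + integral {a..t} (g \<phi>)))"
  have Hc: "continuous_on {a..b} (H \<phi>)" for \<phi>
    unfolding H_def by (intro continuous_intros indefinite_integral_continuous_1 bm_integrable gbm)
  have HB: "(\<lambda>t. H \<phi> (c t)) \<in> bcontfun" for \<phi>
  proof -
    have "continuous_on UNIV (\<lambda>t. H \<phi> (c t))"
      by (rule continuous_on_compose2[OF Hc cc]) (use c in auto)
    moreover have "bounded (H \<phi> ` {a..b})"
      by (intro compact_imp_bounded compact_continuous_image Hc) auto
    then have "bounded (range (\<lambda>t. H \<phi> (c t)))"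
      by (rule bounded_subset) (use c in auto)
    ultimately show ?thesis by (simp add: bcontfun_def)
  qed
  define \<Phi> where "\<Phi> = (\<lambda>\<phi>. Bcontfun (\<lambda>t. H \<phi> (c t)))"
  have app: "apply_bcontfun (\<Phi> \<phi>) t = H \<phi> (c t)" for \<phi> t
    unfolding \<Phi>_def by (simp add: Bcontfun_inverse[OF HB])
  have contr: "dist (\<Phi> \<phi>) (\<Phi> \<psi>) \<le> 1 / 2 * dist \<phi> \<psi>" for \<phi> \<psi>
  proof (rule dist_bound)
    fix t
    define d where "d = dist \<phi> \<psi>"
    have d: "norm (apply_bcontfun \<phi> s - apply_bcontfun \<psi> s) \<le> d" for s
      using dist_bounded[of \<phi> s \<psi>] by (simp add: d_def dist_norm)
    have d0: "d \<ge> 0" by (simp add: d_def)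
    define r where "r = c t"
    have r: "a \<le> r" "r \<le> b" using c[of t] by (auto simp: r_def)
    have int: "((\<lambda>s. L * d * exp (M * (s - a))) has_integral L * d * exp (M * (r - a)) / M - L * d * exp (M * (a - a)) / M) {a..r}"
      using r(1) M by (intro fundamental_theorem_of_calculus)
        (auto intro!: derivative_eq_intros simp: has_real_derivative_iff_has_vector_derivative[symmetric])
    have gi: "g \<phi> integrable_on {a..r}" "g \<psi> integrable_on {a..r}"
      using r by (auto intro!: bm_integrable_sub[OF gbm])
    have "norm (integral {a..r} (g \<phi>) - integral {a..r} (g \<psi>)) = norm (integral {a..r} (\<lambda>s. g \<phi> s - g \<psi> s))"
      using gi by (simp add: Henstock_Kurzweil_Integration.integral_diff)
    also have "\<dots> \<le> integral {a..r} (\<lambda>s. L * d * exp (M * (s - a)))"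
    proof (rule integral_norm_bound_integral)
      show "(\<lambda>s. g \<phi> s - g \<psi> s) integrable_on {a..r}" by (rule integrable_diff[OF gi])
      show "(\<lambda>s. L * d * exp (M * (s - a))) integrable_on {a..r}" using int by blast
      fix s assume s: "s \<in> {a..r}"
      then have "norm (g \<phi> s - g \<psi> s) \<le> L * norm (exp (M * (s - a)) *\<^sub>R apply_bcontfun \<phi> s - exp (M * (s - a)) *\<^sub>R apply_bcontfun \<psi> s)"
        unfolding g_def using r by (intro lip) auto
      also have "\<dots> = L * (exp (M * (s - a)) * norm (apply_bcontfun \<phi> s - apply_bcontfun \<psi> s))"
        by (simp flip: scaleR_diff_right)
      also have "\<dots> \<le> L * (exp (M * (s - a)) * d)"
        using L d by (intro mult_left_mono) auto
      finally show "norm (g \<phi> s - g \<psi> s) \<le> L * d * exp (M * (s - a))" by (simp add: mult_ac)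
    qed
    also have "\<dots> = L * d * exp (M * (r - a)) / M - L * d * exp (M * (a - a)) / M"
      by (rule integral_unique[OF int])
    also have "\<dots> \<le> L * d * exp (M * (r - a)) / M" using L d0 M by simp
    finally have I: "norm (integral {a..r} (g \<phi>) - integral {a..r} (g \<psi>)) \<le> d / 2 * exp (M * (r - a))"
      using L by (simp add: M_def)
    have "dist (apply_bcontfun (\<Phi> \<phi>) t) (apply_bcontfun (\<Phi> \<psi>) t)
        = exp (- M * (r - a)) * norm (integral {a..r} (g \<phi>) - integral {a..r} (g \<psi>))"
      unfolding app H_def dist_norm r_def[symmetric] by (simp flip: scaleR_diff_right)
    also have "\<dots> \<le> exp (- M * (r - a)) * (d / 2 * exp (M * (r - a)))"
      by (intro mult_left_mono I) auto
    also have "\<dots> = exp (- M * (r - a) + M * (r - a)) * (d / 2)" by (simp only: exp_add mult_ac)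
    also have "\<dots> = d / 2" by simp
    finally show "dist (apply_bcontfun (\<Phi> \<phi>) t) (apply_bcontfun (\<Phi> \<psi>) t) \<le> 1 / 2 * dist \<phi> \<psi>"
      by (simp add: d_def)
  qed
  from banach_fix_type[of "1/2" \<Phi>] contr obtain \<phi> where \<phi>: "\<Phi> \<phi> = \<phi>" by auto
  define x where "x = (\<lambda>t. exp (M * (t - a)) *\<^sub>R apply_bcontfun \<phi> t)"
  have gx: "g \<phi> = (\<lambda>s. f s (x s))" by (simp add: g_def x_def)
  have "x t = x0 + integral {a..t} (\<lambda>s. f s (x s))" if t: "t \<in> {a..b}" for t
  proof -
    have "apply_bcontfun \<phi> t = H \<phi> t" using app[of \<phi> t] \<phi> cid[OF t] by simp
    then have "x t = (exp (M * (t - a)) * exp (- M * (t - a))) *\<^sub>R (x0 + integral {a..t} (g \<phi>))"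
      by (simp add: x_def H_def)
    also have "exp (M * (t - a)) * exp (- M * (t - a)) = 1" by (simp add: exp_minus)
    finally show ?thesis by (simp add: gx)
  qed
  moreover have "continuous_on {a..b} x" unfolding x_def by (intro continuous_intros continuous_on_apply_bcontfun)
  ultimately show ?thesis by blast
qed

section \<open>Complex inner product and real matrices acting on complex vectors\<close>

definition hip :: "complex^'n \<Rightarrow> complex^'n \<Rightarrow> complex" where
  "hip u v = (\<Sum>i\<in>UNIV. cnj (u $ i) * v $ i)"

lemma hip_add_left: "hip (u + u') v = hip u v + hip u' v"
  by (simp add: hip_def algebra_simps sum.distrib)

lemma hip_add_right: "hip u (v + v') = hip u v + hip u v'"
  by (simp add: hip_def algebra_simps sum.distrib)

lemma hip_scale_left: "hip (c *s u) v = cnj c * hip u v"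
  by (simp add: hip_def sum_distrib_left mult.assoc)

lemma hip_scale_right: "hip u (c *s v) = c * hip u v"
  by (simp add: hip_def sum_distrib_left mult.assoc mult.left_commute)

lemma cnj_hip: "cnj (hip u v) = hip v u"
  by (simp add: hip_def mult.commute)

lemma hip_scaleR_left: "hip (r *\<^sub>R u) v = r *\<^sub>R hip u v"
  by (simp add: hip_def scaleR_sum_right)

lemma hip_scaleR_right: "hip u (r *\<^sub>R v) = r *\<^sub>R hip u v"
  by (simp add: hip_def scaleR_sum_right)

lemma bounded_bilinear_hip: "bounded_bilinear hip"
  unfolding bilinear_conv_bounded_bilinear[symmetric] bilinear_def
  by (auto intro!: linearI simp: hip_add_left hip_add_right hip_scaleR_left hip_scaleR_right)

lemmas hip_simps = bounded_bilinear.zero_left[OF bounded_bilinear_hip] bounded_bilinear.zero_right[OF bounded_bilinear_hip]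
  bounded_bilinear.minus_left[OF bounded_bilinear_hip] bounded_bilinear.minus_right[OF bounded_bilinear_hip]
  bounded_bilinear.diff_left[OF bounded_bilinear_hip] bounded_bilinear.diff_right[OF bounded_bilinear_hip]
  hip_add_left hip_add_right hip_scale_left hip_scale_right

lemma Re_hip: "Re (hip u v) = u \<bullet> v"
  by (simp add: hip_def inner_vec_def inner_complex_def)

lemma Re_hip_self: "Re (hip u u) = (norm u)\<^sup>2"
  by (simp add: Re_hip power2_norm_eq_inner)

lemma hip_self: "hip u u = complex_of_real ((norm u)\<^sup>2)"
  using cnj_hip[of u u] Re_hip_self[of u] by (simp add: complex_eq_iff)

lemma norm_vec_scale: "norm (c *s (v::complex^'n)) = cmod c * norm v"
proof -
  have "complex_of_real ((norm (c *s v))\<^sup>2) = hip (c *s v) (c *s v)" by (simp only: hip_self)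
  also have "\<dots> = (c * cnj c) * hip v v" by (simp add: hip_scale_left hip_scale_right)
  also have "\<dots> = complex_of_real ((cmod c * norm v)\<^sup>2)"
    by (simp add: hip_self complex_norm_square[symmetric] power_mult_distrib)
  finally have "complex_of_real ((norm (c *s v))\<^sup>2) = complex_of_real ((cmod c * norm v)\<^sup>2)" .
  then have "(norm (c *s v))\<^sup>2 = (cmod c * norm v)\<^sup>2" using of_real_eq_iff by blast
  then show ?thesis by (simp add: power2_eq_iff_nonneg)
qed

lemma norm_hip_le: "cmod (hip u v) \<le> norm u * norm v"
proof (cases "hip u v = 0")
  case False
  \<comment> \<open>A phase that makes the inner product real and reduces the claim to the real
    Cauchy-Schwarz inequality.\<close>
  define c where "c = cnj (hip u v) / cmod (hip u v)"
  have c: "cmod c = 1" using False by (simp add: c_def norm_divide)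
  have "c * hip u v = cmod (hip u v)"
    using False by (simp add: c_def complex_norm_square[symmetric] power2_eq_square mult.commute[of "cnj _"])
  then have "cmod (hip u v) = Re (hip u (c *s v))" by (simp add: hip_scale_right)
  also have "\<dots> \<le> norm u * norm (c *s v)" unfolding Re_hip by (rule norm_cauchy_schwarz)
  finally show ?thesis by (simp add: norm_vec_scale c)
qed simp

definition mv :: "real^'n^'m \<Rightarrow> complex^'n \<Rightarrow> complex^'m" where
  "mv M v = cmat M *v v"

lemma mv_nth: "mv M v $ i = (\<Sum>j\<in>UNIV. complex_of_real (M $ i $ j) * v $ j)"
  by (simp add: mv_def cmat_def matrix_vector_mult_def)

lemma bounded_bilinear_mv: "bounded_bilinear mv"
  unfolding bilinear_conv_bounded_bilinear[symmetric] bilinear_def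
  by (auto intro!: linearI simp: vec_eq_iff mv_nth algebra_simps sum.distrib scaleR_sum_right) (simp_all add: scaleR_conv_of_real mult_ac)

lemmas mv_simps = bounded_bilinear.zero_left[OF bounded_bilinear_mv] bounded_bilinear.zero_right[OF bounded_bilinear_mv]
  bounded_bilinear.minus_left[OF bounded_bilinear_mv] bounded_bilinear.minus_right[OF bounded_bilinear_mv]
  bounded_bilinear.diff_left[OF bounded_bilinear_mv] bounded_bilinear.diff_right[OF bounded_bilinear_mv]
  bounded_bilinear.add_left[OF bounded_bilinear_mv] bounded_bilinear.add_right[OF bounded_bilinear_mv]
  bounded_bilinear.scaleR_left[OF bounded_bilinear_mv] bounded_bilinear.scaleR_right[OF bounded_bilinear_mv]

lemma mv_scale: "mv M (c *s v) = c *s mv M v"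
  by (simp add: vec_eq_iff mv_nth sum_distrib_left mult_ac)

lemma hip_mv_symmetric:
  assumes "transpose M = M"
  shows "hip u (mv M v) = hip (mv M u) v"
proof -
  have M: "M $ i $ j = M $ j $ i" for i j using assms by (metis transpose_def vec_lambda_beta)
  have "hip u (mv M v) = (\<Sum>i\<in>UNIV. \<Sum>j\<in>UNIV. cnj (u $ i) * (complex_of_real (M $ i $ j) * v $ j))"
    by (simp add: hip_def mv_nth sum_distrib_left)
  also have "\<dots> = (\<Sum>j\<in>UNIV. \<Sum>i\<in>UNIV. cnj (u $ i) * (complex_of_real (M $ i $ j) * v $ j))"
    by (rule sum.swap)
  also have "\<dots> = (\<Sum>j\<in>UNIV. \<Sum>i\<in>UNIV. cnj (u $ i) * (complex_of_real (M $ j $ i) * v $ j))"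
    by (intro sum.cong refl arg_cong2[where f="(*)"] arg_cong[where f=complex_of_real] M)
  also have "\<dots> = hip (mv M u) v"
    unfolding hip_def mv_nth by (simp add: sum_distrib_left sum_distrib_right mult_ac)
  finally show ?thesis .
qed

text \<open>The terms mixing real and imaginary part of \<open>u\<close> contribute only to the
  imaginary part of the value, so the real bound is applied to both parts separately.\<close>

lemma mat_ge_scalar_complex:
  assumes "mat_ge_scalar M \<mu>"
  shows "\<mu> * (norm u)\<^sup>2 \<le> Re (hip u (mv M u))"
proof -
  define p where "p = (\<chi> i. Re (u $ i))"
  define q where "q = (\<chi> i. Im (u $ i))"
  have "Re (hip u (mv M u)) = (\<Sum>i\<in>UNIV. \<Sum>j\<in>UNIV. p $ i * (M $ i $ j * p $ j) + q $ i * (M $ i $ j * q $ j))"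
    unfolding hip_def mv_nth Re_sum by (rule sum.cong) (simp_all add: p_def q_def sum_distrib_left sum.distrib)
  also have "\<dots> = p \<bullet> (M *v p) + q \<bullet> (M *v q)"
    by (simp add: inner_vec_def matrix_vector_mult_def sum_distrib_left sum.distrib)
  also have "\<dots> \<ge> \<mu> * (p \<bullet> p) + \<mu> * (q \<bullet> q)"
    using assms unfolding mat_ge_scalar_def by (intro add_mono) auto
  also have "\<mu> * (p \<bullet> p) + \<mu> * (q \<bullet> q) = \<mu> * (norm u)\<^sup>2"
    unfolding power2_norm_eq_inner by (simp add: inner_vec_def inner_complex_def p_def q_def sum.distrib algebra_simps)
  finally show ?thesis .
qed

text \<open>The inverse by Cramer's rule: as a quotient of determinants of the entries it is visibly
  measurable when \<open>P\<close> depends on \<open>t\<close>.\<close>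

definition pinv :: "real^'n^'n \<Rightarrow> complex^'n \<Rightarrow> complex^'n" where
  "pinv P g = (\<chi> k. det (\<chi> i j. if j = k then g $ i else cmat P $ i $ j) / det (cmat P))"

context
  fixes P :: "real^'n^'n" and m :: real
  assumes m: "m > 0" and P: "\<And>v. m * (norm v)\<^sup>2 \<le> Re (hip v (mv P v))"
begin

lemma norm_mv_ge: "m * norm v \<le> norm (mv P v)"
proof (cases "v = 0")
  case False
  have "m * (norm v)\<^sup>2 \<le> norm v * norm (mv P v)"
    using P[of v] norm_cauchy_schwarz[of v "mv P v"] unfolding Re_hip by linarith
  then show ?thesis using False by (simp add: power2_eq_square mult.left_commute)
qed (simp add: mv_simps)

lemma det_cmat_nonzero: "det (cmat P) \<noteq> 0"
proof -
  have "inj ((*v) (cmat P))"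
  proof (rule injI)
    fix x y assume "cmat P *v x = cmat P *v y"
    then have "mv P (x - y) = 0" by (simp add: mv_simps mv_def[symmetric])
    then show "x = y" using norm_mv_ge[of "x - y"] m by (simp add: mult_le_0_iff)
  qed
  then show ?thesis
    using matrix_left_invertible_injective[of "cmat P"] by (metis invertible_det_nz invertible_left_inverse)
qed

lemma pinv_iff: "mv P x = g \<longleftrightarrow> x = pinv P g"
  unfolding mv_def pinv_def by (rule cramer[OF det_cmat_nonzero])

lemma mv_pinv: "mv P (pinv P g) = g"
  using pinv_iff by blast

lemma pinv_diff: "pinv P g - pinv P h = pinv P (g - h)"
  by (subst pinv_iff[symmetric]) (simp add: mv_simps mv_pinv)

lemma norm_pinv_le: "norm (pinv P g) \<le> norm g / m"
  using norm_mv_ge[of "pinv P g"] m by (simp add: mv_pinv field_simps)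

end

lemma borel_measurable_vec_complex:
  fixes f :: "real \<Rightarrow> complex^'n"
  assumes "\<And>k. (\<lambda>t. f t $ k) \<in> borel_measurable M"
  shows "f \<in> borel_measurable M"
proof (subst borel_measurable_euclidean_space, rule ballI)
  fix i :: "complex^'n" assume "i \<in> Basis"
  then obtain k b where i: "i = axis k b" by (auto simp: Basis_vec_def)
  show "(\<lambda>t. f t \<bullet> i) \<in> borel_measurable M" unfolding i inner_axis
    by (intro borel_measurable_inner assms borel_measurable_const)
qed

lemma bm_pinv:
  fixes P :: "real \<Rightarrow> real^'n^'n"
  assumes P: "bm a b P" and g: "bm a b g" and m: "m > 0"
    and pos: "\<And>t v. t \<in> {a..b} \<Longrightarrow> m * (norm v)\<^sup>2 \<le> Re (hip v (mv (P t) v))"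
  shows "bm a b (\<lambda>t. pinv (P t) (g t))"
proof -
  obtain G where G: "G > 0" "\<And>t. t \<in> {a..b} \<Longrightarrow> norm (g t) \<le> G" using bm_bound[OF g] by blast
  have Pij: "(\<lambda>t. cmat (P t) $ i $ j) \<in> borel_measurable (lebesgue_on {a..b})" for i j
  proof -
    have "bounded_linear (\<lambda>x::real^'n^'n. complex_of_real (x $ i $ j))"
      by (intro bounded_linear_compose[OF bounded_linear_of_real] bounded_linear_compose[OF bounded_linear_vec_nth bounded_linear_vec_nth])
    from bm_measurable[OF bm_linear[OF this P]] show ?thesis by (simp add: cmat_def)
  qed
  have gi: "(\<lambda>t. g t $ i) \<in> borel_measurable (lebesgue_on {a..b})" for i
    using bm_measurable[OF bm_linear[OF bounded_linear_vec_nth g]] .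
  have detm: "(\<lambda>t. det (F t)) \<in> borel_measurable (lebesgue_on {a..b})"
    if "\<And>i j. (\<lambda>t. F t $ i $ j) \<in> borel_measurable (lebesgue_on {a..b})" for F :: "real \<Rightarrow> complex^'n^'n"
    unfolding det_def by (intro borel_measurable_sum borel_measurable_times borel_measurable_prod borel_measurable_const that)
  show ?thesis
  proof (rule bmI)
    show "(\<lambda>t. pinv (P t) (g t)) \<in> borel_measurable (lebesgue_on {a..b})"
    proof (rule borel_measurable_vec_complex)
      fix k
      have "(\<lambda>t. det (\<chi> i j. if j = k then g t $ i else cmat (P t) $ i $ j) / det (cmat (P t))) \<in> borel_measurable (lebesgue_on {a..b})"
      proof (intro borel_measurable_divide detm Pij)
        fix i j
        show "(\<lambda>t. (\<chi> i j. if j = k then g t $ i else cmat (P t) $ i $ j) $ i $ j) \<in> borel_measurable (lebesgue_on {a..b})"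
          by (cases "j = k") (simp_all add: gi Pij)
      qed
      then show "(\<lambda>t. pinv (P t) (g t) $ k) \<in> borel_measurable (lebesgue_on {a..b})"
        by (simp add: pinv_def)
    qed
    fix t assume t: "t \<in> {a..b}"
    have "norm (pinv (P t) (g t)) \<le> norm (g t) / m" by (rule norm_pinv_le[OF m pos[OF t]])
    also have "\<dots> \<le> G / m" using G t m by (intro divide_right_mono) auto
    finally show "norm (pinv (P t) (g t)) \<le> G / m" .
  qed
qed

text \<open>A first order system for the pair \<open>(y, z)\<close>. The inhomogeneity
  \<open>g\<close> will carry the initial quasi-derivative and its jumps, which is why
  \<open>z\<close> can start at 0.\<close>

lemma ivp_exists:
  fixes P R :: "real \<Rightarrow> real^'n^'n" and g :: "real \<Rightarrow> complex^'n"
  assumes ab: "a \<le> b" and P: "bm a b P" and R: "bm a b R" and g: "bm a b g" and m: "m > 0"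
    and pos: "\<And>t v. t \<in> {a..b} \<Longrightarrow> m * (norm v)\<^sup>2 \<le> Re (hip v (mv (P t) v))"
  shows "\<exists>y u z. prim a b y u \<and> y a = y0 \<and> prim a b z (\<lambda>t. mv (R t) (y t)) \<and> z a = 0 \<and>
     (\<forall>t\<in>{a..b}. mv (P t) (u t) = z t + g t)"
proof -
  obtain C where C: "C > 0" "\<And>t. t \<in> {a..b} \<Longrightarrow> norm (R t) \<le> C" using bm_bound[OF R] by blast
  obtain K where K: "K \<ge> 0" "\<And>M v. norm (mv M v :: complex^'n) \<le> norm (M::real^'n^'n) * norm v * K"
    using bounded_bilinear.nonneg_bounded[OF bounded_bilinear_mv] by blast
  \<comment> \<open>\<open>1 / m\<close> bounds the inverse of \<open>P t\<close>, and
    \<open>C * K\<close> bounds the action of \<open>R t\<close>.\<close>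
  define L where "L = 1 / m + C * K"
  have L: "L > 0" using m C K by (simp add: L_def add_pos_nonneg)
  define f where "f = (\<lambda>t (x::(complex^'n) \<times> (complex^'n)). (pinv (P t) (snd x + g t), mv (R t) (fst x)))"
  have "\<exists>x. continuous_on {a..b} x \<and> (\<forall>t\<in>{a..b}. x t = (y0, 0) + integral {a..t} (\<lambda>s. f s (x s)))"
  proof (rule volterra_exists[OF ab L])
    fix x :: "real \<Rightarrow> (complex^'n) \<times> (complex^'n)" assume x: "continuous_on {a..b} x"
    have "bm a b (\<lambda>t. pinv (P t) (snd (x t) + g t))"
      by (rule bm_pinv[OF P _ m pos]) (intro bm_add g bm_continuous continuous_on_snd x)
    moreover have "bm a b (\<lambda>t. mv (R t) (fst (x t)))"
      by (intro bm_bilinear[OF bounded_bilinear_mv R] bm_continuous continuous_on_fst x)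
    ultimately have "bm a b (\<lambda>t. (pinv (P t) (snd (x t) + g t), 0) + (0, mv (R t) (fst (x t))))"
      by (intro bm_add bm_linear[OF bounded_linear_Pair[OF bounded_linear_ident bounded_linear_zero]]
        bm_linear[OF bounded_linear_Pair[OF bounded_linear_zero bounded_linear_ident]])
    then show "bm a b (\<lambda>t. f t (x t))" by (simp add: f_def)
  next
    fix t and x y :: "(complex^'n) \<times> (complex^'n)" assume t: "t \<in> {a..b}"
    have sn: "norm (snd x - snd y) \<le> norm (x - y)" and fn: "norm (fst x - fst y) \<le> norm (x - y)"
      by (cases x, cases y, simp add: norm_snd_le) (cases x, cases y, simp add: norm_fst_le)
    have "f t x - f t y = (pinv (P t) (snd x - snd y), mv (R t) (fst x - fst y))"
      by (simp add: f_def pinv_diff[OF m pos[OF t]] mv_simps)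
    then have "norm (f t x - f t y) \<le> norm (pinv (P t) (snd x - snd y)) + norm (mv (R t) (fst x - fst y))"
      by (simp add: norm_Pair_le)
    also have "\<dots> \<le> norm (snd x - snd y) / m + C * norm (fst x - fst y) * K"
      using K C(2)[OF t] by (intro add_mono norm_pinv_le[OF m pos[OF t]] order_trans[OF K(2)] mult_right_mono) auto
    also have "\<dots> \<le> norm (x - y) / m + C * norm (x - y) * K"
      using m C K fn sn
      by (intro add_mono divide_right_mono mult_right_mono mult_left_mono) auto
    also have "\<dots> = L * norm (x - y)" by (simp add: L_def algebra_simps)
    finally show "norm (f t x - f t y) \<le> L * norm (x - y)" .
  qed
  then obtain x where x: "continuous_on {a..b} x" "\<And>t. t \<in> {a..b} \<Longrightarrow> x t = (y0, 0) + integral {a..t} (\<lambda>s. f s (x s))" by blast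
  have xa: "x a = (y0, 0)" using x(2)[of a] ab by simp
  define u where "u = (\<lambda>t. pinv (P t) (snd (x t) + g t))"
  have bu: "bm a b u" unfolding u_def
    by (rule bm_pinv[OF P _ m pos]) (intro bm_add g bm_continuous continuous_on_snd x)
  have bw: "bm a b (\<lambda>t. mv (R t) (fst (x t)))"
    by (intro bm_bilinear[OF bounded_bilinear_mv R] bm_continuous continuous_on_fst x)
  have bf: "bm a b (\<lambda>t. f t (x t))"
  proof -
    have "bm a b (\<lambda>t. (u t, 0) + (0, mv (R t) (fst (x t))))"
      by (intro bm_add bm_linear[OF bounded_linear_Pair[OF bounded_linear_ident bounded_linear_zero] bu]
        bm_linear[OF bounded_linear_Pair[OF bounded_linear_zero bounded_linear_ident] bw])
    then show ?thesis by (simp add: f_def u_def)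
  qed
  have px: "prim a b x (\<lambda>t. f t (x t))"
    by (rule primI[OF bf]) (simp only: xa x(2)[symmetric])
  have "prim a b (\<lambda>t. fst (x t)) u"
    using prim_linear[OF bounded_linear_fst px] by (simp add: f_def u_def)
  moreover have "prim a b (\<lambda>t. snd (x t)) (\<lambda>t. mv (R t) (fst (x t)))"
    using prim_linear[OF bounded_linear_snd px] by (simp add: f_def)
  moreover have "\<forall>t\<in>{a..b}. mv (P t) (u t) = snd (x t) + g t"
    unfolding u_def using mv_pinv[OF m pos] by blast
  ultimately show ?thesis using xa
    by (intro exI[of _ "\<lambda>t. fst (x t)"] exI[of _ u] exI[of _ "\<lambda>t. snd (x t)"]) auto
qed

section \<open>The energy form on a fine mesh\<close>

text \<open>Derivatives are separate arguments, since a function fixes its integrand only up to null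
  sets.\<close>

definition energy :: "real \<Rightarrow> real \<Rightarrow> (real \<Rightarrow> real^'n^'n) \<Rightarrow> (real \<Rightarrow> real^'n^'n) \<Rightarrow> (real \<Rightarrow> complex^'n) \<Rightarrow>
    (real \<Rightarrow> complex^'n) \<Rightarrow> (real \<Rightarrow> complex^'n) \<Rightarrow> (real \<Rightarrow> complex^'n) \<Rightarrow> complex" where
  "energy a b P R v v' y y' = integral {a..b} (\<lambda>t. hip (v' t) (mv (P t) (y' t)) + hip (v t) (mv (R t) (y t)))"

text \<open>The constants \<open>m\<close> and \<open>\<kappa>\<close> record lower bounds only.
  With \<open>R = Q - \<lambda> W\<close> and \<open>W\<close> positive, one \<open>\<kappa>\<close>
  therefore serves all \<open>\<lambda>\<close> below a fixed level, down to minus infinity.\<close>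

definition good :: "real \<Rightarrow> real \<Rightarrow> real \<Rightarrow> real \<Rightarrow> (real \<Rightarrow> real^'n^'n) \<Rightarrow> (real \<Rightarrow> real^'n^'n) \<Rightarrow> bool" where
  "good a b m \<kappa> P R \<longleftrightarrow> bm a b P \<and> bm a b R \<and> (\<forall>t\<in>{a..b}. transpose (P t) = P t \<and> transpose (R t) = R t \<and>
     (\<forall>v. m * (norm v)\<^sup>2 \<le> Re (hip v (mv (P t) v))) \<and> (\<forall>v. - \<kappa> * (norm v)\<^sup>2 \<le> Re (hip v (mv (R t) v))))"

lemma goodD:
  assumes "good a b m \<kappa> P R"
  shows "bm a b P" "bm a b R" "t \<in> {a..b} \<Longrightarrow> transpose (P t) = P t" "t \<in> {a..b} \<Longrightarrow> transpose (R t) = R t"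
    "t \<in> {a..b} \<Longrightarrow> m * (norm v)\<^sup>2 \<le> Re (hip v (mv (P t) v))"
    "t \<in> {a..b} \<Longrightarrow> - \<kappa> * (norm v)\<^sup>2 \<le> Re (hip v (mv (R t) v))"
  using assms unfolding good_def by auto

lemma bm_hip: "bm a b f \<Longrightarrow> bm a b g \<Longrightarrow> bm a b (\<lambda>t. hip (f t) (g t))"
  by (rule bm_bilinear[OF bounded_bilinear_hip])

lemma bm_mv: "bm a b M \<Longrightarrow> bm a b f \<Longrightarrow> bm a b (\<lambda>t. mv (M t) (f t))"
  by (rule bm_bilinear[OF bounded_bilinear_mv])

lemma bm_norm2: "bm a b f \<Longrightarrow> bm a b (\<lambda>t. (norm (f t))\<^sup>2)"
  unfolding power2_norm_eq_inner by (rule bm_bilinear[OF bounded_bilinear_inner])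

lemma bm_energy:
  assumes "bm a b P" "bm a b R" "prim a b v v'" "prim a b y y'"
  shows "bm a b (\<lambda>t. hip (v' t) (mv (P t) (y' t)) + hip (v t) (mv (R t) (y t)))"
  by (intro bm_add bm_hip bm_mv assms prim_bm[OF assms(3)] prim_bm[OF assms(4)] prim_bm_deriv[OF assms(3)] prim_bm_deriv[OF assms(4)])

lemma energy_herm:
  assumes "good a b m \<kappa> P R"
  shows "energy a b P R y y' v v' = cnj (energy a b P R v v' y y')"
  unfolding energy_def integral_cnj
  by (rule Henstock_Kurzweil_Integration.integral_cong)
     (simp add: cnj_hip hip_mv_symmetric[OF goodD(3)[OF assms]] hip_mv_symmetric[OF goodD(4)[OF assms]])

lemma bounded_linear_vec_scale: "bounded_linear (\<lambda>v::complex^'n. c *s v)"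
  unfolding linear_conv_bounded_linear[symmetric]
  by (rule linearI) (simp_all add: vec_eq_iff algebra_simps)

lemma prim_scale: "prim a b y u \<Longrightarrow> prim a b (\<lambda>t. c *s y t) (\<lambda>t. c *s u t)" for y :: "real \<Rightarrow> complex^'n"
  by (rule prim_linear[OF bounded_linear_vec_scale])

lemma energy_comb_right:
  assumes bm: "bm a b P" "bm a b R" and p: "prim a b v v'" "prim a b y y'" "prim a b z z'"
  shows "energy a b P R v v' (\<lambda>t. y t + c *s z t) (\<lambda>t. y' t + c *s z' t) = energy a b P R v v' y y' + c * energy a b P R v v' z z'"
proof -
  have "energy a b P R v v' (\<lambda>t. y t + c *s z t) (\<lambda>t. y' t + c *s z' t) = integral {a..b} (\<lambda>t.
     (hip (v' t) (mv (P t) (y' t)) + hip (v t) (mv (R t) (y t))) + c * (hip (v' t) (mv (P t) (z' t)) + hip (v t) (mv (R t) (z t))))"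
    unfolding energy_def by (simp add: mv_simps mv_scale hip_simps algebra_simps)
  also have "\<dots> = energy a b P R v v' y y' + c * energy a b P R v v' z z'"
    unfolding energy_def
    by (subst Henstock_Kurzweil_Integration.integral_add[OF bm_integrable[OF bm_energy[OF bm p(1,2)]]
          integrable_on_mult_right[OF bm_integrable[OF bm_energy[OF bm p(1,3)]]]]) simp
  finally show ?thesis .
qed

lemma energy_diff_right:
  assumes "bm a b P" "bm a b R" "prim a b v v'" "prim a b y y'" "prim a b z z'"
  shows "energy a b P R v v' (\<lambda>t. y t - z t) (\<lambda>t. y' t - z' t) = energy a b P R v v' y y' - energy a b P R v v' z z'"
  using energy_comb_right[OF assms, of "-1"] by (simp add: vector_sneg_minus1[symmetric])

lemma poincare:
  fixes v :: "real \<Rightarrow> 'v::euclidean_space"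
  assumes v: "prim \<alpha> \<beta> v u" "v \<alpha> = 0" "\<alpha> < \<beta>"
  shows "integral {\<alpha>..\<beta>} (\<lambda>t. (norm (v t))\<^sup>2) \<le> 4 * (\<beta> - \<alpha>)\<^sup>2 * integral {\<alpha>..\<beta>} (\<lambda>t. (norm (u t))\<^sup>2)"
proof -
  define h where "h = \<beta> - \<alpha>"
  have h: "h > 0" using assms by (simp add: h_def)
  define V where "V = integral {\<alpha>..\<beta>} (\<lambda>t. (norm (v t))\<^sup>2)"
  define U where "U = integral {\<alpha>..\<beta>} (\<lambda>t. (norm (u t))\<^sup>2)"
  have bv: "bm \<alpha> \<beta> (\<lambda>t. (norm (v t))\<^sup>2)" and bu: "bm \<alpha> \<beta> (\<lambda>t. (norm (u t))\<^sup>2)"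
    by (rule bm_norm2[OF prim_bm[OF v(1)]], rule bm_norm2[OF prim_bm_deriv[OF v(1)]])
  \<comment> \<open>Weights for Young's inequality: after integration over an interval of length
    \<open>h\<close> the first term contributes half of \<open>V\<close>, which is absorbed on the
    left.\<close>
  define w where "w = (\<lambda>t. (1 / (2 * h)) *\<^sub>R (norm (v t))\<^sup>2 + (2 * h) *\<^sub>R (norm (u t))\<^sup>2)"
  have bw: "bm \<alpha> \<beta> w" unfolding w_def by (intro bm_add bm_scaleR bv bu)
  have Iw: "integral {\<alpha>..\<beta>} w = V / (2 * h) + 2 * h * U"
    unfolding w_def V_def U_def
    by (subst Henstock_Kurzweil_Integration.integral_add[OF bm_integrable[OF bm_scaleR[OF bv]] bm_integrable[OF bm_scaleR[OF bu]]]) simp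
  have pt: "(norm (v t))\<^sup>2 \<le> V / (2 * h) + 2 * h * U" if t: "t \<in> {\<alpha>..\<beta>}" for t
  proof -
    have p: "prim \<alpha> \<beta> (\<lambda>t. v t \<bullet> v t) (\<lambda>t. u t \<bullet> v t + v t \<bullet> u t)"
      by (rule prim_bilinear[OF bounded_bilinear_inner v(1) v(1)])
    have "(norm (v t))\<^sup>2 = integral {\<alpha>..t} (\<lambda>t. u t \<bullet> v t + v t \<bullet> u t)"
      using primD[OF p t] v(2) by (simp add: power2_norm_eq_inner)
    also have "\<dots> \<le> integral {\<alpha>..t} w"
    proof (rule integral_le)
      show "(\<lambda>t. u t \<bullet> v t + v t \<bullet> u t) integrable_on {\<alpha>..t}"
        by (rule bm_integrable_sub[OF prim_bm_deriv[OF p]]) (use t in auto)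
      show "w integrable_on {\<alpha>..t}" by (rule bm_integrable_sub[OF bw]) (use t in auto)
      fix s
      have "u s \<bullet> v s + v s \<bullet> u s \<le> 2 * (norm (u s) * norm (v s))"
        using norm_cauchy_schwarz[of "u s" "v s"] by (simp add: inner_commute)
      also have "\<dots> \<le> w s"
      proof -
        have "0 \<le> (norm (v s) - 2 * h * norm (u s))\<^sup>2 / (2 * h)" using h by simp
        also have "\<dots> = w s - 2 * (norm (u s) * norm (v s))"
          using h by (simp add: w_def field_simps power2_eq_square)
        finally show ?thesis by simp
      qed
      finally show "u s \<bullet> v s + v s \<bullet> u s \<le> w s" .
    qed
    also have "\<dots> \<le> integral {\<alpha>..\<beta>} w"
      using t h by (intro integral_subset_le bm_integrable_sub[OF bw] bm_integrable[OF bw]) (auto simp: w_def)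
    finally show ?thesis unfolding Iw .
  qed
  have "V \<le> integral {\<alpha>..\<beta>} (\<lambda>t. V / (2 * h) + 2 * h * U)"
    unfolding V_def[symmetric] by (subst V_def, rule integral_le[OF bm_integrable[OF bv]]) (use pt in auto)
  also have "\<dots> = V / 2 + 2 * h\<^sup>2 * U" using h v(3) by (simp add: h_def[symmetric] field_simps power2_eq_square)
  finally show ?thesis by (simp add: V_def U_def h_def)
qed

text \<open>The squared norm oscillates by at most the integral of \<open>w\<close>, and comparison
  with its mean value gives the bound. The free \<open>\<delta>\<close> makes the derivative term as
  small as desired, so that boundary values can be dominated when \<open>\<lambda>\<close> is very
  negative.\<close>

lemma trace_bound:
  fixes y :: "real \<Rightarrow> 'v::euclidean_space"
  assumes y: "prim a b y u" and ab: "a < b" and s: "s \<in> {a..b}" and d: "\<delta> > 0"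
  shows "(norm (y s))\<^sup>2 \<le> \<delta> * integral {a..b} (\<lambda>t. (norm (u t))\<^sup>2) + (1 / (b - a) + 1 / \<delta>) * integral {a..b} (\<lambda>t. (norm (y t))\<^sup>2)"
proof -
  define V where "V = integral {a..b} (\<lambda>t. (norm (y t))\<^sup>2)"
  define U where "U = integral {a..b} (\<lambda>t. (norm (u t))\<^sup>2)"
  have bv: "bm a b (\<lambda>t. (norm (y t))\<^sup>2)" and bu: "bm a b (\<lambda>t. (norm (u t))\<^sup>2)"
    by (rule bm_norm2[OF prim_bm[OF y]], rule bm_norm2[OF prim_bm_deriv[OF y]])
  define w where "w = (\<lambda>t. (1 / \<delta>) *\<^sub>R (norm (y t))\<^sup>2 + \<delta> *\<^sub>R (norm (u t))\<^sup>2)"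
  have bw: "bm a b w" unfolding w_def by (intro bm_add bm_scaleR bv bu)
  have Iw: "integral {a..b} w = V / \<delta> + \<delta> * U"
    unfolding w_def V_def U_def
    by (subst Henstock_Kurzweil_Integration.integral_add[OF bm_integrable[OF bm_scaleR[OF bv]] bm_integrable[OF bm_scaleR[OF bu]]]) simp
  have p: "prim a b (\<lambda>t. y t \<bullet> y t) (\<lambda>t. u t \<bullet> y t + y t \<bullet> u t)"
    by (rule prim_bilinear[OF bounded_bilinear_inner y y])
  have ws: "\<bar>u r \<bullet> y r + y r \<bullet> u r\<bar> \<le> w r" for r
  proof -
    have "\<bar>u r \<bullet> y r + y r \<bullet> u r\<bar> \<le> 2 * (norm (u r) * norm (y r))"
      using Cauchy_Schwarz_ineq2[of "u r" "y r"] by (simp add: inner_commute)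
    also have "\<dots> \<le> w r"
    proof -
      have "0 \<le> (norm (y r) - \<delta> * norm (u r))\<^sup>2 / \<delta>" using d by simp
      also have "\<dots> = w r - 2 * (norm (u r) * norm (y r))"
        using d by (simp add: w_def field_simps power2_eq_square)
      finally show ?thesis by simp
    qed
    finally show ?thesis .
  qed
  have pt: "\<bar>(norm (y t))\<^sup>2 - (norm (y r))\<^sup>2\<bar> \<le> V / \<delta> + \<delta> * U" if t: "a \<le> r" "r \<le> t" "t \<le> b" for r t
  proof -
    have "\<bar>(norm (y t))\<^sup>2 - (norm (y r))\<^sup>2\<bar> = norm (integral {r..t} (\<lambda>t. u t \<bullet> y t + y t \<bullet> u t))"
      using prim_diff[OF p t] by (simp add: power2_norm_eq_inner)
    also have "\<dots> \<le> integral {r..t} w"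
      using t ws by (intro integral_norm_bound_integral bm_integrable_sub[OF prim_bm_deriv[OF p]] bm_integrable_sub[OF bw]) auto
    also have "\<dots> \<le> integral {a..b} w"
      using t d by (intro integral_subset_le bm_integrable_sub[OF bw] bm_integrable[OF bw]) (auto simp: w_def)
    finally show ?thesis unfolding Iw .
  qed
  have pt2: "(norm (y s))\<^sup>2 \<le> (norm (y t))\<^sup>2 + (V / \<delta> + \<delta> * U)" if "t \<in> {a..b}" for t
    using pt[of s t] pt[of t s] that s by (cases "s \<le> t") auto
  have "(b - a) * (norm (y s))\<^sup>2 = integral {a..b} (\<lambda>t. (norm (y s))\<^sup>2)" using ab by simp
  also have "\<dots> \<le> integral {a..b} (\<lambda>t. (norm (y t))\<^sup>2 + (V / \<delta> + \<delta> * U))"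
    by (rule integral_le) (use pt2 in \<open>auto intro!: bm_integrable bm_add bm_const bv\<close>)
  also have "\<dots> = V + (b - a) * (V / \<delta> + \<delta> * U)"
    unfolding V_def[symmetric] using ab
    by (subst Henstock_Kurzweil_Integration.integral_add[OF bm_integrable[OF bv] bm_integrable[OF bm_const]]) (simp add: V_def)
  finally show ?thesis unfolding V_def[symmetric] U_def[symmetric] using ab by (simp add: field_simps)
qed

text \<open>The inequality of \<open>poincare\<close> has constant \<open>4 * h\<^sup>2\<close> on a
  cell of length \<open>h\<close>. The condition \<open>fine\<close> says that
  \<open>\<kappa>\<close> times this is at most \<open>m / 2\<close>, so half of the coercivity of
  \<open>P\<close> remains for functions vanishing at the nodes.\<close>

locale mesh =
  fixes a b m \<kappa> :: real and N :: nat
  assumes ab: "a < b" and m: "m > 0" and kap: "\<kappa> \<ge> 0" and N: "N > 0" and fine: "8 * \<kappa> * ((b - a) / N)\<^sup>2 \<le> m"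
begin

definition h where "h = (b - a) / real N"

definition tau :: "nat \<Rightarrow> real" where "tau k = a + real k * h"

lemma h_pos: "h > 0" using ab N by (simp add: h_def)

lemma tau_0: "tau 0 = a" by (simp add: tau_def)

lemma tau_N: "tau N = b" using N by (simp add: tau_def h_def)

lemma tau_Suc: "tau (Suc k) = tau k + h" by (simp add: tau_def algebra_simps)

lemma tau_mono: "i \<le> k \<Longrightarrow> tau i \<le> tau k" using h_pos by (simp add: tau_def)

lemma tau_in: "k \<le> N \<Longrightarrow> tau k \<in> {a..b}"
  using tau_mono[of 0 k] tau_mono[of k N] by (simp add: tau_0 tau_N)

definition jump_sum :: "(nat \<Rightarrow> complex^'n) \<Rightarrow> real \<Rightarrow> complex^'n" where
  "jump_sum jmp t = (\<Sum>k<N. if tau k \<le> t then jmp k else 0)"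

lemma bm_jump_sum: "bm a b (jump_sum jmp)"
  unfolding jump_sum_def by (intro bm_sum bm_if_le bm_const) auto

text \<open>A solution of \<open>-(P y')' + R y = 0\<close> away from the nodes: the quasi-derivative is \<open>z + jump_sum jmp\<close>,
  where \<open>jmp k\<close> is its jump at \<open>tau k\<close> for \<open>k > 0\<close> and \<open>jmp 0\<close> is its initial value.\<close>
definition psol :: "(real \<Rightarrow> real^'n^'n) \<Rightarrow> (real \<Rightarrow> real^'n^'n) \<Rightarrow> (real \<Rightarrow> complex^'n) \<Rightarrow> (real \<Rightarrow> complex^'n) \<Rightarrow>
    (real \<Rightarrow> complex^'n) \<Rightarrow> (nat \<Rightarrow> complex^'n) \<Rightarrow> bool" where
  "psol P R y u z jmp \<longleftrightarrow> prim a b y u \<and> prim a b z (\<lambda>t. mv (R t) (y t)) \<and> z a = 0 \<and>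
     (\<forall>t\<in>{a..b}. mv (P t) (u t) = z t + jump_sum jmp t)"

text \<open>The vector dual to \<open>v (tau k)\<close> in Green's identity: minus the jump at an
  inner node, minus the quasi-derivative at \<open>a\<close>, and the quasi-derivative itself at
  \<open>b\<close>.\<close>

definition flux :: "(real \<Rightarrow> complex^'n) \<Rightarrow> (nat \<Rightarrow> complex^'n) \<Rightarrow> nat \<Rightarrow> complex^'n" where
  "flux z jmp k = (if k < N then - jmp k else z b + (\<Sum>k<N. jmp k))"

text \<open>Integration by parts against the continuous part \<open>z\<close>; jump \<open>k\<close>
  is active only to the right of \<open>tau k\<close> and therefore meets
  \<open>v b - v (tau k)\<close>. The terms at \<open>b\<close> add up to the last flux.\<close>

lemma green:
  assumes g: "good a b m \<kappa> P R" and s: "psol P R y u z jmp" and v: "prim a b v v'"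
  shows "energy a b P R v v' y u = (\<Sum>k\<le>N. hip (v (tau k)) (flux z jmp k))"
proof -
  have y: "prim a b y u" and z: "prim a b z (\<lambda>t. mv (R t) (y t))" and za: "z a = 0"
    and Pu: "\<And>t. t \<in> {a..b} \<Longrightarrow> mv (P t) (u t) = z t + jump_sum jmp t"
    using s unfolding psol_def by auto
  have bv': "bm a b v'" by (rule prim_bm_deriv[OF v])
  have "energy a b P R v v' y u = integral {a..b} (\<lambda>t. (hip (v' t) (z t) + hip (v t) (mv (R t) (y t))) +
       (\<Sum>k<N. if tau k \<le> t then hip (v' t) (jmp k) else 0))"
    unfolding energy_def
  proof (rule Henstock_Kurzweil_Integration.integral_cong)
    fix t assume t: "t \<in> {a..b}"
    have "hip (v' t) (jump_sum jmp t) = (\<Sum>k<N. if tau k \<le> t then hip (v' t) (jmp k) else 0)"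
      unfolding jump_sum_def bounded_bilinear.sum_right[OF bounded_bilinear_hip] by (intro sum.cong) (auto simp: hip_simps)
    then show "hip (v' t) (mv (P t) (u t)) + hip (v t) (mv (R t) (y t)) =
      hip (v' t) (z t) + hip (v t) (mv (R t) (y t)) + (\<Sum>k<N. if tau k \<le> t then hip (v' t) (jmp k) else 0)"
      by (simp add: Pu[OF t] hip_simps)
  qed
  also have "\<dots> = integral {a..b} (\<lambda>t. hip (v' t) (z t) + hip (v t) (mv (R t) (y t))) +
       integral {a..b} (\<lambda>t. \<Sum>k<N. if tau k \<le> t then hip (v' t) (jmp k) else 0)"
    by (intro Henstock_Kurzweil_Integration.integral_add bm_integrable bm_add bm_hip bm_mv bm_sum bm_if_le bm_const bv'
        prim_bm[OF v] prim_bm[OF z] prim_bm[OF y] goodD(2)[OF g]) auto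
  also have "integral {a..b} (\<lambda>t. hip (v' t) (z t) + hip (v t) (mv (R t) (y t))) = hip (v b) (z b)"
    using prim_parts[OF bounded_bilinear_hip v z] ab by (simp add: za hip_simps)
  also have "integral {a..b} (\<lambda>t. \<Sum>k<N. if tau k \<le> t then hip (v' t) (jmp k) else 0) =
      (\<Sum>k<N. integral {a..b} (\<lambda>t. if tau k \<le> t then hip (v' t) (jmp k) else 0))"
    by (intro Henstock_Kurzweil_Integration.integral_sum bm_integrable bm_if_le bm_hip bm_const bv') auto
  also have "\<dots> = (\<Sum>k<N. hip (v b) (jmp k) - hip (v (tau k)) (jmp k))"
  proof (rule sum.cong, simp)
    fix k assume "k \<in> {..<N}"
    then have t: "tau k \<in> {a..b}" by (intro tau_in) auto
    have "integral {a..b} (\<lambda>t. if tau k \<le> t then hip (v' t) (jmp k) else 0) =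
        integral {a..b} (\<lambda>t. if t \<in> {tau k..b} then hip (v' t) (jmp k) else 0)"
      by (rule Henstock_Kurzweil_Integration.integral_cong) auto
    also have "\<dots> = integral {tau k..b} (\<lambda>t. hip (v' t) (jmp k))"
      using t by (subst Henstock_Kurzweil_Integration.integral_restrict_Int) (simp add: Int_absorb2)
    also have "\<dots> = hip (integral {tau k..b} v') (jmp k)"
      using integral_linear[OF bm_integrable_sub[OF bv'] bounded_bilinear.bounded_linear_left[OF bounded_bilinear_hip], of "tau k" b "jmp k"] t
      by (simp add: o_def)
    also have "integral {tau k..b} v' = v b - v (tau k)"
      using prim_diff[OF v, of "tau k" b] t by simp
    finally show "integral {a..b} (\<lambda>t. if tau k \<le> t then hip (v' t) (jmp k) else 0) = hip (v b) (jmp k) - hip (v (tau k)) (jmp k)"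
      by (simp add: hip_simps)
  qed
  finally have "energy a b P R v v' y u = hip (v b) (z b) + (\<Sum>k<N. hip (v b) (jmp k) - hip (v (tau k)) (jmp k))" .
  also have "\<dots> = (\<Sum>k<N. hip (v (tau k)) (flux z jmp k)) + hip (v (tau N)) (flux z jmp N)"
    by (simp add: flux_def hip_simps sum_subtractf sum_negf tau_N bounded_bilinear.sum_right[OF bounded_bilinear_hip])
  also have "\<dots> = (\<Sum>k\<le>N. hip (v (tau k)) (flux z jmp k))" by (simp add: lessThan_Suc_atMost[symmetric])
  finally show ?thesis .
qed

lemma poincare_mesh:
  assumes v: "prim a b v u" and zero: "\<And>k. k \<le> N \<Longrightarrow> v (tau k) = 0"
  shows "integral {a..b} (\<lambda>t. (norm (v t))\<^sup>2) \<le> 4 * h\<^sup>2 * integral {a..b} (\<lambda>t. (norm (u t))\<^sup>2)"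
proof -
  have bv: "bm a b (\<lambda>t. (norm (v t))\<^sup>2)" and bu: "bm a b (\<lambda>t. (norm (u t))\<^sup>2)"
    by (rule bm_norm2[OF prim_bm[OF v]], rule bm_norm2[OF prim_bm_deriv[OF v]])
  have "k \<le> N \<Longrightarrow> integral {a..tau k} (\<lambda>t. (norm (v t))\<^sup>2) \<le> 4 * h\<^sup>2 * integral {a..tau k} (\<lambda>t. (norm (u t))\<^sup>2)" for k
  proof (induction k)
    case 0
    then show ?case by (simp add: tau_0)
  next
    case (Suc k)
    have t: "a \<le> tau k" "tau k < tau (Suc k)" "tau (Suc k) \<le> b"
      using tau_in[of k] tau_in[of "Suc k"] Suc.prems h_pos by (auto simp: tau_Suc)
    have comb: "integral {a..tau k} f + integral {tau k..tau (Suc k)} f = integral {a..tau (Suc k)} f"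
      if "bm a b f" for f :: "real \<Rightarrow> real"
      using t by (intro Henstock_Kurzweil_Integration.integral_combine bm_integrable_sub[OF that]) auto
    have "integral {tau k..tau (Suc k)} (\<lambda>t. (norm (v t))\<^sup>2) \<le>
       4 * (tau (Suc k) - tau k)\<^sup>2 * integral {tau k..tau (Suc k)} (\<lambda>t. (norm (u t))\<^sup>2)"
      using t Suc.prems by (intro poincare prim_subinterval[OF v] zero) auto
    then have "integral {tau k..tau (Suc k)} (\<lambda>t. (norm (v t))\<^sup>2) \<le> 4 * h\<^sup>2 * integral {tau k..tau (Suc k)} (\<lambda>t. (norm (u t))\<^sup>2)"
      by (simp add: tau_Suc)
    moreover have "integral {a..tau k} (\<lambda>t. (norm (v t))\<^sup>2) \<le> 4 * h\<^sup>2 * integral {a..tau k} (\<lambda>t. (norm (u t))\<^sup>2)"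
      using Suc by simp
    ultimately show ?case unfolding comb[OF bv, symmetric] comb[OF bu, symmetric] by (simp add: algebra_simps)
  qed
  from this[of N] show ?thesis by (simp add: tau_N)
qed

text \<open>The bound \<open>\<rho>\<close> is kept apart from \<open>- \<kappa>\<close> because
  there are two uses: coercivity on a fine mesh, and domination by a large positive \<open>R\<close>
  when \<open>\<lambda>\<close> is very negative.\<close>

lemma Re_energy_ge:
  assumes g: "good a b m \<kappa> P R" and v: "prim a b v u"
    and R: "\<And>t w. t \<in> {a..b} \<Longrightarrow> \<rho> * (norm w)\<^sup>2 \<le> Re (hip w (mv (R t) w))"
  shows "m * integral {a..b} (\<lambda>t. (norm (u t))\<^sup>2) + \<rho> * integral {a..b} (\<lambda>t. (norm (v t))\<^sup>2) \<le> Re (energy a b P R v u v u)"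
proof -
  have bv: "bm a b (\<lambda>t. (norm (v t))\<^sup>2)" and bu: "bm a b (\<lambda>t. (norm (u t))\<^sup>2)"
    by (rule bm_norm2[OF prim_bm[OF v]], rule bm_norm2[OF prim_bm_deriv[OF v]])
  have be: "bm a b (\<lambda>t. hip (u t) (mv (P t) (u t)) + hip (v t) (mv (R t) (v t)))"
    by (rule bm_energy[OF goodD(1,2)[OF g] v v])
  have "m * integral {a..b} (\<lambda>t. (norm (u t))\<^sup>2) + \<rho> * integral {a..b} (\<lambda>t. (norm (v t))\<^sup>2) =
     integral {a..b} (\<lambda>t. m *\<^sub>R (norm (u t))\<^sup>2 + \<rho> *\<^sub>R (norm (v t))\<^sup>2)"
    by (subst Henstock_Kurzweil_Integration.integral_add[OF bm_integrable[OF bm_scaleR[OF bu]] bm_integrable[OF bm_scaleR[OF bv]]]) simp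
  also have "\<dots> \<le> integral {a..b} (\<lambda>t. Re (hip (u t) (mv (P t) (u t)) + hip (v t) (mv (R t) (v t))))"
    by (rule integral_le[OF bm_integrable[OF bm_add[OF bm_scaleR[OF bu] bm_scaleR[OF bv]]] bm_integrable[OF bm_linear[OF bounded_linear_Re be]]])
       (auto intro!: add_mono goodD(5)[OF g] R)
  also have "\<dots> = Re (energy a b P R v u v u)"
    unfolding energy_def using integral_linear[OF bm_integrable[OF be] bounded_linear_Re] by (simp add: o_def)
  finally show ?thesis .
qed

lemma coercive:
  assumes g: "good a b m \<kappa> P R" and v: "prim a b v u" and zero: "\<And>k. k \<le> N \<Longrightarrow> v (tau k) = 0"
  shows "m / 2 * integral {a..b} (\<lambda>t. (norm (u t))\<^sup>2) \<le> Re (energy a b P R v u v u)"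
proof -
  define V where "V = integral {a..b} (\<lambda>t. (norm (v t))\<^sup>2)"
  define U where "U = integral {a..b} (\<lambda>t. (norm (u t))\<^sup>2)"
  have U: "U \<ge> 0" unfolding U_def
    by (intro Henstock_Kurzweil_Integration.integral_nonneg bm_integrable bm_norm2 prim_bm_deriv[OF v]) auto
  have "m * U + - \<kappa> * V \<le> Re (energy a b P R v u v u)"
    unfolding U_def V_def by (rule Re_energy_ge[OF g v goodD(6)[OF g]])
  moreover have "\<kappa> * V \<le> \<kappa> * (4 * h\<^sup>2 * U)"
    unfolding U_def V_def by (intro mult_left_mono poincare_mesh[OF v zero] kap)
  moreover have "8 * \<kappa> * h\<^sup>2 * U \<le> m * U" using fine U unfolding h_def by (rule mult_right_mono)
  ultimately show ?thesis unfolding U_def[symmetric] by simp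
qed

lemma zero_of_deriv_norm:
  assumes v: "prim a b v u" and zero: "\<And>k. k \<le> N \<Longrightarrow> v (tau k) = 0"
    and U: "integral {a..b} (\<lambda>t. (norm (u t))\<^sup>2) \<le> 0" and t: "t \<in> {a..b}"
  shows "v t = 0"
proof -
  have bv: "bm a b (\<lambda>t. (norm (v t))\<^sup>2)" by (rule bm_norm2[OF prim_bm[OF v]])
  have "integral {a..b} (\<lambda>t. (norm (v t))\<^sup>2) \<le> 4 * h\<^sup>2 * integral {a..b} (\<lambda>t. (norm (u t))\<^sup>2)"
    by (rule poincare_mesh[OF v zero])
  also have "\<dots> \<le> 0" using U by (intro mult_nonneg_nonpos) auto
  finally have le: "integral {a..b} (\<lambda>t. (norm (v t))\<^sup>2) \<le> 0" .
  moreover have "0 \<le> integral {a..b} (\<lambda>t. (norm (v t))\<^sup>2)"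
    by (intro Henstock_Kurzweil_Integration.integral_nonneg bm_integrable bv) auto
  ultimately have "integral {a..b} (\<lambda>t. (norm (v t))\<^sup>2) = 0" by simp
  then have "\<forall>x\<in>{a..b}. (norm (v x))\<^sup>2 = 0"
    using ab by (subst (asm) integral_eq_0_iff) (auto intro!: continuous_intros prim_continuous[OF v])
  then show ?thesis using t by simp
qed

text \<open>Green's identity gives energy 0, and coercivity turns this into a zero derivative in the
  mean, hence \<open>y = 0\<close> and \<open>z = 0\<close>. Then \<open>P u\<close> equals the
  accumulated jumps, which must vanish cell by cell.\<close>

lemma psol_unique:
  assumes g: "good a b m \<kappa> P R" and s: "psol P R y u z jmp" and zero: "\<And>k. k \<le> N \<Longrightarrow> y (tau k) = 0"
  shows "t \<in> {a..b} \<Longrightarrow> y t = 0" "t \<in> {a..b} \<Longrightarrow> z t = 0" "k < N \<Longrightarrow> jmp k = 0"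
proof -
  have y: "prim a b y u" and z: "prim a b z (\<lambda>t. mv (R t) (y t))" and za: "z a = 0"
    and Pu: "\<And>t. t \<in> {a..b} \<Longrightarrow> mv (P t) (u t) = z t + jump_sum jmp t"
    using s unfolding psol_def by auto
  have bu: "bm a b (\<lambda>t. (norm (u t))\<^sup>2)" by (rule bm_norm2[OF prim_bm_deriv[OF y]])
  have "energy a b P R y u y u = (\<Sum>k\<le>N. hip (y (tau k)) (flux z jmp k))" by (rule green[OF g s y])
  also have "\<dots> = 0" by (rule sum.neutral) (simp add: zero hip_simps)
  finally have "m / 2 * integral {a..b} (\<lambda>t. (norm (u t))\<^sup>2) \<le> 0"
    using coercive[OF g y zero] by simp
  then have U: "integral {a..b} (\<lambda>t. (norm (u t))\<^sup>2) \<le> 0" using m by (simp add: mult_le_0_iff)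
  show y0: "t \<in> {a..b} \<Longrightarrow> y t = 0" for t by (rule zero_of_deriv_norm[OF y zero U])
  show z0: "t \<in> {a..b} \<Longrightarrow> z t = 0" for t
  proof -
    assume t: "t \<in> {a..b}"
    have "integral {a..t} (\<lambda>t. mv (R t) (y t)) = integral {a..t} (\<lambda>t. 0)"
      by (rule Henstock_Kurzweil_Integration.integral_cong) (use t y0 in \<open>auto simp: mv_simps\<close>)
    then show "z t = 0" using primD[OF z t] za by simp
  qed
  obtain C where C: "C > 0" "\<And>t. t \<in> {a..b} \<Longrightarrow> norm (P t) \<le> C" using bm_bound[OF goodD(1)[OF g]] by blast
  obtain K where K: "K \<ge> 0" "\<And>M v. norm (mv M v :: complex^'a) \<le> norm (M::real^'a^'a) * norm v * K"
    using bounded_bilinear.nonneg_bounded[OF bounded_bilinear_mv] by blast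
  have c0: "(\<Sum>i<Suc k. jmp i) = 0" if k: "k < N" for k
  proof -
    \<comment> \<open>Stopping in the middle of the cell keeps the closed interval away from the
      next node, so only the jumps up to \<open>k\<close> are active on it.\<close>
    define s where "s = tau k + h / 2"
    have s: "tau k < s" "s < tau (Suc k)" using h_pos by (auto simp: s_def tau_Suc)
    have t0: "a \<le> tau k" "s \<le> b" using tau_in[of k] tau_in[of "Suc k"] k s by auto
    have gk: "jump_sum jmp t = (\<Sum>i<Suc k. jmp i)" if "t \<in> {tau k..s}" for t
    proof -
      have "jump_sum jmp t = (\<Sum>i\<in>{..<N}. if i \<in> {..<Suc k} then jmp i else 0)"
        unfolding jump_sum_def
      proof (rule sum.cong, simp)
        fix i
        have "tau i \<le> t \<longleftrightarrow> i < Suc k"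
        proof
          assume "tau i \<le> t"
          then have "tau i < tau (Suc k)" using s that by auto
          then show "i < Suc k" using tau_mono[of "Suc k" i] by (meson leD not_less)
        next
          assume "i < Suc k"
          then show "tau i \<le> t" using tau_mono[of i k] that by auto
        qed
        then show "(if tau i \<le> t then jmp i else 0) = (if i \<in> {..<Suc k} then jmp i else 0)" by simp
      qed
      also have "\<dots> = (\<Sum>i\<in>{..<N} \<inter> {..<Suc k}. jmp i)" by (rule sum.inter_restrict[symmetric]) simp
      also have "{..<N} \<inter> {..<Suc k} = {..<Suc k}" using k by auto
      finally show ?thesis .
    qed
    define c where "c = (\<Sum>i<Suc k. jmp i)"
    have "(s - tau k) * (norm c)\<^sup>2 = integral {tau k..s} (\<lambda>t. (norm c)\<^sup>2)" using s by simp
    also have "\<dots> \<le> integral {tau k..s} (\<lambda>t. (C * K)\<^sup>2 *\<^sub>R (norm (u t))\<^sup>2)"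
    proof (rule integral_le)
      show "(\<lambda>t. (C * K)\<^sup>2 *\<^sub>R (norm (u t))\<^sup>2) integrable_on {tau k..s}"
        using t0 by (intro bm_integrable_sub[OF bm_scaleR[OF bu]]) auto
      fix t assume t: "t \<in> {tau k..s}"
      then have ti: "t \<in> {a..b}" using t0 by auto
      have "c = mv (P t) (u t)" using Pu[OF ti] z0[OF ti] gk[OF t] by (simp add: c_def)
      then have "norm c \<le> norm (P t) * norm (u t) * K" using K by simp
      also have "\<dots> \<le> C * norm (u t) * K" using C ti K by (intro mult_right_mono) auto
      finally have "norm c \<le> (C * K) * norm (u t)" by (simp add: mult_ac)
      then have "(norm c)\<^sup>2 \<le> ((C * K) * norm (u t))\<^sup>2" by (intro power_mono) auto
      then show "(norm c)\<^sup>2 \<le> (C * K)\<^sup>2 *\<^sub>R (norm (u t))\<^sup>2" by (simp add: power_mult_distrib)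
    qed auto
    also have "\<dots> = (C * K)\<^sup>2 * integral {tau k..s} (\<lambda>t. (norm (u t))\<^sup>2)" by simp
    also have "\<dots> \<le> (C * K)\<^sup>2 * integral {a..b} (\<lambda>t. (norm (u t))\<^sup>2)"
      using t0 by (intro mult_left_mono integral_subset_le bm_integrable_sub[OF bu] bm_integrable[OF bu]) auto
    also have "\<dots> \<le> 0" using U by (intro mult_nonneg_nonpos) auto
    finally have "(norm c)\<^sup>2 \<le> 0" using s by (simp add: mult_le_0_iff)
    then show ?thesis by (simp add: c_def)
  qed
  show "jmp k = 0" if "k < N" for k
  proof (cases k)
    case 0
    then show ?thesis using c0[of 0] N by simp
  next
    case (Suc j)
    then show ?thesis using c0[of k] c0[of j] that by simp
  qed
qed

end

context mesh begin

lemma psol_lincomb: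
  assumes T: "finite T" and s: "\<And>k. k \<in> T \<Longrightarrow> psol P R (y k) (u k) (z k) (jmp k)"
  shows "psol P R (\<lambda>t. \<Sum>k\<in>T. c k *s y k t) (\<lambda>t. \<Sum>k\<in>T. c k *s u k t) (\<lambda>t. \<Sum>k\<in>T. c k *s z k t) (\<lambda>i. \<Sum>k\<in>T. c k *s jmp k i)"
  unfolding psol_def
proof (intro conjI ballI)
  have y: "prim a b (y k) (u k)" and z: "prim a b (z k) (\<lambda>t. mv (R t) (y k t))" and za: "z k a = 0"
    and Pu: "\<And>t. t \<in> {a..b} \<Longrightarrow> mv (P t) (u k t) = z k t + jump_sum (jmp k) t" if "k \<in> T" for k
    using s[OF that] unfolding psol_def by auto
  show "prim a b (\<lambda>t. \<Sum>k\<in>T. c k *s y k t) (\<lambda>t. \<Sum>k\<in>T. c k *s u k t)"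
    by (intro prim_sum T prim_scale y)
  have "prim a b (\<lambda>t. \<Sum>k\<in>T. c k *s z k t) (\<lambda>t. \<Sum>k\<in>T. c k *s mv (R t) (y k t))"
    by (intro prim_sum T prim_scale z)
  then show "prim a b (\<lambda>t. \<Sum>k\<in>T. c k *s z k t) (\<lambda>t. mv (R t) (\<Sum>k\<in>T. c k *s y k t))"
    by (simp add: bounded_bilinear.sum_right[OF bounded_bilinear_mv] mv_scale)
  show "(\<Sum>k\<in>T. c k *s z k a) = 0" using za by simp
  fix t assume t: "t \<in> {a..b}"
  have gJs: "jump_sum (\<lambda>i. \<Sum>k\<in>T. c k *s jmp k i) t = (\<Sum>k\<in>T. c k *s jump_sum (jmp k) t)"
  proof -
    have "jump_sum (\<lambda>i. \<Sum>k\<in>T. c k *s jmp k i) t = (\<Sum>i<N. \<Sum>k\<in>T. c k *s (if tau i \<le> t then jmp k i else 0))"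
      unfolding jump_sum_def by (intro sum.cong) auto
    also have "\<dots> = (\<Sum>k\<in>T. \<Sum>i<N. c k *s (if tau i \<le> t then jmp k i else 0))" by (rule sum.swap)
    also have "\<dots> = (\<Sum>k\<in>T. c k *s jump_sum (jmp k) t)"
      unfolding jump_sum_def by (simp add: linear_sum[OF bounded_linear.linear[OF bounded_linear_vec_scale]])
    finally show ?thesis .
  qed
  have "mv (P t) (\<Sum>k\<in>T. c k *s u k t) = (\<Sum>k\<in>T. c k *s mv (P t) (u k t))"
    by (simp add: bounded_bilinear.sum_right[OF bounded_bilinear_mv] mv_scale)
  also have "\<dots> = (\<Sum>k\<in>T. c k *s z k t + c k *s jump_sum (jmp k) t)"
    using Pu t by (intro sum.cong) (auto simp: vector_add_ldistrib)
  finally show "mv (P t) (\<Sum>k\<in>T. c k *s u k t) = (\<Sum>k\<in>T. c k *s z k t) + jump_sum (\<lambda>i. \<Sum>k\<in>T. c k *s jmp k i) t"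
    unfolding gJs by (simp add: sum.distrib)
qed

text \<open>Shooting, with existence deduced from uniqueness by counting. There are as many unknown
  jump components as nodal equations at the nodes 1 to \<open>N\<close>, the value at node 0 being
  prescribed. The data \<open>p\<close> enter through one extra unknown \<open>None\<close>, so a
  nontrivial solution exists; uniqueness keeps its \<open>None\<close> coefficient from vanishing,
  and dividing by it gives the values \<open>p\<close>.\<close>

lemma psol_exists:
  fixes p :: "nat \<Rightarrow> complex^'n"
  assumes g: "good a b m \<kappa> P R"
  shows "\<exists>y u z jmp. psol P R y u z jmp \<and> (\<forall>k\<le>N. y (tau k) = p k)"
proof -
  have ex: "\<exists>w. psol P R (fst w) (fst (snd w)) (snd (snd w)) jmp \<and> fst w a = y0" for y0 :: "complex^'n" and jmp
    using ivp_exists[OF less_imp_le[OF ab] goodD(1,2)[OF g] bm_jump_sum m goodD(5)[OF g], of y0 jmp] unfolding psol_def by auto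
  define w where "w = (\<lambda>(y0 :: complex^'n) jmp. SOME w. psol P R (fst w) (fst (snd w)) (snd (snd w)) jmp \<and> fst w a = y0)"
  have w: "psol P R (fst (w y0 jmp)) (fst (snd (w y0 jmp))) (snd (snd (w y0 jmp))) jmp \<and> fst (w y0 jmp) a = y0" for y0 jmp
    unfolding w_def by (rule someI_ex[OF ex])
  define Y where "Y = (\<lambda>y0 jmp. fst (w y0 jmp))"
  define U where "U = (\<lambda>y0 jmp. fst (snd (w y0 jmp)))"
  define Z where "Z = (\<lambda>y0 jmp. snd (snd (w y0 jmp)))"
  have YUZ: "psol P R (Y y0 jmp) (U y0 jmp) (Z y0 jmp) jmp" "Y y0 jmp a = y0" for y0 jmp
    using w unfolding Y_def U_def Z_def by auto
  define A :: "(nat \<times> 'n) set" where "A = {..<N} \<times> UNIV"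
  define T :: "(nat \<times> 'n) option set" where "T = insert None (Some ` A)"
  define e :: "nat \<times> 'n \<Rightarrow> nat \<Rightarrow> complex^'n" where "e = (\<lambda>s i. if i = fst s then axis (snd s) 1 else 0)"
  define jm where "jm = (\<lambda>s. case s of None \<Rightarrow> (\<lambda>_. 0) | Some s \<Rightarrow> e s)"
  define y0 where "y0 = (\<lambda>s::(nat \<times> 'n) option. if s = None then p 0 else 0)"
  define y where "y = (\<lambda>s. Y (y0 s) (jm s))"
  define I :: "(nat \<times> 'n) set" where "I = {1..N} \<times> UNIV"
  have fin: "finite A" "finite T" "finite I" by (auto simp: A_def T_def I_def)
  have "card A = card I" by (simp add: A_def I_def card_cartesian_product)
  moreover have "card T = Suc (card A)" unfolding T_def using fin
    by (simp add: card_image)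
  ultimately have lt: "card I < card T" by simp
  \<comment> \<open>Subtracting \<open>p\<close> in the \<open>None\<close> column makes the
    equations say that the combination takes the values \<open>c None *s p k\<close> at the
    nodes.\<close>
  from homogeneous_system_nontrivial[OF fin(3,2) lt, of "\<lambda>s li. (y s (tau (fst li)) - (if s = None then p (fst li) else 0)) $ snd li"]
  obtain c where c: "\<exists>s\<in>T. c s \<noteq> 0"
    and ceq: "\<forall>li\<in>I. (\<Sum>s\<in>T. c s * (y s (tau (fst li)) - (if s = None then p (fst li) else 0)) $ snd li) = 0" by blast
  have sumT: "(\<Sum>s\<in>T. f s) = f None + (\<Sum>s\<in>A. f (Some s))" for f :: "(nat \<times> 'n) option \<Rightarrow> 'v::comm_monoid_add"
    unfolding T_def using fin by (simp add: sum.reindex)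
  define q where "q = (\<lambda>t. \<Sum>s\<in>T. c s *s y s t)"
  have node: "q (tau k) = c None *s p k" if k: "k \<le> N" for k
  proof (cases "k = 0")
    case True
    have "q a = (\<Sum>s\<in>T. c s *s y0 s)" by (simp add: q_def y_def YUZ(2))
    also have "\<dots> = c None *s p 0" unfolding sumT by (simp add: y0_def)
    finally show ?thesis using True by (simp add: tau_0)
  next
    case False
    show ?thesis
    proof (rule vec_eq_iff[THEN iffD2], rule allI)
      fix i
      have "(k, i) \<in> I" using k False by (simp add: I_def)
      then have "(\<Sum>s\<in>T. c s * (y s (tau k) - (if s = None then p k else 0)) $ i) = 0"
        using bspec[OF ceq, of "(k, i)"] by (simp only: fst_conv snd_conv)
      then show "q (tau k) $ i = (c None *s p k) $ i"
        unfolding q_def by (simp add: sumT algebra_simps)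
    qed
  qed
  have qsol: "psol P R q (\<lambda>t. \<Sum>s\<in>T. c s *s U (y0 s) (jm s) t) (\<lambda>t. \<Sum>s\<in>T. c s *s Z (y0 s) (jm s) t) (\<lambda>i. \<Sum>s\<in>T. c s *s jm s i)"
    unfolding q_def y_def by (rule psol_lincomb[OF fin(2) YUZ(1)])
  have "c None \<noteq> 0"
  proof
    assume c0: "c None = 0"
    have z: "(\<Sum>s\<in>T. c s *s jm s k) = 0" if "k < N" for k
      by (rule psol_unique(3)[OF g qsol]) (use node c0 that in auto)
    have "c (Some (k, j)) = 0" if kj: "(k, j) \<in> A" for k j
    proof -
      have "0 = (\<Sum>s\<in>T. c s *s jm s k) $ j" using z kj by (simp add: A_def)
      also have "\<dots> = (\<Sum>s\<in>A. c (Some s) * (e s k $ j))" by (simp add: sumT jm_def)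
      also have "\<dots> = (\<Sum>s\<in>A. if s = (k, j) then c (Some s) else 0)"
        by (intro sum.cong) (auto simp: e_def axis_def)
      also have "\<dots> = c (Some (k, j))" using kj fin by simp
      finally show ?thesis by simp
    qed
    then show False using c c0 unfolding T_def by auto
  qed
  then have "psol P R (\<lambda>t. \<Sum>s\<in>T. (c s / c None) *s y s t) (\<lambda>t. \<Sum>s\<in>T. (c s / c None) *s U (y0 s) (jm s) t)
      (\<lambda>t. \<Sum>s\<in>T. (c s / c None) *s Z (y0 s) (jm s) t) (\<lambda>i. \<Sum>s\<in>T. (c s / c None) *s jm s i)"
    unfolding y_def by (intro psol_lincomb[OF fin(2) YUZ(1)])
  moreover have "(\<Sum>s\<in>T. (c s / c None) *s y s (tau k)) = p k" if k: "k \<le> N" for k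
  proof -
    have "(\<Sum>s\<in>T. (c s / c None) *s y s (tau k)) = (1 / c None) *s q (tau k)"
      unfolding q_def by (simp add: linear_sum[OF bounded_linear.linear[OF bounded_linear_vec_scale]] vector_smult_assoc)
    then show ?thesis using node[OF k] \<open>c None \<noteq> 0\<close> by (simp add: vector_smult_assoc)
  qed
  ultimately show ?thesis by blast
qed

section \<open>The reduced energy as a function of the nodal values\<close>

definition sol :: "(real \<Rightarrow> real^'n^'n) \<Rightarrow> (real \<Rightarrow> real^'n^'n) \<Rightarrow> (nat \<Rightarrow> complex^'n) \<Rightarrow>
    (real \<Rightarrow> complex^'n) \<times> (real \<Rightarrow> complex^'n) \<times> (real \<Rightarrow> complex^'n) \<times> (nat \<Rightarrow> complex^'n)" where
  "sol P R p = (SOME (y, u, z, jmp). psol P R y u z jmp \<and> (\<forall>k\<le>N. y (tau k) = p k))"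

definition "solY P R p = fst (sol P R p)"
definition "solU P R p = fst (snd (sol P R p))"
definition "solZ P R p = fst (snd (snd (sol P R p)))"
definition "solJ P R p = snd (snd (snd (sol P R p)))"

text \<open>By \<open>green\<close>, this is the energy of the piecewise solution; on the diagonal it is the minimum of the
  energy over all functions with the given nodal values.\<close>
definition reduced_energy :: "(real \<Rightarrow> real^'n^'n) \<Rightarrow> (real \<Rightarrow> real^'n^'n) \<Rightarrow> (nat \<Rightarrow> complex^'n) \<Rightarrow> (nat \<Rightarrow> complex^'n) \<Rightarrow> complex" where
  "reduced_energy P R p q = (\<Sum>k\<le>N. hip (p k) (flux (solZ P R q) (solJ P R q) k))"

lemma sol_psol:
  assumes "good a b m \<kappa> P R"
  shows "psol P R (solY P R p) (solU P R p) (solZ P R p) (solJ P R p)" "k \<le> N \<Longrightarrow> solY P R p (tau k) = p k"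
proof -
  have "\<exists>x. case x of (y, u, z, jmp) \<Rightarrow> psol P R y u z jmp \<and> (\<forall>k\<le>N. y (tau k) = p k)"
    using psol_exists[OF assms, of p] by auto
  from someI_ex[OF this] show "psol P R (solY P R p) (solU P R p) (solZ P R p) (solJ P R p)"
    "k \<le> N \<Longrightarrow> solY P R p (tau k) = p k"
    unfolding sol_def[symmetric] solY_def solU_def solZ_def solJ_def by (auto simp: case_prod_beta)
qed

lemma sol_prim: "good a b m \<kappa> P R \<Longrightarrow> prim a b (solY P R p) (solU P R p)"
  using sol_psol(1) unfolding psol_def by blast

text \<open>The fluxes see a test function only at the nodes, so any function with nodal values
  \<open>p\<close> may stand in the first place. Symmetry, minimality and the perturbation estimate
  all start here.\<close>

lemma reduced_energy_energy:
  assumes g: "good a b m \<kappa> P R" and v: "prim a b v v'" and p: "\<And>k. k \<le> N \<Longrightarrow> v (tau k) = p k"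
  shows "reduced_energy P R p q = energy a b P R v v' (solY P R q) (solU P R q)"
  unfolding green[OF g sol_psol(1)[OF g] v] reduced_energy_def using p by simp

lemma reduced_energy_energy_sol:
  assumes g: "good a b m \<kappa> P R"
  shows "reduced_energy P R p q = energy a b P R (solY P R p) (solU P R p) (solY P R q) (solU P R q)"
  by (rule reduced_energy_energy[OF g sol_prim[OF g] sol_psol(2)[OF g]])

lemma reduced_energy_herm: "good a b m \<kappa> P R \<Longrightarrow> reduced_energy P R q p = cnj (reduced_energy P R p q)"
  unfolding reduced_energy_energy_sol by (rule energy_herm)

lemma reduced_energy_comb_left: "reduced_energy P R (\<lambda>k. q k + c *s r k) p = reduced_energy P R q p + cnj c * reduced_energy P R r p"
  unfolding reduced_energy_def by (simp add: hip_simps sum.distrib sum_distrib_left)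

lemma reduced_energy_comb_right:
  assumes g: "good a b m \<kappa> P R"
  shows "reduced_energy P R p (\<lambda>k. q k + c *s r k) = reduced_energy P R p q + c * reduced_energy P R p r"
proof -
  have "reduced_energy P R p (\<lambda>k. q k + c *s r k) = cnj (reduced_energy P R (\<lambda>k. q k + c *s r k) p)" by (rule reduced_energy_herm[OF g])
  also have "\<dots> = cnj (reduced_energy P R q p) + c * cnj (reduced_energy P R r p)" by (simp add: reduced_energy_comb_left)
  also have "\<dots> = reduced_energy P R p q + c * reduced_energy P R p r" by (simp add: reduced_energy_herm[OF g, of p, symmetric])
  finally show ?thesis .
qed

lemma reduced_energy_zero_left: "(\<And>k. k \<le> N \<Longrightarrow> q k = 0) \<Longrightarrow> reduced_energy P R q p = 0"
  unfolding reduced_energy_def by (rule sum.neutral) (simp add: hip_simps)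

lemma reduced_energy_zero_right: "good a b m \<kappa> P R \<Longrightarrow> (\<And>k. k \<le> N \<Longrightarrow> q k = 0) \<Longrightarrow> reduced_energy P R p q = 0"
  using reduced_energy_zero_left[of q P R p] reduced_energy_herm[of P R p q] by simp

text \<open>Pythagoras: \<open>v - solY P R p\<close> vanishes at the nodes and is therefore
  orthogonal to the piecewise solution.\<close>

lemma energy_split:
  assumes g: "good a b m \<kappa> P R" and v: "prim a b v v'" and p: "\<And>k. k \<le> N \<Longrightarrow> v (tau k) = p k"
  shows "energy a b P R (\<lambda>t. v t - solY P R p t) (\<lambda>t. v' t - solU P R p t) (solY P R p) (solU P R p) = 0"
    "Re (energy a b P R v v' v v') = Re (reduced_energy P R p p) +
       Re (energy a b P R (\<lambda>t. v t - solY P R p t) (\<lambda>t. v' t - solU P R p t) (\<lambda>t. v t - solY P R p t) (\<lambda>t. v' t - solU P R p t))"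
proof -
  let ?Y = "solY P R p" and ?U = "solU P R p"
  let ?w = "\<lambda>t. v t - ?Y t" and ?w' = "\<lambda>t. v' t - ?U t"
  have Y: "prim a b ?Y ?U" by (rule sol_prim[OF g])
  have w: "prim a b ?w ?w'" by (rule prim_diff_fun[OF v Y])
  have wp: "?w (tau k) = (\<lambda>_. 0) k" if "k \<le> N" for k using p[OF that] sol_psol(2)[OF g that] by simp
  show z: "energy a b P R ?w ?w' ?Y ?U = 0"
    using reduced_energy_energy[OF g w wp, of p] reduced_energy_zero_left[of "\<lambda>_. 0" P R p] by simp
  have bm: "bm a b P" "bm a b R" using goodD[OF g] by auto
  have z': "energy a b P R ?Y ?U ?w ?w' = 0" using energy_herm[OF g, of ?Y ?U ?w ?w'] z by simp
  have ev: "energy a b P R x x' v v' = energy a b P R x x' ?w ?w' + energy a b P R x x' ?Y ?U" if "prim a b x x'" for x x'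
    using energy_diff_right[OF bm that v Y] by simp
  have "energy a b P R v v' v v' = cnj (energy a b P R v v' ?w ?w') + cnj (energy a b P R v v' ?Y ?U)"
    using energy_herm[OF g, of v v' v v'] ev[OF v] by simp
  also have "\<dots> = energy a b P R ?w ?w' v v' + energy a b P R ?Y ?U v v'"
    by (simp add: energy_herm[OF g, symmetric])
  also have "\<dots> = energy a b P R ?w ?w' ?w ?w' + energy a b P R ?Y ?U ?Y ?U"
    unfolding ev[OF w] ev[OF Y] z z' by simp
  finally show "Re (energy a b P R v v' v v') = Re (reduced_energy P R p p) + Re (energy a b P R ?w ?w' ?w ?w')"
    unfolding reduced_energy_energy_sol[OF g] by simp
qed

lemma int_norm2_nonneg: "bm a b f \<Longrightarrow> 0 \<le> integral {a..b} (\<lambda>t. (norm (f t))\<^sup>2)"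
  by (intro Henstock_Kurzweil_Integration.integral_nonneg bm_integrable bm_norm2) auto

lemma reduced_energy_min:
  assumes g: "good a b m \<kappa> P R" and v: "prim a b v v'" and p: "\<And>k. k \<le> N \<Longrightarrow> v (tau k) = p k"
  shows "Re (reduced_energy P R p p) \<le> Re (energy a b P R v v' v v')"
proof -
  let ?w = "\<lambda>t. v t - solY P R p t" and ?w' = "\<lambda>t. v' t - solU P R p t"
  have w: "prim a b ?w ?w'" by (rule prim_diff_fun[OF v sol_prim[OF g]])
  have wp: "?w (tau k) = 0" if "k \<le> N" for k using p[OF that] sol_psol(2)[OF g that] by simp
  have "0 \<le> m / 2 * integral {a..b} (\<lambda>t. (norm (?w' t))\<^sup>2)"
    using m int_norm2_nonneg[OF prim_bm_deriv[OF w]] by simp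
  also have "\<dots> \<le> Re (energy a b P R ?w ?w' ?w ?w')" by (rule coercive[OF g w wp])
  finally show ?thesis using energy_split(2)[OF g v p] by simp
qed

lemma sol_norm_pos:
  assumes g: "good a b m \<kappa> P R" and p: "k \<le> N" "p k \<noteq> 0"
  shows "integral {a..b} (\<lambda>t. (norm (solY P R p t))\<^sup>2) > 0"
proof (rule ccontr)
  assume "\<not> ?thesis"
  then have "integral {a..b} (\<lambda>t. (norm (solY P R p t))\<^sup>2) = 0"
    using int_norm2_nonneg[OF prim_bm[OF sol_prim[OF g]], of p] by simp
  then have "\<forall>x\<in>{a..b}. (norm (solY P R p x))\<^sup>2 = 0"
    using ab by (subst (asm) integral_eq_0_iff) (auto intro!: continuous_intros prim_continuous[OF sol_prim[OF g]])
  then show False using sol_psol(2)[OF g p(1), of p] tau_in[OF p(1)] p(2) by force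
qed

lemma energy_mono:
  assumes g: "good a b m \<kappa> P R1" "good a b m \<kappa> P R2" and v: "prim a b v v'"
    and le: "\<And>t x. t \<in> {a..b} \<Longrightarrow> Re (hip x (mv (R2 t) x)) \<le> Re (hip x (mv (R1 t) x)) - \<delta> * (norm x)\<^sup>2"
  shows "Re (energy a b P R2 v v' v v') \<le> Re (energy a b P R1 v v' v v') - \<delta> * integral {a..b} (\<lambda>t. (norm (v t))\<^sup>2)"
proof -
  let ?f = "\<lambda>R t. hip (v' t) (mv (P t) (v' t)) + hip (v t) (mv (R t) (v t))"
  have be: "bm a b (?f R1)" "bm a b (?f R2)"
    by (rule bm_energy[OF goodD(1,2)[OF g(1)] v v], rule bm_energy[OF goodD(1,2)[OF g(2)] v v])
  have bv: "bm a b (\<lambda>t. (norm (v t))\<^sup>2)" by (rule bm_norm2[OF prim_bm[OF v]])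
  have re: "Re (energy a b P R v v' v v') = integral {a..b} (\<lambda>t. Re (?f R t))" if "bm a b (?f R)" for R
    unfolding energy_def using integral_linear[OF bm_integrable[OF that] bounded_linear_Re] by (simp add: o_def)
  have "Re (energy a b P R2 v v' v v') \<le> integral {a..b} (\<lambda>t. Re (?f R1 t) + (- \<delta>) *\<^sub>R (norm (v t))\<^sup>2)"
    unfolding re[OF be(2)]
    by (rule integral_le[OF bm_integrable[OF bm_linear[OF bounded_linear_Re be(2)]]
        bm_integrable[OF bm_add[OF bm_linear[OF bounded_linear_Re be(1)] bm_scaleR[OF bv]]]])
      (use le in \<open>auto simp: algebra_simps\<close>)
  also have "\<dots> = Re (energy a b P R1 v v' v v') - \<delta> * integral {a..b} (\<lambda>t. (norm (v t))\<^sup>2)"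
    unfolding re[OF be(1)]
    by (subst Henstock_Kurzweil_Integration.integral_add[OF bm_integrable[OF bm_linear[OF bounded_linear_Re be(1)]] bm_integrable[OF bm_scaleR[OF bv]]]) simp
  finally show ?thesis .
qed

text \<open>The minimizer for \<open>R1\<close> is a competitor for \<open>R2\<close>. The
  quantitative gain is kept because it makes the forms strictly decreasing on kernels.\<close>

lemma reduced_energy_mono:
  assumes g: "good a b m \<kappa> P R1" "good a b m \<kappa> P R2"
    and le: "\<And>t x. t \<in> {a..b} \<Longrightarrow> Re (hip x (mv (R2 t) x)) \<le> Re (hip x (mv (R1 t) x)) - \<delta> * (norm x)\<^sup>2"
  shows "Re (reduced_energy P R2 p p) \<le> Re (reduced_energy P R1 p p) - \<delta> * integral {a..b} (\<lambda>t. (norm (solY P R1 p t))\<^sup>2)"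
proof -
  have Y: "prim a b (solY P R1 p) (solU P R1 p)" by (rule sol_prim[OF g(1)])
  have "Re (reduced_energy P R2 p p) \<le> Re (energy a b P R2 (solY P R1 p) (solU P R1 p) (solY P R1 p) (solU P R1 p))"
    by (rule reduced_energy_min[OF g(2) Y sol_psol(2)[OF g(1)]])
  also have "\<dots> \<le> Re (energy a b P R1 (solY P R1 p) (solU P R1 p) (solY P R1 p) (solU P R1 p)) - \<delta> * integral {a..b} (\<lambda>t. (norm (solY P R1 p t))\<^sup>2)"
    by (rule energy_mono[OF g Y le])
  finally show ?thesis by (simp add: reduced_energy_energy_sol[OF g(1)])
qed

definition h1_energy :: "(real \<Rightarrow> complex^'n) \<Rightarrow> (real \<Rightarrow> complex^'n) \<Rightarrow> real" where
  "h1_energy v v' = integral {a..b} (\<lambda>t. (norm (v' t))\<^sup>2 + (norm (v t))\<^sup>2)"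

lemma h1_energy_eq: "prim a b v v' \<Longrightarrow> h1_energy v v' = integral {a..b} (\<lambda>t. (norm (v' t))\<^sup>2) + integral {a..b} (\<lambda>t. (norm (v t))\<^sup>2)"
  unfolding h1_energy_def
  by (rule Henstock_Kurzweil_Integration.integral_add) (auto intro: bm_integrable bm_norm2 prim_bm prim_bm_deriv)

lemma h1_energy_nonneg: "prim a b v v' \<Longrightarrow> h1_energy v v' \<ge> 0"
  using h1_energy_eq[of v v'] int_norm2_nonneg[of v] int_norm2_nonneg[of v'] prim_bm[of a b v v'] prim_bm_deriv[of a b v v'] by simp

lemma energy_perturb:
  fixes P :: "real \<Rightarrow> real^'n^'n"
  assumes bm: "bm a b P" "bm a b R" "bm a b P'" "bm a b R'" and v: "prim a b v v'" and y: "prim a b y y'"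
    and K: "K \<ge> 0" "\<And>M x. norm (mv M x :: complex^'n) \<le> norm (M::real^'n^'n) * norm x * K"
    and e: "\<And>t. t \<in> {a..b} \<Longrightarrow> norm (P' t - P t) \<le> \<epsilon>" "\<And>t. t \<in> {a..b} \<Longrightarrow> norm (R' t - R t) \<le> \<epsilon>"
  shows "cmod (energy a b P' R' v v' y y' - energy a b P R v v' y y') \<le> \<epsilon> * K / 2 * (h1_energy v v' + h1_energy y y')"
proof -
  let ?f = "\<lambda>P R t. hip (v' t) (mv (P t) (y' t)) + hip (v t) (mv (R t) (y t))"
  have be: "bm a b (?f P R)" "bm a b (?f P' R')"
    by (rule bm_energy[OF bm(1,2) v y], rule bm_energy[OF bm(3,4) v y])
  have b2: "bm a b (\<lambda>t. (norm (v' t))\<^sup>2 + (norm (v t))\<^sup>2)" "bm a b (\<lambda>t. (norm (y' t))\<^sup>2 + (norm (y t))\<^sup>2)"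
    by (intro bm_add bm_norm2 prim_bm[OF v] prim_bm_deriv[OF v], intro bm_add bm_norm2 prim_bm[OF y] prim_bm_deriv[OF y])
  have bb: "bm a b (\<lambda>t. (\<epsilon> * K / 2) *\<^sub>R (((norm (v' t))\<^sup>2 + (norm (v t))\<^sup>2) + ((norm (y' t))\<^sup>2 + (norm (y t))\<^sup>2)))"
    by (rule bm_scaleR[OF bm_add[OF b2]])
  have tri: "cmod (hip x (mv M z)) \<le> \<epsilon> * K / 2 * ((norm x)\<^sup>2 + (norm z)\<^sup>2)" if "norm M \<le> \<epsilon>" for M :: "real^'n^'n" and x z :: "complex^'n"
  proof -
    have "cmod (hip x (mv M z)) \<le> norm x * norm (mv M z)" by (rule norm_hip_le)
    also have "\<dots> \<le> norm x * (norm M * norm z * K)" by (intro mult_left_mono K) auto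
    also have "\<dots> \<le> norm x * (\<epsilon> * norm z * K)" using that K by (intro mult_left_mono mult_right_mono) auto
    also have "\<dots> = \<epsilon> * K * (norm x * norm z)" by simp
    also have "\<dots> \<le> \<epsilon> * K * (((norm x)\<^sup>2 + (norm z)\<^sup>2) / 2)"
    proof (rule mult_left_mono)
      have "0 \<le> (norm x - norm z)\<^sup>2" by simp
      then show "norm x * norm z \<le> ((norm x)\<^sup>2 + (norm z)\<^sup>2) / 2" by (simp add: power2_diff)
      have "0 \<le> \<epsilon>" using that norm_ge_zero[of M] by linarith
      then show "0 \<le> \<epsilon> * K" using K by simp
    qed
    finally show ?thesis by simp
  qed
  have 1: "energy a b P' R' v v' y y' - energy a b P R v v' y y' = integral {a..b} (\<lambda>t. ?f P' R' t - ?f P R t)"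
    unfolding energy_def by (rule Henstock_Kurzweil_Integration.integral_diff[OF bm_integrable[OF be(2)] bm_integrable[OF be(1)], symmetric])
  have 2: "cmod (integral {a..b} (\<lambda>t. ?f P' R' t - ?f P R t)) \<le> integral {a..b} (\<lambda>t. (\<epsilon> * K / 2) *\<^sub>R (((norm (v' t))\<^sup>2 + (norm (v t))\<^sup>2) + ((norm (y' t))\<^sup>2 + (norm (y t))\<^sup>2)))"
  proof (rule integral_norm_bound_integral[OF bm_integrable[OF bm_diff[OF be(2,1)]] bm_integrable[OF bb]])
    fix t assume t: "t \<in> {a..b}"
    have "?f P' R' t - ?f P R t = hip (v' t) (mv (P' t - P t) (y' t)) + hip (v t) (mv (R' t - R t) (y t))"
      by (simp add: mv_simps hip_simps)
    also have "cmod \<dots> \<le> \<epsilon> * K / 2 * ((norm (v' t))\<^sup>2 + (norm (y' t))\<^sup>2) + \<epsilon> * K / 2 * ((norm (v t))\<^sup>2 + (norm (y t))\<^sup>2)"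
      by (intro norm_triangle_mono tri e t)
    finally show "cmod (?f P' R' t - ?f P R t) \<le> (\<epsilon> * K / 2) *\<^sub>R (((norm (v' t))\<^sup>2 + (norm (v t))\<^sup>2) + ((norm (y' t))\<^sup>2 + (norm (y t))\<^sup>2))"
      by (simp add: algebra_simps)
  qed
  have 3: "integral {a..b} (\<lambda>t. (\<epsilon> * K / 2) *\<^sub>R (((norm (v' t))\<^sup>2 + (norm (v t))\<^sup>2) + ((norm (y' t))\<^sup>2 + (norm (y t))\<^sup>2)))
      = \<epsilon> * K / 2 * (h1_energy v v' + h1_energy y y')"
  proof -
    have "integral {a..b} (\<lambda>t. ((norm (v' t))\<^sup>2 + (norm (v t))\<^sup>2) + ((norm (y' t))\<^sup>2 + (norm (y t))\<^sup>2)) = h1_energy v v' + h1_energy y y'"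
      unfolding h1_energy_def by (rule Henstock_Kurzweil_Integration.integral_add[OF bm_integrable[OF b2(1)] bm_integrable[OF b2(2)]])
    then show ?thesis by (simp only: real_scaleR_def Henstock_Kurzweil_Integration.integral_mult_right)
  qed
  show ?thesis using 2 unfolding 1 3 .
qed

text \<open>Only the unperturbed solution enters the bound. The difference \<open>w\<close> of the
  two solutions vanishes at the nodes and is controlled by its perturbed energy \<open>X\<close>;
  \<open>small\<close> lets the part of the error that contains \<open>w\<close> be absorbed into
  \<open>X\<close>.\<close>

lemma reduced_energy_perturb:
  fixes P :: "real \<Rightarrow> real^'n^'n"
  assumes g: "good a b m \<kappa> P R" "good a b m \<kappa> P' R'"
    and K: "K \<ge> 0" "\<And>M x. norm (mv M x :: complex^'n) \<le> norm (M::real^'n^'n) * norm x * K"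
    and e: "\<And>t. t \<in> {a..b} \<Longrightarrow> norm (P' t - P t) \<le> \<epsilon>" "\<And>t. t \<in> {a..b} \<Longrightarrow> norm (R' t - R t) \<le> \<epsilon>"
    and small: "\<epsilon> * K * (1 + 4 * h\<^sup>2) \<le> m / 2"
  shows "\<bar>Re (reduced_energy P' R' p p) - Re (reduced_energy P R p p)\<bar> \<le> 3 * \<epsilon> * K * h1_energy (solY P R p) (solU P R p)"
proof -
  let ?Y = "solY P R p" and ?U = "solU P R p" and ?Y' = "solY P' R' p" and ?U' = "solU P' R' p"
  let ?w = "\<lambda>t. ?Y t - ?Y' t" and ?w' = "\<lambda>t. ?U t - ?U' t"
  have Y: "prim a b ?Y ?U" and Y': "prim a b ?Y' ?U'" using sol_prim g by auto
  have w: "prim a b ?w ?w'" by (rule prim_diff_fun[OF Y Y'])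
  have wp: "?w (tau k) = 0" if "k \<le> N" for k using sol_psol(2)[OF g(1) that] sol_psol(2)[OF g(2) that] by simp
  have bm: "bm a b P" "bm a b R" "bm a b P'" "bm a b R'" using goodD(1,2)[OF g(1)] goodD(1,2)[OF g(2)] by auto
  have eps0: "\<epsilon> \<ge> 0" using order_trans[OF norm_ge_zero e(1)[of a]] ab by simp
  define E where "E = h1_energy ?Y ?U"
  define E0 where "E0 = h1_energy ?w ?w'"
  define U0 where "U0 = integral {a..b} (\<lambda>t. (norm (?w' t))\<^sup>2)"
  define X where "X = Re (energy a b P' R' ?w ?w' ?w ?w')"
  have E: "E \<ge> 0" "E0 \<ge> 0" unfolding E_def E0_def by (auto intro: h1_energy_nonneg Y w)
  have U0: "U0 \<ge> 0" unfolding U0_def by (rule int_norm2_nonneg[OF prim_bm_deriv[OF w]])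
  have co: "m / 2 * U0 \<le> X" unfolding U0_def X_def by (rule coercive[OF g(2) w wp])
  have E0: "E0 \<le> (1 + 4 * h\<^sup>2) * U0"
    using poincare_mesh[OF w wp] unfolding E0_def h1_energy_eq[OF w] U0_def by (simp add: algebra_simps)
  have z1: "energy a b P' R' ?w ?w' ?Y' ?U' = 0"
    by (rule energy_split(1)[OF g(2) Y sol_psol(2)[OF g(1)]])
  have z2: "energy a b P R ?w ?w' ?Y ?U = 0"
    using reduced_energy_energy[OF g(1) w, of "\<lambda>_. 0" p] wp reduced_energy_zero_left[of "\<lambda>_. 0" P R p] by simp
  \<comment> \<open>Both solutions are orthogonal to \<open>w\<close>, each in its own energy, so
    the energy of \<open>w\<close> is a pure difference of the two forms and hence small with
    \<open>\<epsilon>\<close>.\<close>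
  have "energy a b P' R' ?w ?w' ?w ?w' = energy a b P' R' ?w ?w' ?Y ?U - energy a b P R ?w ?w' ?Y ?U"
    using energy_diff_right[OF bm(3,4) w Y Y'] z1 z2 by simp
  then have "X \<le> \<epsilon> * K / 2 * (E0 + E)"
    using energy_perturb[OF bm w Y K e] complex_Re_le_cmod[of "energy a b P' R' ?w ?w' ?w ?w'"]
    unfolding X_def E_def E0_def by simp
  have "\<epsilon> * K * E0 \<le> \<epsilon> * K * ((1 + 4 * h\<^sup>2) * U0)" using eps0 K E0 by (intro mult_left_mono) auto
  also have "\<dots> = (\<epsilon> * K * (1 + 4 * h\<^sup>2)) * U0" by simp
  also have "\<dots> \<le> m / 2 * U0" using small U0 by (rule mult_right_mono)
  also have "\<dots> \<le> X" by (rule co)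
  finally have "\<epsilon> * K * E0 \<le> X" .
  then have XE: "X \<le> \<epsilon> * K * E" using \<open>X \<le> \<epsilon> * K / 2 * (E0 + E)\<close> by (simp add: algebra_simps)
  have "0 \<le> m / 2 * U0" using m U0 by simp
  then have X0: "X \<ge> 0" using co by linarith
  have "Re (energy a b P' R' ?Y ?U ?Y ?U) = Re (reduced_energy P' R' p p) + X"
    unfolding X_def by (rule energy_split(2)[OF g(2) Y sol_psol(2)[OF g(1)]])
  moreover have "cmod (energy a b P' R' ?Y ?U ?Y ?U - energy a b P R ?Y ?U ?Y ?U) \<le> \<epsilon> * K * E"
    using energy_perturb[OF bm Y Y K e] unfolding E_def by simp
  then have "\<bar>Re (energy a b P' R' ?Y ?U ?Y ?U) - Re (reduced_energy P R p p)\<bar> \<le> \<epsilon> * K * E"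
    unfolding reduced_energy_energy_sol[OF g(1)] using abs_Re_le_cmod[of "energy a b P' R' ?Y ?U ?Y ?U - energy a b P R ?Y ?U ?Y ?U"] by simp
  ultimately have "\<bar>Re (reduced_energy P' R' p p) - Re (reduced_energy P R p p)\<bar> \<le> 2 * (\<epsilon> * K * E)" using XE X0 by linarith
  also have "\<dots> \<le> 3 * \<epsilon> * K * E" using eps0 K E by (simp add: mult_right_mono)
  finally show ?thesis unfolding E_def .
qed

lemma reduced_energy_tendsto:
  fixes P :: "real \<Rightarrow> real^'n^'n"
  assumes g: "good a b m \<kappa> P R" and gs: "\<forall>\<^sub>F s in F. good a b m \<kappa> (Ps s) (Rs s)"
    and lim: "\<And>\<epsilon>. \<epsilon> > 0 \<Longrightarrow> \<forall>\<^sub>F s in F. \<forall>t\<in>{a..b}. norm (Ps s t - P t) \<le> \<epsilon> \<and> norm (Rs s t - R t) \<le> \<epsilon>"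
  shows "((\<lambda>s. Re (reduced_energy (Ps s) (Rs s) p p)) \<longlongrightarrow> Re (reduced_energy P R p p)) F"
proof (rule tendstoI)
  fix e :: real assume e: "e > 0"
  obtain K where K: "K \<ge> 0" "\<And>M x. norm (mv M x :: complex^'n) \<le> norm (M::real^'n^'n) * norm x * K"
    using bounded_bilinear.nonneg_bounded[OF bounded_bilinear_mv] by blast
  define E where "E = h1_energy (solY P R p) (solU P R p)"
  have E: "E \<ge> 0" unfolding E_def by (rule h1_energy_nonneg[OF sol_prim[OF g]])
  have "((\<lambda>\<epsilon>. \<epsilon> * K * (1 + 4 * h\<^sup>2)) \<longlongrightarrow> 0 * K * (1 + 4 * h\<^sup>2)) (at_right 0)" by (intro tendsto_intros)
  then have 1: "\<forall>\<^sub>F \<epsilon> in at_right 0. \<epsilon> * K * (1 + 4 * h\<^sup>2) < m / 2" by (rule order_tendstoD(2)) (use m in simp)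
  have "((\<lambda>\<epsilon>. 3 * \<epsilon> * K * E) \<longlongrightarrow> 3 * 0 * K * E) (at_right 0)" by (intro tendsto_intros)
  then have 2: "\<forall>\<^sub>F \<epsilon> in at_right 0. 3 * \<epsilon> * K * E < e" by (rule order_tendstoD(2)) (use e in simp)
  from eventually_happens'[OF _ eventually_conj[OF eventually_conj[OF 1 2] eventually_at_right_less[of 0]]]
  obtain \<epsilon> where \<epsilon>: "\<epsilon> > 0" "\<epsilon> * K * (1 + 4 * h\<^sup>2) < m / 2" "3 * \<epsilon> * K * E < e" by auto
  show "\<forall>\<^sub>F s in F. dist (Re (reduced_energy (Ps s) (Rs s) p p)) (Re (reduced_energy P R p p)) < e"
    using gs lim[OF \<epsilon>(1)]
  proof eventually_elim
    case (elim s)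
    have "\<bar>Re (reduced_energy (Ps s) (Rs s) p p) - Re (reduced_energy P R p p)\<bar> \<le> 3 * \<epsilon> * K * E"
      unfolding E_def by (rule reduced_energy_perturb[OF g elim(1) K]) (use elim(2) \<epsilon> in auto)
    then show ?case using \<epsilon>(3) by (simp add: dist_real_def)
  qed
qed

end

section \<open>Hermitian matrices\<close>

lemma hip_hermitian:
  assumes "hermitian M"
  shows "hip u (M *v v) = hip (M *v u) v"
proof -
  have M: "cnj (M $ j $ i) = M $ i $ j" for i j
    using assms unfolding hermitian_def adj_def by (metis vec_lambda_beta)
  have "hip u (M *v v) = (\<Sum>i\<in>UNIV. \<Sum>j\<in>UNIV. cnj (u $ i) * (M $ i $ j * v $ j))"
    by (simp add: hip_def matrix_vector_mult_def sum_distrib_left)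
  also have "\<dots> = (\<Sum>j\<in>UNIV. \<Sum>i\<in>UNIV. cnj (u $ i) * (M $ i $ j * v $ j))" by (rule sum.swap)
  also have "\<dots> = (\<Sum>j\<in>UNIV. \<Sum>i\<in>UNIV. cnj (u $ i) * (cnj (M $ j $ i) * v $ j))" by (simp only: M)
  also have "\<dots> = hip (M *v u) v"
    by (simp add: hip_def matrix_vector_mult_def sum_distrib_left sum_distrib_right mult_ac)
  finally show ?thesis .
qed

lemma continuous_on_hip [continuous_intros]:
  "continuous_on S f \<Longrightarrow> continuous_on S g \<Longrightarrow> continuous_on S (\<lambda>x. hip (f x) (g x))"
  by (rule bounded_bilinear.continuous_on[OF bounded_bilinear_hip])

lemma linear_cmv: "linear (\<lambda>x. (M::complex^'n^'m) *v x)"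
  by (rule linearI) (simp_all add: vec_eq_iff matrix_vector_mult_def algebra_simps sum.distrib scaleR_sum_right)

text \<open>The Rayleigh quotient is maximised over unit vectors orthogonal to the earlier
  eigenvectors; such vectors exist because there are fewer equations than unknowns.\<close>

lemma hermitian_eigenvector_extend:
  fixes M :: "complex^'n^'n"
  assumes M: "hermitian M" and k: "k < CARD('n)" and e: "\<And>i. i < k \<Longrightarrow> M *v e i = complex_of_real (d i) *s e i"
  shows "\<exists>x r. hip x x = 1 \<and> (\<forall>i<k. hip (e i) x = 0) \<and> M *v x = complex_of_real r *s x"
proof -
  define S where "S = {x::complex^'n. \<forall>i<k. hip (e i) x = 0} \<inter> sphere 0 1"
  have cm: "continuous_on T (\<lambda>x. M *v x)" for T
    using linear_continuous_on[of "\<lambda>x. M *v x"] linear_cmv linear_conv_bounded_linear by blast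
  have "closed {x::complex^'n. \<forall>i<k. hip (e i) x = 0}"
    by (intro closed_Collect_all closed_Collect_imp closed_Collect_eq continuous_intros open_Collect_const)
  then have cS: "compact S" unfolding S_def by (rule closed_Int_compact) simp
  have "card {..<k} < card (UNIV::'n set)" using k by simp
  from homogeneous_system_nontrivial[OF _ _ this, of "\<lambda>j i. cnj (e i $ j)"] obtain c
    where c: "\<exists>j. c j \<noteq> 0" "\<And>i. i < k \<Longrightarrow> (\<Sum>j\<in>UNIV. c j * cnj (e i $ j)) = 0" by auto
  define v where "v = (\<chi> j. c j)"
  have v0: "v \<noteq> 0" using c(1) by (auto simp: v_def vec_eq_iff)
  have "(1 / norm v) *\<^sub>R v \<in> S"
    using c(2) v0 by (auto simp: S_def hip_scaleR_right) (simp add: hip_def v_def mult.commute)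
  then have ne: "S \<noteq> {}" by blast
  obtain x where x: "x \<in> S" "\<And>y. y \<in> S \<Longrightarrow> Re (hip y (M *v y)) \<le> Re (hip x (M *v x))"
  proof -
    have "continuous_on S (\<lambda>x. Re (hip x (M *v x)))" by (intro continuous_intros cm)
    from continuous_attains_sup[OF cS ne this] show ?thesis using that by blast
  qed
  define r where "r = Re (hip x (M *v x))"
  have xo: "hip (e i) x = 0" if "i < k" for i using x(1) that by (auto simp: S_def)
  have nx: "norm x = 1" using x(1) by (simp add: S_def)
  have Q: "Re (hip y (M *v y)) \<le> r * (norm y)\<^sup>2" if y: "\<And>i. i < k \<Longrightarrow> hip (e i) y = 0" for y
  proof (cases "y = 0")
    case False
    have "(1 / norm y) *\<^sub>R y \<in> S" using y False by (auto simp: S_def hip_scaleR_right)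
    from x(2)[OF this] show ?thesis
      using False by (simp add: linear_scale[OF linear_cmv] hip_scaleR_left hip_scaleR_right r_def field_simps power2_eq_square)
  qed (simp add: hip_simps)
  \<comment> \<open>The residual of the eigenvalue equation. It is again orthogonal to the earlier
    eigenvectors, hence an admissible direction of variation at the maximizer.\<close>
  define w where "w = r *\<^sub>R x - M *v x"
  have wo: "hip (e i) w = 0" if "i < k" for i
    using xo[OF that] by (simp add: w_def hip_simps hip_scaleR_right hip_hermitian[OF M] e[OF that])
  define W where "W = (norm w)\<^sup>2"
  define B where "B = r * W - Re (hip w (M *v w))"
  have B: "B \<ge> 0" using Q[OF wo] by (simp add: B_def W_def)
  have tt: "0 \<le> 2 * t * W + t\<^sup>2 * B" for t
  proof -
    let ?y = "x + t *\<^sub>R w"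
    have f1: "Re (hip ?y (M *v ?y)) \<le> r * (norm ?y)\<^sup>2"
      by (rule Q) (simp add: xo wo hip_simps hip_scaleR_right)
    have f2: "Re (hip ?y (M *v ?y)) = r + 2 * t * Re (hip w (M *v x)) + t\<^sup>2 * Re (hip w (M *v w))"
    proof -
      have "Re (hip x (M *v w)) = Re (hip w (M *v x))"
        using hip_hermitian[OF M, of x w] cnj_hip[of w "M *v x"] by (metis cnj.simps(1))
      then show ?thesis
        by (simp add: linear_add[OF linear_cmv] linear_scale[OF linear_cmv] hip_simps hip_scaleR_left hip_scaleR_right r_def power2_eq_square algebra_simps)
    qed
    have f3: "(norm ?y)\<^sup>2 = 1 + 2 * t * (w \<bullet> x) + t\<^sup>2 * W"
      unfolding W_def power2_norm_eq_inner using nx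
      by (simp add: inner_add_left inner_add_right inner_commute power2_eq_square norm_eq_1[symmetric] algebra_simps)
    have f4: "W = r * (w \<bullet> x) - Re (hip w (M *v x))"
    proof -
      have "W = Re (hip w w)" by (simp add: W_def Re_hip_self)
      also have "\<dots> = r * Re (hip w x) - Re (hip w (M *v x))"
        by (subst (2) w_def) (simp add: hip_simps hip_scaleR_right)
      finally show ?thesis by (simp add: Re_hip)
    qed
    have "r * (1 + 2 * t * (w \<bullet> x) + t\<^sup>2 * W) - (r + 2 * t * Re (hip w (M *v x)) + t\<^sup>2 * Re (hip w (M *v w)))
        = 2 * t * (r * (w \<bullet> x) - Re (hip w (M *v x))) + t\<^sup>2 * B" by (simp add: B_def algebra_simps)
    then show ?thesis using f1 unfolding f2 f3 f4[symmetric] by linarith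
  qed
  have "W = 0"
  proof (rule ccontr)
    assume "W \<noteq> 0"
    then have W: "W > 0" by (simp add: W_def)
    \<comment> \<open>A negative step \<open>t = - c\<close>, short enough that the linear term
      outweighs the quadratic one; the 1 keeps the denominator positive.\<close>
    define c where "c = W / (B + 1)"
    have c: "c > 0" "c * B = W - c" using W B by (simp_all add: c_def field_simps)
    have "0 \<le> 2 * (- c) * W + (- c)\<^sup>2 * B" by (rule tt)
    also have "\<dots> = - 2 * c * W + c * (c * B)" by (simp add: power2_eq_square)
    also have "\<dots> = - (c * W) - c * c" unfolding c(2) by (simp add: algebra_simps)
    also have "\<dots> < 0" using mult_pos_pos[OF c(1) W] mult_pos_pos[OF c(1) c(1)] by linarith
    finally show False by simp
  qed
  have "M *v x = complex_of_real r *s x"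
  proof -
    have "M *v x = r *\<^sub>R x" using \<open>W = 0\<close> by (simp add: W_def w_def)
    also have "\<dots> = complex_of_real r *s x"
      by (simp only: vec_eq_iff vector_scaleR_component vector_smult_component) (simp add: scaleR_conv_of_real)
    finally show ?thesis .
  qed
  moreover have "hip x x = 1" using nx by (simp add: hip_self)
  ultimately show ?thesis using xo by blast
qed

lemma hermitian_spectral:
  fixes M :: "complex^'n^'n"
  assumes M: "hermitian M"
  shows "\<exists>(e::'n \<Rightarrow> complex^'n) (d::'n \<Rightarrow> real). \<forall>i. M *v e i = complex_of_real (d i) *s e i \<and> (\<forall>j. hip (e i) (e j) = (if i = j then 1 else 0))"
proof -
  have "\<exists>e d. \<forall>i<k. M *v e i = complex_of_real (d i) *s e i \<and> (\<forall>j<k. hip (e i) (e j) = (if i = j then 1 else 0))"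
    if "k \<le> CARD('n)" for k using that
  proof (induction k)
    case (Suc k)
    then obtain e d where ed: "\<And>i. i < k \<Longrightarrow> M *v e i = complex_of_real (d i) *s e i"
      "\<And>i j. i < k \<Longrightarrow> j < k \<Longrightarrow> hip (e i) (e j) = (if i = j then 1 else 0)" by auto
    have "k < CARD('n)" using Suc.prems by simp
    from hermitian_eigenvector_extend[where e=e and d=d, OF M this ed(1)] obtain x r where
      x: "hip x x = 1" "\<And>i. i < k \<Longrightarrow> hip (e i) x = 0" "M *v x = complex_of_real r *s x" by auto
    have x': "hip x (e i) = 0" if "i < k" for i using x(2)[OF that] cnj_hip[of "e i" x] by simp
    show ?case
      by (rule exI[of _ "e(k := x)"], rule exI[of _ "d(k := r)"]) (auto simp: ed x x' less_Suc_eq)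
  qed simp
  from this[OF le_refl] obtain e d where ed: "\<And>i. i < CARD('n) \<Longrightarrow> M *v e i = complex_of_real (d i) *s e i"
      "\<And>i j. i < CARD('n) \<Longrightarrow> j < CARD('n) \<Longrightarrow> hip (e i) (e j) = (if i = j then 1 else 0)" by blast
  obtain g :: "'n \<Rightarrow> nat" where g: "bij_betw g UNIV {0..<CARD('n)}"
    using ex_bij_betw_finite_nat[of "UNIV :: 'n set"] by auto
  then have g': "g i < CARD('n)" "g i = g j \<longleftrightarrow> i = j" for i j
    by (auto simp: bij_betw_def inj_on_def)
  show ?thesis
    by (rule exI[of _ "\<lambda>i. e (g i)"], rule exI[of _ "\<lambda>i. d (g i)"]) (simp add: ed g')
qed

text \<open>Over the polynomial ring the constant eigenvector matrix \<open>U\<close> intertwines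
  the characteristic matrix \<open>X\<close> with the diagonal matrix \<open>D\<close>;
  \<open>det U\<close> is nonzero and cancels.\<close>

lemma det_charpoly_eigenbasis:
  fixes M :: "complex^'n^'n" and e :: "'n \<Rightarrow> complex^'n"
  assumes ev: "\<And>i. M *v e i = d i *s e i" and orth: "\<And>i j. hip (e i) (e j) = (if i = j then 1 else 0)"
  shows "det (\<chi> i j. [: - (M $ i $ j), (if i = j then 1 else 0) :]) = (\<Prod>i\<in>UNIV. [: - d i, 1 :])"
proof -
  define X :: "complex poly^'n^'n" where "X = (\<chi> i j. [: - (M $ i $ j), (if i = j then 1 else 0) :])"
  define U :: "complex poly^'n^'n" where "U = (\<chi> i j. [: e j $ i :])"
  define V :: "complex poly^'n^'n" where "V = (\<chi> i j. [: cnj (e i $ j) :])"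
  define D :: "complex poly^'n^'n" where "D = (\<chi> i j. if i = j then [: - d i, 1 :] else 0)"
  have "V ** U = mat 1"
  proof (simp add: vec_eq_iff, intro allI)
    fix i j
    have "(V ** U) $ i $ j = [: hip (e i) (e j) :]"
      by (rule poly_eqI) (simp add: V_def U_def matrix_matrix_mult_def hip_def coeff_sum coeff_pCons mult.commute split: nat.split)
    then show "(V ** U) $ i $ j = mat 1 $ i $ j" by (simp add: orth mat_def)
  qed
  then have "det V * det U = 1" by (metis det_I det_mul)
  then have U0: "det U \<noteq> 0" by auto
  have "X ** U = U ** D"
  proof (simp add: vec_eq_iff, intro allI)
    fix i j
    have "(M *v e j) $ i = d j * e j $ i" by (simp add: ev)
    then have Me: "(\<Sum>k\<in>UNIV. M $ i $ k * e j $ k) = d j * e j $ i" by (simp add: matrix_vector_mult_def)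
    have "(X ** U) $ i $ j = (\<Sum>k\<in>UNIV. [: - (M $ i $ k * e j $ k), (if i = k then e j $ k else 0) :])"
      by (auto simp: X_def U_def matrix_matrix_mult_def mult.commute intro!: sum.cong)
    also have "\<dots> = [: - (d j * e j $ i), e j $ i :]"
    proof (rule poly_eqI)
      fix n
      show "coeff (\<Sum>k\<in>UNIV. [: - (M $ i $ k * e j $ k), (if i = k then e j $ k else 0) :]) n = coeff [: - (d j * e j $ i), e j $ i :] n"
        by (cases n; cases "n - 1") (simp_all add: coeff_sum sum_negf Me coeff_pCons split: nat.split)
    qed
    also have "\<dots> = (U ** D) $ i $ j"
      by (simp add: U_def D_def matrix_matrix_mult_def if_distrib[of "(*) _"] cong: if_cong)
    finally show "(X ** U) $ i $ j = (U ** D) $ i $ j" .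
  qed
  then have "det X * det U = det U * det D" by (metis det_mul)
  then have "det X = det D" using U0 by simp
  also have "\<dots> = (\<Prod>i\<in>UNIV. D $ i $ i)" by (rule det_diagonal) (simp add: D_def)
  finally show ?thesis by (simp add: X_def D_def)
qed

definition padm :: "'n set \<Rightarrow> complex^'n^'n \<Rightarrow> complex^'n^'n" where
  "padm K M = (\<chi> i j. if i \<in> K \<and> j \<in> K then M $ i $ j else 0)"

text \<open>Padding with zeros replaces the submatrix by one of full size. A permutation that moves
  a point outside \<open>K\<close> meets a zero entry there, and each fixed point outside
  \<open>K\<close> contributes a factor \<open>[:0, 1:]\<close>.\<close>

lemma charpoly_sub_pad:
  "det (\<chi> i j. [: - (padm K M $ i $ j), (if i = j then 1 else 0) :]) = charpoly_sub K M * [:0, 1:] ^ card (- K)"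
proof -
  let ?F = "\<lambda>p. of_int (sign p) * (\<Prod>i\<in>UNIV. [: - (padm K M $ i $ p i), (if i = p i then 1 else 0) :])"
  have "det (\<chi> i j. [: - (padm K M $ i $ j), (if i = j then 1 else 0) :]) = (\<Sum>p\<in>{p. p permutes UNIV}. ?F p)"
    by (simp add: det_def)
  also have "\<dots> = (\<Sum>p\<in>{p. p permutes K}. ?F p)"
  proof (rule sum.mono_neutral_right)
    show "{p. p permutes K} \<subseteq> {p. p permutes UNIV}" using permutes_subset by blast
    show "\<forall>p\<in>{p. p permutes UNIV} - {p. p permutes K}. ?F p = 0"
    proof
      fix p assume p: "p \<in> {p. p permutes UNIV} - {p. p permutes K}"
      then obtain i where i: "i \<notin> K" "p i \<noteq> i" unfolding permutes_def by auto
      then have "[: - (padm K M $ i $ p i), (if i = p i then 1 else 0) :] = 0" by (auto simp: padm_def)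
      then have "(\<Prod>i\<in>UNIV. [: - (padm K M $ i $ p i), (if i = p i then 1 else 0) :]) = 0"
        by (intro prod_zero bexI[of _ i]) auto
      then show "?F p = 0" by simp
    qed
  qed (simp add: finite_permutations)
  also have "\<dots> = (\<Sum>p\<in>{p. p permutes K}. of_int (sign p) *
       (\<Prod>i\<in>K. [: - (M $ i $ p i), (if p i = i then 1 else 0) :]) * [:0, 1:] ^ card (- K))"
  proof (rule sum.cong, simp)
    fix p assume "p \<in> {p. p permutes K}"
    then have p: "p permutes K" by simp
    have "(\<Prod>i\<in>UNIV. [: - (padm K M $ i $ p i), (if i = p i then 1 else 0) :]) =
       (\<Prod>i\<in>K. [: - (padm K M $ i $ p i), (if i = p i then 1 else 0) :]) * (\<Prod>i\<in>-K. [: - (padm K M $ i $ p i), (if i = p i then 1 else 0) :])"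
      by (subst prod.union_disjoint[symmetric]) (auto simp: Compl_partition)
    also have "(\<Prod>i\<in>K. [: - (padm K M $ i $ p i), (if i = p i then 1 else 0) :]) = (\<Prod>i\<in>K. [: - (M $ i $ p i), (if p i = i then 1 else 0) :])"
      using permutes_in_image[OF p] by (intro prod.cong) (auto simp: padm_def)
    also have "(\<Prod>i\<in>-K. [: - (padm K M $ i $ p i), (if i = p i then 1 else 0) :]) = (\<Prod>i\<in>-K. [:0, 1:])"
      using permutes_not_in[OF p] by (intro prod.cong) (auto simp: padm_def)
    finally show "?F p = of_int (sign p) *
       (\<Prod>i\<in>K. [: - (M $ i $ p i), (if p i = i then 1 else 0) :]) * [:0, 1:] ^ card (- K)" by (simp add: mult.assoc)
  qed
  also have "\<dots> = charpoly_sub K M * [:0, 1:] ^ card (- K)"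
    unfolding charpoly_sub_def by (simp add: sum_distrib_right)
  finally show ?thesis .
qed

lemma order_prod_linear:
  assumes "finite T"
  shows "order r (\<Prod>i\<in>T. [: - d i, 1 :]) = card {i\<in>T. d i = (r::complex)}"
  using assms
proof (induction T rule: finite_induct)
  case (insert i T)
  have nz: "[: - d i, 1 :] * (\<Prod>i\<in>T. [: - d i, 1 :]) \<noteq> 0"
    using insert unfolding mult_eq_0_iff by (auto simp: prod_zero_iff)
  have "order r [: - d i, 1 :] = (if d i = r then 1 else 0)"
    using order_power_n_n[of r 1] order_0I[of "[: - d i, 1 :]" r] by auto
  moreover have "{j \<in> insert i T. d j = r} = (if d i = r then insert i {j\<in>T. d j = r} else {j\<in>T. d j = r})" by auto
  ultimately show ?case using insert order_mult[OF nz, of r] by (simp add: card_insert_if)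
qed simp

definition subform :: "'n set \<Rightarrow> complex^'n^'n \<Rightarrow> ('n \<Rightarrow> complex) \<Rightarrow> ('n \<Rightarrow> complex) \<Rightarrow> complex" where
  "subform K M x y = hip (\<chi> i. if i \<in> K then x i else 0) (M *v (\<chi> i. if i \<in> K then y i else 0))"

lemma hform_subform:
  assumes M: "hermitian M"
  shows "hform K (subform K M)"
proof (rule hformI)
  fix x y z :: "'a \<Rightarrow> complex" and c
  have "(\<chi> i. if i \<in> K then y i + c * z i else 0) = (\<chi> i. if i \<in> K then y i else 0) + c *s (\<chi> i. if i \<in> K then z i else 0)"
    by (simp add: vec_eq_iff)
  then show "subform K M x (\<lambda>i. y i + c * z i) = subform K M x y + c * subform K M x z"
    unfolding subform_def by (simp add: matrix_vector_right_distrib vector_scalar_commute hip_simps)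
next
  fix x y
  show "subform K M y x = cnj (subform K M x y)"
    unfolding subform_def by (simp add: cnj_hip hip_hermitian[OF M])
next
  fix x y :: "'a \<Rightarrow> complex" assume "\<And>i. i \<in> K \<Longrightarrow> y i = 0"
  then have "(\<chi> i. if i \<in> K then y i else 0) = 0" by (simp add: vec_eq_iff)
  then show "subform K M x y = 0" unfolding subform_def by (simp add: hip_simps)
qed

lemma hform_superset: "hform K B \<Longrightarrow> K \<subseteq> L \<Longrightarrow> hform L B"
  unfolding hform_def by (meson subsetD)

lemma subform_pad: "subform K M x y = hip (\<chi> i. x i) (padm K M *v (\<chi> i. y i))"
  unfolding subform_def hip_def matrix_vector_mult_def padm_def
  by (auto intro!: sum.cong simp: if_distrib if_distribR cong: if_cong)

text \<open>The link between roots of \<open>charpoly_sub\<close> and inertia. Padding adds only the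
  eigenvalue 0, so the positive roots and their orders are those of the full matrix, whose
  eigenbasis diagonalises the form.\<close>

lemma pidx_subform:
  fixes M :: "complex^('d::finite+'d)^('d+'d)"
  assumes M: "hermitian M"
  shows "pidx (subform K M) = n_pos K M"
proof -
  have "hermitian (padm K M)"
    using M unfolding hermitian_def adj_def padm_def by (auto simp: vec_eq_iff)
  from hermitian_spectral[OF this] obtain e :: "('d+'d) \<Rightarrow> complex^('d+'d)" and d where ed: "\<forall>i. padm K M *v e i = complex_of_real (d i) *s e i \<and> (\<forall>j. hip (e i) (e j) = (if i = j then 1 else 0))"
    by blast
  have ev: "\<And>i. padm K M *v e i = complex_of_real (d i) *s e i" and orth: "\<And>i j. hip (e i) (e j) = (if i = j then 1 else 0)"
    using ed by auto
  have cp: "charpoly_sub K M * [:0, 1:] ^ card (- K) = (\<Prod>i\<in>UNIV. [: - complex_of_real (d i), 1 :])"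
    unfolding charpoly_sub_pad[symmetric] by (rule det_charpoly_eigenbasis[OF ev orth])
  have nz: "charpoly_sub K M * [:0, 1:] ^ card (- K) \<noteq> 0" unfolding cp by auto
  have ord: "order r (charpoly_sub K M) = card {i. complex_of_real (d i) = r}" if "r \<noteq> 0" for r
  proof -
    have "order r ([:0, 1:] ^ card (- K)) = 0" using that by (intro order_0I) auto
    then show ?thesis using order_mult[OF nz, of r] order_prod_linear[of UNIV r "\<lambda>i. complex_of_real (d i)"] unfolding cp by simp
  qed
  define T where "T = {i. d i > 0}"
  have roots: "{r. poly (charpoly_sub K M) r = 0 \<and> r \<in> \<real> \<and> Re r > 0} = (\<lambda>i. complex_of_real (d i)) ` T"
  proof (intro set_eqI iffI)
    fix r assume r: "r \<in> {r. poly (charpoly_sub K M) r = 0 \<and> r \<in> \<real> \<and> Re r > 0}"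
    then have "r \<noteq> 0" by auto
    moreover have "order r (charpoly_sub K M) \<noteq> 0" using r nz order_root by auto
    ultimately have "{i. complex_of_real (d i) = r} \<noteq> {}" using ord by auto
    then show "r \<in> (\<lambda>i. complex_of_real (d i)) ` T" using r by (auto simp: T_def)
  next
    fix r assume "r \<in> (\<lambda>i. complex_of_real (d i)) ` T"
    then obtain i where i: "r = complex_of_real (d i)" "d i > 0" by (auto simp: T_def)
    then have "order r (charpoly_sub K M) \<noteq> 0" using ord[of r] by (auto simp: card_eq_0_iff)
    then show "r \<in> {r. poly (charpoly_sub K M) r = 0 \<and> r \<in> \<real> \<and> Re r > 0}" using i order_root by auto
  qed
  have "n_pos K M = (\<Sum>r\<in>(\<lambda>i. complex_of_real (d i)) ` T. card {i\<in>T. complex_of_real (d i) = r})"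
    unfolding n_pos_def roots
  proof (rule sum.cong, simp)
    fix r assume "r \<in> (\<lambda>i. complex_of_real (d i)) ` T"
    then obtain i where i: "r = complex_of_real (d i)" "d i > 0" by (auto simp: T_def)
    then have "order r (charpoly_sub K M) = card {i. complex_of_real (d i) = r}" by (intro ord) auto
    also have "{i. complex_of_real (d i) = r} = {i\<in>T. complex_of_real (d i) = r}" using i by (auto simp: T_def)
    finally show "order r (charpoly_sub K M) = card {i\<in>T. complex_of_real (d i) = r}" .
  qed
  also have "\<dots> = card T"
    using sum.image_gen[of T "\<lambda>_. 1::nat" "\<lambda>i. complex_of_real (d i)"] by simp
  finally have np: "n_pos K M = card {i\<in>UNIV. d i > 0}" by (simp add: T_def)
  \<comment> \<open>\<open>nidx\<close> does not refer to a coordinate set, so the form may be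
    diagonalised over all coordinates although it sees only those in \<open>K\<close>.\<close>
  have "diag_basis UNIV (subform K M) (\<lambda>j i. e j $ i) d"
    unfolding diag_basis_def orth_fam_def
  proof (intro conjI ballI allI)
    fix j k
    show "subform K M (\<lambda>i. e j $ i) (\<lambda>i. e k $ i) = (if j = k then complex_of_real (d j) else 0)"
      unfolding subform_pad by (simp add: ev orth hip_simps)
  next
    fix x :: "('d + 'd) \<Rightarrow> complex"
    define V :: "complex^('d+'d)^('d+'d)" where "V = (\<chi> i j. cnj (e i $ j))"
    define U :: "complex^('d+'d)^('d+'d)" where "U = (\<chi> i j. e j $ i)"
    have "V ** U = mat 1"
      using orth by (simp add: vec_eq_iff V_def U_def matrix_matrix_mult_def mat_def hip_def)
    then have "U ** V = mat 1" by (simp add: matrix_left_right_inverse)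
    then have "U *v (V *v (\<chi> i. x i)) = (\<chi> i. x i)" by (simp add: matrix_vector_mul_assoc)
    then have "x i = lc (\<lambda>j. (V *v (\<chi> i. x i)) $ j) (\<lambda>j i. e j $ i) UNIV i" for i
      unfolding lc_def U_def by (simp add: vec_eq_iff matrix_vector_mult_def[of "\<chi> i j. e j $ i"] mult.commute)
    then show "\<exists>c. \<forall>i\<in>UNIV. x i = lc c (\<lambda>j i. e j $ i) UNIV i" by blast
  qed
  then show ?thesis
    unfolding np by (intro pidx_diag[OF hform_superset[OF hform_subform[OF M]]]) auto
qed

section \<open>Normal forms of boundary conditions\<close>

lemma matmul_nth: "(G ** X) $ i $ j = (\<Sum>k\<in>UNIV. G $ i $ k * X $ k $ j)"
  by (simp add: matrix_matrix_mult_def)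

text \<open>\<open>nfC\<close> gathers the columns that are unit vectors in the normal form, with
  the sign that turns them into the identity; \<open>nfD\<close> gathers the remaining ones. Both
  transform by left multiplication, so on an orbit \<open>S\<close> is the inverse of
  \<open>nfC\<close> times \<open>nfD\<close>.\<close>

definition nfC :: "('d+'d) set \<Rightarrow> ('d::finite) cm2 \<Rightarrow> ('d::finite) cm2 \<Rightarrow> ('d::finite) cm2" where
  "nfC K A B = (\<chi> i j. if j \<in> K then - (A $ i $ j) else B $ i $ j)"

definition nfD :: "('d+'d) set \<Rightarrow> ('d::finite) cm2 \<Rightarrow> ('d::finite) cm2 \<Rightarrow> ('d::finite) cm2" where
  "nfD K A B = (\<chi> i j. if j \<in> K then B $ i $ j else A $ i $ j)"

lemma nfC_mul: "nfC K (G ** A) (G ** B) = G ** nfC K A B"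
  by (simp add: nfC_def vec_eq_iff matmul_nth sum_negf)

lemma nfD_mul: "nfD K (G ** A) (G ** B) = G ** nfD K A B"
  by (simp add: nfD_def vec_eq_iff matmul_nth)

lemma nfC_nf: "nfC K (nfA K S) (nfB K S) = mat 1"
  by (simp add: nfC_def nfA_def nfB_def vec_eq_iff mat_def)

lemma nfD_nf: "nfD K (nfA K S) (nfB K S) = S"
  by (simp add: nfD_def nfA_def nfB_def vec_eq_iff)

lemma nf_reconstruct:
  assumes "nfC K A B ** S = nfD K A B"
  shows "A = nfC K A B ** nfA K S" "B = nfC K A B ** nfB K S"
proof -
  have e: "(\<Sum>k\<in>UNIV. nfC K A B $ i $ k * S $ k $ j) = nfD K A B $ i $ j" for i j
    using arg_cong[OF assms, of "\<lambda>M. M $ i $ j"] by (simp add: matmul_nth)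
  have "(nfC K A B ** nfA K S) $ i $ j = A $ i $ j" for i j
  proof (cases "j \<in> K")
    case True
    have "(nfC K A B ** nfA K S) $ i $ j = (\<Sum>k\<in>UNIV. if k = j then A $ i $ j else 0)"
      unfolding matmul_nth by (rule sum.cong) (auto simp: nfC_def nfA_def True)
    then show ?thesis by simp
  next
    case False
    then show ?thesis using e[of i j] by (simp add: matmul_nth nfA_def) (simp add: nfD_def)
  qed
  then show "A = nfC K A B ** nfA K S" by (simp add: vec_eq_iff)
  have "(nfC K A B ** nfB K S) $ i $ j = B $ i $ j" for i j
  proof (cases "j \<in> K")
    case False
    have "(nfC K A B ** nfB K S) $ i $ j = (\<Sum>k\<in>UNIV. if k = j then B $ i $ j else 0)"
      unfolding matmul_nth by (rule sum.cong) (auto simp: nfC_def nfB_def False)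
    then show ?thesis by simp
  next
    case True
    then show ?thesis using e[of i j] by (simp add: matmul_nth nfB_def) (simp add: nfD_def)
  qed
  then show "B = nfC K A B ** nfB K S" by (simp add: vec_eq_iff)
qed

lemma adj_mul: "adj (X ** Y) = adj Y ** adj X"
  by (simp add: adj_def vec_eq_iff matrix_matrix_mult_def mult.commute)

text \<open>The unit columns collapse each entry of the two products to entries of \<open>S\<close>.
  In all four cases of membership in \<open>K\<close> the equation compares \<open>S $ i $ j\<close>
  with the conjugate of \<open>S $ j $ i\<close>.\<close>

lemma nf_hermitian:
  fixes S :: "('d::finite) cm2"
  assumes "nfA K S ** adj (nfB K S) = nfB K S ** adj (nfA K S)"
  shows "hermitian S"
proof -
  have "cnj (S $ j $ i) = S $ i $ j" for i j
  proof -
    have l: "(nfA K S ** adj (nfB K S)) $ i $ j = (if i \<in> K then - cnj (S $ j $ i) else 0) + (if j \<in> K then 0 else S $ i $ j)"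
    proof -
      have "(nfA K S ** adj (nfB K S)) $ i $ j = (\<Sum>k\<in>UNIV. (if k = i then (if i \<in> K then - cnj (S $ j $ i) else 0) else 0)
         + (if k = j then (if j \<in> K then 0 else S $ i $ j) else 0))"
        unfolding matmul_nth by (rule sum.cong) (auto simp: nfA_def nfB_def adj_def)
      then show ?thesis by (simp add: sum.distrib)
    qed
    have r: "(nfB K S ** adj (nfA K S)) $ i $ j = (if j \<in> K then - (S $ i $ j) else 0) + (if i \<in> K then 0 else cnj (S $ j $ i))"
    proof -
      have "(nfB K S ** adj (nfA K S)) $ i $ j = (\<Sum>k\<in>UNIV. (if k = j then (if j \<in> K then - (S $ i $ j) else 0) else 0)
         + (if k = i then (if i \<in> K then 0 else cnj (S $ j $ i)) else 0))"
        unfolding matmul_nth by (rule sum.cong) (auto simp: nfA_def nfB_def adj_def)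
      then show ?thesis by (simp add: sum.distrib)
    qed
    show ?thesis using arg_cong[OF assms, of "\<lambda>M. M $ i $ j"] unfolding l r
      by (auto split: if_splits)
  qed
  then show ?thesis by (simp add: hermitian_def adj_def vec_eq_iff)
qed

lemma orbit_self: "X \<in> orbit X"
  unfolding orbit_def by (auto intro!: exI[of _ "mat 1"] simp: invertible_def intro: exI[of _ "mat 1"] prod_eqI)

lemma orbit_mul:
  fixes G :: "('d::finite) cm2"
  assumes "invertible G"
  shows "orbit (G ** A, G ** B) = orbit (A, B)"
proof -
  obtain G' where G': "G ** G' = mat 1" "G' ** G = mat 1" using assms unfolding invertible_def by blast
  have iG': "invertible G'" using G' unfolding invertible_def by blast
  show ?thesis unfolding orbit_def
  proof (intro set_eqI iffI; clarsimp)
    fix L :: "'d cm2" assume "invertible L"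
    then show "\<exists>H. L ** (G ** A) = H ** A \<and> L ** (G ** B) = H ** B \<and> invertible H"
      using assms by (intro exI[of _ "L ** G"]) (simp add: matrix_mul_assoc invertible_mult)
  next
    fix L :: "'d cm2" assume "invertible L"
    moreover have "L ** G' ** (G ** X) = L ** X" for X :: "'d cm2"
      using G'(2) by (metis matrix_mul_assoc matrix_mul_lid)
    ultimately show "\<exists>H. L ** A = H ** (G ** A) \<and> L ** B = H ** (G ** B) \<and> invertible H"
      using iG' by (intro exI[of _ "L ** G'"]) (simp add: invertible_mult)
  qed
qed

lemma nf_unique:
  assumes "(A, B) \<in> orbit (nfA K S, nfB K S)"
  shows "invertible (nfC K A B)" "nfC K A B ** S = nfD K A B"
proof -
  obtain G where G: "invertible G" "A = G ** nfA K S" "B = G ** nfB K S"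
    using assms unfolding orbit_def by auto
  have "nfC K A B = G" using G by (simp add: nfC_mul nfC_nf)
  moreover have "nfD K A B = G ** S" using G by (simp add: nfD_mul nfD_nf)
  ultimately show "invertible (nfC K A B)" "nfC K A B ** S = nfD K A B" using G by auto
qed

lemma orbit_nf_inject: "orbit (nfA K S, nfB K S) = orbit (nfA K S', nfB K S') \<longleftrightarrow> S = S'"
proof
  assume "orbit (nfA K S, nfB K S) = orbit (nfA K S', nfB K S')"
  then have "(nfA K S, nfB K S) \<in> orbit (nfA K S', nfB K S')" using orbit_self by blast
  from nf_unique(2)[OF this] show "S = S'" by (simp add: nfC_nf nfD_nf)
qed simp

lemma OK_S_of:
  assumes "X \<in> OK K"
  shows "hermitian (S_of K X)" "X = orbit (nfA K (S_of K X), nfB K (S_of K X))"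
proof -
  obtain S where S: "hermitian S" "X = orbit (nfA K S, nfB K S)" using assms unfolding OK_def by blast
  have "S_of K X = S" unfolding S_of_def using S orbit_nf_inject by (intro the_equality) auto
  then show "hermitian (S_of K X)" "X = orbit (nfA K (S_of K X), nfB K (S_of K X))" using S by auto
qed

section \<open>Continuity of the Hermitian matrix in the quotient topology\<close>

lemma openin_BCtop: "openin BCtop U \<longleftrightarrow> BCopen U"
  unfolding BCtop_def topology_inverse'[OF istopology_BCopen] ..

lemma open_Collect_all_finite:
  assumes "\<And>k::'k::finite. open {x. Q k x}"
  shows "open {x. \<forall>k. Q k x}"
proof -
  have "{x. \<forall>k. Q k x} = (\<Inter>k\<in>UNIV. {x. Q k x})" by auto
  then show ?thesis using assms by (simp add: open_INT)
qed

text \<open>The numerator in Cramer's rule for \<open>C\<inverse> D\<close>; it exhibits \<open>S\<close> as a continuous function of \<open>(A, B)\<close>.\<close>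
definition cramer_num :: "('d::finite) cm2 \<Rightarrow> 'd cm2 \<Rightarrow> ('d+'d) \<Rightarrow> ('d+'d) \<Rightarrow> complex" where
  "cramer_num C D k l = det (\<chi> i j. if j = k then D $ i $ l else C $ i $ j)"

lemma cramer_num_mul: "cramer_num C (C ** S) k l = S $ k $ l * det C"
proof -
  have "(\<chi> i j. if j = k then (C ** S) $ i $ l else C $ i $ j) = (\<chi> i j. if j = k then (C *v column l S) $ i else C $ i $ j)"
    by (simp add: vec_eq_iff matmul_nth matrix_vector_mult_def column_def)
  then show ?thesis unfolding cramer_num_def using cramer_lemma[of k C "column l S"] by (simp add: column_def)
qed

lemma continuous_on_det_entries:
  fixes F :: "'a::topological_space \<Rightarrow> complex^'n^'n"
  assumes "\<And>i j. continuous_on T (\<lambda>x. F x $ i $ j)"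
  shows "continuous_on T (\<lambda>x. det (F x))"
  unfolding det_def by (intro continuous_intros assms)

text \<open>In a quotient topology a neighbourhood must be given by an open preimage. The conditions
  with \<open>S\<close> close to the limit form such a set \<open>V\<close>: by Cramer's rule its
  preimage is cut out by strict inequalities between continuous functions of the entries of
  \<open>(A, B)\<close>.\<close>

lemma S_of_tendsto:
  fixes A :: "('d::finite) bcond"
  assumes lim: "limitin (subtopology BCtop (OK K)) As A F"
  shows "((\<lambda>s. S_of K (As s)) \<longlongrightarrow> S_of K A) F"
proof -
  define S where "S = S_of K A"
  have top: "topspace BCtop \<subseteq> BC" unfolding topspace_def openin_BCtop BCopen_def by blast
  have A: "A \<in> OK K" "A \<in> BC" using lim top unfolding limitin_def by auto
  have S: "hermitian S" "A = orbit (nfA K S, nfB K S)" using OK_S_of[OF A(1)] by (auto simp: S_def)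
  have entry: "\<forall>\<^sub>F s in F. \<forall>k l. cmod (S_of K (As s) $ k $ l - S $ k $ l) < \<epsilon>" if \<epsilon>: "\<epsilon> > 0" for \<epsilon>
  proof -
    define V where "V = {X \<in> BC. \<exists>S'. hermitian S' \<and> X = orbit (nfA K S', nfB K S') \<and> (\<forall>k l. cmod (S' $ k $ l - S $ k $ l) < \<epsilon>)}"
    \<comment> \<open>Closeness of the entries of \<open>S\<close>, multiplied by the modulus of the
      determinant so that no division occurs.\<close>
    define cond where "cond = (\<lambda>x. det (nfC K (fst x) (snd x)) \<noteq> 0 \<and> (\<forall>k l.
       cmod (cramer_num (nfC K (fst x) (snd x)) (nfD K (fst x) (snd x)) k l - S $ k $ l * det (nfC K (fst x) (snd x))) < \<epsilon> * cmod (det (nfC K (fst x) (snd x)))))"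
    have key: "cond (A', B') \<longleftrightarrow> (\<forall>k l. cmod (S' $ k $ l - S $ k $ l) < \<epsilon>)"
      if i: "invertible (nfC K A' B')" and e: "nfC K A' B' ** S' = nfD K A' B'" for A' B' S'
    proof -
      have d: "det (nfC K A' B') \<noteq> 0" using i by (simp add: invertible_det_nz)
      have "cmod (cramer_num (nfC K A' B') (nfD K A' B') k l - S $ k $ l * det (nfC K A' B')) = cmod (S' $ k $ l - S $ k $ l) * cmod (det (nfC K A' B'))" for k l
        unfolding e[symmetric] cramer_num_mul by (simp add: norm_mult[symmetric] algebra_simps)
      then show ?thesis using d by (simp add: cond_def)
    qed
    have eq: "{x \<in> BCset. orbit x \<in> V} = BCset \<inter> {x. cond x}"
    proof (intro set_eqI iffI)
      fix x :: "'d bmat" assume x: "x \<in> {x \<in> BCset. orbit x \<in> V}"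
      then obtain S' where S': "orbit x = orbit (nfA K S', nfB K S')" "\<forall>k l. cmod (S' $ k $ l - S $ k $ l) < \<epsilon>"
        unfolding V_def by auto
      have "(fst x, snd x) \<in> orbit (nfA K S', nfB K S')" using orbit_self[of x] S'(1) by simp
      from key[OF nf_unique[OF this]] S'(2) x show "x \<in> BCset \<inter> {x. cond x}" by simp
    next
      fix x :: "'d bmat" assume x: "x \<in> BCset \<inter> {x. cond x}"
      obtain A' B' where AB: "x = (A', B')" by (cases x)
      define G where "G = nfC K A' B'"
      have iG: "invertible G" using x unfolding cond_def AB G_def by (simp add: invertible_det_nz)
      obtain G' where G': "G ** G' = mat 1" "G' ** G = mat 1" using iG unfolding invertible_def by blast
      define S' where "S' = G' ** nfD K A' B'"
      have e: "G ** S' = nfD K A' B'" unfolding S'_def by (simp add: matrix_mul_assoc G')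
      have AB': "A' = G ** nfA K S'" "B' = G ** nfB K S'" using nf_reconstruct e unfolding G_def by auto
      have "A' ** adj B' = B' ** adj A'" using x unfolding AB BCset_def by simp
      \<comment> \<open>Self-adjointness passes to the normal form by cancelling \<open>G\<close> on
        the left and its adjoint on the right; this is what makes \<open>S'\<close>
        Hermitian.\<close>
      then have "G ** (nfA K S' ** adj (nfB K S')) ** adj G = G ** (nfB K S' ** adj (nfA K S')) ** adj G"
        unfolding AB' adj_mul by (simp add: matrix_mul_assoc)
      then have "G' ** (G ** (nfA K S' ** adj (nfB K S')) ** adj G) ** adj G' = G' ** (G ** (nfB K S' ** adj (nfA K S')) ** adj G) ** adj G'"
        by simp
      moreover have "adj G ** adj G' = mat 1"
      proof -
        have "adj G ** adj G' = adj (G' ** G)" by (simp add: adj_mul)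
        also have "\<dots> = mat 1" unfolding G' by (simp add: adj_def mat_def vec_eq_iff)
        finally show ?thesis .
      qed
      then have "G' ** (G ** X ** adj G) ** adj G' = X" for X
        using G'(2) by (metis matrix_mul_assoc matrix_mul_lid matrix_mul_rid)
      ultimately have "nfA K S' ** adj (nfB K S') = nfB K S' ** adj (nfA K S')" by simp
      then have "hermitian S'" by (rule nf_hermitian)
      moreover have "orbit x = orbit (nfA K S', nfB K S')" unfolding AB using AB' orbit_mul[OF iG] by metis
      moreover have "\<forall>k l. cmod (S' $ k $ l - S $ k $ l) < \<epsilon>"
        using key[of A' B' S'] iG e x unfolding G_def AB by simp
      moreover have "orbit x \<in> BC" using x unfolding BC_def by blast
      ultimately show "x \<in> {x \<in> BCset. orbit x \<in> V}" using x unfolding V_def by auto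
    qed
    have "open {x. cond x}"
    proof -
      have c1: "continuous_on UNIV (\<lambda>x::'d bmat. nfC K (fst x) (snd x) $ i $ j)" for i j
        by (cases "j \<in> K") (simp_all add: nfC_def continuous_intros)
      have c2: "continuous_on UNIV (\<lambda>x::'d bmat. nfD K (fst x) (snd x) $ i $ j)" for i j
        by (cases "j \<in> K") (simp_all add: nfD_def continuous_intros)
      have c3: "continuous_on UNIV (\<lambda>x::'d bmat. det (nfC K (fst x) (snd x)))"
        by (rule continuous_on_det_entries[OF c1])
      have c4: "continuous_on UNIV (\<lambda>x::'d bmat. cramer_num (nfC K (fst x) (snd x)) (nfD K (fst x) (snd x)) k l)" for k l
        unfolding cramer_num_def
      proof (rule continuous_on_det_entries)
        fix i j show "continuous_on UNIV (\<lambda>x::'d bmat. (\<chi> i j. if j = k then nfD K (fst x) (snd x) $ i $ l else nfC K (fst x) (snd x) $ i $ j) $ i $ j)"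
          by (cases "j = k") (simp_all add: c1 c2)
      qed
      show ?thesis unfolding cond_def
        by (intro open_Collect_conj open_Collect_neq open_Collect_all_finite open_Collect_less continuous_intros c3 c4)
    qed
    then have "openin (top_of_set BCset) {x \<in> BCset. orbit x \<in> V}" unfolding eq by blast
    then have "openin BCtop V" unfolding openin_BCtop BCopen_def by (auto simp: V_def)
    then have o: "openin (subtopology BCtop (OK K)) (V \<inter> OK K)" unfolding openin_subtopology by blast
    have "A \<in> V" unfolding V_def using A(2) S \<epsilon> by auto
    then have "\<forall>\<^sub>F s in F. As s \<in> V \<inter> OK K" using lim o A(1) unfolding limitin_def by blast
    then show ?thesis
    proof eventually_elim
      case (elim s)
      then obtain S' where S': "As s = orbit (nfA K S', nfB K S')" "\<forall>k l. cmod (S' $ k $ l - S $ k $ l) < \<epsilon>"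
        unfolding V_def by blast
      have "As s = orbit (nfA K (S_of K (As s)), nfB K (S_of K (As s)))" using OK_S_of(2) elim by blast
      then have "S' = S_of K (As s)" using S'(1) orbit_nf_inject by metis
      then show ?case using S'(2) by simp
    qed
  qed
  have "((\<lambda>s. S_of K (As s) $ k $ l) \<longlongrightarrow> S $ k $ l) F" for k l
    unfolding tendsto_iff dist_norm by (intro allI impI, rule eventually_mono[OF entry]) auto
  then show ?thesis unfolding S_def[symmetric] by (intro vec_tendstoI)
qed

section \<open>Nullity as the dimension of the kernel\<close>

lemma kernel_family_card_le:
  assumes h: "hform I B" and I: "finite I" and T: "finite T"
    and ker: "\<And>j y. j \<in> T \<Longrightarrow> B y (v j) = 0"
    and ind: "\<And>c. (\<And>i. i \<in> I \<Longrightarrow> lc c v T i = 0) \<Longrightarrow> (\<And>j. j \<in> T \<Longrightarrow> c j = 0)"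
  shows "card T \<le> zidx I B"
proof (rule ccontr)
  assume n: "\<not> ?thesis"
  obtain e \<sigma> where d: "diag_basis I B e \<sigma>" using exists_diag_basis[OF h I] by blast
  have "\<forall>j. \<exists>a. \<forall>i\<in>I. v j i = lc a e I i" using d unfolding diag_basis_def by blast
  then obtain a where a: "\<And>j i. i \<in> I \<Longrightarrow> v j i = lc (a j) e I i" by metis
  \<comment> \<open>Pairing with \<open>e i\<close> shows that kernel vectors have no component
    along directions with \<open>\<sigma> i\<close> nonzero.\<close>
  have az: "a j i = 0" if j: "j \<in> T" and i: "i \<in> I" "\<sigma> i \<noteq> 0" for i j
  proof -
    have "0 = B (e i) (v j)" using ker[OF j] by simp
    also have "\<dots> = B (e i) (lc (a j) e I)" by (rule hform_cong[OF h]) (use a in auto)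
    also have "\<dots> = (\<Sum>k\<in>I. a j k * B (e i) (e k))" by (rule hform_lc_right[OF h I])
    also have "\<dots> = (\<Sum>k\<in>I. if k = i then a j i * complex_of_real (\<sigma> i) else 0)"
      using d i unfolding diag_basis_def orth_fam_def by (intro sum.cong) auto
    also have "\<dots> = a j i * complex_of_real (\<sigma> i)" using I i by simp
    finally show ?thesis using i by simp
  qed
  have "card {i\<in>I. \<sigma> i = 0} < card T" using n zidx_diag[OF h I d] by simp
  from homogeneous_system_nontrivial[OF _ T this, of a] I obtain c where
    c: "\<exists>j\<in>T. c j \<noteq> 0" "\<And>i. i \<in> I \<Longrightarrow> \<sigma> i = 0 \<Longrightarrow> (\<Sum>j\<in>T. c j * a j i) = 0" by auto
  have call: "(\<Sum>j\<in>T. c j * a j i) = 0" if "i \<in> I" for i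
    using c(2)[OF that] az that by (cases "\<sigma> i = 0") auto
  have "lc c v T i = 0" if "i \<in> I" for i
  proof -
    have "lc c v T i = (\<Sum>j\<in>T. \<Sum>k\<in>I. c j * a j k * e k i)"
      using a that by (simp add: lc_def sum_distrib_left mult.assoc)
    also have "\<dots> = (\<Sum>k\<in>I. \<Sum>j\<in>T. c j * a j k * e k i)" by (rule sum.swap)
    also have "\<dots> = (\<Sum>k\<in>I. (\<Sum>j\<in>T. c j * a j k) * e k i)" by (simp add: sum_distrib_right)
    also have "\<dots> = 0" using call by simp
    finally show ?thesis .
  qed
  then show False using ind c(1) by blast
qed

lemma kernel_basis_exists:
  fixes B :: "('i \<Rightarrow> complex) \<Rightarrow> ('i \<Rightarrow> complex) \<Rightarrow> complex"
  assumes h: "hform I B" and I: "finite I"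
  shows "\<exists>(T::'i set) e. finite T \<and> card T = zidx I B \<and> (\<forall>j\<in>T. \<forall>y. B y (e j) = 0) \<and>
    (\<forall>c. (\<forall>i\<in>I. lc c e T i = 0) \<longrightarrow> (\<forall>j\<in>T. c j = 0))"
proof -
  obtain e \<sigma> where d: "diag_basis I B e \<sigma>" using exists_diag_basis[OF h I] by blast
  define T where "T = {i\<in>I. \<sigma> i = 0}"
  have sp: "\<And>x. \<exists>c. \<forall>i\<in>I. x i = lc c e I i" using d unfolding diag_basis_def by blast
  have "B y (e j) = 0" if "j \<in> T" for y j
  proof -
    obtain a where a: "\<forall>i\<in>I. y i = lc a e I i" using sp by blast
    have "B y (e j) = B (lc a e I) (e j)" by (rule hform_cong2[OF h]) (use a in auto)
    also have "\<dots> = (\<Sum>k\<in>I. cnj (a k) * B (e k) (e j))" by (rule hform_lc_left[OF h I])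
    also have "\<dots> = 0" using d that unfolding diag_basis_def orth_fam_def T_def by (intro sum.neutral) auto
    finally show ?thesis .
  qed
  moreover have "c j = 0" if z: "\<forall>i\<in>I. lc c e T i = 0" and j: "j \<in> T" for c j
  proof -
    define c' where "c' = (\<lambda>i. if i \<in> T then c i else 0)"
    have "lc c' e I i = lc c e T i" for i
    proof -
      have "lc c' e I i = (\<Sum>k\<in>I. if k \<in> T then c k * e k i else 0)"
        unfolding lc_def c'_def by (rule sum.cong) auto
      also have "\<dots> = (\<Sum>k\<in>I \<inter> T. c k * e k i)" by (rule sum.inter_restrict[OF I, symmetric])
      also have "I \<inter> T = T" by (auto simp: T_def)
      finally show ?thesis by (simp add: lc_def)
    qed
    then have "c' j = 0" using spanning_independent[OF I sp, of c' j] z j by (auto simp: T_def)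
    then show ?thesis using j by (simp add: c'_def)
  qed
  ultimately show ?thesis using zidx_diag[OF h I d] I
    by (intro exI[of _ T] exI[of _ e]) (auto simp: T_def)
qed

section \<open>Pointwise normalized coefficients\<close>

text \<open>One constant \<open>\<mu>\<close> bounds both \<open>P\<close> and \<open>W\<close> from
  below: it serves as the coercivity constant of the mesh and as the rate at which the form
  decreases in the spectral parameter.\<close>

definition nice :: "real \<Rightarrow> real \<Rightarrow> real \<Rightarrow> real \<Rightarrow> ('d::finite) coef \<Rightarrow> bool" where
  "nice a b \<mu> C w \<longleftrightarrow> bm a b (fst w) \<and> bm a b (fst (snd w)) \<and> bm a b (snd (snd w)) \<and>
    (\<forall>t\<in>{a..b}. transpose (fst w t) = fst w t \<and> transpose (fst (snd w) t) = fst (snd w) t \<and> transpose (snd (snd w) t) = snd (snd w) t \<and>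
       (\<forall>v. \<mu> * (norm v)\<^sup>2 \<le> Re (hip v (mv (fst w t) v))) \<and> (\<forall>v. \<mu> * (norm v)\<^sup>2 \<le> Re (hip v (mv (snd (snd w) t) v))) \<and>
       norm (fst w t) \<le> C \<and> norm (fst (snd w) t) \<le> C \<and> norm (snd (snd w) t) \<le> C)"

lemma niceD:
  assumes "nice a b \<mu> C w"
  shows "bm a b (fst w)" "bm a b (fst (snd w))" "bm a b (snd (snd w))"
    "t \<in> {a..b} \<Longrightarrow> transpose (fst w t) = fst w t" "t \<in> {a..b} \<Longrightarrow> transpose (fst (snd w) t) = fst (snd w) t"
    "t \<in> {a..b} \<Longrightarrow> transpose (snd (snd w) t) = snd (snd w) t"
    "t \<in> {a..b} \<Longrightarrow> \<mu> * (norm v)\<^sup>2 \<le> Re (hip v (mv (fst w t) v))"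
    "t \<in> {a..b} \<Longrightarrow> \<mu> * (norm v)\<^sup>2 \<le> Re (hip v (mv (snd (snd w) t) v))"
    "t \<in> {a..b} \<Longrightarrow> norm (fst w t) \<le> C" "t \<in> {a..b} \<Longrightarrow> norm (fst (snd w) t) \<le> C"
    "t \<in> {a..b} \<Longrightarrow> norm (snd (snd w) t) \<le> C"
  using assms unfolding nice_def by auto

definition AEeq :: "real \<Rightarrow> real \<Rightarrow> ('d::finite) coef \<Rightarrow> 'd coef \<Rightarrow> bool" where
  "AEeq a b w w' \<longleftrightarrow> (AE t in lebesgue_on {a..b}. fst w t = fst w' t \<and> fst (snd w) t = fst (snd w') t \<and> snd (snd w) t = snd (snd w') t)"

text \<open>\<open>\<Phi>\<close> is a parameter because of two uses: fixed bounds, with a constant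
  reference triple, and closeness to the limit coefficients, with these as reference.\<close>

lemma modify_on_null:
  fixes w w0 :: "('d::finite) coef"
  assumes meas: "fst w \<in> borel_measurable (lebesgue_on {a..b})" "fst (snd w) \<in> borel_measurable (lebesgue_on {a..b})"
      "snd (snd w) \<in> borel_measurable (lebesgue_on {a..b})"
    and meas0: "fst w0 \<in> borel_measurable (lebesgue_on {a..b})" "fst (snd w0) \<in> borel_measurable (lebesgue_on {a..b})"
      "snd (snd w0) \<in> borel_measurable (lebesgue_on {a..b})"
    and ae: "AE t in lebesgue_on {a..b}. \<Phi> t (fst w t) (fst (snd w) t) (snd (snd w) t)"
    and all: "\<And>t. t \<in> {a..b} \<Longrightarrow> \<Phi> t (fst w0 t) (fst (snd w0) t) (snd (snd w0) t)"
  shows "\<exists>w'. AEeq a b w w' \<and> fst w' \<in> borel_measurable (lebesgue_on {a..b}) \<and> fst (snd w') \<in> borel_measurable (lebesgue_on {a..b}) \<and>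
      snd (snd w') \<in> borel_measurable (lebesgue_on {a..b}) \<and> (\<forall>t\<in>{a..b}. \<Phi> t (fst w' t) (fst (snd w') t) (snd (snd w') t))"
proof -
  from AE_E[OF ae] obtain Z where
    Z: "{t \<in> space (lebesgue_on {a..b}). \<not> \<Phi> t (fst w t) (fst (snd w) t) (snd (snd w) t)} \<subseteq> Z"
      "emeasure (lebesgue_on {a..b}) Z = 0" "Z \<in> sets (lebesgue_on {a..b})" by blast
  have "{t \<in> space (lebesgue_on {a..b}). t \<in> Z} = Z" using sets.sets_into_space[OF Z(3)] by blast
  then have Zs: "{t \<in> space (lebesgue_on {a..b}). t \<in> Z} \<in> sets (lebesgue_on {a..b})" using Z(3) by simp
  define w' where "w' = (\<lambda>t. if t \<in> Z then fst w0 t else fst w t, \<lambda>t. if t \<in> Z then fst (snd w0) t else fst (snd w) t,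
     \<lambda>t. if t \<in> Z then snd (snd w0) t else snd (snd w) t)"
  have "AE t in lebesgue_on {a..b}. t \<notin> Z" using Z by (intro AE_not_in) (simp add: null_sets_def)
  then have "AEeq a b w w'" unfolding AEeq_def by eventually_elim (simp add: w'_def)
  moreover have "fst w' \<in> borel_measurable (lebesgue_on {a..b})" "fst (snd w') \<in> borel_measurable (lebesgue_on {a..b})"
      "snd (snd w') \<in> borel_measurable (lebesgue_on {a..b})"
    unfolding w'_def using meas meas0 Zs by (auto intro!: measurable_If)
  moreover have "\<Phi> t (fst w' t) (fst (snd w') t) (snd (snd w') t)" if "t \<in> {a..b}" for t
    using Z(1) all[OF that] that by (cases "t \<in> Z") (auto simp: w'_def)
  ultimately show ?thesis by blast
qed

lemma OmegaD:
  assumes "w \<in> Omega a b"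
  shows "fst w \<in> borel_measurable (lebesgue_on {a..b})" "fst (snd w) \<in> borel_measurable (lebesgue_on {a..b})"
    "snd (snd w) \<in> borel_measurable (lebesgue_on {a..b})"
    "AE t in lebesgue_on {a..b}. transpose (fst w t) = fst w t \<and> transpose (fst (snd w) t) = fst (snd w) t \<and> transpose (snd (snd w) t) = snd (snd w) t"
    "\<exists>C. AE t in lebesgue_on {a..b}. norm (fst w t) \<le> C \<and> norm (fst (snd w) t) \<le> C \<and> norm (snd (snd w) t) \<le> C"
    "\<exists>\<mu>>0. AE t in lebesgue_on {a..b}. mat_ge_scalar (fst w t) \<mu> \<and> mat_ge_scalar (snd (snd w) t) \<mu>"
proof -
  obtain P Q W where w: "w = (P, Q, W)" by (cases w)
  have O: "Linf_fun a b P" "Linf_fun a b Q" "Linf_fun a b W"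
    "AE t in lebesgue_on {a..b}. transpose (P t) = P t \<and> transpose (Q t) = Q t \<and> transpose (W t) = W t"
    "\<exists>\<mu>1>0. AE t in lebesgue_on {a..b}. mat_ge_scalar (P t) \<mu>1" "\<exists>\<mu>2>0. AE t in lebesgue_on {a..b}. mat_ge_scalar (W t) \<mu>2"
    using assms unfolding w Omega_def by auto
  show "fst w \<in> borel_measurable (lebesgue_on {a..b})" "fst (snd w) \<in> borel_measurable (lebesgue_on {a..b})"
    "snd (snd w) \<in> borel_measurable (lebesgue_on {a..b})"
    "AE t in lebesgue_on {a..b}. transpose (fst w t) = fst w t \<and> transpose (fst (snd w) t) = fst (snd w) t \<and> transpose (snd (snd w) t) = snd (snd w) t"
    using O unfolding w Linf_fun_def by auto
  obtain C1 C2 C3 where C: "AE t in lebesgue_on {a..b}. norm (P t) \<le> C1" "AE t in lebesgue_on {a..b}. norm (Q t) \<le> C2" "AE t in lebesgue_on {a..b}. norm (W t) \<le> C3"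
    using O(1-3) unfolding Linf_fun_def by blast
  then have "AE t in lebesgue_on {a..b}. norm (P t) \<le> max C1 (max C2 C3) \<and> norm (Q t) \<le> max C1 (max C2 C3) \<and> norm (W t) \<le> max C1 (max C2 C3)"
    by eventually_elim auto
  then show "\<exists>C. AE t in lebesgue_on {a..b}. norm (fst w t) \<le> C \<and> norm (fst (snd w) t) \<le> C \<and> norm (snd (snd w) t) \<le> C"
    unfolding w by auto
  obtain \<mu>1 \<mu>2 where mu: "\<mu>1 > 0" "\<mu>2 > 0" "AE t in lebesgue_on {a..b}. mat_ge_scalar (P t) \<mu>1" "AE t in lebesgue_on {a..b}. mat_ge_scalar (W t) \<mu>2"
    using O(5,6) by blast
  have weaken: "mat_ge_scalar M \<mu> \<Longrightarrow> \<nu> \<le> \<mu> \<Longrightarrow> mat_ge_scalar M \<nu>" for M :: "real^'d^'d" and \<mu> \<nu>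
    unfolding mat_ge_scalar_def by (meson inner_ge_zero mult_right_mono order_trans)
  from mu(3,4) have "AE t in lebesgue_on {a..b}. mat_ge_scalar (P t) (min \<mu>1 \<mu>2) \<and> mat_ge_scalar (W t) (min \<mu>1 \<mu>2)"
    by eventually_elim (auto intro: weaken)
  then show "\<exists>\<mu>>0. AE t in lebesgue_on {a..b}. mat_ge_scalar (fst w t) \<mu> \<and> mat_ge_scalar (snd (snd w) t) \<mu>"
    unfolding w using mu(1,2) by (intro exI[of _ "min \<mu>1 \<mu>2"]) auto
qed

lemma hip_ge_mono: "\<mu> * (norm v)\<^sup>2 \<le> x \<Longrightarrow> \<nu> \<le> \<mu> \<Longrightarrow> \<nu> * (norm v)\<^sup>2 \<le> (x::real)"
  by (meson mult_right_mono order_trans zero_le_power2)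

lemma mv_mat_1: "mv (mat 1) v = v"
proof -
  have "mv (mat 1) v $ i = (\<Sum>j\<in>UNIV. if j = i then v $ i else 0)" for i
    unfolding mv_nth mat_def by (rule sum.cong) auto
  then show ?thesis by (simp add: vec_eq_iff)
qed

lemma Omega_nice:
  fixes w :: "('d::finite) coef"
  assumes "w \<in> Omega a b"
  shows "\<exists>w' \<mu> C. nice a b \<mu> C w' \<and> \<mu> > 0 \<and> C > 0 \<and> AEeq a b w w'"
proof -
  obtain C0 where C0: "AE t in lebesgue_on {a..b}. norm (fst w t) \<le> C0 \<and> norm (fst (snd w) t) \<le> C0 \<and> norm (snd (snd w) t) \<le> C0"
    using OmegaD(5)[OF assms] by blast
  obtain \<mu>0 where \<mu>0: "\<mu>0 > 0" "AE t in lebesgue_on {a..b}. mat_ge_scalar (fst w t) \<mu>0 \<and> mat_ge_scalar (snd (snd w) t) \<mu>0"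
    using OmegaD(6)[OF assms] by blast
  \<comment> \<open>The cap 1, together with a bound \<open>C\<close> above the norm of the identity
    matrix, makes the triple of identity, zero and identity an admissible replacement on the null
    set.\<close>
  define \<mu> where "\<mu> = min \<mu>0 1"
  define C where "C = max C0 (norm (mat 1 :: real^'d^'d)) + 1"
  have C: "C > 0" unfolding C_def by (simp add: add_nonneg_pos le_max_iff_disj)
  define \<Phi> where "\<Phi> = (\<lambda>(t::real) (P::real^'d^'d) (Q::real^'d^'d) (W::real^'d^'d). transpose P = P \<and> transpose Q = Q \<and> transpose W = W \<and>
     (\<forall>v. \<mu> * (norm v)\<^sup>2 \<le> Re (hip v (mv P v))) \<and> (\<forall>v. \<mu> * (norm v)\<^sup>2 \<le> Re (hip v (mv W v))) \<and> norm P \<le> C \<and> norm Q \<le> C \<and> norm W \<le> C)"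
  have "AE t in lebesgue_on {a..b}. \<Phi> t (fst w t) (fst (snd w) t) (snd (snd w) t)"
    using OmegaD(4)[OF assms] C0 \<mu>0(2)
  proof eventually_elim
    case (elim t)
    then show ?case unfolding \<Phi>_def C_def
      by (auto intro!: hip_ge_mono[OF mat_ge_scalar_complex, of _ \<mu>0] simp: \<mu>_def)
  qed
  moreover have "\<Phi> t ((\<lambda>_. mat 1) t) ((\<lambda>_. 0) t) ((\<lambda>_. mat 1) t)" for t
  proof -
    have "\<mu> * (norm v)\<^sup>2 \<le> (norm v)\<^sup>2" for v :: "complex^'d"
      using \<mu>0(1) by (intro mult_left_le_one_le) (auto simp: \<mu>_def)
    moreover have "transpose (0::real^'d^'d) = 0" by (simp add: transpose_def vec_eq_iff)
    moreover have "norm (mat 1 :: real^'d^'d) \<le> C" by (simp add: C_def)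
    ultimately show ?thesis using C unfolding \<Phi>_def mv_mat_1 Re_hip_self by simp
  qed
  ultimately obtain w' where w': "AEeq a b w w'" "fst w' \<in> borel_measurable (lebesgue_on {a..b})" "fst (snd w') \<in> borel_measurable (lebesgue_on {a..b})"
      "snd (snd w') \<in> borel_measurable (lebesgue_on {a..b})" "\<forall>t\<in>{a..b}. \<Phi> t (fst w' t) (fst (snd w') t) (snd (snd w') t)"
    using modify_on_null[OF OmegaD(1-3)[OF assms], of "(\<lambda>_. mat 1, \<lambda>_. 0, \<lambda>_. mat 1)" \<Phi>] by auto
  have "nice a b \<mu> C w'" using w'(2-5) unfolding nice_def \<Phi>_def by (auto intro!: bmI[of _ _ _ C])
  moreover have "\<mu> > 0" using \<mu>0 by (simp add: \<mu>_def)
  ultimately show ?thesis using w'(1) C by blast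
qed

text \<open>The limit coefficients satisfy the bounds with \<open>2 * \<mu>\<close> and
  \<open>C\<close>. A perturbation with \<open>\<epsilon> * K \<le> \<mu>\<close> and
  \<open>\<epsilon> \<le> 1\<close> costs half of the first and adds 1 to the second, so the
  resulting constants are common to a whole neighbourhood.\<close>

lemma Omega_nice_near:
  fixes w :: "('d::finite) coef"
  assumes w: "w \<in> Omega a b" and n: "nice a b (2 * \<mu>) C w0"
    and K: "K \<ge> 0" "\<And>M x. norm (mv M x :: complex^'d) \<le> norm (M::real^'d^'d) * norm x * K" and small: "\<epsilon> * K \<le> \<mu>"
    and e: "\<epsilon> \<ge> 0" "\<epsilon> \<le> 1"
    and near: "AE t in lebesgue_on {a..b}. norm (fst w t - fst w0 t) \<le> \<epsilon> \<and> norm (fst (snd w) t - fst (snd w0) t) \<le> \<epsilon> \<and>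
        norm (snd (snd w) t - snd (snd w0) t) \<le> \<epsilon>"
  shows "\<exists>w'. nice a b \<mu> (C + 1) w' \<and> AEeq a b w w' \<and> (\<forall>t\<in>{a..b}. norm (fst w' t - fst w0 t) \<le> \<epsilon> \<and> norm (fst (snd w') t - fst (snd w0) t) \<le> \<epsilon> \<and>
        norm (snd (snd w') t - snd (snd w0) t) \<le> \<epsilon>)"
proof -
  define \<Phi> where "\<Phi> = (\<lambda>t (P::real^'d^'d) (Q::real^'d^'d) (W::real^'d^'d). transpose P = P \<and> transpose Q = Q \<and> transpose W = W \<and>
     norm (P - fst w0 t) \<le> \<epsilon> \<and> norm (Q - fst (snd w0) t) \<le> \<epsilon> \<and> norm (W - snd (snd w0) t) \<le> \<epsilon>)"
  have 1: "AE t in lebesgue_on {a..b}. \<Phi> t (fst w t) (fst (snd w) t) (snd (snd w) t)"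
    using OmegaD(4)[OF w] near by eventually_elim (auto simp: \<Phi>_def)
  have 2: "\<Phi> t (fst w0 t) (fst (snd w0) t) (snd (snd w0) t)" if "t \<in> {a..b}" for t
    using n that e unfolding nice_def \<Phi>_def by auto
  have m0: "fst w0 \<in> borel_measurable (lebesgue_on {a..b})" "fst (snd w0) \<in> borel_measurable (lebesgue_on {a..b})"
      "snd (snd w0) \<in> borel_measurable (lebesgue_on {a..b})" using n unfolding nice_def by (auto intro: bm_measurable)
  from modify_on_null[OF OmegaD(1-3)[OF w] m0 1 2] obtain w' where
    w': "AEeq a b w w'" "fst w' \<in> borel_measurable (lebesgue_on {a..b})" "fst (snd w') \<in> borel_measurable (lebesgue_on {a..b})"
      "snd (snd w') \<in> borel_measurable (lebesgue_on {a..b})" "\<And>t. t \<in> {a..b} \<Longrightarrow> \<Phi> t (fst w' t) (fst (snd w') t) (snd (snd w') t)"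
    by blast
  have bd: "norm X \<le> C + 1" if "norm Y \<le> C" "norm (X - Y) \<le> \<epsilon>" for X Y :: "real^'d^'d"
    using that e norm_triangle_sub[of X Y] by linarith
  have pos: "\<mu> * (norm v)\<^sup>2 \<le> Re (hip v (mv X v))"
    if X: "2 * \<mu> * (norm v)\<^sup>2 \<le> Re (hip v (mv Y v))" "norm (X - Y) \<le> \<epsilon>" for X Y :: "real^'d^'d" and v
  proof -
    have "\<bar>Re (hip v (mv (X - Y) v))\<bar> \<le> norm v * norm (mv (X - Y) v)"
      using abs_Re_le_cmod norm_hip_le order_trans by blast
    also have "\<dots> \<le> norm v * (norm (X - Y) * norm v * K)" by (intro mult_left_mono K) auto
    also have "\<dots> = (norm (X - Y) * K) * (norm v)\<^sup>2" by (simp add: power2_eq_square)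
    also have "\<dots> \<le> \<mu> * (norm v)\<^sup>2"
      using X(2) K(1) small by (intro mult_right_mono) (auto intro: order_trans[OF mult_right_mono])
    finally have "\<bar>Re (hip v (mv (X - Y) v))\<bar> \<le> \<mu> * (norm v)\<^sup>2" .
    moreover have "Re (hip v (mv X v)) = Re (hip v (mv Y v)) + Re (hip v (mv (X - Y) v))"
      by (simp add: mv_simps hip_simps)
    ultimately show ?thesis using X(1) by simp
  qed
  have "nice a b \<mu> (C + 1) w'"
    unfolding nice_def
  proof (intro conjI ballI)
    have C: "norm (fst w' t) \<le> C + 1" "norm (fst (snd w') t) \<le> C + 1" "norm (snd (snd w') t) \<le> C + 1" if "t \<in> {a..b}" for t
      using w'(5)[OF that] bd[OF niceD(9)[OF n that]] bd[OF niceD(10)[OF n that]] bd[OF niceD(11)[OF n that]]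
      unfolding \<Phi>_def by blast+
    then show "bm a b (fst w')" "bm a b (fst (snd w'))" "bm a b (snd (snd w'))" using w'(2-4) by (auto intro!: bmI[of _ _ _ "C + 1"])
    fix t assume t: "t \<in> {a..b}"
    show "norm (fst w' t) \<le> C + 1" "norm (fst (snd w') t) \<le> C + 1" "norm (snd (snd w') t) \<le> C + 1" using C t by auto
    show "transpose (fst w' t) = fst w' t" "transpose (fst (snd w') t) = fst (snd w') t" "transpose (snd (snd w') t) = snd (snd w') t"
      using w'(5)[OF t] unfolding \<Phi>_def by auto
    show "\<forall>v. \<mu> * (norm v)\<^sup>2 \<le> Re (hip v (mv (fst w' t) v))" "\<forall>v. \<mu> * (norm v)\<^sup>2 \<le> Re (hip v (mv (snd (snd w') t) v))"
      using w'(5)[OF t] pos[OF niceD(7)[OF n t]] pos[OF niceD(8)[OF n t]] unfolding \<Phi>_def by blast+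
  qed
  then show ?thesis using w'(1,5) unfolding \<Phi>_def by blast
qed

section \<open>Invariance under changes of the coefficients on null sets\<close>

lemma AE_negligible:
  assumes "AE s in lebesgue_on {a..b::real}. Q s"
  shows "\<exists>Z. negligible Z \<and> (\<forall>s\<in>{a..b} - Z. Q s)"
proof -
  from AE_E[OF assms] obtain Z where
    Z: "{t \<in> space (lebesgue_on {a..b}). \<not> Q t} \<subseteq> Z" "emeasure (lebesgue_on {a..b}) Z = 0" "Z \<in> sets (lebesgue_on {a..b})" by blast
  then have "Z \<in> null_sets (lebesgue_on {a..b})" by (simp add: null_sets_def)
  then have "negligible Z" unfolding negligible_iff_null_sets by (subst (asm) null_sets_restrict_space) auto
  moreover have "\<forall>s\<in>{a..b} - Z. Q s" using Z(1) by auto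
  ultimately show ?thesis by blast
qed

lemma integral_AE_cong:
  fixes f g :: "real \<Rightarrow> 'v::euclidean_space"
  assumes ae: "AE s in lebesgue_on {a..b}. f s = g s" and t: "t \<in> {a..b}"
  shows "integral {a..t} f = integral {a..t} g"
proof -
  obtain Z where Z: "negligible Z" "\<forall>s\<in>{a..b} - Z. f s = g s" using AE_negligible[OF ae] by blast
  show ?thesis by (rule integral_spike[OF Z(1)]) (use Z(2) t in auto)
qed

lemma absolutely_integrable_AE_cong:
  fixes f g :: "real \<Rightarrow> 'v::euclidean_space"
  assumes ae: "AE s in lebesgue_on {a..b}. f s = g s" and f: "f absolutely_integrable_on {a..b}"
  shows "g absolutely_integrable_on {a..b}"
proof -
  obtain Z where Z: "negligible Z" "\<forall>s\<in>{a..b} - Z. f s = g s" using AE_negligible[OF ae] by blast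
  show ?thesis by (rule absolutely_integrable_spike[OF f Z(1)]) (use Z(2) in auto)
qed

lemma sl_sol_AEeq1:
  assumes "AEeq a b w w'" "sl_sol a b w lam y z"
  shows "sl_sol a b w' lam y z"
proof -
  obtain P Q W P' Q' W' where w: "w = (P, Q, W)" "w' = (P', Q', W')" by (cases w, cases w') auto
  have ae: "AE t in lebesgue_on {a..b}. P t = P' t \<and> Q t = Q' t \<and> W t = W' t"
    using assms(1) unfolding AEeq_def w by simp
  obtain u where u: "u absolutely_integrable_on {a..b}" "\<forall>t\<in>{a..b}. y t = y a + integral {a..t} u"
    "AE t in lebesgue_on {a..b}. cmat (P t) *v u t = z t"
    and q: "(\<lambda>s. cmat (Q s - lam *\<^sub>R W s) *v y s) absolutely_integrable_on {a..b}"
      "\<forall>t\<in>{a..b}. z t = z a + integral {a..t} (\<lambda>s. cmat (Q s - lam *\<^sub>R W s) *v y s)"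
    using assms(2) unfolding w sl_sol_def prod.case by blast
  have "AE t in lebesgue_on {a..b}. cmat (P' t) *v u t = z t" using ae u(3) by eventually_elim simp
  moreover have ae2: "AE s in lebesgue_on {a..b}. cmat (Q s - lam *\<^sub>R W s) *v y s = cmat (Q' s - lam *\<^sub>R W' s) *v y s"
    using ae by eventually_elim simp
  moreover note absolutely_integrable_AE_cong[OF ae2 q(1)]
  moreover have "\<forall>t\<in>{a..b}. z t = z a + integral {a..t} (\<lambda>s. cmat (Q' s - lam *\<^sub>R W' s) *v y s)"
  proof
    fix t assume t: "t \<in> {a..b}"
    show "z t = z a + integral {a..t} (\<lambda>s. cmat (Q' s - lam *\<^sub>R W' s) *v y s)"
      unfolding integral_AE_cong[OF ae2 t, symmetric] by (rule bspec[OF q(2) t])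
  qed
  ultimately show ?thesis unfolding w sl_sol_def prod.case using u(1,2) by blast
qed

lemma eig_mult_AEeq:
  assumes "AEeq a b w w'"
  shows "eig_mult a b w = eig_mult a b w'"
proof -
  have "AEeq a b w' w" using assms unfolding AEeq_def by (auto elim: eventually_mono)
  then have "sl_sol a b w lam y z = sl_sol a b w' lam y z" for lam y z
    using sl_sol_AEeq1 assms by blast
  then show ?thesis unfolding eig_mult_def bvp_sol_def by (intro ext) simp
qed

lemma eig_count_AEeq: "AEeq a b w w' \<Longrightarrow> eig_count a b w = eig_count a b w'"
  unfolding eig_count_def by (intro ext) (simp add: eig_mult_AEeq)

section \<open>The reduced form of a boundary value problem\<close>

text \<open>The coordinate \<open>Inl (k, j)\<close> of a vector is component \<open>j\<close> at node \<open>k\<close>; the coordinate \<open>Inr i\<close>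
  with \<open>i \<in> K\<close> is a Lagrange multiplier, which takes the value \<open>Z_i\<close> on the kernel.\<close>
definition nodes :: "((nat \<times> 'd) + ('d + 'd) \<Rightarrow> complex) \<Rightarrow> nat \<Rightarrow> complex^('d::finite)" where
  "nodes x k = (\<chi> j. x (Inl (k, j)))"

definition multiplier :: "('d + 'd) set \<Rightarrow> ((nat \<times> 'd) + ('d + 'd) \<Rightarrow> complex) \<Rightarrow> complex^('d::finite + 'd)" where
  "multiplier K x = (\<chi> i. if i \<in> K then x (Inr i) else 0)"

definition Rl :: "('d::finite) coef \<Rightarrow> real \<Rightarrow> 'd rmatf" where
  "Rl w lam t = fst (snd w) t - lam *\<^sub>R snd (snd w) t"

lemma nodes_comb: "nodes (\<lambda>i. y i + c * z i) = (\<lambda>k. nodes y k + c *s nodes z k)"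
  by (simp add: nodes_def vec_eq_iff fun_eq_iff)

lemma nodes_lc: "nodes (lc c x T) k = (\<Sum>j\<in>T. c j *s nodes (x j) k)"
  by (simp add: nodes_def lc_def vec_eq_iff)

lemma multiplier_comb: "multiplier K (\<lambda>i. y i + c * z i) = multiplier K y + c *s multiplier K z"
  by (simp add: multiplier_def vec_eq_iff)

lemma sum_UNIV_Plus: "(\<Sum>i\<in>(UNIV::('d::finite + 'e::finite) set). f i) = (\<Sum>j\<in>UNIV. f (Inl j)) + (\<Sum>j\<in>UNIV. f (Inr j))"
  using sum.Plus[of "UNIV::'d set" "UNIV::'e set" f] by (simp add: UNIV_Plus_UNIV)

lemma nf_row:
  "(nfA K S *v Y + nfB K S *v Z) $ i = (S *v (\<chi> j. if j \<in> K then Z $ j else Y $ j)) $ i - (if i \<in> K then Y $ i else - (Z $ i))"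
proof -
  have "(nfA K S *v Y + nfB K S *v Z) $ i = (\<Sum>j\<in>UNIV. nfA K S $ i $ j * Y $ j + nfB K S $ i $ j * Z $ j)"
    by (simp add: matrix_vector_mult_def sum.distrib)
  also have "\<dots> = (\<Sum>j\<in>UNIV. S $ i $ j * (if j \<in> K then Z $ j else Y $ j) - (if j = i then (if i \<in> K then Y $ i else - (Z $ i)) else 0))"
    by (rule sum.cong) (auto simp: nfA_def nfB_def)
  also have "\<dots> = (S *v (\<chi> j. if j \<in> K then Z $ j else Y $ j)) $ i - (if i \<in> K then Y $ i else - (Z $ i))"
    by (simp add: matrix_vector_mult_def sum_subtractf)
  finally show ?thesis .
qed

lemma orbit_bc_iff:
  fixes A B :: "('d::finite) cm2"
  shows "(\<exists>(A', B')\<in>orbit (A, B). A' *v Y + B' *v Z = 0) \<longleftrightarrow> A *v Y + B *v Z = 0"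
proof
  assume "\<exists>(A', B')\<in>orbit (A, B). A' *v Y + B' *v Z = 0"
  then obtain G :: "'d cm2" where G: "invertible G" "(G ** A) *v Y + (G ** B) *v Z = 0"
    unfolding orbit_def by auto
  then obtain G' where G': "G' ** G = mat 1" unfolding invertible_def by blast
  have "G *v (A *v Y + B *v Z) = 0"
    using G(2) by (simp add: matrix_vector_right_distrib matrix_vector_mul_assoc)
  then have "G' *v (G *v (A *v Y + B *v Z)) = 0" by simp
  then show "A *v Y + B *v Z = 0" by (simp add: matrix_vector_mul_assoc G')
next
  assume "A *v Y + B *v Z = 0"
  then show "\<exists>(A', B')\<in>orbit (A, B). A' *v Y + B' *v Z = 0" using orbit_self[of "(A, B)"] by (intro bexI[of _ "(A, B)"]) auto
qed

context mesh begin

text \<open>The signs are those of the boundary vector \<open>bvY\<close>. Since the flux at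
  \<open>a\<close> is minus the quasi-derivative there, the same map sends nodal values to
  \<open>Y\<close> and fluxes to \<open>Z\<close>.\<close>

definition bY :: "(nat \<Rightarrow> complex^('d::finite)) \<Rightarrow> complex^('d + 'd)" where
  "bY p = (\<chi> i. case i of Inl j \<Rightarrow> - (p 0 $ j) | Inr j \<Rightarrow> p N $ j)"

definition mixed_bv :: "('d + 'd) set \<Rightarrow> ((nat \<times> 'd) + ('d + 'd) \<Rightarrow> complex) \<Rightarrow> complex^('d::finite + 'd)" where
  "mixed_bv K x = (\<chi> i. if i \<in> K then x (Inr i) else bY (nodes x) $ i)"

text \<open>In normal form the boundary condition reads \<open>S v = u\<close> with \<open>v = (Z_K, Y_c)\<close> and \<open>u = (Y_K, - Z_c)\<close>,
  \<open>c\<close> being the complement of \<open>K\<close>. Stationarity in the multipliers yields the rows in \<open>K\<close>,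
  stationarity in the boundary values the other rows, and in the interior nodal values the continuity of \<open>P y'\<close>.\<close>
definition reduced_form :: "('d + 'd) set \<Rightarrow> ('d::finite) cm2 \<Rightarrow> 'd rmatf \<Rightarrow> 'd rmatf \<Rightarrow> ((nat \<times> 'd) + ('d + 'd) \<Rightarrow> complex) \<Rightarrow>
    ((nat \<times> 'd) + ('d + 'd) \<Rightarrow> complex) \<Rightarrow> complex" where
  "reduced_form K S P R x y = reduced_energy P R (nodes x) (nodes y) + hip (mixed_bv K x) (S *v mixed_bv K y) - hip (multiplier K x) (bY (nodes y)) - hip (bY (nodes x)) (multiplier K y)"

definition form_index :: "('d + 'd) set \<Rightarrow> ((nat \<times> 'd) + ('d + 'd)) set" where
  "form_index K = Inl ` ({..N} \<times> UNIV) \<union> Inr ` K"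

lemma finite_form_index: "finite (form_index (K :: ('d::finite + 'd) set))"
  by (simp add: form_index_def)

lemma bY_comb: "bY (\<lambda>k. p k + c *s q k) = bY p + c *s bY q"
  by (auto simp: bY_def vec_eq_iff split: sum.split)

lemma mixed_bv_comb: "mixed_bv K (\<lambda>i. y i + c * z i) = mixed_bv K y + c *s mixed_bv K z"
  by (simp add: mixed_bv_def vec_eq_iff nodes_comb bY_comb)

lemma hip_bY: "hip (bY p) (bY q) = hip (p 0) (q 0) + hip (p N) (q N)"
  by (simp add: hip_def sum_UNIV_Plus bY_def)

lemma nodes_zero: "(\<And>i. i \<in> form_index K \<Longrightarrow> x i = 0) \<Longrightarrow> k \<le> N \<Longrightarrow> nodes x k = 0"
  by (simp add: nodes_def form_index_def vec_eq_iff)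

lemma bY_zero: "p 0 = 0 \<Longrightarrow> p N = 0 \<Longrightarrow> bY p = 0"
  by (auto simp: bY_def vec_eq_iff split: sum.split)

lemma mixed_bv_zero: "(\<And>i. i \<in> form_index K \<Longrightarrow> x i = 0) \<Longrightarrow> mixed_bv K x = 0"
  using bY_zero[of "nodes x"] nodes_zero[of K x] by (simp add: mixed_bv_def vec_eq_iff form_index_def)

lemma multiplier_zero: "(\<And>i. i \<in> form_index K \<Longrightarrow> x i = 0) \<Longrightarrow> multiplier K x = 0"
  by (simp add: multiplier_def vec_eq_iff form_index_def)

lemma hform_reduced_form:
  assumes g: "good a b m \<kappa> P R" and S: "hermitian S"
  shows "hform (form_index K) (reduced_form K S P R)"
proof (rule hformI)
  fix x y z c
  show "reduced_form K S P R x (\<lambda>i. y i + c * z i) = reduced_form K S P R x y + c * reduced_form K S P R x z"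
    unfolding reduced_form_def nodes_comb reduced_energy_comb_right[OF g] mixed_bv_comb multiplier_comb bY_comb
    by (simp add: hip_simps matrix_vector_right_distrib vector_scalar_commute algebra_simps)
next
  fix x y
  show "reduced_form K S P R y x = cnj (reduced_form K S P R x y)"
    unfolding reduced_form_def by (simp add: cnj_hip hip_hermitian[OF S]) (rule reduced_energy_herm[OF g])
next
  fix x y :: "(nat \<times> 'a) + ('a + 'a) \<Rightarrow> complex"
  assume y: "\<And>i. i \<in> form_index K \<Longrightarrow> y i = 0"
  have v: "mixed_bv K y = 0" "multiplier K y = 0" by (rule mixed_bv_zero, rule y, assumption) (rule multiplier_zero, rule y, assumption)
  have ny: "nodes y k = 0" if "k \<le> N" for k by (rule nodes_zero[OF _ that]) (rule y)
  have "reduced_energy P R (nodes x) (nodes y) = 0" by (rule reduced_energy_zero_right[OF g ny])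
  moreover have "bY (nodes y) = 0" by (rule bY_zero) (use ny in auto)
  ultimately show "reduced_form K S P R x y = 0" unfolding reduced_form_def v by (simp add: hip_simps)
qed

abbreviation G :: "'d rmatf \<Rightarrow> 'd rmatf \<Rightarrow> (nat \<Rightarrow> complex^('d::finite)) \<Rightarrow> nat \<Rightarrow> complex^'d" where
  "G P R p \<equiv> flux (solZ P R p) (solJ P R p)"

lemma reduced_form_kernel:
  "(\<forall>y. reduced_form K S P R y x = 0) \<longleftrightarrow>
    (\<forall>k. 0 < k \<and> k < N \<longrightarrow> G P R (nodes x) k = 0) \<and>
    (\<forall>i\<in>K. bY (G P R (nodes x)) $ i = x (Inr i) \<and> (S *v mixed_bv K x) $ i = bY (nodes x) $ i) \<and>
    (\<forall>i. i \<notin> K \<longrightarrow> (S *v mixed_bv K x) $ i = - (bY (G P R (nodes x)) $ i))" (is "_ \<longleftrightarrow> ?R")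
proof -
  define g where "g = G P R (nodes x)"
  \<comment> \<open>\<open>T\<close> and \<open>U\<close> are the residuals of stationarity in the
    boundary values and in the multipliers.\<close>
  define T where "T = (\<chi> i. if i \<in> K then bY g $ i - x (Inr i) else bY g $ i + (S *v mixed_bv K x) $ i)"
  define U where "U = (\<chi> i. if i \<in> K then (S *v mixed_bv K x) $ i - bY (nodes x) $ i else 0)"
  have form: "reduced_form K S P R y x = (\<Sum>k\<in>{0<..<N}. hip (nodes y k) (g k)) + hip (bY (nodes y)) T + hip (multiplier K y) U" for y
  proof -
    have "{..N} = insert 0 (insert N {0<..<N})" using N by auto
    then have "reduced_energy P R (nodes y) (nodes x) = (\<Sum>k\<in>{0<..<N}. hip (nodes y k) (g k)) + hip (bY (nodes y)) (bY g)"
      unfolding reduced_energy_def hip_bY g_def using N by simp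
    moreover have "hip (bY (nodes y)) (bY g) + hip (mixed_bv K y) (S *v mixed_bv K x) - hip (multiplier K y) (bY (nodes x)) - hip (bY (nodes y)) (multiplier K x)
       = hip (bY (nodes y)) T + hip (multiplier K y) U"
    proof -
      have "hip (bY (nodes y)) (bY g) + hip (mixed_bv K y) (S *v mixed_bv K x) - hip (multiplier K y) (bY (nodes x)) - hip (bY (nodes y)) (multiplier K x)
        = (\<Sum>i\<in>UNIV. cnj (bY (nodes y) $ i) * bY g $ i + cnj (mixed_bv K y $ i) * (S *v mixed_bv K x) $ i - cnj (multiplier K y $ i) * bY (nodes x) $ i
           - cnj (bY (nodes y) $ i) * multiplier K x $ i)"
        unfolding hip_def by (simp add: sum.distrib sum_subtractf)
      also have "\<dots> = (\<Sum>i\<in>UNIV. cnj (bY (nodes y) $ i) * T $ i + cnj (multiplier K y $ i) * U $ i)"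
        by (rule sum.cong) (auto simp: T_def U_def multiplier_def mixed_bv_def algebra_simps)
      finally show ?thesis unfolding hip_def by (simp add: sum.distrib)
    qed
    ultimately show ?thesis unfolding reduced_form_def by (simp add: algebra_simps)
  qed
  have "(\<forall>y. reduced_form K S P R y x = 0) \<longleftrightarrow> (\<forall>k\<in>{0<..<N}. g k = 0) \<and> T = 0 \<and> U = 0"
  proof
    assume z: "\<forall>y. reduced_form K S P R y x = 0"
    \<comment> \<open>A test vector whose components are the residuals themselves; the form then
      becomes a sum of squares.\<close>
    define y where "y = (\<lambda>s. case s of Inl (k, j) \<Rightarrow> (if k = 0 then - (T $ Inl j) else if k = N then T $ Inr j else g k $ j) | Inr i \<Rightarrow> U $ i)"
    have y1: "nodes y k = g k" if "k \<in> {0<..<N}" for k using that by (simp add: nodes_def y_def)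
    have y2: "bY (nodes y) = T" using N by (auto simp: bY_def nodes_def y_def vec_eq_iff split: sum.split)
    have y3: "multiplier K y = U" by (simp add: multiplier_def y_def U_def vec_eq_iff)
    have "0 = Re (reduced_form K S P R y x)" using z by simp
    also have "\<dots> = (\<Sum>k\<in>{0<..<N}. (norm (g k))\<^sup>2) + (norm T)\<^sup>2 + (norm U)\<^sup>2"
      unfolding form y2 y3 by (simp add: y1 Re_hip_self)
    finally have s: "(\<Sum>k\<in>{0<..<N}. (norm (g k))\<^sup>2) + (norm T)\<^sup>2 + (norm U)\<^sup>2 = 0" by simp
    have "(\<Sum>k\<in>{0<..<N}. (norm (g k))\<^sup>2) \<ge> 0" by (rule sum_nonneg) simp
    then have s1: "(\<Sum>k\<in>{0<..<N}. (norm (g k))\<^sup>2) = 0" and "(norm T)\<^sup>2 = 0" "(norm U)\<^sup>2 = 0"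
      using s zero_le_power2[of "norm T"] zero_le_power2[of "norm U"] by linarith+
    moreover have "\<forall>k\<in>{0<..<N}. (norm (g k))\<^sup>2 = 0" using s1 by (subst (asm) sum_nonneg_eq_0_iff) auto
    ultimately show "(\<forall>k\<in>{0<..<N}. g k = 0) \<and> T = 0 \<and> U = 0" by simp
  next
    assume "(\<forall>k\<in>{0<..<N}. g k = 0) \<and> T = 0 \<and> U = 0"
    then show "\<forall>y. reduced_form K S P R y x = 0" unfolding form by (simp add: hip_simps)
  qed
  also have "T = 0 \<longleftrightarrow> (\<forall>i. if i \<in> K then bY g $ i = x (Inr i) else (S *v mixed_bv K x) $ i = - (bY g $ i))"
    unfolding T_def vec_eq_iff by (auto simp: eq_neg_iff_add_eq_0 add.commute)
  also have "U = 0 \<longleftrightarrow> (\<forall>i\<in>K. (S *v mixed_bv K x) $ i = bY (nodes x) $ i)"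
    unfolding U_def vec_eq_iff by auto
  finally show ?thesis unfolding g_def[symmetric] by (auto split: if_splits)
qed

lemma psol_diff:
  assumes "psol P R y1 u1 z1 j1" "psol P R y2 u2 z2 j2"
  shows "psol P R (\<lambda>t. y1 t - y2 t) (\<lambda>t. u1 t - u2 t) (\<lambda>t. z1 t - z2 t) (\<lambda>i. j1 i - j2 i)"
proof -
  have "psol P R (\<lambda>t. \<Sum>k\<in>{True, False}. (if k then 1 else -1) *s (if k then y1 else y2) t)
     (\<lambda>t. \<Sum>k\<in>{True, False}. (if k then 1 else -1) *s (if k then u1 else u2) t)
     (\<lambda>t. \<Sum>k\<in>{True, False}. (if k then 1 else -1) *s (if k then z1 else z2) t)
     (\<lambda>i. \<Sum>k\<in>{True, False}. (if k then 1 else -1) *s (if k then j1 else j2) i)"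
    by (rule psol_lincomb) (use assms in auto)
  then show ?thesis by (simp add: vector_sneg_minus1[symmetric])
qed

lemma sol_unique:
  assumes g: "good a b m \<kappa> P R" and s: "psol P R y u z jmp" and p: "\<And>k. k \<le> N \<Longrightarrow> y (tau k) = p k"
  shows "t \<in> {a..b} \<Longrightarrow> solY P R p t = y t" "k \<le> N \<Longrightarrow> G P R p k = flux z jmp k"
proof -
  note d = psol_diff[OF sol_psol(1)[OF g, of p] s]
  have zero: "solY P R p (tau k) - y (tau k) = 0" if "k \<le> N" for k using sol_psol(2)[OF g that] p[OF that] by simp
  show "t \<in> {a..b} \<Longrightarrow> solY P R p t = y t" using psol_unique(1)[OF g d zero] by simp
  have "solZ P R p b = z b" using psol_unique(2)[OF g d zero, of b] ab by simp
  moreover have j: "solJ P R p i = jmp i" if "i < N" for i using psol_unique(3)[OF g d zero that] by simp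
  moreover have "(\<Sum>i<N. solJ P R p i) = (\<Sum>i<N. jmp i)" by (rule sum.cong) (use j in auto)
  ultimately show "k \<le> N \<Longrightarrow> G P R p k = flux z jmp k" unfolding flux_def by simp
qed

text \<open>On the kernel the multipliers equal boundary fluxes, and these are determined by the
  nodal values.\<close>

lemma reduced_form_kernel_nodes:
  assumes g: "good a b m \<kappa> P R" and ker: "\<forall>y. reduced_form K S P R y x = 0" and zero: "\<And>k. k \<le> N \<Longrightarrow> nodes x k = 0" and i: "i \<in> form_index K"
  shows "x i = 0"
proof -
  have "psol P R (\<lambda>_. 0) (\<lambda>_. 0) (\<lambda>_. 0) (\<lambda>_. 0)"
    unfolding psol_def jump_sum_def by (auto simp: mv_simps intro: prim_const)
  from sol_unique(2)[OF g this] zero have G0: "G P R (nodes x) k = 0" if "k \<le> N" for k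
    using that by (simp add: flux_def)
  show ?thesis
  proof (cases i)
    case (Inl kj)
    then obtain k j where kj: "i = Inl (k, j)" "k \<le> N" using i by (cases kj) (auto simp: form_index_def)
    then show ?thesis using zero[of k] by (simp add: nodes_def vec_eq_iff)
  next
    case (Inr l)
    then have "l \<in> K" using i by (auto simp: form_index_def)
    then have "bY (G P R (nodes x)) $ l = x (Inr l)" using ker unfolding reduced_form_kernel by blast
    then show ?thesis using bY_zero[of "G P R (nodes x)"] G0 Inr by simp
  qed
qed

lemma bvY_bY: "bvY a b y = bY (\<lambda>k. y (tau k))"
  by (auto simp: bvY_def bY_def tau_0 tau_N vec_eq_iff split: sum.split)

lemma kernel_bvp_sol:
  assumes g: "good a b m \<kappa> (fst w) (Rl w lam)"
    and ker: "\<forall>y. reduced_form K S (fst w) (Rl w lam) y x = 0"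
  shows "bvp_sol a b w (orbit (nfA K S, nfB K S)) lam (solY (fst w) (Rl w lam) (nodes x))"
proof -
  obtain P Q W where w: "w = (P, Q, W)" by (cases w)
  define R where "R = Rl w lam"
  define y where "y = solY P R (nodes x)"
  define u where "u = solU P R (nodes x)"
  define z0 where "z0 = solZ P R (nodes x)"
  define jm where "jm = solJ P R (nodes x)"
  have g': "good a b m \<kappa> P R" using g by (simp add: w R_def)
  have ps: "psol P R y u z0 jm" unfolding y_def u_def z0_def jm_def by (rule sol_psol(1)[OF g'])
  have py: "prim a b y u" and pz: "prim a b z0 (\<lambda>t. mv (R t) (y t))" and za: "z0 a = 0"
    and Pu: "\<And>t. t \<in> {a..b} \<Longrightarrow> mv (P t) (u t) = z0 t + jump_sum jm t"
    using ps unfolding psol_def by auto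
  have yn: "y (tau k) = nodes x k" if "k \<le> N" for k unfolding y_def by (rule sol_psol(2)[OF g' that])
  have kr: "\<And>k. 0 < k \<and> k < N \<Longrightarrow> flux z0 jm k = 0"
    "\<And>i. i \<in> K \<Longrightarrow> bY (flux z0 jm) $ i = x (Inr i) \<and> (S *v mixed_bv K x) $ i = bY (nodes x) $ i"
    "\<And>i. i \<notin> K \<Longrightarrow> (S *v mixed_bv K x) $ i = - (bY (flux z0 jm) $ i)"
    using ker unfolding reduced_form_kernel w R_def[symmetric, unfolded w] z0_def jm_def by auto
  \<comment> \<open>Vanishing inner fluxes mean that the quasi-derivative has no jumps, so
    \<open>z0\<close> plus the constant \<open>jm 0\<close> is a quasi-derivative on the whole
    interval.\<close>
  have jz: "jm k = 0" if "0 < k" "k < N" for k using kr(1)[of k] that by (simp add: flux_def)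
  have gJ0: "jump_sum jm t = jm 0" if "t \<in> {a..b}" for t
  proof -
    have "jump_sum jm t = (\<Sum>k<N. if k = 0 then jm 0 else 0)"
      unfolding jump_sum_def by (rule sum.cong) (use jz that in \<open>auto simp: tau_0\<close>)
    then show ?thesis using N by simp
  qed
  have sj: "(\<Sum>k<N. jm k) = jm 0"
  proof -
    have "(\<Sum>k<N. jm k) = (\<Sum>k<N. if k = 0 then jm 0 else 0)" by (rule sum.cong) (use jz in auto)
    then show ?thesis using N by simp
  qed
  define z where "z = (\<lambda>t. z0 t + jm 0)"
  have bZ: "bvZ a b z = bY (flux z0 jm)"
    using N by (auto simp: bvZ_def bY_def vec_eq_iff flux_def z_def za sj split: sum.split)
  have bYn: "bY (nodes x) = bvY a b y" unfolding bvY_bY using N yn by (auto simp: bY_def vec_eq_iff split: sum.split)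
  have mvR: "cmat (Q s - lam *\<^sub>R W s) *v y s = mv (R s) (y s)" for s by (simp add: mv_def R_def Rl_def w)
  have sl: "sl_sol a b w lam y z"
    unfolding w sl_sol_def prod.case mvR
  proof (intro conjI exI[of _ u])
    show "u absolutely_integrable_on {a..b}" by (rule bm_absolutely_integrable[OF prim_bm_deriv[OF py]])
    show "\<forall>t\<in>{a..b}. y t = y a + integral {a..t} u" using py unfolding prim_def by blast
    show "AE t in lebesgue_on {a..b}. cmat (P t) *v u t = z t"
      by (rule AE_I2) (simp add: mv_def[symmetric] Pu gJ0 z_def)
    show "(\<lambda>s. mv (R s) (y s)) absolutely_integrable_on {a..b}" by (rule bm_absolutely_integrable[OF prim_bm_deriv[OF pz]])
    show "\<forall>t\<in>{a..b}. z t = z a + integral {a..t} (\<lambda>s. mv (R s) (y s))"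
    proof
      fix t assume "t \<in> {a..b}"
      from primD[OF pz this] show "z t = z a + integral {a..t} (\<lambda>s. mv (R s) (y s))"
        unfolding z_def za by (simp add: add.commute)
    qed
  qed
  have vx: "mixed_bv K x = (\<chi> j. if j \<in> K then bvZ a b z $ j else bvY a b y $ j)"
    unfolding mixed_bv_def bZ bYn[symmetric] using kr(2) by (simp add: vec_eq_iff)
  have "nfA K S *v bvY a b y + nfB K S *v bvZ a b z = 0"
    unfolding vec_eq_iff nf_row vx[symmetric]
    using kr(2,3) by (auto simp: bZ bYn)
  then show ?thesis
    unfolding bvp_sol_def using sl orbit_bc_iff[of "nfA K S" "nfB K S" "bvY a b y" "bvZ a b z"]
    unfolding y_def R_def w by auto
qed

lemma bvp_sol_kernel:
  assumes g: "good a b m \<kappa> (fst w) (Rl w lam)"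
    and y: "bvp_sol a b w (orbit (nfA K S, nfB K S)) lam y"
  shows "\<exists>x u z jmp. psol (fst w) (Rl w lam) y u z jmp \<and> (\<forall>k\<le>N. nodes x k = y (tau k)) \<and> (\<forall>y. reduced_form K S (fst w) (Rl w lam) y x = 0)"
proof -
  obtain P Q W where w: "w = (P, Q, W)" by (cases w)
  define R where "R = Rl w lam"
  have g': "good a b m \<kappa> P R" using g by (simp add: w R_def)
  have mvR: "cmat (Q s - lam *\<^sub>R W s) *v y s = mv (R s) (y s)" for s by (simp add: mv_def R_def Rl_def w)
  obtain z where z: "sl_sol a b w lam y z" "nfA K S *v bvY a b y + nfB K S *v bvZ a b z = 0"
    using y orbit_bc_iff[of "nfA K S" "nfB K S" "bvY a b y"] unfolding bvp_sol_def by blast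
  obtain u0 where u0: "\<forall>t\<in>{a..b}. y t = y a + integral {a..t} u0" "AE t in lebesgue_on {a..b}. cmat (P t) *v u0 t = z t"
    and Ry: "(\<lambda>s. mv (R s) (y s)) absolutely_integrable_on {a..b}"
      "\<forall>t\<in>{a..b}. z t = z a + integral {a..t} (\<lambda>s. mv (R s) (y s))"
    using z(1) unfolding w sl_sol_def prod.case mvR by blast
  have cz: "continuous_on {a..b} z"
  proof (rule continuous_on_eq)
    show "continuous_on {a..b} (\<lambda>t. z a + integral {a..t} (\<lambda>s. mv (R s) (y s)))"
      using Ry(1) by (intro continuous_intros indefinite_integral_continuous_1) (simp add: absolutely_integrable_on_def)
    show "z a + integral {a..t} (\<lambda>s. mv (R s) (y s)) = z t" if "t \<in> {a..b}" for t
      by (rule bspec[OF Ry(2) that, symmetric])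
  qed
  \<comment> \<open>The derivative provided by \<open>sl_sol\<close> is only absolutely integrable.
    It agrees almost everywhere with the inverse of \<open>P\<close> applied to the continuous
    \<open>z\<close>, which is bounded.\<close>
  define u where "u = (\<lambda>t. pinv (P t) (z t))"
  have bu: "bm a b u" unfolding u_def by (rule bm_pinv[OF goodD(1)[OF g'] bm_continuous[OF cz] m goodD(5)[OF g']])
  have uu: "AE t in lebesgue_on {a..b}. u0 t = u t"
  proof -
    have "AE t in lebesgue_on {a..b}. t \<in> {a..b}" by (rule AE_I2) simp
    then show ?thesis using u0(2)
    proof eventually_elim
      case (elim t)
      then have "mv (P t) (u0 t) = z t" by (simp add: mv_def)
      then show ?case unfolding u_def using pinv_iff[OF m goodD(5)[OF g' elim(1)]] by blast
    qed
  qed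
  have py: "prim a b y u"
  proof (rule primI[OF bu])
    fix t assume t: "t \<in> {a..b}"
    show "y t = y a + integral {a..t} u"
      unfolding integral_AE_cong[OF uu t, symmetric] by (rule bspec[OF u0(1) t])
  qed
  have bRy: "bm a b (\<lambda>t. mv (R t) (y t))" by (rule bm_mv[OF goodD(2)[OF g'] prim_bm[OF py]])
  define z0 where "z0 = (\<lambda>t. z t - z a)"
  \<comment> \<open>The initial quasi-derivative is stored as the jump at node 0; there are no
    others.\<close>
  define jm where "jm = (\<lambda>k::nat. if k = 0 then z a else 0)"
  have gJ0: "jump_sum jm t = z a" if "t \<in> {a..b}" for t
  proof -
    have "jump_sum jm t = (\<Sum>k<N. if k = 0 then z a else 0)"
      unfolding jump_sum_def jm_def by (rule sum.cong) (use that in \<open>auto simp: tau_0\<close>)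
    then show ?thesis using N by simp
  qed
  have ps: "psol P R y u z0 jm"
    unfolding psol_def
  proof (intro conjI ballI)
    show "prim a b z0 (\<lambda>t. mv (R t) (y t))"
    proof (rule primI[OF bRy])
      fix t assume t: "t \<in> {a..b}"
      show "z0 t = z0 a + integral {a..t} (\<lambda>t. mv (R t) (y t))"
        using bspec[OF Ry(2) t] unfolding z0_def by simp
    qed
    fix t assume t: "t \<in> {a..b}"
    show "mv (P t) (u t) = z0 t + jump_sum jm t"
      unfolding u_def gJ0[OF t] z0_def using mv_pinv[OF m goodD(5)[OF g' t]] by simp
  qed (use py in \<open>auto simp: z0_def\<close>)
  \<comment> \<open>The nodal values of \<open>y\<close>, with the quasi-derivatives at the two ends
    as multipliers.\<close>
  define x where "x = (\<lambda>s. case s of Inl (k, j) \<Rightarrow> y (tau k) $ j | Inr i \<Rightarrow> bvZ a b z $ i)"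
  have ndx: "nodes x k = y (tau k)" for k by (simp add: nodes_def x_def vec_eq_iff)
  have Gk: "G P R (nodes x) k = flux z0 jm k" if "k \<le> N" for k
    by (rule sol_unique(2)[OF g' ps _ that]) (simp add: ndx)
  have sj: "(\<Sum>k<N. jm k) = z a" using N by (simp add: jm_def)
  have bG: "bY (G P R (nodes x)) = bvZ a b z"
    using N sj Gk[of 0] Gk[of N] by (auto simp: bvZ_def bY_def vec_eq_iff flux_def z0_def jm_def split: sum.split)
  have bYn: "bY (nodes x) = bvY a b y" unfolding bvY_bY by (auto simp: ndx bY_def vec_eq_iff split: sum.split)
  have vx: "mixed_bv K x = (\<chi> j. if j \<in> K then bvZ a b z $ j else bvY a b y $ j)"
    unfolding mixed_bv_def bYn by (simp add: vec_eq_iff x_def)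
  have row: "(S *v mixed_bv K x) $ i = (if i \<in> K then bvY a b y $ i else - (bvZ a b z $ i))" for i
    using z(2) unfolding vec_eq_iff nf_row vx[symmetric] by (simp add: right_minus_eq)
  have Gz: "G P R (nodes x) k = 0" if "0 < k" "k < N" for k
  proof -
    have "flux z0 jm k = 0" unfolding flux_def using that by (simp add: jm_def)
    then show ?thesis using Gk[of k] that by simp
  qed
  have xi: "x (Inr i) = bvZ a b z $ i" for i by (simp add: x_def)
  have "\<forall>y. reduced_form K S P R y x = 0"
    unfolding reduced_form_kernel bG bYn using row Gz xi by auto
  then show ?thesis using ps ndx unfolding w R_def[unfolded w] by auto
qed

text \<open>A supremum of naturals is meaningful only for a bounded set, so it is shown to be an
  attained maximum. Sampling at the nodes loses nothing: a solution that vanishes at all nodes is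
  zero, and a kernel vector is determined by its nodal values.\<close>

lemma eig_mult_zidx:
  assumes g: "good a b m \<kappa> (fst w) (Rl w lam)" and S: "hermitian S"
  shows "eig_mult a b w (orbit (nfA K S, nfB K S)) lam = zidx (form_index K) (reduced_form K S (fst w) (Rl w lam))"
proof -
  define P where "P = fst w"
  define R where "R = Rl w lam"
  define X where "X = orbit (nfA K S, nfB K S)"
  have g': "good a b m \<kappa> P R" using g by (simp add: P_def R_def)
  have hf: "hform (form_index K) (reduced_form K S P R)" by (rule hform_reduced_form[OF g' S])
  define Z where "Z = {card F | F. finite F \<and> F \<subseteq> {y. bvp_sol a b w X lam y} \<and> lin_indep_on a b F}"
  have up: "k \<le> zidx (form_index K) (reduced_form K S P R)" if kZ: "k \<in> Z" for k
  proof -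
    obtain F where F: "k = card F" "finite F" "F \<subseteq> {y. bvp_sol a b w X lam y}" "lin_indep_on a b F"
      using kZ unfolding Z_def by blast
    have "\<forall>f\<in>F. \<exists>q. psol P R f (fst (snd q)) (fst (snd (snd q))) (snd (snd (snd q))) \<and> (\<forall>k\<le>N. nodes (fst q) k = f (tau k)) \<and> (\<forall>y. reduced_form K S P R y (fst q) = 0)"
    proof
      fix f assume "f \<in> F"
      then have "bvp_sol a b w (orbit (nfA K S, nfB K S)) lam f" using F(3) unfolding X_def by blast
      from bvp_sol_kernel[OF g this] obtain x u z jm where
        "psol P R f u z jm \<and> (\<forall>k\<le>N. nodes x k = f (tau k)) \<and> (\<forall>y. reduced_form K S P R y x = 0)"
        unfolding P_def R_def by blast
      then show "\<exists>q. psol P R f (fst (snd q)) (fst (snd (snd q))) (snd (snd (snd q))) \<and> (\<forall>k\<le>N. nodes (fst q) k = f (tau k)) \<and> (\<forall>y. reduced_form K S P R y (fst q) = 0)"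
        by (intro exI[of _ "(x, u, z, jm)"]) simp
    qed
    from bchoice[OF this] obtain q where q: "\<And>f. f \<in> F \<Longrightarrow> psol P R f (fst (snd (q f))) (fst (snd (snd (q f)))) (snd (snd (snd (q f))))"
      "\<And>f k. f \<in> F \<Longrightarrow> k \<le> N \<Longrightarrow> nodes (fst (q f)) k = f (tau k)" "\<And>f y. f \<in> F \<Longrightarrow> reduced_form K S P R y (fst (q f)) = 0" by blast
    have "card F \<le> zidx (form_index K) (reduced_form K S P R)"
    proof (rule kernel_family_card_le[OF hf finite_form_index F(2), of "\<lambda>f. fst (q f)"])
      fix c j assume z: "\<And>i. i \<in> form_index K \<Longrightarrow> lc c (\<lambda>f. fst (q f)) F i = 0" and j: "j \<in> F"
      have zero: "(\<Sum>f\<in>F. c f *s f (tau k)) = 0" if "k \<le> N" for k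
      proof -
        have "nodes (lc c (\<lambda>f. fst (q f)) F) k = 0" by (rule nodes_zero[OF _ that]) (rule z)
        then have "(\<Sum>f\<in>F. c f *s nodes (fst (q f)) k) = 0" unfolding nodes_lc .
        moreover have "(\<Sum>f\<in>F. c f *s nodes (fst (q f)) k) = (\<Sum>f\<in>F. c f *s f (tau k))"
          by (intro sum.cong refl arg_cong2[where f="(*s)"] q(2) that)
        ultimately show ?thesis by simp
      qed
      have ps: "psol P R (\<lambda>t. \<Sum>f\<in>F. c f *s f t) (\<lambda>t. \<Sum>f\<in>F. c f *s fst (snd (q f)) t)
         (\<lambda>t. \<Sum>f\<in>F. c f *s fst (snd (snd (q f))) t) (\<lambda>i. \<Sum>f\<in>F. c f *s snd (snd (snd (q f))) i)"
        by (rule psol_lincomb[OF F(2)]) (rule q(1))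
      have "(\<Sum>f\<in>F. c f *s f t) = 0" if t: "t \<in> {a..b}" for t
        by (rule psol_unique(1)[OF g' ps _ t]) (rule zero)
      then show "c j = 0" using F(4) j unfolding lin_indep_on_def by blast
    qed (use q(3) in auto)
    then show ?thesis by (simp add: F(1))
  qed
  have low: "zidx (form_index K) (reduced_form K S P R) \<in> Z"
  proof -
    from kernel_basis_exists[OF hf finite_form_index] obtain T :: "((nat \<times> 'a) + ('a + 'a)) set" and e where
      T: "finite T" "card T = zidx (form_index K) (reduced_form K S P R)" "\<And>j y. j \<in> T \<Longrightarrow> reduced_form K S P R y (e j) = 0"
      "\<And>c j. (\<forall>i\<in>form_index K. lc c e T i = 0) \<Longrightarrow> j \<in> T \<Longrightarrow> c j = 0" by blast
    define f where "f = (\<lambda>j. solY P R (nodes (e j)))"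
    have indep: "c j = 0" if c: "\<And>t. t \<in> {a..b} \<Longrightarrow> (\<Sum>j\<in>T. c j *s f j t) = 0" and j: "j \<in> T" for c j
    proof -
      have nz: "nodes (lc c e T) k = 0" if k: "k \<le> N" for k
        using c[OF tau_in[OF k]] unfolding nodes_lc f_def by (simp add: sol_psol(2)[OF g' k])
      have "\<forall>y. reduced_form K S P R y (lc c e T) = 0"
        by (simp add: hform_lc_right[OF hf T(1)] T(3))
      then have "\<forall>i\<in>form_index K. lc c e T i = 0" using reduced_form_kernel_nodes[OF g' _ nz] by blast
      then show ?thesis using T(4) j by blast
    qed
    \<comment> \<open>\<open>lin_indep_on\<close> speaks about sets of functions, so distinct
      indices must give distinct functions for the cardinality to come out right.\<close>
    have inj: "inj_on f T"
    proof (rule inj_onI, rule ccontr)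
      fix i j assume ij: "i \<in> T" "j \<in> T" "f i = f j" "i \<noteq> j"
      define c where "c = (\<lambda>k. if k = i then 1 else if k = j then -1 else (0::complex))"
      have "(\<Sum>k\<in>T. c k *s f k t) = 0" for t
      proof -
        have "(\<Sum>k\<in>T. c k *s f k t) = (\<Sum>k\<in>{i, j}. c k *s f k t)"
          by (rule sum.mono_neutral_right) (use ij T(1) in \<open>auto simp: c_def\<close>)
        also have "\<dots> = 0" using ij by (simp add: c_def vector_sneg_minus1[symmetric])
        finally show ?thesis .
      qed
      from indep[OF this ij(1)] show False by (simp add: c_def)
    qed
    have "lin_indep_on a b (f ` T)"
      unfolding lin_indep_on_def
    proof (intro allI impI ballI)
      fix c g assume z: "\<forall>t\<in>{a..b}. (\<Sum>g\<in>f ` T. c g *s g t) = 0" and gT: "g \<in> f ` T"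
      obtain j where j: "j \<in> T" "g = f j" using gT by blast
      have "c (f j) = 0"
        by (rule indep[of "\<lambda>j. c (f j)", OF _ j(1)]) (use z in \<open>simp add: sum.reindex[OF inj]\<close>)
      then show "c g = 0" using j by simp
    qed
    moreover have "f ` T \<subseteq> {y. bvp_sol a b w X lam y}"
      using kernel_bvp_sol[OF g] T(3) unfolding f_def X_def P_def R_def by blast
    moreover have "card (f ` T) = zidx (form_index K) (reduced_form K S P R)" using card_image[OF inj] T(2) by simp
    ultimately show ?thesis unfolding Z_def using T(1) by (intro CollectI exI[of _ "f ` T"]) auto
  qed
  have "Sup Z = zidx (form_index K) (reduced_form K S P R)" by (rule cSup_eq_maximum[OF low up])
  then show ?thesis unfolding eig_mult_def Z_def X_def P_def R_def .
qed

end

section \<open>Dependence on the spectral parameter\<close>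

lemma mv_bound_exists: "\<exists>c\<ge>0. \<forall>(M::real^'n^'n) (x::complex^'n). norm (mv M x) \<le> norm M * norm x * c"
  using bounded_bilinear.nonneg_bounded[OF bounded_bilinear_mv] by blast

lemma abs_quad_le:
  assumes K: "K \<ge> 0" "\<And>M x. norm (mv M x :: complex^'d) \<le> norm (M::real^'d^'d) * norm x * K"
    and M: "norm (M::real^('d::finite)^'d) \<le> C"
  shows "\<bar>Re (hip v (mv M v))\<bar> \<le> K * C * (norm v)\<^sup>2"
proof -
  have "\<bar>Re (hip v (mv M v))\<bar> \<le> norm v * norm (mv M v)"
    using abs_Re_le_cmod norm_hip_le order_trans by blast
  also have "\<dots> \<le> norm v * (norm M * norm v * K)" by (intro mult_left_mono K) auto
  also have "\<dots> \<le> norm v * (C * norm v * K)" using K M by (intro mult_left_mono mult_right_mono) auto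
  finally show ?thesis by (simp add: power2_eq_square mult_ac)
qed

lemma Rl_quad: "Re (hip x (mv (Rl w l t) x)) = Re (hip x (mv (fst (snd w) t) x)) - l * Re (hip x (mv (snd (snd w) t) x))"
  by (simp add: Rl_def mv_simps hip_simps hip_scaleR_right)

text \<open>Only an upper bound for \<open>l\<close> enters, because \<open>W\<close> is positive:
  lowering \<open>l\<close> makes \<open>Rl w l\<close> larger.\<close>

lemma nice_good:
  fixes w :: "('d::finite) coef"
  assumes n: "nice a b \<mu> C w" and K: "K \<ge> 0" "\<And>M x. norm (mv M x :: complex^'d) \<le> norm (M::real^'d^'d) * norm x * K"
    and l: "l \<le> \<Lambda>" "\<Lambda> \<ge> 0" and mu: "\<mu> > 0" and C: "C > 0"
  shows "good a b \<mu> (K * C * (1 + \<Lambda>)) (fst w) (Rl w l)"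
  unfolding good_def
proof (intro conjI ballI)
  show "bm a b (fst w)" by (rule niceD(1)[OF n])
  show "bm a b (Rl w l)" unfolding Rl_def by (intro bm_diff bm_scaleR niceD(2)[OF n] niceD(3)[OF n])
  fix t assume t: "t \<in> {a..b}"
  show "transpose (fst w t) = fst w t" by (rule niceD(4)[OF n t])
  show "transpose (Rl w l t) = Rl w l t"
    using niceD(5)[OF n t] niceD(6)[OF n t] by (simp add: Rl_def transpose_def vec_eq_iff)
  show "\<forall>v. \<mu> * (norm v)\<^sup>2 \<le> Re (hip v (mv (fst w t) v))" using niceD(7)[OF n t] by blast
  show "\<forall>v. - (K * C * (1 + \<Lambda>)) * (norm v)\<^sup>2 \<le> Re (hip v (mv (Rl w l t) v))"
  proof
    fix v :: "complex^'d"
    define q where "q = Re (hip v (mv (fst (snd w) t) v))"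
    define r where "r = Re (hip v (mv (snd (snd w) t) v))"
    define B where "B = K * C * (norm v)\<^sup>2"
    have q: "- B \<le> q" unfolding q_def B_def using abs_quad_le[OF K niceD(10)[OF n t], of v] by linarith
    have r: "r \<le> B" unfolding r_def B_def using abs_quad_le[OF K niceD(11)[OF n t], of v] by linarith
    have "0 \<le> \<mu> * (norm v)\<^sup>2" using mu by simp
    then have r0: "0 \<le> r" unfolding r_def using niceD(8)[OF n t, of v] by linarith
    have "l * r \<le> \<Lambda> * B"
    proof -
      have "l * r \<le> \<Lambda> * r" using l r0 by (intro mult_right_mono) auto
      also have "\<dots> \<le> \<Lambda> * B" using l r by (intro mult_left_mono) auto
      finally show ?thesis .
    qed
    then have "- B - \<Lambda> * B \<le> q - l * r" using q by linarith
    then show "- (K * C * (1 + \<Lambda>)) * (norm v)\<^sup>2 \<le> Re (hip v (mv (Rl w l t) v))"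
      unfolding Rl_quad q_def[symmetric] r_def[symmetric] B_def by (simp add: algebra_simps)
  qed
qed

lemma mesh_exists:
  assumes "a < b" "m > 0" "\<kappa> \<ge> 0"
  shows "\<exists>N. mesh a b m \<kappa> N"
proof -
  obtain N0 :: nat where N0: "8 * \<kappa> * (b - a)\<^sup>2 / m < real N0" using reals_Archimedean2 by blast
  define N where "N = max N0 1"
  have N: "real N \<ge> 1" "N > 0" "8 * \<kappa> * (b - a)\<^sup>2 / m \<le> real N" using N0 by (auto simp: N_def)
  have "8 * \<kappa> * (b - a)\<^sup>2 \<le> real N * m" using N(3) assms by (simp add: pos_divide_le_eq)
  also have "\<dots> \<le> (real N)\<^sup>2 * m" using N assms by (intro mult_right_mono) (auto simp: power2_eq_square)
  finally have "8 * \<kappa> * ((b - a) / real N)\<^sup>2 \<le> m" using N by (simp add: power_divide field_simps)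
  then show ?thesis using assms N by (intro exI[of _ N] mesh.intro) auto
qed

context mesh begin

lemma reduced_form_diff: "reduced_form K S P R2 x y - reduced_energy P R2 (nodes x) (nodes y) = reduced_form K S P R1 x y - reduced_energy P R1 (nodes x) (nodes y)"
  by (simp add: reduced_form_def)

lemma Rl_quad_mono:
  assumes n: "nice a b \<mu> C w" and l: "l1 \<le> l2" and t: "t \<in> {a..b}"
  shows "Re (hip x (mv (Rl w l2 t) x)) \<le> Re (hip x (mv (Rl w l1 t) x)) - ((l2 - l1) * \<mu>) * (norm x)\<^sup>2"
proof -
  have "(l2 - l1) * (\<mu> * (norm x)\<^sup>2) \<le> (l2 - l1) * Re (hip x (mv (snd (snd w) t) x))"
    using l niceD(8)[OF n t] by (intro mult_left_mono) auto
  then show ?thesis unfolding Rl_quad by (simp add: algebra_simps)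
qed

lemma reduced_form_mono:
  assumes n: "nice a b \<mu> C w" and g: "good a b m \<kappa> (fst w) (Rl w l1)" "good a b m \<kappa> (fst w) (Rl w l2)" and l: "l1 \<le> l2"
  shows "Re (reduced_form K S (fst w) (Rl w l2) x x) \<le> Re (reduced_form K S (fst w) (Rl w l1) x x)
     - (l2 - l1) * \<mu> * integral {a..b} (\<lambda>t. (norm (solY (fst w) (Rl w l1) (nodes x) t))\<^sup>2)"
  using reduced_energy_mono[OF g Rl_quad_mono[OF n l], of "nodes x"] arg_cong[OF reduced_form_diff[of K S "fst w" "Rl w l2" x x "Rl w l1"], of Re]
  by simp

lemma reduced_form_tendsto_lam:
  assumes n: "nice a b \<mu> C w" and g: "\<And>l. l \<le> \<Lambda> \<Longrightarrow> good a b m \<kappa> (fst w) (Rl w l)" and S: "hermitian S" and l0: "l0 \<in> {\<alpha>..\<beta>}" "\<beta> \<le> \<Lambda>"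
  shows "((\<lambda>l. reduced_form K S (fst w) (Rl w l) x y) \<longlongrightarrow> reduced_form K S (fst w) (Rl w l0) x y) (at l0 within {\<alpha>..\<beta>})"
proof (rule hform_tendsto[where I = "form_index K" and B = "reduced_form K S (fst w) (Rl w l0)" and Bs = "\<lambda>l. reduced_form K S (fst w) (Rl w l)"])
  have ev: "\<forall>\<^sub>F l in at l0 within {\<alpha>..\<beta>}. good a b m \<kappa> (fst w) (Rl w l)"
    using g l0 by (auto simp: eventually_at_filter intro!: always_eventually)
  show "hform (form_index K) (reduced_form K S (fst w) (Rl w l0))" using g l0 by (intro hform_reduced_form S) auto
  show "\<forall>\<^sub>F l in at l0 within {\<alpha>..\<beta>}. hform (form_index K) (reduced_form K S (fst w) (Rl w l))"
    using ev by eventually_elim (rule hform_reduced_form[OF _ S])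
  fix x
  have "((\<lambda>l. Re (reduced_energy (fst w) (Rl w l) (nodes x) (nodes x))) \<longlongrightarrow> Re (reduced_energy (fst w) (Rl w l0) (nodes x) (nodes x))) (at l0 within {\<alpha>..\<beta>})"
  proof (rule reduced_energy_tendsto[OF _ ev])
    show "good a b m \<kappa> (fst w) (Rl w l0)" using g l0 by auto
    fix \<epsilon> :: real assume e: "\<epsilon> > 0"
    have "((\<lambda>l. \<bar>l - l0\<bar> * C) \<longlongrightarrow> \<bar>l0 - l0\<bar> * C) (at l0 within {\<alpha>..\<beta>})" by (intro tendsto_intros)
    then have "\<forall>\<^sub>F l in at l0 within {\<alpha>..\<beta>}. \<bar>l - l0\<bar> * C < \<epsilon>" by (rule order_tendstoD(2)) (use e in simp)
    then show "\<forall>\<^sub>F l in at l0 within {\<alpha>..\<beta>}. \<forall>t\<in>{a..b}. norm (fst w t - fst w t) \<le> \<epsilon> \<and> norm (Rl w l t - Rl w l0 t) \<le> \<epsilon>"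
    proof eventually_elim
      case (elim l)
      have "norm (Rl w l t - Rl w l0 t) \<le> \<epsilon>" if t: "t \<in> {a..b}" for t
      proof -
        have "Rl w l t - Rl w l0 t = (l0 - l) *\<^sub>R snd (snd w) t" by (simp add: Rl_def algebra_simps)
        then have "norm (Rl w l t - Rl w l0 t) = \<bar>l - l0\<bar> * norm (snd (snd w) t)" by (simp add: abs_minus_commute)
        also have "\<dots> \<le> \<bar>l - l0\<bar> * C" using niceD(11)[OF n t] by (intro mult_left_mono) auto
        finally show ?thesis using elim by simp
      qed
      then show ?case using e by simp
    qed
  qed
  then show "((\<lambda>l. Re (reduced_form K S (fst w) (Rl w l) x x)) \<longlongrightarrow> Re (reduced_form K S (fst w) (Rl w l0) x x)) (at l0 within {\<alpha>..\<beta>})"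
    unfolding reduced_form_def by (auto intro!: tendsto_intros)
qed

lemma reduced_form_ker_node:
  assumes g: "good a b m \<kappa> P R" and ker: "\<And>y. reduced_form K S P R y x = 0" and x: "\<exists>i\<in>form_index K. x i \<noteq> 0"
  shows "\<exists>k\<le>N. nodes x k \<noteq> 0"
  using reduced_form_kernel_nodes[OF g, of K S x] ker x by blast

text \<open>Strict crossing comes from the gain \<open>(l2 - l1) * m\<close> times the mean square
  of a piecewise solution, which is positive since a nonzero kernel vector has a nonzero nodal
  value.\<close>

lemma crossing_eig_mult:
  fixes w :: "('d::finite) coef" and K :: "('d + 'd) set"
  assumes n: "nice a b m C w" and g: "\<And>l. l \<le> \<Lambda> \<Longrightarrow> good a b m \<kappa> (fst w) (Rl w l)" and S: "hermitian S"
    and ab': "\<alpha> \<le> \<beta>" "\<beta> \<le> \<Lambda>"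
  defines "X \<equiv> orbit (nfA K S, nfB K S)"
  shows "finite {l. \<alpha> \<le> l \<and> l < \<beta> \<and> eig_mult a b w X l > 0} \<and>
    nidx (reduced_form K S (fst w) (Rl w \<beta>)) = nidx (reduced_form K S (fst w) (Rl w \<alpha>)) + (\<Sum>l\<in>{l. \<alpha> \<le> l \<and> l < \<beta> \<and> eig_mult a b w X l > 0}. eig_mult a b w X l)"
proof -
  let ?B = "\<lambda>l. reduced_form K S (fst w) (Rl w l)"
  have gl: "good a b m \<kappa> (fst w) (Rl w l)" if "l \<in> {\<alpha>..\<beta>}" for l using g that ab' by auto
  have em: "eig_mult a b w X l = zidx (form_index K) (?B l)" if "l \<in> {\<alpha>..\<beta>}" for l
    unfolding X_def by (rule eig_mult_zidx[OF gl[OF that] S])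
  have "finite {l. \<alpha> \<le> l \<and> l < \<beta> \<and> zidx (form_index K) (?B l) > 0} \<and>
     nidx (?B \<beta>) = nidx (?B \<alpha>) + (\<Sum>l\<in>{l. \<alpha> \<le> l \<and> l < \<beta> \<and> zidx (form_index K) (?B l) > 0}. zidx (form_index K) (?B l))"
  proof (rule nidx_crossing_count[OF finite_form_index ab'(1)])
    show "hform (form_index K) (?B l)" if "l \<in> {\<alpha>..\<beta>}" for l by (rule hform_reduced_form[OF gl[OF that] S])
    show "((\<lambda>l. ?B l x y) \<longlongrightarrow> ?B l0 x y) (at l0 within {\<alpha>..\<beta>})" if "l0 \<in> {\<alpha>..\<beta>}" for l0 x y
      by (rule reduced_form_tendsto_lam[OF n g S that ab'(2)])
    have V0: "0 \<le> (l2 - l1) * m * integral {a..b} (\<lambda>t. (norm (solY (fst w) (Rl w l1) p t))\<^sup>2)"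
      if "l1 \<in> {\<alpha>..\<beta>}" "l1 \<le> l2" for l1 l2 p
      using m that int_norm2_nonneg[OF prim_bm[OF sol_prim[OF gl[OF that(1)]]]] by simp
    show "Re (?B l2 x x) \<le> Re (?B l1 x x)" if "l1 \<in> {\<alpha>..\<beta>}" "l2 \<in> {\<alpha>..\<beta>}" "l1 \<le> l2" for l1 l2 x
      using reduced_form_mono[OF n gl[OF that(1)] gl[OF that(2)] that(3), of K S x] V0[OF that(1,3), of "nodes x"] by linarith
    fix l1 l2 x assume l: "l1 \<in> {\<alpha>..\<beta>}" "l2 \<in> {\<alpha>..\<beta>}" and ker: "\<And>y. ?B l1 y x = 0" and x: "\<exists>i\<in>form_index K. x i \<noteq> 0"
    obtain k where k: "k \<le> N" "nodes x k \<noteq> 0" using reduced_form_ker_node[OF gl[OF l(1)] ker x] by blast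
    have q1: "Re (?B l1 x x) = 0" using ker by simp
    show "(l1 < l2 \<longrightarrow> Re (?B l2 x x) < 0) \<and> (l2 < l1 \<longrightarrow> 0 < Re (?B l2 x x))"
    proof (intro conjI impI)
      assume lt: "l1 < l2"
      have "0 < (l2 - l1) * m * integral {a..b} (\<lambda>t. (norm (solY (fst w) (Rl w l1) (nodes x) t))\<^sup>2)"
        using lt m sol_norm_pos[OF gl[OF l(1)], of k "nodes x"] k by simp
      then show "Re (?B l2 x x) < 0"
        using reduced_form_mono[OF n gl[OF l(1)] gl[OF l(2)] less_imp_le[OF lt], of K S x] q1 by linarith
    next
      assume lt: "l2 < l1"
      \<comment> \<open>For a smaller parameter the comparison runs from \<open>l2\<close> up to
        \<open>l1\<close>, so the gain is that of the solution at \<open>l2\<close> with the nodal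
        values of the kernel vector at \<open>l1\<close>.\<close>
      have "0 < (l1 - l2) * m * integral {a..b} (\<lambda>t. (norm (solY (fst w) (Rl w l2) (nodes x) t))\<^sup>2)"
        using lt m sol_norm_pos[OF gl[OF l(2)], of k "nodes x"] k by simp
      then show "0 < Re (?B l2 x x)"
        using reduced_form_mono[OF n gl[OF l(2)] gl[OF l(1)] less_imp_le[OF lt], of K S x] q1 by linarith
    qed
  qed
  moreover have "{l. \<alpha> \<le> l \<and> l < \<beta> \<and> zidx (form_index K) (?B l) > 0} = {l. \<alpha> \<le> l \<and> l < \<beta> \<and> eig_mult a b w X l > 0}"
    using em by auto
  moreover have "(\<Sum>l\<in>{l. \<alpha> \<le> l \<and> l < \<beta> \<and> eig_mult a b w X l > 0}. zidx (form_index K) (?B l)) =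
    (\<Sum>l\<in>{l. \<alpha> \<le> l \<and> l < \<beta> \<and> eig_mult a b w X l > 0}. eig_mult a b w X l)"
    by (rule sum.cong) (use em in auto)
  ultimately show ?thesis by simp
qed

text \<open>Since \<open>\<zeta>* S \<zeta> \<le> 0\<close>, the mixed term \<open>- 2 \<epsilon> |\<zeta>|\<^sup>2\<close> decides the sign of the form for small \<open>\<epsilon>\<close>.\<close>
definition boundary_test :: "('d + 'd) set \<Rightarrow> real \<Rightarrow> (('d::finite + 'd) \<Rightarrow> complex) \<Rightarrow> (nat \<times> 'd) + ('d + 'd) \<Rightarrow> complex" where
  "boundary_test K \<epsilon> \<zeta> s = (case s of Inr i \<Rightarrow> \<zeta> i | Inl kj \<Rightarrow>
     (if fst kj = 0 then - complex_of_real \<epsilon> * (if Inl (snd kj) \<in> K then \<zeta> (Inl (snd kj)) else 0)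
      else if fst kj = N then complex_of_real \<epsilon> * (if Inr (snd kj) \<in> K then \<zeta> (Inr (snd kj)) else 0) else 0))"

definition restrict_vec :: "'i set \<Rightarrow> ('i \<Rightarrow> complex) \<Rightarrow> complex^'i" where
  "restrict_vec K \<zeta> = (\<chi> i. if i \<in> K then \<zeta> i else 0)"

lemma subform_restrict_vec: "subform K M x y = hip (restrict_vec K x) (M *v restrict_vec K y)"
  by (simp add: subform_def restrict_vec_def)

lemma boundary_test_comb: "boundary_test K \<epsilon> (\<lambda>i. y i + c * z i) = (\<lambda>s. boundary_test K \<epsilon> y s + c * boundary_test K \<epsilon> z s)"
  by (auto simp: boundary_test_def fun_eq_iff algebra_simps split: sum.split)

lemma boundary_test_lc: "finite T \<Longrightarrow> boundary_test K \<epsilon> (lc c e T) = lc c (\<lambda>i. boundary_test K \<epsilon> (e i)) T"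
proof (induction T rule: finite_induct)
  case empty
  then show ?case by (auto simp: boundary_test_def lc_def fun_eq_iff split: sum.split)
next
  case (insert j T)
  have "lc c e (insert j T) = (\<lambda>i. lc c e T i + c j * e j i)" using insert by (simp add: lc_def add.commute)
  then have "boundary_test K \<epsilon> (lc c e (insert j T)) = (\<lambda>s. boundary_test K \<epsilon> (lc c e T) s + c j * boundary_test K \<epsilon> (e j) s)" by (simp only: boundary_test_comb)
  then show ?case using insert by (simp add: lc_def add.commute)
qed

lemma boundary_test_simps:
  "bY (nodes (boundary_test K \<epsilon> \<zeta>)) = complex_of_real \<epsilon> *s restrict_vec K \<zeta>" "mixed_bv K (boundary_test K \<epsilon> \<zeta>) = restrict_vec K \<zeta>" "multiplier K (boundary_test K \<epsilon> \<zeta>) = restrict_vec K \<zeta>"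
  "nodes (boundary_test K \<epsilon> \<zeta>) = (\<lambda>k. 0 + complex_of_real \<epsilon> *s nodes (boundary_test K 1 \<zeta>) k)"
proof -
  show b: "bY (nodes (boundary_test K \<epsilon> \<zeta>)) = complex_of_real \<epsilon> *s restrict_vec K \<zeta>"
    using N by (auto simp: bY_def nodes_def boundary_test_def restrict_vec_def vec_eq_iff split: sum.split)
  show "mixed_bv K (boundary_test K \<epsilon> \<zeta>) = restrict_vec K \<zeta>" unfolding mixed_bv_def b by (auto simp: boundary_test_def restrict_vec_def vec_eq_iff)
  show "multiplier K (boundary_test K \<epsilon> \<zeta>) = restrict_vec K \<zeta>" by (auto simp: multiplier_def boundary_test_def restrict_vec_def vec_eq_iff)
  show "nodes (boundary_test K \<epsilon> \<zeta>) = (\<lambda>k. 0 + complex_of_real \<epsilon> *s nodes (boundary_test K 1 \<zeta>) k)"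
    by (auto simp: nodes_def boundary_test_def vec_eq_iff fun_eq_iff)
qed

lemma reduced_form_boundary_test:
  assumes g: "good a b m \<kappa> P R"
  shows "Re (reduced_form K S P R (boundary_test K \<epsilon> \<zeta>) (boundary_test K \<epsilon> \<zeta>)) =
    \<epsilon>\<^sup>2 * Re (reduced_energy P R (nodes (boundary_test K 1 \<zeta>)) (nodes (boundary_test K 1 \<zeta>))) + Re (subform K S \<zeta> \<zeta>) - 2 * \<epsilon> * (norm (restrict_vec K \<zeta>))\<^sup>2"
proof -
  have z: "reduced_energy P R (\<lambda>_. 0) q = 0" "reduced_energy P R q (\<lambda>_. 0) = 0" for q
    using reduced_energy_zero_left[of "\<lambda>_. 0" P R q] reduced_energy_zero_right[OF g, of "\<lambda>_. 0" q] by auto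
  define H where "H = reduced_energy P R (nodes (boundary_test K 1 \<zeta>)) (nodes (boundary_test K 1 \<zeta>))"
  have "reduced_energy P R (nodes (boundary_test K \<epsilon> \<zeta>)) (nodes (boundary_test K \<epsilon> \<zeta>)) =
      reduced_energy P R (\<lambda>k. 0 + complex_of_real \<epsilon> *s nodes (boundary_test K 1 \<zeta>) k) (\<lambda>k. 0 + complex_of_real \<epsilon> *s nodes (boundary_test K 1 \<zeta>) k)"
    by (simp only: boundary_test_simps(4)[of K \<epsilon> \<zeta>])
  also have "\<dots> = complex_of_real \<epsilon> * (complex_of_real \<epsilon> * H)"
    unfolding reduced_energy_comb_left reduced_energy_comb_right[OF g] z H_def by simp
  finally have "Re (reduced_energy P R (nodes (boundary_test K \<epsilon> \<zeta>)) (nodes (boundary_test K \<epsilon> \<zeta>))) = \<epsilon>\<^sup>2 * Re H"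
    by (simp add: power2_eq_square)
  then show ?thesis
    unfolding reduced_form_def boundary_test_simps(1-3) subform_restrict_vec H_def[symmetric]
    by (simp add: hip_scale_left hip_scale_right hip_self)
qed

lemma hermitian_mat_1: "hermitian (mat 1 :: complex^'n^'n)"
  by (simp add: hermitian_def adj_def mat_def vec_eq_iff)

lemma delta_orth: "orth_fam (\<lambda>x y. - subform K (mat 1) x y) (\<lambda>j i. if i = j then 1 else 0) (\<lambda>_. - 1) (K :: ('n::finite) set)"
proof -
  have "hip (restrict_vec K (\<lambda>i. if i = j then 1 else 0)) (restrict_vec K (\<lambda>i. if i = k then 1 else 0)) = (if j = k then 1 else 0)"
    if "j \<in> K" "k \<in> K" for j k
  proof -
    have "hip (restrict_vec K (\<lambda>i. if i = j then 1 else 0)) (restrict_vec K (\<lambda>i. if i = k then 1 else 0)) = (\<Sum>i\<in>UNIV. if i = j then (if j = k then 1 else 0) else 0)"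
      unfolding hip_def restrict_vec_def by (rule sum.cong) (use that in auto)
    then show ?thesis by simp
  qed
  then show ?thesis unfolding orth_fam_def subform_restrict_vec by simp
qed

text \<open>Each eigenvector of \<open>S_K\<close> with eigenvalue at most 0 yields a negative
  direction: the boundary values are moved slightly along the multiplier, and the coupling term,
  linear in \<open>\<epsilon>\<close>, outweighs the quadratic energy. This is how null directions
  of \<open>S_K\<close> become negative.\<close>

lemma nidx_reduced_form_ge:
  fixes K :: "('d::finite + 'd) set"
  assumes g: "good a b m \<kappa> P R" and S: "hermitian S"
  shows "card K - n_pos K S \<le> nidx (reduced_form K S P R)"
proof -
  have hS: "hform K (subform K S)" by (rule hform_subform[OF S])
  obtain e \<sigma> where d: "diag_basis K (subform K S) e \<sigma>" using exists_diag_basis[OF hS] by auto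
  define T where "T = {i\<in>K. \<sigma> i \<le> 0}"
  have "card {i\<in>K. \<sigma> i > 0} = n_pos K S"
    using pidx_diag[OF hS _ d] pidx_subform[OF S] by simp
  moreover have "card T + card {i\<in>K. \<sigma> i > 0} = card K"
  proof -
    have "K = T \<union> {i\<in>K. \<sigma> i > 0}" by (auto simp: T_def)
    moreover have "card (T \<union> {i\<in>K. \<sigma> i > 0}) = card T + card {i\<in>K. \<sigma> i > 0}"
      by (rule card_Un_disjoint) (auto simp: T_def)
    ultimately show ?thesis by simp
  qed
  ultimately have cT: "card K - n_pos K S = card T" by simp
  define B0 where "B0 = (\<lambda>x y. - subform K (mat 1) x y)"
  define H where "H = (\<lambda>x y. reduced_energy P R (nodes (boundary_test K 1 x)) (nodes (boundary_test K 1 y)))"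
  have hB0: "hform K B0" unfolding B0_def by (rule hform_uminus[OF hform_subform[OF hermitian_mat_1]])
  have hH: "hform K H"
  proof (rule hformI)
    show "H x (\<lambda>i. y i + c * z i) = H x y + c * H x z" for x y z c
      unfolding H_def boundary_test_comb nodes_comb by (rule reduced_energy_comb_right[OF g])
    show "H y x = cnj (H x y)" for x y unfolding H_def by (rule reduced_energy_herm[OF g])
    show "H x y = 0" if "\<And>i. i \<in> K \<Longrightarrow> y i = 0" for x y
      unfolding H_def by (rule reduced_energy_zero_right[OF g]) (use that in \<open>auto simp: nodes_def boundary_test_def vec_eq_iff\<close>)
  qed
  \<comment> \<open>The value at the test vector without the contribution of \<open>S_K\<close>,
    divided by \<open>2 * \<epsilon>\<close>. It perturbs the negative definite \<open>B0\<close>,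
    so \<open>negf_perturb\<close> yields one \<open>\<epsilon>\<close> for all
    \<open>\<zeta>\<close> at once.\<close>
  define Bs where "Bs = (\<lambda>\<epsilon> x y. B0 x y + complex_of_real (\<epsilon> / 2) * H x y)"
  have "\<forall>\<^sub>F \<epsilon> in at_right 0. negf (Bs \<epsilon>) (\<lambda>j i. if i = j then 1 else 0) K"
  proof (rule negf_perturb[OF hB0 _ delta_orth[of K, folded B0_def]])
    show "\<forall>\<^sub>F s in at_right 0. hform K (Bs s)"
      unfolding Bs_def by (rule always_eventually) (intro allI hform_add hB0 hH)
    show "((\<lambda>s. Bs s x y) \<longlongrightarrow> B0 x y) (at_right 0)" for x y
    proof -
      have "((\<lambda>s. Bs s x y) \<longlongrightarrow> B0 x y + complex_of_real (0 / 2) * H x y) (at_right 0)"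
        unfolding Bs_def by (intro tendsto_intros) auto
      then show ?thesis by simp
    qed
  qed auto
  from eventually_happens'[OF _ eventually_conj[OF this eventually_at_right_less[of 0]]] obtain \<epsilon>
    where e: "negf (Bs \<epsilon>) (\<lambda>j i. if i = j then 1 else 0) K" "\<epsilon> > 0" by auto
  have "negf (reduced_form K S P R) (\<lambda>i. boundary_test K \<epsilon> (e i)) T"
    unfolding negf_def
  proof (intro allI impI)
    fix c :: "('d + 'd) \<Rightarrow> complex" assume "\<exists>j\<in>T. c j \<noteq> 0"
    then obtain j where j: "j \<in> T" "c j \<noteq> 0" by blast
    define \<zeta> where "\<zeta> = lc c e T"
    have o: "orth_fam (subform K S) e \<sigma> T" using d unfolding diag_basis_def T_def by (auto intro: orth_fam_subset)
    have "\<exists>i\<in>K. \<zeta> i \<noteq> 0"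
    proof (rule ccontr)
      assume n: "\<not> ?thesis"
      define c' where "c' = (\<lambda>i. if i \<in> T then c i else 0)"
      have "lc c' e K i = \<zeta> i" for i
      proof -
        have "lc c' e K i = (\<Sum>k\<in>K. if k \<in> T then c k * e k i else 0)"
          unfolding lc_def c'_def by (rule sum.cong) auto
        also have "\<dots> = (\<Sum>k\<in>K \<inter> T. c k * e k i)" by (rule sum.inter_restrict[symmetric]) simp
        also have "K \<inter> T = T" by (auto simp: T_def)
        finally show ?thesis by (simp add: lc_def \<zeta>_def)
      qed
      moreover have "\<And>x. \<exists>c. \<forall>i\<in>K. x i = lc c e K i" using d unfolding diag_basis_def by blast
      ultimately have "c' j = 0" using spanning_independent[of K e c' j] n j by (auto simp: T_def)
      then show False using j by (simp add: c'_def)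
    qed
    then have "Re (Bs \<epsilon> (lc \<zeta> (\<lambda>j i. if i = j then 1 else 0) K) (lc \<zeta> (\<lambda>j i. if i = j then 1 else 0) K)) < 0"
      using e(1) unfolding negf_def by blast
    moreover have lcz: "lc \<zeta> (\<lambda>j i. if i = j then 1 else 0) K i = \<zeta> i" if "i \<in> K" for i
    proof -
      have "lc \<zeta> (\<lambda>j i. if i = j then 1 else 0) K i = (\<Sum>j\<in>K. if j = i then \<zeta> i else 0)"
        unfolding lc_def by (rule sum.cong) auto
      then show ?thesis using that by simp
    qed
    have hBs: "hform K (Bs \<epsilon>)" unfolding Bs_def by (intro hform_add hB0 hH)
    have "Bs \<epsilon> (lc \<zeta> (\<lambda>j i. if i = j then 1 else 0) K) (lc \<zeta> (\<lambda>j i. if i = j then 1 else 0) K) = Bs \<epsilon> \<zeta> \<zeta>"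
      by (rule hform_cong2[OF hBs]) (rule lcz, assumption)+
    ultimately have neg: "Re (Bs \<epsilon> \<zeta> \<zeta>) < 0" by (simp only:)
    have "Re (subform K S \<zeta> \<zeta>) = (\<Sum>j\<in>T. \<sigma> j * (cmod (c j))\<^sup>2)"
      unfolding \<zeta>_def diag_quad[OF hS o finite] by simp
    also have "\<dots> \<le> 0" by (intro sum_nonpos) (simp add: T_def mult_nonpos_nonneg)
    finally have sub: "Re (subform K S \<zeta> \<zeta>) \<le> 0" .
    have "Re (reduced_form K S P R (boundary_test K \<epsilon> \<zeta>) (boundary_test K \<epsilon> \<zeta>)) = 2 * \<epsilon> * Re (Bs \<epsilon> \<zeta> \<zeta>) + Re (subform K S \<zeta> \<zeta>)"
      unfolding reduced_form_boundary_test[OF g] Bs_def B0_def H_def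
      by (simp add: subform_restrict_vec hip_self power2_eq_square algebra_simps)
    also have "\<dots> < 0" using mult_pos_neg[OF e(2) neg] sub by linarith
    finally show "Re (reduced_form K S P R (lc c (\<lambda>i. boundary_test K \<epsilon> (e i)) T) (lc c (\<lambda>i. boundary_test K \<epsilon> (e i)) T)) < 0"
      unfolding \<zeta>_def boundary_test_lc[OF finite] .
  qed
  from nidx_ge[OF hform_reduced_form[OF g S] finite_form_index finite this] show ?thesis by (simp add: cT)
qed

end

lemma n_pos_le_card: "hermitian S \<Longrightarrow> n_pos K S \<le> card (K :: ('d::finite + 'd) set)"
  using inertia_sum[OF hform_subform[of S K]] pidx_subform[of S K] by simp

context mesh begin

text \<open>For very negative \<open>\<lambda>\<close> the form is positive on all nodal values
  together with the multipliers from the positive eigenspace of \<open>S_K\<close>: the energy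
  dominates any prescribed multiple of the squared boundary values, and Young's inequality splits
  the coupling between this and the gap \<open>\<tau>\<close> of \<open>S_K\<close>.\<close>

lemma pidx_reduced_form_bot:
  fixes w :: "('d::finite) coef" and K :: "('d + 'd) set"
  assumes n: "nice a b m C w" and g: "\<And>l. l \<le> \<Lambda> \<Longrightarrow> good a b m \<kappa> (fst w) (Rl w l)" and S: "hermitian S"
  shows "\<exists>l0\<le>\<Lambda>. \<forall>l\<le>l0. card (form_index K) - (card K - n_pos K S) \<le> pidx (reduced_form K S (fst w) (Rl w l))"
proof -
  have hS: "hform K (subform K S)" by (rule hform_subform[OF S])
  obtain e \<sigma> where d: "diag_basis K (subform K S) e \<sigma>" using exists_diag_basis[OF hS] by auto
  define Tp where "Tp = {i\<in>K. \<sigma> i > 0}"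
  have cTp: "card Tp = n_pos K S" using pidx_diag[OF hS _ d] pidx_subform[OF S] by (simp add: Tp_def)
  define B0 where "B0 = (\<lambda>x y. - subform K S x y)"
  \<comment> \<open>\<open>subform K (mat 1)\<close> is the squared length, so a positive parameter
    for which this stays negative is a lower bound for \<open>S_K\<close> on its positive
    eigenspace.\<close>
  define Bs where "Bs = (\<lambda>\<epsilon> x y. B0 x y + complex_of_real \<epsilon> * subform K (mat 1) x y)"
  have hB0: "hform K B0" unfolding B0_def by (rule hform_uminus[OF hS])
  have "\<forall>\<^sub>F \<epsilon> in at_right 0. negf (Bs \<epsilon>) e Tp"
  proof (rule negf_perturb[OF hB0])
    show "\<forall>\<^sub>F s in at_right 0. hform K (Bs s)"
      unfolding Bs_def by (rule always_eventually) (intro allI hform_add hB0 hform_subform hermitian_mat_1)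
    show "orth_fam B0 e (\<lambda>i. - \<sigma> i) Tp"
      using diag_basis_uminus[OF d] unfolding diag_basis_def B0_def Tp_def by (auto intro: orth_fam_subset)
    show "((\<lambda>s. Bs s x y) \<longlongrightarrow> B0 x y) (at_right 0)" for x y
    proof -
      have "((\<lambda>s. Bs s x y) \<longlongrightarrow> B0 x y + complex_of_real 0 * subform K (mat 1) x y) (at_right 0)"
        unfolding Bs_def by (intro tendsto_intros)
      then show ?thesis by simp
    qed
  qed (auto simp: Tp_def)
  from eventually_happens'[OF _ eventually_conj[OF this eventually_at_right_less[of 0]]] obtain \<tau>
    where \<tau>: "negf (Bs \<tau>) e Tp" "\<tau> > 0" by auto
  have coer: "\<tau> * (norm (restrict_vec K (lc c e Tp)))\<^sup>2 < Re (subform K S (lc c e Tp) (lc c e Tp))" if "\<exists>j\<in>Tp. c j \<noteq> 0" for c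
  proof -
    have "Re (Bs \<tau> (lc c e Tp) (lc c e Tp)) < 0" using \<tau>(1) that unfolding negf_def by blast
    moreover have "Re (Bs \<tau> \<zeta> \<zeta>) = \<tau> * (norm (restrict_vec K \<zeta>))\<^sup>2 - Re (subform K S \<zeta> \<zeta>)" for \<zeta>
      unfolding Bs_def B0_def subform_restrict_vec by (simp add: hip_self)
    ultimately show ?thesis by simp
  qed
  obtain s where s: "s \<ge> 0" "\<And>v. norm (S *v v) \<le> norm v * s"
    using bounded_linear.nonneg_bounded[of "\<lambda>v. S *v v"] linear_cmv linear_conv_bounded_linear by blast
  obtain k where k: "k \<ge> 0" "\<And>M x. norm (mv M x :: complex^'d) \<le> norm (M::real^'d^'d) * norm x * k"
    using mv_bound_exists by blast
  \<comment> \<open>Room for the boundary block of \<open>S\<close>, bounded by \<open>s\<close>,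
    and for the Young remainder \<open>(s + 1)\<^sup>2 / \<tau>\<close>; here \<open>s + 1\<close>
    bounds the coupling through \<open>S\<close> and through the identity.\<close>
  define C' where "C' = s + 2 * (s + 1)\<^sup>2 / \<tau> + 1"
  have C': "C' > 0" using s \<tau> unfolding C'_def by (simp add: add_nonneg_pos)
  \<comment> \<open>Makes \<open>2 * C' * \<delta> = m\<close>, so the derivative terms of the trace
    bounds at the two ends are absorbed by the energy of \<open>P\<close>.\<close>
  define \<delta> where "\<delta> = m / (2 * C')"
  have \<delta>: "\<delta> > 0" using m C' by (simp add: \<delta>_def)
  \<comment> \<open>The lower bound required of \<open>R\<close> for absorbing the mean-square terms
    as well; the extra 1 leaves the term \<open>V\<close> that is needed for strictness.\<close>
  define D where "D = 2 * C' * (1 / (b - a) + 1 / \<delta>) + 1"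
  have D: "D > 0" using C' ab \<delta> unfolding D_def by (simp add: add_pos_pos)
  \<comment> \<open>Below this level \<open>Q - l W\<close> is bounded below by
    \<open>- l * m - k * C\<close>, hence by \<open>D\<close>.\<close>
  define l0 where "l0 = min \<Lambda> (min 0 (- (D + k * C) / m))"
  have bottom: "card (form_index K) - (card K - n_pos K S) \<le> pidx (reduced_form K S (fst w) (Rl w l))" if l: "l \<le> l0" for l
  proof -
    define P where "P = fst w"
    define R where "R = Rl w l"
    have gl: "good a b m \<kappa> P R" using g l unfolding P_def R_def l0_def by auto
    have l1: "l \<le> 0" "D + k * C \<le> - l * m"
    proof -
      show "l \<le> 0" using l by (simp add: l0_def)
      have "l \<le> - (D + k * C) / m" using l by (simp add: l0_def)
      then show "D + k * C \<le> - l * m" using m by (simp add: pos_le_divide_eq)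
    qed
    have Rge: "D * (norm v)\<^sup>2 \<le> Re (hip v (mv (R t) v))" if t: "t \<in> {a..b}" for t v
    proof -
      have "- (k * C * (norm v)\<^sup>2) \<le> Re (hip v (mv (fst (snd w) t) v))"
        using abs_quad_le[OF k niceD(10)[OF n t], of v] by linarith
      moreover have "- l * (m * (norm v)\<^sup>2) \<le> - l * Re (hip v (mv (snd (snd w) t) v))"
        using l1(1) niceD(8)[OF n t] by (intro mult_left_mono) auto
      moreover have "(D + k * C) * (norm v)\<^sup>2 \<le> (- l * m) * (norm v)\<^sup>2" using l1(2) by (intro mult_right_mono) auto
      ultimately show ?thesis unfolding R_def Rl_quad by (simp add: algebra_simps)
    qed
    have Hge: "integral {a..b} (\<lambda>t. (norm (solY P R p t))\<^sup>2) + C' * (norm (bY p))\<^sup>2 \<le> Re (reduced_energy P R p p)" for p :: "nat \<Rightarrow> complex^'d"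
    proof -
      define V where "V = integral {a..b} (\<lambda>t. (norm (solY P R p t))\<^sup>2)"
      define U where "U = integral {a..b} (\<lambda>t. (norm (solU P R p t))\<^sup>2)"
      have Y: "prim a b (solY P R p) (solU P R p)" by (rule sol_prim[OF gl])
      have mU: "m * U + D * V \<le> Re (reduced_energy P R p p)"
        unfolding U_def V_def reduced_energy_energy_sol[OF gl] by (rule Re_energy_ge[OF gl Y Rge])
      have tr: "(norm (p k))\<^sup>2 \<le> \<delta> * U + (1 / (b - a) + 1 / \<delta>) * V" if k: "k \<le> N" for k
        using trace_bound[OF Y ab tau_in[OF k] \<delta>] sol_psol(2)[OF gl k, of p] unfolding U_def V_def by simp
      from tr[of 0] tr[of N] have "(norm (bY p))\<^sup>2 \<le> 2 * (\<delta> * U + (1 / (b - a) + 1 / \<delta>) * V)"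
        using Re_hip_self[of "bY p"] Re_hip_self[of "p 0"] Re_hip_self[of "p N"] unfolding hip_bY by simp
      then have "C' * (norm (bY p))\<^sup>2 \<le> C' * (2 * (\<delta> * U + (1 / (b - a) + 1 / \<delta>) * V))"
        using C' by (intro mult_left_mono) auto
      also have "\<dots> = m * U + (D - 1) * V"
      proof -
        have d2: "2 * C' * \<delta> = m" using C' by (simp add: \<delta>_def)
        have "C' * (2 * (\<delta> * U + X * V)) = (2 * C' * \<delta>) * U + (2 * C' * X) * V" for X by (simp add: algebra_simps)
        then show ?thesis unfolding d2 D_def by simp
      qed
      finally show ?thesis using mU unfolding V_def[symmetric] by (simp add: algebra_simps)
    qed
    \<comment> \<open>Indices of the claimed positive subspace: unit vectors for the nodal values
      and eigenvectors in \<open>Tp\<close> for the multipliers, in total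
      \<open>card (form_index K)\<close> minus \<open>card K - n_pos K S\<close>.\<close>
    define T where "T = Inl ` ({..N} \<times> (UNIV::'d set)) \<union> Inr ` Tp"
    define v :: "(nat \<times> 'd) + ('d + 'd) \<Rightarrow> (nat \<times> 'd) + ('d + 'd) \<Rightarrow> complex"
      where "v = (\<lambda>s r. case s of Inl kj \<Rightarrow> (if r = Inl kj then 1 else 0) | Inr i \<Rightarrow> (case r of Inl _ \<Rightarrow> 0 | Inr i' \<Rightarrow> e i i'))"
    have finT: "finite T" by (simp add: T_def)
    have sumT: "lc c v T r = (\<Sum>kj\<in>{..N} \<times> UNIV. c (Inl kj) * v (Inl kj) r) + (\<Sum>i\<in>Tp. c (Inr i) * v (Inr i) r)" for c r
    proof -
      have "Inl ` ({..N} \<times> (UNIV::'d set)) \<inter> Inr ` Tp = {}" by auto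
      then show ?thesis unfolding lc_def T_def
        by (subst sum.union_disjoint) (auto simp: sum.reindex inj_on_def)
    qed
    have xl: "lc c v T (Inl (k, j)) = c (Inl (k, j))" if "k \<le> N" for c k j
    proof -
      have "(\<Sum>kj\<in>{..N} \<times> UNIV. c (Inl kj) * v (Inl kj) (Inl (k, j))) = (\<Sum>kj\<in>{..N} \<times> UNIV. if kj = (k, j) then c (Inl (k, j)) else 0)"
        by (rule sum.cong) (auto simp: v_def)
      also have "\<dots> = c (Inl (k, j))" using that by simp
      finally show ?thesis unfolding sumT by (simp add: v_def)
    qed
    have xr: "lc c v T (Inr i) = lc (\<lambda>i. c (Inr i)) e Tp i" for c i
      unfolding sumT by (simp add: v_def lc_def)
    have "negf (\<lambda>x y. - reduced_form K S P R x y) v T"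
      unfolding negf_def
    proof (intro allI impI)
      fix c :: "(nat \<times> 'd) + ('d + 'd) \<Rightarrow> complex" assume "\<exists>j\<in>T. c j \<noteq> 0"
      then obtain s0 where s0: "s0 \<in> T" "c s0 \<noteq> 0" by blast
      define x where "x = lc c v T"
      define \<zeta> where "\<zeta> = lc (\<lambda>i. c (Inr i)) e Tp"
      have ztx: "multiplier K x = restrict_vec K \<zeta>" unfolding multiplier_def restrict_vec_def x_def xr \<zeta>_def ..
      define bc where "bc = (\<chi> i. if i \<in> K then 0 else bY (nodes x) $ i)"
      have vvx: "mixed_bv K x = bc + multiplier K x" by (simp add: mixed_bv_def bc_def multiplier_def vec_eq_iff)
      define Z where "Z = norm (multiplier K x)"
      define Y where "Y = norm (bY (nodes x))"
      have bcY: "norm bc \<le> Y" unfolding Y_def by (rule norm_le_componentwise_cart) (simp add: bc_def)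
      have YZ: "Y \<ge> 0" "Z \<ge> 0" by (auto simp: Y_def Z_def)
      have absRe: "\<bar>Re (hip p q)\<bar> \<le> norm p * norm q" for p q :: "complex^('d + 'd)"
        unfolding Re_hip by (rule Cauchy_Schwarz_ineq2)
      have Sb: "norm (S *v bc) \<le> Y * s" using order_trans[OF s(2) mult_right_mono[OF bcY s(1)]] .
      have f1: "- (s * Y\<^sup>2) \<le> Re (hip bc (S *v bc))"
      proof -
        have "\<bar>Re (hip bc (S *v bc))\<bar> \<le> Y * (Y * s)" using order_trans[OF absRe mult_mono[OF bcY Sb]] YZ by simp
        then show ?thesis by (simp add: power2_eq_square mult_ac)
      qed
      have f2: "- (Z * (Y * s)) \<le> Re (hip (multiplier K x) (S *v bc))"
        using absRe[of "multiplier K x" "S *v bc"] mult_left_mono[OF Sb YZ(2)] unfolding Z_def by linarith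
      have f3: "Re (hip (multiplier K x) (bY (nodes x))) \<le> Z * Y"
        using absRe[of "multiplier K x" "bY (nodes x)"] unfolding Z_def Y_def by linarith
      have f4: "Re (hip bc (S *v multiplier K x)) = Re (hip (multiplier K x) (S *v bc))"
        using hip_hermitian[OF S, of bc "multiplier K x"] cnj_hip[of "multiplier K x" "S *v bc"] by (metis cnj.simps(1))
      have f5: "Re (hip (bY (nodes x)) (multiplier K x)) = Re (hip (multiplier K x) (bY (nodes x)))"
        by (simp add: Re_hip inner_commute)
      have q: "Re (reduced_form K S P R x x) = Re (reduced_energy P R (nodes x) (nodes x)) + Re (hip bc (S *v bc)) + 2 * Re (hip (multiplier K x) (S *v bc))
          + Re (subform K S \<zeta> \<zeta>) - 2 * Re (hip (multiplier K x) (bY (nodes x)))"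
        unfolding reduced_form_def vvx subform_restrict_vec ztx[symmetric] using f4 f5
        by (simp add: matrix_vector_right_distrib hip_simps)
      have young: "2 * (s + 1) * (Z * Y) \<le> \<tau> * Z\<^sup>2 + (C' - s) * Y\<^sup>2"
      proof -
        have "0 \<le> (\<tau> * Z - (s + 1) * Y)\<^sup>2 / \<tau>" using \<tau> by simp
        also have "\<dots> = \<tau> * Z\<^sup>2 - 2 * (s + 1) * (Z * Y) + (s + 1)\<^sup>2 / \<tau> * Y\<^sup>2"
          using \<tau> by (simp add: power2_diff field_simps power2_eq_square)
        finally have "2 * (s + 1) * (Z * Y) \<le> \<tau> * Z\<^sup>2 + (s + 1)\<^sup>2 / \<tau> * Y\<^sup>2" by simp
        moreover have "(s + 1)\<^sup>2 / \<tau> * Y\<^sup>2 \<le> (C' - s) * Y\<^sup>2"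
        proof (rule mult_right_mono)
          have "0 \<le> (s + 1)\<^sup>2 / \<tau>" using \<tau> by simp
          then show "(s + 1)\<^sup>2 / \<tau> \<le> C' - s" by (simp add: C'_def)
        qed simp
        ultimately show ?thesis by linarith
      qed
      have sub: "\<tau> * Z\<^sup>2 \<le> Re (subform K S \<zeta> \<zeta>)"
      proof (cases "\<exists>i\<in>Tp. c (Inr i) \<noteq> 0")
        case True
        from coer[of "\<lambda>i. c (Inr i)", OF True] show ?thesis unfolding Z_def ztx \<zeta>_def by simp
      next
        case False
        then have "\<zeta> = (\<lambda>i. 0)" by (auto simp: \<zeta>_def lc_def)
        then have "restrict_vec K \<zeta> = 0" by (simp add: restrict_vec_def vec_eq_iff)
        then show ?thesis unfolding Z_def ztx subform_restrict_vec by (simp add: hip_simps)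
      qed
      define V where "V = integral {a..b} (\<lambda>t. (norm (solY P R (nodes x) t))\<^sup>2)"
      have H: "V + C' * Y\<^sup>2 \<le> Re (reduced_energy P R (nodes x) (nodes x))" unfolding V_def Y_def by (rule Hge)
      have V0: "V \<ge> 0" unfolding V_def by (rule int_norm2_nonneg[OF prim_bm[OF sol_prim[OF gl]]])
      have low: "V + (Re (subform K S \<zeta> \<zeta>) - \<tau> * Z\<^sup>2) \<le> Re (reduced_form K S P R x x)"
        unfolding q using H f1 f2 f3 young by (simp add: algebra_simps)
      have "0 < Re (reduced_form K S P R x x)"
      proof (cases "\<exists>i\<in>Tp. c (Inr i) \<noteq> 0")
        case True
        from coer[of "\<lambda>i. c (Inr i)", OF True] have "\<tau> * Z\<^sup>2 < Re (subform K S \<zeta> \<zeta>)" unfolding Z_def ztx \<zeta>_def .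
        then show ?thesis using low V0 by linarith
      next
        case False
        then obtain k j where kj: "k \<le> N" "c (Inl (k, j)) \<noteq> 0" using s0 unfolding T_def by auto
        then have "nodes x k $ j \<noteq> 0" using xl[OF kj(1), of c j] by (simp add: nodes_def x_def)
        then have "nodes x k \<noteq> 0" by auto
        from sol_norm_pos[where p = "nodes x" and k = k, OF gl kj(1) this] have "V > 0" unfolding V_def .
        then show ?thesis using low sub by linarith
      qed
      then show "Re (- reduced_form K S P R (lc c v T) (lc c v T)) < 0" by (simp add: x_def)
    qed
    from nidx_ge[OF hform_uminus[OF hform_reduced_form[OF gl S]] finite_form_index finT this]
    have "card T \<le> pidx (reduced_form K S P R)" .
    moreover have "card T = card (Inl ` ({..N} \<times> (UNIV::'d set)) :: ((nat \<times> 'd) + ('d + 'd)) set) + card Tp"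
      unfolding T_def by (subst card_Un_disjoint) (auto simp: card_image)
    moreover have "card (form_index K) = card (Inl ` ({..N} \<times> (UNIV::'d set)) :: ((nat \<times> 'd) + ('d + 'd)) set) + card K"
      unfolding form_index_def by (subst card_Un_disjoint) (auto simp: card_image)
    ultimately show ?thesis unfolding P_def R_def using cTp n_pos_le_card[OF S, of K] by linarith
  qed
  show ?thesis by (rule exI[of _ l0]) (use bottom in \<open>auto simp: l0_def\<close>)
qed

text \<open>The lower bounds for the two indices add up to the full dimension, so both are
  equalities.\<close>

lemma nidx_reduced_form_bot:
  fixes w :: "('d::finite) coef" and K :: "('d + 'd) set"
  assumes n: "nice a b m C w" and g: "\<And>l. l \<le> \<Lambda> \<Longrightarrow> good a b m \<kappa> (fst w) (Rl w l)" and S: "hermitian S"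
  shows "\<exists>l0\<le>\<Lambda>. \<forall>l\<le>l0. nidx (reduced_form K S (fst w) (Rl w l)) = card K - n_pos K S"
proof -
  obtain l0 where l0: "l0 \<le> \<Lambda>" "\<And>l. l \<le> l0 \<Longrightarrow> card (form_index K) - (card K - n_pos K S) \<le> pidx (reduced_form K S (fst w) (Rl w l))"
    using pidx_reduced_form_bot[OF n g S, where K = K] by blast
  have "nidx (reduced_form K S (fst w) (Rl w l)) = card K - n_pos K S" if l: "l \<le> l0" for l
  proof -
    have gl: "good a b m \<kappa> (fst w) (Rl w l)" using g l l0(1) by auto
    have "card K \<le> card (form_index K)"
    proof -
      have "card K = card (Inr ` K :: ((nat \<times> 'd) + ('d + 'd)) set)" by (simp add: card_image)
      also have "\<dots> \<le> card (form_index K)" by (rule card_mono[OF finite_form_index]) (simp add: form_index_def)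
      finally show ?thesis .
    qed
    then show ?thesis
      using nidx_reduced_form_ge[OF gl S, of K] l0(2)[OF l] inertia_sum[OF hform_reduced_form[OF gl S] finite_form_index, of K] by linarith
  qed
  then show ?thesis using l0(1) by blast
qed

text \<open>Counting starts at a level below which the index is constant, so no eigenvalue can lie
  there. From that level on, the growth of the index up to \<open>\<beta>\<close> counts the
  eigenvalues strictly below \<open>\<beta>\<close>, and the nullity adds \<open>\<beta>\<close>
  itself.\<close>

lemma eig_count_nidx:
  fixes w :: "('d::finite) coef" and K :: "('d + 'd) set"
  assumes n: "nice a b m C w" and g: "\<And>l. l \<le> \<Lambda> \<Longrightarrow> good a b m \<kappa> (fst w) (Rl w l)" and S: "hermitian S"
    and b: "\<beta> \<le> \<Lambda>"
  defines "X \<equiv> orbit (nfA K S, nfB K S)"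
  shows "finite {l. l \<le> \<beta> \<and> eig_mult a b w X l > 0}"
    "eig_count a b w X \<beta> + (card K - n_pos K S) = nidx (reduced_form K S (fst w) (Rl w \<beta>)) + zidx (form_index K) (reduced_form K S (fst w) (Rl w \<beta>))"
    "\<exists>l0. \<forall>l\<le>l0. eig_mult a b w X l = 0"
proof -
  let ?B = "\<lambda>l. reduced_form K S (fst w) (Rl w l)"
  obtain l0 where l0: "l0 \<le> \<Lambda>" "\<And>l. l \<le> l0 \<Longrightarrow> nidx (?B l) = card K - n_pos K S"
    using nidx_reduced_form_bot[OF n g S, where K = K] by blast
  \<comment> \<open>An eigenvalue below \<open>l0\<close> would raise the negative index between
    \<open>l\<close> and \<open>l0\<close>, where it is constant.\<close>
  have low: "eig_mult a b w X l = 0" if l: "l < l0" for l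
  proof (rule ccontr)
    assume ne: "eig_mult a b w X l \<noteq> 0"
    let ?E = "{l'. l \<le> l' \<and> l' < l0 \<and> eig_mult a b w X l' > 0}"
    have c: "finite ?E \<and> nidx (?B l0) = nidx (?B l) + (\<Sum>l\<in>?E. eig_mult a b w X l)"
      unfolding X_def by (rule crossing_eig_mult[OF n g S]) (use l l0 in auto)
    moreover have "nidx (?B l0) = nidx (?B l)" using l0(2)[of l] l0(2)[of l0] l by simp
    ultimately have "(\<Sum>l\<in>?E. eig_mult a b w X l) = 0" "finite ?E" by simp_all
    moreover have "l \<in> ?E" using l ne by auto
    ultimately show False using ne by simp
  qed
  \<comment> \<open>\<open>low\<close> covers only levels strictly below \<open>l0\<close>, hence
    the shift by 1.\<close>
  then show "\<exists>l0. \<forall>l\<le>l0. eig_mult a b w X l = 0" by (intro exI[of _ "l0 - 1"]) auto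
  define \<alpha> where "\<alpha> = min l0 \<beta>"
  let ?E = "{l. \<alpha> \<le> l \<and> l < \<beta> \<and> eig_mult a b w X l > 0}"
  have c: "finite ?E \<and> nidx (?B \<beta>) = nidx (?B \<alpha>) + (\<Sum>l\<in>?E. eig_mult a b w X l)"
    unfolding X_def by (rule crossing_eig_mult[OF n g S]) (use b in \<open>auto simp: \<alpha>_def\<close>)
  have na: "nidx (?B \<alpha>) = card K - n_pos K S" by (rule l0(2)) (simp add: \<alpha>_def)
  have em: "eig_mult a b w X \<beta> = zidx (form_index K) (?B \<beta>)"
    unfolding X_def by (rule eig_mult_zidx[OF g[OF b] S])
  have eq: "{l. l \<le> \<beta> \<and> eig_mult a b w X l > 0} = ?E \<union> (if eig_mult a b w X \<beta> > 0 then {\<beta>} else {})"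
  proof -
    have ge: "l \<ge> \<alpha>" if "eig_mult a b w X l > 0" for l
    proof (rule ccontr)
      assume "\<not> ?thesis"
      then have "l < l0" by (simp add: \<alpha>_def)
      from low[OF this] that show False by simp
    qed
    have "l \<le> \<beta> \<and> eig_mult a b w X l > 0 \<longleftrightarrow> l \<in> ?E \<union> (if eig_mult a b w X \<beta> > 0 then {\<beta>} else {})" for l
    proof (cases "l = \<beta>")
      case False
      then have "l \<le> \<beta> \<longleftrightarrow> l < \<beta>" by linarith
      then show ?thesis using ge[of l] False by auto
    qed simp
    then show ?thesis by (intro set_eqI) (simp only: mem_Collect_eq)
  qed
  show "finite {l. l \<le> \<beta> \<and> eig_mult a b w X l > 0}" unfolding eq using c by auto
  have "eig_count a b w X \<beta> = (\<Sum>l\<in>?E. eig_mult a b w X l) + eig_mult a b w X \<beta>"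
    unfolding eig_count_def eq using c by (subst sum.union_disjoint) auto
  then show "eig_count a b w X \<beta> + (card K - n_pos K S) = nidx (?B \<beta>) + zidx (form_index K) (?B \<beta>)"
    using c na em by simp
qed

end

section \<open>Polynomial test functions\<close>

lemma prim_of_real_poly:
  fixes p :: "real poly" and e :: "complex^'n"
  shows "prim a b (\<lambda>t. complex_of_real (poly p t) *s e) (\<lambda>t. complex_of_real (poly (pderiv p) t) *s e)"
proof -
  have "prim a b (poly p) (poly (pderiv p))"
  proof (rule primI)
    show "bm a b (poly (pderiv p))" by (intro bm_continuous continuous_intros)
    fix t assume t: "t \<in> {a..b}"
    have "((poly (pderiv p)) has_integral (poly p t - poly p a)) {a..t}"
      using t by (intro fundamental_theorem_of_calculus)
        (auto simp: has_real_derivative_iff_has_vector_derivative[symmetric] intro: DERIV_subset[OF poly_DERIV])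
    then show "poly p t = poly p a + integral {a..t} (poly (pderiv p))" by (simp add: integral_unique)
  qed
  moreover have "bounded_linear (\<lambda>r. complex_of_real r *s e)"
    unfolding linear_conv_bounded_linear[symmetric]
    by (rule linearI) (simp_all add: vec_eq_iff algebra_simps scaleR_conv_of_real[where 'a = complex])
  ultimately show ?thesis by (rule prim_linear[rotated])
qed

text \<open>The quadratic factor vanishes at both ends, so with zero multipliers all boundary terms
  of the reduced form disappear, whatever the boundary condition.\<close>

definition bump_poly :: "real \<Rightarrow> real \<Rightarrow> nat \<Rightarrow> real poly" where
  "bump_poly a b j = monom 1 j * ([:- a, 1:] * [:b, -1:])"

lemma poly_bump_poly: "poly (bump_poly a b j) t = t ^ j * ((t - a) * (b - t))"
  by (simp add: bump_poly_def poly_monom algebra_simps)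

lemma monomials_independent:
  assumes ab: "a < (b::real)" and z: "\<And>t. a < t \<Longrightarrow> t < b \<Longrightarrow> (\<Sum>j<n. c j * complex_of_real t ^ j) = 0" and j: "j < n"
  shows "c j = (0::complex)"
proof -
  define p where "p = (\<Sum>j<n. monom (c j) j)"
  have "poly p (complex_of_real t) = 0" if "t \<in> {a<..<b}" for t
    using z[of t] that by (simp add: p_def poly_sum poly_monom)
  then have "complex_of_real ` {a<..<b} \<subseteq> {z. poly p z = 0}" by auto
  moreover have "infinite (complex_of_real ` {a<..<b})"
    using ab by (simp add: finite_image_iff inj_on_def)
  ultimately have "p = 0" using poly_roots_finite[of p] finite_subset by blast
  then have "coeff p j = 0" by simp
  then show ?thesis using j by (simp add: p_def coeff_sum)
qed

section \<open>Counting eigenvalues\<close>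

lemma energy_affine:
  assumes n: "nice a b \<mu> C w" and v: "prim a b v v'" and y: "prim a b y y'"
  shows "energy a b (fst w) (Rl w l) v v' y y' = energy a b (fst w) (Rl w 0) v v' y y'
     + complex_of_real l * (energy a b (fst w) (Rl w 1) v v' y y' - energy a b (fst w) (Rl w 0) v v' y y')"
proof -
  let ?f = "\<lambda>l t. hip (v' t) (mv (fst w t) (y' t)) + hip (v t) (mv (Rl w l t) (y t))"
  have bf: "bm a b (?f l)" for l
    by (rule bm_energy[OF niceD(1)[OF n] _ v y]) (unfold Rl_def, intro bm_diff bm_scaleR niceD(2)[OF n] niceD(3)[OF n])
  have pt: "?f l t = ?f 0 t + complex_of_real l * (?f 1 t - ?f 0 t)" for t
    by (simp add: Rl_def mv_simps hip_simps hip_scaleR_right scaleR_conv_of_real[where 'a = complex] algebra_simps)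
  have i1: "(\<lambda>t. complex_of_real l * (?f 1 t - ?f 0 t)) integrable_on {a..b}"
    by (intro integrable_on_mult_right integrable_diff bm_integrable bf)
  have "integral {a..b} (?f l) = integral {a..b} (\<lambda>t. ?f 0 t + complex_of_real l * (?f 1 t - ?f 0 t))"
    by (rule Henstock_Kurzweil_Integration.integral_cong) (rule pt)
  also have "\<dots> = integral {a..b} (?f 0) + integral {a..b} (\<lambda>t. complex_of_real l * (?f 1 t - ?f 0 t))"
    by (rule Henstock_Kurzweil_Integration.integral_add[OF bm_integrable[OF bf] i1])
  also have "integral {a..b} (\<lambda>t. complex_of_real l * (?f 1 t - ?f 0 t)) = complex_of_real l * integral {a..b} (\<lambda>t. ?f 1 t - ?f 0 t)"
    by (rule Henstock_Kurzweil_Integration.integral_mult_right)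
  also have "integral {a..b} (\<lambda>t. ?f 1 t - ?f 0 t) = integral {a..b} (?f 1) - integral {a..b} (?f 0)"
    by (rule Henstock_Kurzweil_Integration.integral_diff[OF bm_integrable[OF bf] bm_integrable[OF bf]])
  finally show ?thesis unfolding energy_def .
qed

lemma hform_energy:
  assumes g: "good a b m \<kappa> P R" and T: "finite T" and v: "\<And>j. j \<in> T \<Longrightarrow> prim a b (v j) (v' j)"
  shows "hform T (\<lambda>c d. energy a b P R (\<lambda>t. \<Sum>j\<in>T. c j *s v j t) (\<lambda>t. \<Sum>j\<in>T. c j *s v' j t) (\<lambda>t. \<Sum>j\<in>T. d j *s v j t) (\<lambda>t. \<Sum>j\<in>T. d j *s v' j t))"
proof (rule hformI)
  have p: "prim a b (\<lambda>t. \<Sum>j\<in>T. c j *s v j t) (\<lambda>t. \<Sum>j\<in>T. c j *s v' j t)" for c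
    by (intro prim_sum T prim_scale v)
  fix x y z c
  have s: "(\<Sum>j\<in>T. (y j + c * z j) *s w j) = (\<Sum>j\<in>T. y j *s w j) + c *s (\<Sum>j\<in>T. z j *s w j)" for w :: "_ \<Rightarrow> complex^'n"
    by (simp add: linear_sum[OF bounded_linear.linear[OF bounded_linear_vec_scale]] vector_sadd_rdistrib sum.distrib vector_smult_assoc)
  show "energy a b P R (\<lambda>t. \<Sum>j\<in>T. x j *s v j t) (\<lambda>t. \<Sum>j\<in>T. x j *s v' j t) (\<lambda>t. \<Sum>j\<in>T. (y j + c * z j) *s v j t) (\<lambda>t. \<Sum>j\<in>T. (y j + c * z j) *s v' j t) =
    energy a b P R (\<lambda>t. \<Sum>j\<in>T. x j *s v j t) (\<lambda>t. \<Sum>j\<in>T. x j *s v' j t) (\<lambda>t. \<Sum>j\<in>T. y j *s v j t) (\<lambda>t. \<Sum>j\<in>T. y j *s v' j t) +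
    c * energy a b P R (\<lambda>t. \<Sum>j\<in>T. x j *s v j t) (\<lambda>t. \<Sum>j\<in>T. x j *s v' j t) (\<lambda>t. \<Sum>j\<in>T. z j *s v j t) (\<lambda>t. \<Sum>j\<in>T. z j *s v' j t)"
    unfolding s by (rule energy_comb_right[OF goodD(1,2)[OF g] p p p])
next
  fix x y
  show "energy a b P R (\<lambda>t. \<Sum>j\<in>T. y j *s v j t) (\<lambda>t. \<Sum>j\<in>T. y j *s v' j t) (\<lambda>t. \<Sum>j\<in>T. x j *s v j t) (\<lambda>t. \<Sum>j\<in>T. x j *s v' j t) =
    cnj (energy a b P R (\<lambda>t. \<Sum>j\<in>T. x j *s v j t) (\<lambda>t. \<Sum>j\<in>T. x j *s v' j t) (\<lambda>t. \<Sum>j\<in>T. y j *s v j t) (\<lambda>t. \<Sum>j\<in>T. y j *s v' j t))"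
    by (rule energy_herm[OF g])
next
  fix x y :: "'b \<Rightarrow> complex" assume "\<And>i. i \<in> T \<Longrightarrow> y i = 0"
  then have z: "(\<Sum>j\<in>T. y j *s w j) = 0" for w :: "_ \<Rightarrow> complex^'n" by (intro sum.neutral) simp
  show "energy a b P R (\<lambda>t. \<Sum>j\<in>T. x j *s v j t) (\<lambda>t. \<Sum>j\<in>T. x j *s v' j t) (\<lambda>t. \<Sum>j\<in>T. y j *s v j t) (\<lambda>t. \<Sum>j\<in>T. y j *s v' j t) = 0"
    unfolding energy_def z by (simp add: mv_simps hip_simps)
qed

text \<open>Needed so that \<open>eigval\<close> is the infimum of a nonempty set. On a space of
  test functions of any dimension the energy divided by \<open>\<lambda>\<close> tends to a negative
  definite form, so it is negative there for large \<open>\<lambda>\<close>; the reduced energy,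
  being minimal, is negative as well.\<close>

lemma eig_count_unbounded:
  fixes w :: "('d::finite) coef" and K :: "('d + 'd) set"
  assumes n: "nice a b \<mu> C w" and mu: "\<mu> > 0" and C: "C > 0" and ab: "a < b" and S: "hermitian S"
  shows "\<exists>\<beta>. q \<le> eig_count a b w (orbit (nfA K S, nfB K S)) \<beta>"
proof -
  obtain k where k: "k \<ge> 0" "\<And>M x. norm (mv M x :: complex^'d) \<le> norm (M::real^'d^'d) * norm x * k"
    using mv_bound_exists by blast
  \<comment> \<open>The counting formula subtracts at most \<open>card K\<close> from the negative
    index, so this many negative directions suffice for \<open>q\<close> eigenvalues.\<close>
  define n' where "n' = q + card K"
  define I where "I = {..<n'}"
  have I: "finite I" by (simp add: I_def)
  define e0 :: "complex^'d" where "e0 = axis undefined 1"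
  define v where "v = (\<lambda>j t. complex_of_real (poly (bump_poly a b j) t) *s e0)"
  define v' where "v' = (\<lambda>j t. complex_of_real (poly (pderiv (bump_poly a b j)) t) *s e0)"
  have pv: "prim a b (v j) (v' j)" for j unfolding v_def v'_def by (rule prim_of_real_poly)
  define vc where "vc = (\<lambda>c t. \<Sum>j\<in>I. c j *s v j t)"
  define vc' where "vc' = (\<lambda>c t. \<Sum>j\<in>I. c j *s v' j t)"
  have pvc: "prim a b (vc c) (vc' c)" for c unfolding vc_def vc'_def by (intro prim_sum I prim_scale pv)
  define P where "P = fst w"
  define E where "E = (\<lambda>l c d. energy a b P (Rl w l) (vc c) (vc' c) (vc d) (vc' d))"
  have g1: "good a b \<mu> (k * C * (1 + \<Lambda>)) P (Rl w l)" if "l \<le> \<Lambda>" "0 \<le> \<Lambda>" for l \<Lambda>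
    unfolding P_def by (rule nice_good[OF n k that mu C])
  have hE: "hform I (E l)" for l
    unfolding E_def vc_def vc'_def by (rule hform_energy[OF g1[of l "\<bar>l\<bar>"] I pv]) auto
  have Eaff: "E l c d = E 0 c d + complex_of_real l * (E 1 c d - E 0 c d)" for l c d
    unfolding E_def P_def by (rule energy_affine[OF n pvc pvc])
  \<comment> \<open>The slope of the energy in the spectral parameter, that is, minus the form of
    \<open>W\<close>.\<close>
  define B0 where "B0 = (\<lambda>c d. E 1 c d + complex_of_real (-1) * E 0 c d)"
  have hB0: "hform I B0" unfolding B0_def by (rule hform_add[OF hE hE])
  have "0 \<le> k * C * (1 + 1)" using k C by simp
  from mesh_exists[OF ab mu this] obtain N1 where "mesh a b \<mu> (k * C * (1 + 1)) N1" by blast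
  \<comment> \<open>An auxiliary mesh for the levels 0 and 1, which gives access to the monotonicity
    of the energy there.\<close>
  then interpret M1: mesh a b \<mu> "k * C * (1 + 1)" N1 .
  have neg: "Re (B0 c c) < 0" if c: "\<exists>j\<in>I. c j \<noteq> 0" for c
  proof -
    define V where "V = integral {a..b} (\<lambda>t. (norm (vc c t))\<^sup>2)"
    have "Re (E 1 c c) \<le> Re (E 0 c c) - ((1 - 0) * \<mu>) * V"
      unfolding E_def V_def P_def by (rule M1.energy_mono[OF g1[unfolded P_def] g1[unfolded P_def] pvc M1.Rl_quad_mono[OF n]]) auto
    moreover have "V > 0"
    proof (rule ccontr)
      assume "\<not> V > 0"
      then have "V = 0" using M1.int_norm2_nonneg[OF prim_bm[OF pvc[of c]]] by (simp add: V_def)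
      then have "\<forall>t\<in>{a..b}. (norm (vc c t))\<^sup>2 = 0"
        unfolding V_def using ab by (subst (asm) integral_eq_0_iff) (auto intro!: continuous_intros prim_continuous[OF pvc])
      then have z: "vc c t = 0" if "t \<in> {a..b}" for t using that by simp
      have "(\<Sum>j<n'. c j * complex_of_real t ^ j) = 0" if t: "a < t" "t < b" for t
      proof -
        have "0 = vc c t $ undefined" using z[of t] t by simp
        also have "\<dots> = (\<Sum>j<n'. c j * complex_of_real t ^ j) * complex_of_real ((t - a) * (b - t))"
          by (simp add: vc_def v_def I_def e0_def poly_bump_poly sum_distrib_right mult.assoc)
        finally show ?thesis using t by simp
      qed
      then have "c j = 0" if "j < n'" for j using monomials_independent[OF ab _ that, of c] by blast
      then show False using c by (auto simp: I_def)
    qed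
    moreover have "0 < \<mu> * V" by (rule mult_pos_pos[OF mu \<open>V > 0\<close>])
    moreover have "Re (B0 c c) = Re (E 1 c c) - Re (E 0 c c)" by (simp add: B0_def)
    ultimately show ?thesis by simp
  qed
  obtain e \<sigma> where d: "diag_basis I B0 e \<sigma>" using exists_diag_basis[OF hB0 I] by blast
  have sneg: "\<sigma> j < 0" if j: "j \<in> I" for j
  proof -
    have "B0 (e j) (e j) = complex_of_real (\<sigma> j)" using d j unfolding diag_basis_def orth_fam_def by auto
    moreover have "\<exists>i\<in>I. e j i \<noteq> 0"
    proof (rule ccontr)
      assume z: "\<not> ?thesis"
      have "(if j = j then 1 else 0 :: complex) = 0"
      proof (rule spanning_independent[OF I, of e "\<lambda>i. if i = j then 1 else 0" j])
        show "\<exists>c. \<forall>i\<in>I. x i = lc c e I i" for x using d unfolding diag_basis_def by blast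
        show "lc (\<lambda>i. if i = j then 1 else 0) e I i = 0" if "i \<in> I" for i
          unfolding lc_def using z that by (intro sum.neutral) auto
      qed (rule j)
      then show False by simp
    qed
    then have "Re (B0 (e j) (e j)) < 0" by (rule neg)
    ultimately show ?thesis by simp
  qed
  \<comment> \<open>Since the energy is affine in \<open>l\<close>, this is the energy at level
    \<open>l\<close> divided by \<open>l\<close>; for large \<open>l\<close> it is a small
    perturbation of \<open>B0\<close>.\<close>
  define Bs where "Bs = (\<lambda>l c d. B0 c d + complex_of_real (1 / l) * E 0 c d)"
  have "\<forall>\<^sub>F l in at_top. negf (Bs l) e I"
  proof (rule negf_perturb[OF hB0 _ _ I sneg])
    show "\<forall>\<^sub>F s in at_top. hform I (Bs s)" unfolding Bs_def by (rule always_eventually) (intro allI hform_add hB0 hE)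
    show "orth_fam B0 e \<sigma> I" using d unfolding diag_basis_def by blast
    show "((\<lambda>s. Bs s x y) \<longlongrightarrow> B0 x y) at_top" for x y
    proof -
      have "((\<lambda>s. 1 / s) \<longlongrightarrow> (0::real)) at_top" by (rule tendsto_divide_0[OF tendsto_const filterlim_at_top_imp_at_infinity[OF filterlim_ident]])
      then have "((\<lambda>s. Bs s x y) \<longlongrightarrow> B0 x y + complex_of_real 0 * E 0 x y) at_top"
        unfolding Bs_def by (intro tendsto_intros)
      then show ?thesis by simp
    qed
  qed
  from eventually_happens'[OF _ eventually_conj[OF this eventually_gt_at_top[of 0]]] obtain l
    where l: "negf (Bs l) e I" "l > 0" by auto
  have Eneg: "Re (E l (lc c e I) (lc c e I)) < 0" if "\<exists>j\<in>I. c j \<noteq> 0" for c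
  proof -
    have "E l x x = complex_of_real l * Bs l x x" for x
      unfolding Bs_def B0_def Eaff[of l] using l(2) by (simp add: field_simps)
    then have "Re (E l (lc c e I) (lc c e I)) = l * Re (Bs l (lc c e I) (lc c e I))" by simp
    moreover have "Re (Bs l (lc c e I) (lc c e I)) < 0" using l(1) that unfolding negf_def by blast
    ultimately show ?thesis using l(2) by (simp add: mult_pos_neg)
  qed
  define \<kappa> where "\<kappa> = k * C * (1 + l)"
  have "0 \<le> \<kappa>" using k C l by (simp add: \<kappa>_def)
  from mesh_exists[OF ab mu this] obtain N where "mesh a b \<mu> \<kappa> N" by blast
  then interpret M: mesh a b \<mu> \<kappa> N .
  have gl: "good a b \<mu> \<kappa> P (Rl w l')" if "l' \<le> l" for l' unfolding \<kappa>_def by (rule g1) (use that l in auto)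
  define xn :: "(nat \<Rightarrow> complex) \<Rightarrow> (nat \<times> 'd) + ('d + 'd) \<Rightarrow> complex"
    where "xn = (\<lambda>c s. case s of Inl kj \<Rightarrow> vc c (M.tau (fst kj)) $ snd kj | Inr _ \<Rightarrow> 0)"
  have ndx: "nodes (xn c) k = vc c (M.tau k)" for c k by (simp add: nodes_def xn_def vec_eq_iff)
  have vend: "vc c a = 0" "vc c b = 0" for c by (simp_all add: vc_def v_def poly_bump_poly)
  have bYx: "M.bY (nodes (xn c)) = 0" for c by (rule M.bY_zero) (simp_all add: ndx M.tau_0 M.tau_N vend)
  have vvx: "M.mixed_bv K (xn c) = 0" for c unfolding M.mixed_bv_def bYx by (simp add: xn_def vec_eq_iff)
  have ztx: "multiplier K (xn c) = 0" for c by (simp add: multiplier_def xn_def vec_eq_iff)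
  have xnl: "lc c (\<lambda>j. xn (e j)) I = xn (lc c e I)" for c
  proof
    fix s
    show "lc c (\<lambda>j. xn (e j)) I s = xn (lc c e I) s"
    proof (cases s)
      case (Inl kj)
      have "lc c (\<lambda>j. xn (e j)) I s = (\<Sum>j\<in>I. \<Sum>i\<in>I. c j * e j i * v i (M.tau (fst kj)) $ snd kj)"
        unfolding Inl lc_def xn_def vc_def by (simp add: sum_distrib_left mult.assoc)
      also have "\<dots> = (\<Sum>i\<in>I. \<Sum>j\<in>I. c j * e j i * v i (M.tau (fst kj)) $ snd kj)" by (rule sum.swap)
      also have "\<dots> = xn (lc c e I) s"
        unfolding Inl lc_def xn_def vc_def by (simp add: sum_distrib_right)
      finally show ?thesis .
    qed (simp add: lc_def xn_def)
  qed
  have "negf (M.reduced_form K S P (Rl w l)) (\<lambda>j. xn (e j)) I"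
    unfolding negf_def xnl
  proof (intro allI impI)
    fix c :: "nat \<Rightarrow> complex" assume c: "\<exists>j\<in>I. c j \<noteq> 0"
    define x where "x = lc c e I"
    have "Re (M.reduced_form K S P (Rl w l) (xn x) (xn x)) = Re (M.reduced_energy P (Rl w l) (nodes (xn x)) (nodes (xn x)))"
      unfolding M.reduced_form_def vvx ztx bYx by (simp add: hip_simps)
    also have "\<dots> \<le> Re (energy a b P (Rl w l) (vc x) (vc' x) (vc x) (vc' x))"
      by (rule M.reduced_energy_min[OF gl[OF order_refl] pvc]) (simp add: ndx)
    also have "\<dots> < 0" using Eneg[OF c] unfolding E_def x_def .
    finally show "Re (M.reduced_form K S P (Rl w l) (xn (lc c e I)) (xn (lc c e I))) < 0" unfolding x_def .
  qed
  from nidx_ge[OF M.hform_reduced_form[OF gl[OF order_refl] S] M.finite_form_index I this]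
  have "n' \<le> nidx (M.reduced_form K S P (Rl w l))" by (simp add: I_def)
  moreover have "eig_count a b w (orbit (nfA K S, nfB K S)) l + (card K - n_pos K S)
      = nidx (M.reduced_form K S P (Rl w l)) + zidx (M.form_index K) (M.reduced_form K S P (Rl w l))"
    unfolding P_def by (rule M.eig_count_nidx(2)[OF n _ S order_refl]) (rule gl[unfolded P_def])
  ultimately have "q \<le> eig_count a b w (orbit (nfA K S, nfB K S)) l" unfolding n'_def by linarith
  then show ?thesis by blast
qed

text \<open>\<open>eigval\<close> is an infimum and \<open>eig_count\<close> a sum over a set of
  reals; these three facts give them their intended meaning.\<close>

lemma eigenvalue_list:
  fixes w :: "('d::finite) coef" and K :: "('d + 'd) set"
  assumes w: "w \<in> Omega a b" and A: "A \<in> OK K" and ab: "a < b"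
  shows "finite {l. l \<le> \<beta> \<and> eig_mult a b w A l > 0}" "\<exists>l0. \<forall>l\<le>l0. eig_mult a b w A l = 0"
    "\<exists>\<beta>. q \<le> eig_count a b w A \<beta>"
proof -
  obtain w' \<mu> C where n: "nice a b \<mu> C w'" "\<mu> > 0" "C > 0" and ae: "AEeq a b w w'"
    using Omega_nice[OF w] by blast
  define S where "S = S_of K A"
  have S: "hermitian S" "A = orbit (nfA K S, nfB K S)" using OK_S_of[OF A] by (auto simp: S_def)
  obtain k where k: "k \<ge> 0" "\<And>M x. norm (mv M x :: complex^'d) \<le> norm (M::real^'d^'d) * norm x * k"
    using mv_bound_exists by blast
  define \<kappa> where "\<kappa> = k * C * (1 + \<bar>\<beta>\<bar>)"
  have "0 \<le> \<kappa>" using k n by (simp add: \<kappa>_def)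
  from mesh_exists[OF ab n(2) this] obtain N where "mesh a b \<mu> \<kappa> N" by blast
  then interpret M: mesh a b \<mu> \<kappa> N .
  have g: "good a b \<mu> \<kappa> (fst w') (Rl w' l)" if "l \<le> \<bar>\<beta>\<bar>" for l
    unfolding \<kappa>_def by (rule nice_good[OF n(1) k that _ n(2,3)]) simp
  show "finite {l. l \<le> \<beta> \<and> eig_mult a b w A l > 0}"
    using M.eig_count_nidx(1)[OF n(1) g S(1), where \<beta> = \<beta> and K = K] unfolding eig_mult_AEeq[OF ae] S(2) by simp
  show "\<exists>l0. \<forall>l\<le>l0. eig_mult a b w A l = 0"
    using M.eig_count_nidx(3)[OF n(1) g S(1), where \<beta> = \<beta> and K = K] unfolding eig_mult_AEeq[OF ae] S(2) by simp
  show "\<exists>\<beta>. q \<le> eig_count a b w A \<beta>"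
    unfolding eig_count_AEeq[OF ae] S(2) by (rule eig_count_unbounded[OF n ab S(1)])
qed

text \<open>The hypothesis excludes the value infinity, which \<open>real_of_ereal\<close> sends to
  0 and for which the bound would fail.\<close>

lemma Linf_dist_bound:
  assumes "Linf_dist a b f g < 1"
  shows "AE t in lebesgue_on {a..b}. norm (f t - g t) \<le> \<bar>real_of_ereal (Linf_dist a b f g)\<bar>"
proof -
  have "AE t in lebesgue_on {a..b}. ereal (norm (f t - g t)) \<le> Linf_dist a b f g"
    unfolding Linf_dist_def by (rule esssup_AE)
  then show ?thesis
  proof eventually_elim
    case (elim t)
    then show ?case using assms by (cases "Linf_dist a b f g") auto
  qed
qed

lemma nice_weaken: "nice a b \<mu> C w \<Longrightarrow> \<nu> \<le> \<mu> \<Longrightarrow> C \<le> D \<Longrightarrow> nice a b \<nu> D w"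
  unfolding nice_def by (auto intro: hip_ge_mono order_trans)

text \<open>Mesh and constants are chosen from the limit problem before \<open>s\<close>, so that
  the forms for all nearby \<open>s\<close> live on the same coordinates and can be compared. At a
  level that is no eigenvalue the limit form is nondegenerate, and its index is stable.\<close>

lemma eig_count_limit:
  fixes w :: "('d::finite) coef" and ws :: "real \<Rightarrow> 'd coef" and K :: "('d + 'd) set"
  assumes ab: "a < b" and w: "w \<in> Omega a b" and A: "A \<in> OK K"
    and ev: "\<forall>\<^sub>F s in F. ws s \<in> Omega a b \<and> As s \<in> OK K"
    and wlim: "Omega_tendsto a b ws w F" and Slim: "((\<lambda>s. S_of K (As s)) \<longlongrightarrow> S_of K A) F"
    and non: "eig_mult a b w A \<beta> = 0"
  shows "\<forall>\<^sub>F s in F. eig_count a b (ws s) (As s) \<beta> + (card K - n_pos K (S_of K (As s))) =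
    eig_count a b w A \<beta> + (card K - n_pos K (S_of K A))"
proof -
  obtain w0 \<mu>' C' where n': "nice a b \<mu>' C' w0" "\<mu>' > 0" "C' > 0" and ae: "AEeq a b w w0"
    using Omega_nice[OF w] by blast
  \<comment> \<open>Slack for the perturbed coefficients, in the shape required by
    \<open>Omega_nice_near\<close>.\<close>
  define \<mu> where "\<mu> = \<mu>' / 2"
  define C where "C = C' + 1"
  have mu: "\<mu> > 0" "C > 0" using n' by (auto simp: \<mu>_def C_def)
  have n2: "nice a b (2 * \<mu>) C' w0" using n'(1) by (simp add: \<mu>_def)
  have n: "nice a b \<mu> C w0" by (rule nice_weaken[OF n'(1)]) (use n' in \<open>auto simp: \<mu>_def C_def\<close>)
  obtain k where k: "k \<ge> 0" "\<And>M x. norm (mv M x :: complex^'d) \<le> norm (M::real^'d^'d) * norm x * k"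
    using mv_bound_exists by blast
  define S where "S = S_of K A"
  have S: "hermitian S" "A = orbit (nfA K S, nfB K S)" using OK_S_of[OF A] by (auto simp: S_def)
  define \<kappa> where "\<kappa> = k * C * (1 + \<bar>\<beta>\<bar>)"
  have "0 \<le> \<kappa>" using k mu by (simp add: \<kappa>_def)
  from mesh_exists[OF ab mu(1) this] obtain N where "mesh a b \<mu> \<kappa> N" by blast
  then interpret M: mesh a b \<mu> \<kappa> N .
  have gd: "good a b \<mu> \<kappa> (fst u) (Rl u l)" if "nice a b \<mu> C u" "l \<le> \<bar>\<beta>\<bar>" for l and u :: "'d coef"
    unfolding \<kappa>_def by (rule nice_good[OF that(1) k that(2) _ mu]) simp
  define r1 where "r1 = (\<lambda>s. \<bar>real_of_ereal (Linf_dist a b (fst (ws s)) (fst w))\<bar>)"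
  define r2 where "r2 = (\<lambda>s. \<bar>real_of_ereal (Linf_dist a b (fst (snd (ws s))) (fst (snd w)))\<bar>)"
  define r3 where "r3 = (\<lambda>s. \<bar>real_of_ereal (Linf_dist a b (snd (snd (ws s))) (snd (snd w)))\<bar>)"
  define \<delta> where "\<delta> = (\<lambda>s. r1 s + r2 s + r3 s)"
  have L: "((\<lambda>s. Linf_dist a b (fst (ws s)) (fst w)) \<longlongrightarrow> ereal 0) F"
    "((\<lambda>s. Linf_dist a b (fst (snd (ws s))) (fst (snd w))) \<longlongrightarrow> ereal 0) F"
    "((\<lambda>s. Linf_dist a b (snd (snd (ws s))) (snd (snd w))) \<longlongrightarrow> ereal 0) F"
    using wlim unfolding Omega_tendsto_def zero_ereal_def by auto
  have "(\<delta> \<longlongrightarrow> \<bar>0\<bar> + \<bar>0\<bar> + \<bar>0\<bar>) F"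
    unfolding \<delta>_def r1_def r2_def r3_def by (intro tendsto_intros lim_real_of_ereal L)
  then have \<delta>lim: "(\<delta> \<longlongrightarrow> 0) F" by simp
  have \<delta>0: "\<delta> s \<ge> 0" for s unfolding \<delta>_def r1_def r2_def r3_def by (intro add_nonneg_nonneg abs_ge_zero)
  have r0: "r1 s \<ge> 0" "r2 s \<ge> 0" "r3 s \<ge> 0" for s unfolding r1_def r2_def r3_def by (rule abs_ge_zero)+
  have rle: "r1 s \<le> \<delta> s" "r2 s \<le> \<delta> s" "r3 s \<le> \<delta> s" for s using r0[of s] unfolding \<delta>_def by linarith+
  have "((\<lambda>s. \<delta> s * k) \<longlongrightarrow> 0 * k) F" by (intro tendsto_intros \<delta>lim)
  then have d1: "\<forall>\<^sub>F s in F. \<delta> s * k < \<mu>" by (rule order_tendstoD(2)) (use mu in simp)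
  have d2: "\<forall>\<^sub>F s in F. \<delta> s < 1" by (rule order_tendstoD(2)[OF \<delta>lim]) simp
  have L1: "\<forall>\<^sub>F s in F. Linf_dist a b (fst (ws s)) (fst w) < 1" "\<forall>\<^sub>F s in F. Linf_dist a b (fst (snd (ws s))) (fst (snd w)) < 1"
    "\<forall>\<^sub>F s in F. Linf_dist a b (snd (snd (ws s))) (snd (snd w)) < 1"
    by (rule order_tendstoD(2)[OF L(1)] order_tendstoD(2)[OF L(2)] order_tendstoD(2)[OF L(3)], simp)+
  define \<Psi> where "\<Psi> = (\<lambda>s (u :: 'd coef). nice a b \<mu> C u \<and> AEeq a b (ws s) u \<and> (\<forall>t\<in>{a..b}. norm (fst u t - fst w0 t) \<le> \<delta> s \<and>
      norm (fst (snd u) t - fst (snd w0) t) \<le> \<delta> s \<and> norm (snd (snd u) t - snd (snd w0) t) \<le> \<delta> s))"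
  \<comment> \<open>Everywhere-bounded representatives of the coefficients along the path. The
    choice is meaningful only for those \<open>s\<close> at which one exists, which is eventually
    the case.\<close>
  define us where "us = (\<lambda>s. SOME u. \<Psi> s u)"
  have ex: "\<forall>\<^sub>F s in F. \<Psi> s (us s)"
    using ev d1 d2 L1
  proof eventually_elim
    case (elim s)
    have near: "AE t in lebesgue_on {a..b}. norm (fst (ws s) t - fst w0 t) \<le> \<delta> s \<and> norm (fst (snd (ws s)) t - fst (snd w0) t) \<le> \<delta> s \<and>
        norm (snd (snd (ws s)) t - snd (snd w0) t) \<le> \<delta> s"
      using Linf_dist_bound[OF elim(4)] Linf_dist_bound[OF elim(5)] Linf_dist_bound[OF elim(6)] ae[unfolded AEeq_def]
    proof eventually_elim
      case (elim t)
      then show ?case using rle[of s, unfolded r1_def r2_def r3_def] by (auto intro: order_trans)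
    qed
    have "\<exists>u. \<Psi> s u"
      unfolding \<Psi>_def C_def
      by (rule Omega_nice_near[OF _ n2 k _ \<delta>0 _ near]) (use elim in auto)
    then show ?case unfolding us_def by (rule someI_ex)
  qed
  define B where "B = M.reduced_form K S (fst w0) (Rl w0 \<beta>)"
  define Bs where "Bs = (\<lambda>s. M.reduced_form K (S_of K (As s)) (fst (us s)) (Rl (us s) \<beta>))"
  have g0: "good a b \<mu> \<kappa> (fst w0) (Rl w0 \<beta>)" by (rule gd[OF n]) simp
  have hB: "hform (M.form_index K) B" unfolding B_def by (rule M.hform_reduced_form[OF g0 S(1)])
  have gs: "\<forall>\<^sub>F s in F. good a b \<mu> \<kappa> (fst (us s)) (Rl (us s) \<beta>)"
    using ex by eventually_elim (rule gd, auto simp: \<Psi>_def)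
  have hBs: "\<forall>\<^sub>F s in F. hform (M.form_index K) (Bs s)"
    using gs ev unfolding Bs_def by eventually_elim (rule M.hform_reduced_form, auto intro: OK_S_of)
  have lim: "((\<lambda>s. Bs s x y) \<longlongrightarrow> B x y) F" for x y
  proof (rule hform_tendsto[where I = "M.form_index K" and B = B and Bs = Bs, OF hB hBs])
    fix x
    have H: "((\<lambda>s. Re (M.reduced_energy (fst (us s)) (Rl (us s) \<beta>) (nodes x) (nodes x))) \<longlongrightarrow> Re (M.reduced_energy (fst w0) (Rl w0 \<beta>) (nodes x) (nodes x))) F"
    proof (rule M.reduced_energy_tendsto[OF g0 gs])
      fix \<epsilon> :: real assume e: "\<epsilon> > 0"
      have "((\<lambda>s. \<delta> s * (1 + \<bar>\<beta>\<bar>)) \<longlongrightarrow> 0 * (1 + \<bar>\<beta>\<bar>)) F" by (intro tendsto_intros \<delta>lim)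
      then have "\<forall>\<^sub>F s in F. \<delta> s * (1 + \<bar>\<beta>\<bar>) < \<epsilon>" by (rule order_tendstoD(2)) (use e in simp)
      then show "\<forall>\<^sub>F s in F. \<forall>t\<in>{a..b}. norm (fst (us s) t - fst w0 t) \<le> \<epsilon> \<and> norm (Rl (us s) \<beta> t - Rl w0 \<beta> t) \<le> \<epsilon>"
        using ex
      proof eventually_elim
        case (elim s)
        have "\<delta> s * 1 \<le> \<delta> s * (1 + \<bar>\<beta>\<bar>)" by (rule mult_left_mono[OF _ \<delta>0]) simp
        then have d\<epsilon>: "\<delta> s \<le> \<epsilon>" using elim(1) by simp
        have "norm (Rl (us s) \<beta> t - Rl w0 \<beta> t) \<le> \<epsilon>" if t: "t \<in> {a..b}" for t
        proof -
          have "Rl (us s) \<beta> t - Rl w0 \<beta> t = (fst (snd (us s)) t - fst (snd w0) t) - \<beta> *\<^sub>R (snd (snd (us s)) t - snd (snd w0) t)"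
            by (simp add: Rl_def algebra_simps)
          also have "norm \<dots> \<le> norm (fst (snd (us s)) t - fst (snd w0) t) + \<bar>\<beta>\<bar> * norm (snd (snd (us s)) t - snd (snd w0) t)"
            by (rule order_trans[OF norm_triangle_ineq4]) simp
          also have "\<dots> \<le> \<delta> s + \<bar>\<beta>\<bar> * \<delta> s"
            using elim(2) t unfolding \<Psi>_def by (intro add_mono mult_left_mono) auto
          finally show ?thesis using elim(1) by (simp add: algebra_simps)
        qed
        moreover have "norm (fst (us s) t - fst w0 t) \<le> \<epsilon>" if "t \<in> {a..b}" for t
          using elim(2) that order_trans[OF _ d\<epsilon>] unfolding \<Psi>_def by blast
        ultimately show ?case by blast
      qed
    qed
    have SV: "((\<lambda>s. S_of K (As s) *v z) \<longlongrightarrow> S *v z) F" for z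
      unfolding matrix_vector_mult_def
      by (rule vec_tendstoI) (simp, intro tendsto_intros tendsto_vec_nth Slim[folded S_def])
    have SH: "((\<lambda>s. Re (hip z (S_of K (As s) *v z))) \<longlongrightarrow> Re (hip z (S *v z))) F" for z
      by (intro tendsto_Re bounded_bilinear.tendsto[OF bounded_bilinear_hip] tendsto_const SV)
    show "((\<lambda>s. Re (Bs s x x)) \<longlongrightarrow> Re (B x x)) F"
      unfolding Bs_def B_def M.reduced_form_def using tendsto_add[OF H SH[of "M.mixed_bv K x"]]
      by (auto intro!: tendsto_intros simp: SH H)
  qed
  have zero: "zidx (M.form_index K) B = 0"
    using non unfolding eig_mult_AEeq[OF ae] S(2) B_def M.eig_mult_zidx[OF g0 S(1)] .
  from nidx_nondegenerate_limit[OF hB M.finite_form_index hBs lim zero] have "\<forall>\<^sub>F s in F. nidx (Bs s) = nidx B \<and> zidx (M.form_index K) (Bs s) = 0" .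
  then show ?thesis using ex ev
  proof eventually_elim
    case (elim s)
    have ns: "nice a b \<mu> C (us s)" and aes: "AEeq a b (ws s) (us s)" using elim(2) unfolding \<Psi>_def by auto
    have Ss: "hermitian (S_of K (As s))" "As s = orbit (nfA K (S_of K (As s)), nfB K (S_of K (As s)))"
      using OK_S_of elim(3) by blast+
    have "eig_count a b (us s) (orbit (nfA K (S_of K (As s)), nfB K (S_of K (As s)))) \<beta> + (card K - n_pos K (S_of K (As s))) =
        nidx (Bs s) + zidx (M.form_index K) (Bs s)"
      unfolding Bs_def by (rule M.eig_count_nidx(2)[OF ns gd[OF ns] Ss(1)]) auto
    moreover have "eig_count a b w0 (orbit (nfA K S, nfB K S)) \<beta> + (card K - n_pos K S) = nidx B + zidx (M.form_index K) B"
      unfolding B_def by (rule M.eig_count_nidx(2)[OF n gd[OF n] S(1)]) auto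
    ultimately show ?case
      using elim(1) zero Ss(2) S(2) unfolding eig_count_AEeq[OF aes] eig_count_AEeq[OF ae] S_def by simp
  qed
qed

lemma eig_count_mono:
  assumes "\<And>\<beta>. finite {l. l \<le> \<beta> \<and> eig_mult a b w A l > 0}" "\<beta> \<le> \<gamma>"
  shows "eig_count a b w A \<beta> \<le> eig_count a b w A \<gamma>"
  unfolding eig_count_def by (rule sum_mono2[OF assms(1)]) (use assms(2) in auto)

lemma eig_count_set_bdd_below:
  assumes "\<exists>l0. \<forall>l\<le>l0. eig_mult a b w A l = 0" "1 \<le> n"
  shows "bdd_below {\<beta>. n \<le> eig_count a b w A \<beta>}"
proof -
  obtain l0 where l0: "\<And>l. l \<le> l0 \<Longrightarrow> eig_mult a b w A l = 0" using assms(1) by blast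
  show ?thesis
  proof (rule bdd_belowI)
    fix \<beta> assume b: "\<beta> \<in> {\<beta>. n \<le> eig_count a b w A \<beta>}"
    show "l0 \<le> \<beta>"
    proof (rule ccontr)
      assume "\<not> l0 \<le> \<beta>"
      then have "{l. l \<le> \<beta> \<and> eig_mult a b w A l > 0} = {}" using l0 by fastforce
      then have "eig_count a b w A \<beta> = 0" unfolding eig_count_def by simp
      then show False using b assms(2) by simp
    qed
  qed
qed

lemma eigval_le:
  assumes "\<exists>l0. \<forall>l\<le>l0. eig_mult a b w A l = 0" "1 \<le> n" "n \<le> eig_count a b w A \<beta>"
  shows "eigval a b n w A \<le> \<beta>"
  unfolding eigval_def by (rule cInf_lower[OF _ eig_count_set_bdd_below[OF assms(1,2)]]) (use assms(3) in simp)

text \<open>The level \<open>\<gamma>\<close> witnesses that the set is nonempty; the infimum of an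
  empty set of reals would carry no information.\<close>

lemma eigval_ge:
  assumes fin: "\<And>\<beta>. finite {l. l \<le> \<beta> \<and> eig_mult a b w A l > 0}" and "n \<le> eig_count a b w A \<gamma>" "eig_count a b w A \<beta> < n"
  shows "\<beta> \<le> eigval a b n w A"
  unfolding eigval_def
proof (rule cInf_greatest)
  show "{\<mu>. n \<le> eig_count a b w A \<mu>} \<noteq> {}" using assms(2) by blast
  fix x assume "x \<in> {\<mu>. n \<le> eig_count a b w A \<mu>}"
  then show "\<beta> \<le> x" using eig_count_mono[OF fin, of x \<beta>] assms(3) by fastforce
qed

lemma noneigenvalue_between:
  assumes fin: "\<And>\<beta>. finite {l. l \<le> \<beta> \<and> eig_mult a b w A l > 0}" and "x < (y::real)"
  shows "\<exists>l. x < l \<and> l < y \<and> eig_mult a b w A l = 0"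
proof -
  have "infinite {x<..<y}" using assms(2) by (rule infinite_Ioo)
  from Diff_infinite_finite[OF fin this] obtain l where "l \<in> {x<..<y} - {l. l \<le> y \<and> eig_mult a b w A l > 0}"
    by (metis all_not_in_conv finite.emptyI)
  then show ?thesis by (intro exI[of _ l]) auto
qed

theorem theorem7p10:
  fixes a b :: real
    and K :: "('d::finite + 'd) set"
    and n0 np nm n00 n0p n0m :: nat
    and w :: "'d coef" and A :: "'d bcond"
    and ws :: "real \<Rightarrow> 'd coef" and As :: "real \<Rightarrow> 'd bcond"
  assumes "a < b" and "CARD('d) \<ge> 2"
    and "K \<noteq> {}"
    and "n0 + np + nm = card K" and "n00 + n0p + n0m = card K"
    and "0 < n00" and "n0 < n00" and "np \<ge> n0p" and "nm \<ge> n0m"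
    and "w \<in> Omega a b" and "A \<in> J K n00 n0p n0m"
    and "\<forall>s\<in>{0<..1}. ws s \<in> Omega a b \<and> As s \<in> J K n0 np nm"
    and "Omega_continuous_on a b {0<..1} ws"
    and "continuous_map (top_of_set {0<..1}) (subtopology BCtop (OK K)) As"
    and "Omega_tendsto a b ws w (at_right 0)"
    and "limitin (subtopology BCtop (OK K)) As A (at_right 0)"
  shows "(\<forall>n. 1 \<le> n \<and> n \<le> np - n0p \<longrightarrow>
            filterlim (\<lambda>s. eigval a b n (ws s) (As s)) at_bot (at_right 0))
       \<and> (\<forall>n. n > np - n0p \<longrightarrow>
            ((\<lambda>s. eigval a b n (ws s) (As s)) \<longlongrightarrow> eigval a b (n - (np - n0p)) w A) (at_right 0))"
proof -
  define r where "r = np - n0p"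
  have A: "A \<in> OK K" "n_pos K (S_of K A) = n0p" using assms(11) unfolding J_def by auto
  have "\<forall>\<^sub>F s in at_right (0::real). s \<in> {0<..1}"
    unfolding eventually_at_right_field by (intro exI[of _ 1]) auto
  then have ev: "\<forall>\<^sub>F s in at_right 0. ws s \<in> Omega a b \<and> As s \<in> OK K \<and> n_pos K (S_of K (As s)) = np"
    by eventually_elim (use assms(12) in \<open>auto simp: J_def\<close>)
  then have ev1: "\<forall>\<^sub>F s in at_right 0. ws s \<in> Omega a b \<and> As s \<in> OK K" by eventually_elim simp
  note Slim = S_of_tendsto[OF assms(16)]
  note pf = eigenvalue_list[OF assms(10) A(1) assms(1)]
  \<comment> \<open>Since \<open>np\<close> and \<open>n0p\<close> are at most
    \<open>card K\<close>, the subtractions of natural numbers are exact, and \<open>card K\<close>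
    cancels from the two counts.\<close>
  have count: "\<forall>\<^sub>F s in at_right 0. eig_count a b (ws s) (As s) \<beta> = eig_count a b w A \<beta> + r"
    if "eig_mult a b w A \<beta> = 0" for \<beta>
    using eig_count_limit[OF assms(1,10) A(1) ev1 assms(15) Slim that] ev
  proof eventually_elim
    case (elim s)
    then show ?case using A(2) assms(4,5,8) unfolding r_def by linarith
  qed
  have "filterlim (\<lambda>s. eigval a b n (ws s) (As s)) at_bot (at_right 0)" if n: "1 \<le> n" "n \<le> r" for n
    unfolding filterlim_at_bot
  proof
    fix Z :: real
    \<comment> \<open>At any level that is no eigenvalue of the limit problem the count along the
      path is eventually at least \<open>r\<close>, however low the level.\<close>
    obtain \<beta> where \<beta>: "\<beta> < Z" "eig_mult a b w A \<beta> = 0" using noneigenvalue_between[OF pf(1), of "Z - 1" Z] by auto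
    show "\<forall>\<^sub>F s in at_right 0. eigval a b n (ws s) (As s) \<le> Z"
      using count[OF \<beta>(2)] ev1
    proof eventually_elim
      case (elim s)
      have "eigval a b n (ws s) (As s) \<le> \<beta>"
        by (rule eigval_le[OF eigenvalue_list(2)[of "ws s" a b "As s" K] n(1)]) (use elim assms(1) n in auto)
      then show ?case using \<beta>(1) by simp
    qed
  qed
  moreover have "((\<lambda>s. eigval a b n (ws s) (As s)) \<longlongrightarrow> eigval a b (n - r) w A) (at_right 0)" if n: "n > r" for n
  proof (rule tendstoI)
    fix \<epsilon> :: real assume \<epsilon>: "\<epsilon> > 0"
    define L where "L = eigval a b (n - r) w A"
    have n1: "1 \<le> n - r" using n by simp
    \<comment> \<open>\<open>L\<close> is enclosed between two levels at which the counts along the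
      path are eventually known: the limit count is below \<open>n - r\<close> at the lower one and
      at least \<open>n - r\<close> at the upper one.\<close>
    obtain \<beta>1 where \<beta>1: "L - \<epsilon> < \<beta>1" "\<beta>1 < L" "eig_mult a b w A \<beta>1 = 0"
      using noneigenvalue_between[OF pf(1), of "L - \<epsilon>" L] \<epsilon> by auto
    obtain \<beta>2 where \<beta>2: "L < \<beta>2" "\<beta>2 < L + \<epsilon>" "eig_mult a b w A \<beta>2 = 0"
      using noneigenvalue_between[OF pf(1), of L "L + \<epsilon>"] \<epsilon> by auto
    have c1: "eig_count a b w A \<beta>1 < n - r"
    proof (rule ccontr)
      assume "\<not> ?thesis"
      then have "L \<le> \<beta>1" unfolding L_def by (intro eigval_le[OF pf(2) n1]) simp
      then show False using \<beta>1(2) by simp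
    qed
    have c2: "n - r \<le> eig_count a b w A \<beta>2"
    proof (rule ccontr)
      assume "\<not> ?thesis"
      then have lt: "eig_count a b w A \<beta>2 < n - r" by simp
      obtain \<gamma> where "n - r \<le> eig_count a b w A \<gamma>" using pf(3) by blast
      from eigval_ge[OF pf(1) this lt] show False using \<beta>2(1) unfolding L_def by simp
    qed
    show "\<forall>\<^sub>F s in at_right 0. dist (eigval a b n (ws s) (As s)) (eigval a b (n - r) w A) < \<epsilon>"
      using count[OF \<beta>1(3)] count[OF \<beta>2(3)] ev1
    proof eventually_elim
      case (elim s)
      have ws: "ws s \<in> Omega a b" "As s \<in> OK K" using elim(3) by auto
      have k1: "eig_count a b (ws s) (As s) \<beta>1 < n" and k2: "n \<le> eig_count a b (ws s) (As s) \<beta>2"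
        using elim(1,2) c1 c2 n by linarith+
      have "eigval a b n (ws s) (As s) \<le> \<beta>2"
        by (rule eigval_le[OF eigenvalue_list(2)[OF ws assms(1)] _ k2]) (use n in simp)
      moreover have "\<beta>1 \<le> eigval a b n (ws s) (As s)"
        by (rule eigval_ge[OF eigenvalue_list(1)[OF ws assms(1)] k2 k1])
      ultimately show ?case using \<beta>1 \<beta>2 unfolding dist_real_def L_def[symmetric] by linarith
    qed
  qed
  ultimately show ?thesis unfolding r_def[symmetric] by blast
qed

end
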